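(* Let $p\in\{2,3,4\}$. For all integers $k\ge1$, $\ell\ge0$ there exist $a_{k,\ell}\in\mathbb{R}$ and $C^\infty$ functions $A_{k,\ell},B_{k,\ell}:\mathbb{R}\to\mathbb{R}$ such that, for any $0<c<1$, any integer $k_0\ge1$ and any integer $\ell_0\ge0$, the function $$v(t,x)=Q(y)+Q_c(y_c)+\sum_{(k,\ell)\in\Sigma_0}c^\ell\Big(Q_c^k(y_c)A_{k,\ell}(y)+(Q_c^k)'(y_c)B_{k,\ell}(y)\Big),$$ where $\Sigma_0=\{(k,\ell):1\le k\le k_0,\ 0\le\ell\le\ell_0\}$, $y_c=x+(1-c)t$, $y=x-\alpha(y_c)$ and $\alpha(s)=\sum_{(k,\ell)\in\Sigma_0}a_{k,\ell}c^\ell\int_0^sQ_c^k(s')\,ds'$, satisfies: 1. with $S(t,x)=\partial_tv+\partial_x(\partial_x^2v-v+v^p)$, for all $j\ge0$ and all $t\in[-T_c,T_c]$, $$\|\partial_x^jS(t)\|_{L^2(\mathbb{R})}\le Kc^{n_0},\qquad n_0=\big(\tfrac12-\tfrac1{100}\big)\min\Big(\frac{k_0}{p-1},1+\ell_0\Big),$$ where $K=K(j,k_0,\ell_0)>0$; 2. $v(t)\in H^1(\mathbb{R})$ for all $t\in\mathbb{R}$, and for all $t\in[-T_c,T_c]$, $$\|v(t)-Q(y)-Q_c(y_c)\|_{H^1(\mathbb{R})}\le Kc^{\frac1{p-1}},$$ where $K=K(k_0,\ell_0)>0$ (here $Q(y)$, $Q_c(y_c)$ denote the functions $x\mapsto Q(x-\alpha(x+(1-c)t))$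 and $x\mapsto Q_c(x+(1-c)t)$).
   Context: $Q$ is the unique even positive $H^1$ solution of $Q''+Q^p=Q$, i.e. $Q(x)=\big(\frac{p+1}{2\cosh^2(\frac{p-1}2x)}\big)^{1/(p-1)}$, and for $c>0$, $Q_c(x)=c^{1/(p-1)}Q(\sqrt c\,x)$. $T_c=c^{-\frac12-\frac1{100}}$. *)

theory Defs
  imports "HOL-Analysis.Analysis"
begin

definition Qsol :: "nat \<Rightarrow> real \<Rightarrow> real" where
  "Qsol p x = ((real p + 1) / (2 * (cosh ((real p - 1) / 2 * x))\<^sup>2)) powr (1 / (real p - 1))"

definition Qc :: "nat \<Rightarrow> real \<Rightarrow> real \<Rightarrow> real" where
  "Qc p c x = c powr (1 / (real p - 1)) * Qsol p (sqrt c * x)"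

definition Tc :: "real \<Rightarrow> real" where
  "Tc c = c powr (-(1/2 + 1/100))"

definition smooth_fun :: "(real \<Rightarrow> real) \<Rightarrow> bool" where
  "smooth_fun f \<longleftrightarrow> (\<forall>n x. ((deriv ^^ n) f) differentiable (at x))"

definition alpha :: "nat \<Rightarrow> (nat \<Rightarrow> nat \<Rightarrow> real) \<Rightarrow> real \<Rightarrow> nat \<Rightarrow> nat \<Rightarrow> real \<Rightarrow> real" where
  "alpha p a c k0 l0 s =
     (\<Sum>k\<in>{1..k0}. \<Sum>l\<in>{0..l0}. a k l * c ^ l * (LBINT s'=0..s. (Qc p c s') ^ k))"

definition vfun :: "nat \<Rightarrow> (nat \<Rightarrow> nat \<Rightarrow> real) \<Rightarrow> (nat \<Rightarrow> nat \<Rightarrow> real \<Rightarrow> real)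
     \<Rightarrow> (nat \<Rightarrow> nat \<Rightarrow> real \<Rightarrow> real) \<Rightarrow> real \<Rightarrow> nat \<Rightarrow> nat \<Rightarrow> real \<Rightarrow> real \<Rightarrow> real" where
  "vfun p a A B c k0 l0 t x =
     (let yc = x + (1 - c) * t; y = x - alpha p a c k0 l0 yc in
      Qsol p y + Qc p c yc +
      (\<Sum>k\<in>{1..k0}. \<Sum>l\<in>{0..l0}. c ^ l *
          ((Qc p c yc) ^ k * A k l y + deriv (\<lambda>s. (Qc p c s) ^ k) yc * B k l y)))"

definition Sfun :: "nat \<Rightarrow> (nat \<Rightarrow> nat \<Rightarrow> real) \<Rightarrow> (nat \<Rightarrow> nat \<Rightarrow> real \<Rightarrow> real)
     \<Rightarrow> (nat \<Rightarrow> nat \<Rightarrow> real \<Rightarrow> real) \<Rightarrow> real \<Rightarrow> nat \<Rightarrow> nat \<Rightarrow> real \<Rightarrow> real \<Rightarrow> real" where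
  "Sfun p a A B c k0 l0 t x =
     deriv (\<lambda>\<tau>. vfun p a A B c k0 l0 \<tau> x) t +
     deriv (\<lambda>z. (deriv ^^ 2) (\<lambda>w. vfun p a A B c k0 l0 t w) z
                 - vfun p a A B c k0 l0 t z + (vfun p a A B c k0 l0 t z) ^ p) x"

definition sq_integrable :: "(real \<Rightarrow> real) \<Rightarrow> bool" where
  "sq_integrable f \<longleftrightarrow> f \<in> borel_measurable lborel \<and> integrable lborel (\<lambda>x. (f x)\<^sup>2)"

definition L2norm :: "(real \<Rightarrow> real) \<Rightarrow> real" where
  "L2norm f = sqrt (\<integral>x. (f x)\<^sup>2 \<partial>lborel)"

definition test_fun :: "(real \<Rightarrow> real) \<Rightarrow> bool" where
  "test_fun \<phi> \<longleftrightarrow> smooth_fun \<phi> \<and> compact (closure {x. \<phi> x \<noteq> 0})"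

definition weak_deriv :: "(real \<Rightarrow> real) \<Rightarrow> (real \<Rightarrow> real) \<Rightarrow> bool" where
  "weak_deriv f g \<longleftrightarrow> (\<forall>\<phi>. test_fun \<phi> \<longrightarrow>
      (\<integral>x. f x * deriv \<phi> x \<partial>lborel) = - (\<integral>x. g x * \<phi> x \<partial>lborel))"

definition H1 :: "(real \<Rightarrow> real) \<Rightarrow> bool" where
  "H1 f \<longleftrightarrow> sq_integrable f \<and> (\<exists>g. sq_integrable g \<and> weak_deriv f g)"

definition H1norm :: "(real \<Rightarrow> real) \<Rightarrow> real" where
  "H1norm f = sqrt ((L2norm f)\<^sup>2 + (L2norm (SOME g. sq_integrable g \<and> weak_deriv f g))\<^sup>2)"

end

theory Submission
  imports Defs "HOL-Library.Function_Algebras"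
begin

text \<open>The soliton \<open>Q_c\<close> is treated formally: \<open>s = y_c\<close>, \<open>y\<close> and \<open>c\<close> are independent variables,
  and the equations \<open>q'' = c q - q ^ p\<close>, \<open>q' ^ 2 = c q ^ 2 - 2 q ^ (p + 1) / (p + 1)\<close> make the span of the
  terms \<open>c ^ l q ^ k F(y)\<close> and \<open>c ^ l (q ^ k)' F(y)\<close> an algebra stable under \<open>\<partial>_s\<close> and \<open>\<partial>_y\<close>. By evenness
  and because the profile equations have divergence form, the residual is always a \<open>y\<close>-derivative
  of terms \<open>c ^ l q ^ k F(y) + c ^ l (q ^ k)' G(y)\<close> with \<open>F\<close> even and \<open>G\<close> odd. Running through all pairs \<open>(k, l)\<close>
  in an order compatible with the product order, each such term is removed by solving \<open>L A = F - a (3 Q - 2 Q ^ p)\<close>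
  and an analogous equation for \<open>B\<close>, with \<open>L f = - f'' + f - p Q ^ (p - 1) f\<close>; the phase coefficient \<open>a\<close> makes the
  second right-hand side orthogonal to the kernel \<open>Q'\<close>, which is possible since \<open>p \<noteq> 5\<close>. Truncating to a
  rectangle only leaves terms outside it.

  The coefficients grow at most like \<open>\<bar>y\<bar> ^ d\<close> with \<open>d \<le> (k - 1) / (p - 1) + l\<close>. For \<open>\<bar>t\<bar> \<le> T_c\<close> every
  power of \<open>y\<close> costs at most \<open>T_c = c powr (- 51 / 100)\<close> against the decay of \<open>Q_c\<close>, while the factor
  \<open>c ^ l q ^ k\<close> gains \<open>l + k / (p - 1)\<close> powers of \<open>c\<close>, and the difference gives both estimates.\<close>

section \<open>Growth classes\<close>

text \<open>The obstacle is growth in \<open>y\<close>. Every step needs the residual as a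
  \<open>y\<close>-derivative, yet the primitive of a coefficient that does not decay gains a power
  of \<open>y\<close>. Integration is therefore performed only where something pays for it. A
  coefficient with a factor \<open>Q\<close> decays rapidly and has a bounded primitive. In
  \<open>v ^ p\<close> the part without \<open>Q\<close> is a product of \<open>p\<close> factors
  that all decay in \<open>s\<close>, and \<open>p - 1\<close> of them pay for one power of
  \<open>y\<close>. This is the origin of the two weights that recur, \<open>p\<close> before an
  integration and 1 after it. The exponent in the final estimate comes out as follows. With
  \<open>r = (k - 1) / (p - 1) + l\<close>, a term at \<open>(k, l)\<close> has size
  \<open>c powr (r + 1 / (p - 1))\<close>, its growth costs at most \<open>51 / 100 * r\<close>, and
  the norm of a profile of width \<open>1 / sqrt c\<close> costs \<open>1 / 4\<close>. Since
  \<open>1 / (p - 1)\<close> is at least \<open>1 / 3\<close>, the last loss is absorbed and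
  \<open>49 / 100 * r\<close> remains.\<close>

definition poly_bounded :: "real \<Rightarrow> (real \<Rightarrow> real) \<Rightarrow> bool" where
  "poly_bounded d f \<longleftrightarrow> (\<exists>C. \<forall>x. \<bar>f x\<bar> \<le> C * (1 + \<bar>x\<bar>) powr d)"

text \<open>Derivatives keep the exponent \<open>d\<close> instead of lowering it: the profiles
  inherit their higher derivatives from a differential equation, which gives no gain.\<close>

primrec growsn :: "nat \<Rightarrow> real \<Rightarrow> (real \<Rightarrow> real) \<Rightarrow> bool" where
  "growsn 0 d f \<longleftrightarrow> poly_bounded d f"
| "growsn (Suc n) d f \<longleftrightarrow> poly_bounded d f \<and> (\<forall>x. f differentiable (at x)) \<and> growsn n d (deriv f)"

definition grows :: "real \<Rightarrow> (real \<Rightarrow> real) \<Rightarrow> bool" where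
  "grows d f \<longleftrightarrow> (\<forall>n. growsn n d f)"

definition rapid :: "(real \<Rightarrow> real) \<Rightarrow> bool" where
  "rapid f \<longleftrightarrow> (\<forall>d. grows d f)"

lemma poly_boundedE:
  assumes "poly_bounded d f"
  obtains C where "C > 0" "\<And>x. \<bar>f x\<bar> \<le> C * (1 + \<bar>x\<bar>) powr d"
proof -
  obtain C where C: "\<And>x. \<bar>f x\<bar> \<le> C * (1 + \<bar>x\<bar>) powr d"
    using assms unfolding poly_bounded_def by blast
  have "\<bar>f x\<bar> \<le> (\<bar>C\<bar> + 1) * (1 + \<bar>x\<bar>) powr d" for x
  proof -
    have "C * (1 + \<bar>x\<bar>) powr d \<le> (\<bar>C\<bar> + 1) * (1 + \<bar>x\<bar>) powr d"
      by (rule mult_right_mono) auto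
    then show ?thesis using C[of x] by linarith
  qed
  then show ?thesis by (intro that[of "\<bar>C\<bar> + 1"]) auto
qed

lemma poly_boundedI: "(\<And>x. \<bar>f x\<bar> \<le> C * (1 + \<bar>x\<bar>) powr d) \<Longrightarrow> poly_bounded d f"
  unfolding poly_bounded_def by blast

lemma poly_bounded_mono:
  assumes "poly_bounded d f" "d \<le> d'" shows "poly_bounded d' f"
proof -
  obtain C where C: "C > 0" "\<And>x. \<bar>f x\<bar> \<le> C * (1 + \<bar>x\<bar>) powr d"
    using poly_boundedE[OF assms(1)] by blast
  have "\<bar>f x\<bar> \<le> C * (1 + \<bar>x\<bar>) powr d'" for x
    by (rule order_trans[OF C(2)]) (use C(1) assms(2) in \<open>auto intro!: mult_left_mono powr_mono\<close>)
  then show ?thesis by (rule poly_boundedI)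
qed

lemma poly_bounded_add:
  assumes "poly_bounded d f" "poly_bounded d g" shows "poly_bounded d (\<lambda>x. f x + g x)"
proof -
  obtain C where C: "C > 0" "\<And>x. \<bar>f x\<bar> \<le> C * (1 + \<bar>x\<bar>) powr d"
    using poly_boundedE[OF assms(1)] by blast
  obtain D where D: "D > 0" "\<And>x. \<bar>g x\<bar> \<le> D * (1 + \<bar>x\<bar>) powr d"
    using poly_boundedE[OF assms(2)] by blast
  have "\<bar>f x + g x\<bar> \<le> (C + D) * (1 + \<bar>x\<bar>) powr d" for x
    unfolding distrib_right using C(2)[of x] D(2)[of x] by linarith
  then show ?thesis by (rule poly_boundedI)
qed

lemma poly_bounded_mult:
  assumes "poly_bounded d f" "poly_bounded e g" shows "poly_bounded (d + e) (\<lambda>x. f x * g x)"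
proof -
  obtain C where C: "C > 0" "\<And>x. \<bar>f x\<bar> \<le> C * (1 + \<bar>x\<bar>) powr d"
    using poly_boundedE[OF assms(1)] by blast
  obtain D where D: "D > 0" "\<And>x. \<bar>g x\<bar> \<le> D * (1 + \<bar>x\<bar>) powr e"
    using poly_boundedE[OF assms(2)] by blast
  have "\<bar>f x * g x\<bar> \<le> (C * D) * (1 + \<bar>x\<bar>) powr (d + e)" for x
  proof -
    have "\<bar>f x\<bar> * \<bar>g x\<bar> \<le> (C * (1 + \<bar>x\<bar>) powr d) * (D * (1 + \<bar>x\<bar>) powr e)"
      using C D by (intro mult_mono) auto
    then show ?thesis by (simp add: abs_mult powr_add mult_ac)
  qed
  then show ?thesis by (rule poly_boundedI)
qed

lemma poly_bounded_const: "0 \<le> d \<Longrightarrow> poly_bounded d (\<lambda>x. r)"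
  by (rule poly_boundedI[of _ "\<bar>r\<bar>"]) (auto intro!: mult_le_cancel_left1[THEN iffD2] ge_one_powr_ge_zero)

lemma poly_bounded_reflect: "poly_bounded d f \<Longrightarrow> poly_bounded d (\<lambda>x. f (- x))"
  unfolding poly_bounded_def by (metis abs_minus_cancel)

lemma growsn_bounded: "growsn n d f \<Longrightarrow> poly_bounded d f"
  by (cases n) auto

lemma growsn_SucD: "growsn (Suc n) d f \<Longrightarrow> growsn n d f"
  by (induction n arbitrary: f) auto

lemma growsn_SucI:
  assumes "poly_bounded d f" "\<And>x. (f has_real_derivative f' x) (at x)" "growsn n d f'"
  shows "growsn (Suc n) d f"
proof -
  have "deriv f = f'" using assms(2) by (auto simp: DERIV_imp_deriv)
  then show ?thesis using assms by (auto simp: real_differentiable_def)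
qed

lemma growsn_SucE:
  assumes "growsn (Suc n) d f"
  obtains "\<And>x. (f has_real_derivative deriv f x) (at x)" "growsn n d (deriv f)" "poly_bounded d f"
  using assms by (auto simp: DERIV_deriv_iff_real_differentiable)

lemma growsn_mono: "growsn n d f \<Longrightarrow> d \<le> d' \<Longrightarrow> growsn n d' f"
  by (induction n arbitrary: f) (auto intro: poly_bounded_mono)

lemma growsn_add: "growsn n d f \<Longrightarrow> growsn n d g \<Longrightarrow> growsn n d (\<lambda>x. f x + g x)"
proof (induction n arbitrary: f g)
  case 0 then show ?case by (simp add: poly_bounded_add)
next
  case (Suc n)
  from Suc.prems(1) obtain f: "\<And>x. (f has_real_derivative deriv f x) (at x)" "growsn n d (deriv f)" "poly_bounded d f"
    by (rule growsn_SucE) blast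
  from Suc.prems(2) obtain g: "\<And>x. (g has_real_derivative deriv g x) (at x)" "growsn n d (deriv g)" "poly_bounded d g"
    by (rule growsn_SucE) blast
  show ?case
    by (rule growsn_SucI[OF poly_bounded_add[OF f(3) g(3)] DERIV_add[OF f(1) g(1)] Suc.IH[OF f(2) g(2)]])
qed

lemma growsn_mult: "growsn n d f \<Longrightarrow> growsn n e g \<Longrightarrow> growsn n (d + e) (\<lambda>x. f x * g x)"
proof (induction n arbitrary: f g)
  case 0 then show ?case by (simp add: poly_bounded_mult)
next
  case (Suc n)
  from Suc.prems(1) obtain f: "\<And>x. (f has_real_derivative deriv f x) (at x)" "growsn n d (deriv f)" "poly_bounded d f"
    by (rule growsn_SucE) blast
  from Suc.prems(2) obtain g: "\<And>x. (g has_real_derivative deriv g x) (at x)" "growsn n e (deriv g)" "poly_bounded e g"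
    by (rule growsn_SucE) blast
  have "growsn n (d + e) (\<lambda>x. deriv f x * g x + deriv g x * f x)"
    using growsn_add[OF Suc.IH[OF f(2) growsn_SucD[OF Suc.prems(2)]] Suc.IH[OF growsn_SucD[OF Suc.prems(1)] g(2)]]
    by (simp add: mult.commute)
  then show ?case
    by (intro growsn_SucI[OF poly_bounded_mult[OF f(3) g(3)] DERIV_mult[OF f(1) g(1)]])
qed

lemma growsn_const: "0 \<le> d \<Longrightarrow> growsn n d (\<lambda>x. r)"
proof (induction n arbitrary: r)
  case (Suc n)
  then show ?case
    by (intro growsn_SucI[where f' = "\<lambda>_. 0"]) (auto intro: poly_bounded_const)
qed (auto intro: poly_bounded_const)

lemma growsn_reflect: "growsn n d f \<Longrightarrow> growsn n d (\<lambda>x. f (- x))"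
proof (induction n arbitrary: f)
  case 0 then show ?case by (simp add: poly_bounded_reflect)
next
  case (Suc n)
  from Suc.prems obtain f: "\<And>x. (f has_real_derivative deriv f x) (at x)" "growsn n d (deriv f)" "poly_bounded d f"
    by (rule growsn_SucE) blast
  have d: "((\<lambda>x. f (- x)) has_real_derivative - 1 * deriv f (- x)) (at x)" for x
    using DERIV_chain2[OF f(1) DERIV_minus[OF DERIV_ident]] by simp
  show ?case
    using growsn_SucI[OF poly_bounded_reflect[OF f(3)] d]
      growsn_mult[OF growsn_const[of 0 n "-1"] Suc.IH[OF f(2)]] by simp
qed

lemma grows_bounded: "grows d f \<Longrightarrow> poly_bounded d f"
  unfolding grows_def using growsn_bounded by blast

lemma grows_deriv: "grows d f \<Longrightarrow> grows d (deriv f)"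
  unfolding grows_def by (metis growsn.simps(2))

lemma grows_DERIV: "grows d f \<Longrightarrow> (f has_real_derivative deriv f x) (at x)"
  unfolding grows_def by (metis growsn_SucE)

lemma growsI:
  assumes "poly_bounded d f" "\<And>x. (f has_real_derivative f' x) (at x)" "grows d f'"
  shows "grows d f"
proof -
  have "growsn n d f" for n
    using assms(1,3) growsn_SucI[OF assms(1,2)] by (cases n) (auto simp: grows_def)
  then show ?thesis by (simp add: grows_def)
qed

lemma grows_mono: "grows d f \<Longrightarrow> d \<le> d' \<Longrightarrow> grows d' f"
  unfolding grows_def using growsn_mono by blast

lemma grows_add: "grows d f \<Longrightarrow> grows d g \<Longrightarrow> grows d (\<lambda>x. f x + g x)"
  unfolding grows_def using growsn_add by blast

lemma grows_mult: "grows d f \<Longrightarrow> grows e g \<Longrightarrow> grows (d + e) (\<lambda>x. f x * g x)"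
  unfolding grows_def using growsn_mult by blast

lemma grows_const: "0 \<le> d \<Longrightarrow> grows d (\<lambda>x. r)"
  unfolding grows_def using growsn_const by blast

lemma grows_cmult: "grows d f \<Longrightarrow> grows d (\<lambda>x. r * f x)"
  using grows_mult[OF grows_const[of 0 r]] by simp

lemma grows_diff: "grows d f \<Longrightarrow> grows d g \<Longrightarrow> grows d (\<lambda>x. f x - g x)"
  using grows_add[of d f "\<lambda>x. - 1 * g x"] grows_cmult[of d g "-1"] by simp

lemma grows_reflect: "grows d f \<Longrightarrow> grows d (\<lambda>x. f (- x))"
  unfolding grows_def using growsn_reflect by blast

lemma grows_smooth: "grows d f \<Longrightarrow> smooth_fun f"
proof -
  have "grows d f \<Longrightarrow> grows d ((deriv ^^ n) f)" for n
    by (induction n) (auto intro: grows_deriv)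
  then show "grows d f \<Longrightarrow> smooth_fun f"
    unfolding smooth_fun_def using grows_DERIV real_differentiable_def by blast
qed

lemma grows_id: "grows 1 (\<lambda>x. x)"
  by (rule growsI[where f' = "\<lambda>_. 1"])
    (auto intro!: grows_const poly_boundedI[of _ 1] DERIV_ident)

lemma rapid_grows: "rapid f \<Longrightarrow> grows d f"
  by (simp add: rapid_def)

lemma rapid_add: "rapid f \<Longrightarrow> rapid g \<Longrightarrow> rapid (\<lambda>x. f x + g x)"
  by (simp add: rapid_def grows_add)

lemma rapid_diff: "rapid f \<Longrightarrow> rapid g \<Longrightarrow> rapid (\<lambda>x. f x - g x)"
  by (simp add: rapid_def grows_diff)

lemma rapid_mult: "rapid f \<Longrightarrow> grows d g \<Longrightarrow> rapid (\<lambda>x. f x * g x)"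
  unfolding rapid_def
proof
  fix e assume "\<forall>d. grows d f" "grows d g"
  then have "grows ((e - d) + d) (\<lambda>x. f x * g x)" by (intro grows_mult) auto
  then show "grows e (\<lambda>x. f x * g x)" by simp
qed

lemma rapid_cmult: "rapid f \<Longrightarrow> rapid (\<lambda>x. r * f x)"
  by (simp add: rapid_def grows_cmult)

lemma rapid_deriv: "rapid f \<Longrightarrow> rapid (deriv f)"
  by (simp add: rapid_def grows_deriv)

lemma rapid_reflect: "rapid f \<Longrightarrow> rapid (\<lambda>x. f (- x))"
  by (simp add: rapid_def grows_reflect)

lemma rapid_power: "rapid f \<Longrightarrow> 0 < n \<Longrightarrow> rapid (\<lambda>x. f x ^ n)"
proof (induction n)
  case (Suc n)
  then show ?case
    using rapid_mult[OF Suc.prems(1), of 0 "\<lambda>x. f x ^ n"] rapid_grows[of "\<lambda>x. f x ^ n"] grows_const[of 0 1]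
    by (cases n) auto
qed simp

text \<open>Meaningless unless \<open>f\<close> has a primitive; used for continuous \<open>f\<close> only.\<close>
definition prim :: "(real \<Rightarrow> real) \<Rightarrow> real \<Rightarrow> real" where
  "prim f = (SOME F. F 0 = 0 \<and> (\<forall>x. (F has_real_derivative f x) (at x)))"

lemma DERIV_LBINT:
  fixes f :: "real \<Rightarrow> real"
  assumes "\<And>x. isCont f x"
  shows "((\<lambda>x. LBINT t=0..x. f t) has_real_derivative f x) (at x)"
proof -
  have c: "continuous_on A f" for A
    using assms continuous_at_imp_continuous_on by blast
  define a where "a = - \<bar>x\<bar> - 1"
  define b where "b = \<bar>x\<bar> + 1"
  have "((\<lambda>u. LBINT t=0..u. f t) has_vector_derivative f x) (at x within {a..b})"
    using interval_integral_FTC2[of a 0 b f x] c by (auto simp: a_def b_def zero_ereal_def)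
  then have "((\<lambda>u. LBINT t=0..u. f t) has_vector_derivative f x) (at x within {a<..<b})"
    by (rule has_vector_derivative_within_subset) auto
  then show ?thesis
    unfolding has_real_derivative_iff_has_vector_derivative
    by (subst (asm) at_within_open) (auto simp: a_def b_def)
qed

lemma prim_exists:
  fixes f :: "real \<Rightarrow> real"
  assumes "\<And>x. isCont f x"
  shows "\<exists>F. F 0 = 0 \<and> (\<forall>x. (F has_real_derivative f x) (at x))"
proof (intro exI conjI allI)
  show "(LBINT t=0..(0::real). f t) = 0" by (simp add: zero_ereal_def)
  show "((\<lambda>x. LBINT t=0..x. f t) has_real_derivative f x) (at x)" for x by (rule DERIV_LBINT[OF assms])
qed

lemma
  assumes "\<And>x. isCont f x"
  shows prim_0: "prim f 0 = 0" and DERIV_prim: "(prim f has_real_derivative f x) (at x)"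
  using someI_ex[OF prim_exists[OF assms]] unfolding prim_def by auto

section \<open>Identities and bounds for primitives\<close>

lemma same_DERIV_imp_eq:
  fixes F G :: "real \<Rightarrow> real"
  assumes "\<And>x. (F has_real_derivative f x) (at x)" "\<And>x. (G has_real_derivative f x) (at x)" "F a = G a"
  shows "F = G"
proof
  fix x
  have "((\<lambda>x. F x - G x) has_real_derivative 0) (at x)" for x
    using DERIV_diff[OF assms(1) assms(2)] by simp
  then have "F x - G x = F a - G a"
    using DERIV_isconst_all[of "\<lambda>x. F x - G x"] by blast
  then show "F x = G x" using assms(3) by simp
qed

lemma prim_reflect:
  assumes "\<And>x. isCont f x" "\<And>x. f (- x) = r * f x"
  shows "prim f (- x) = - r * prim f x"
proof -
  have "(\<lambda>x. prim f (- x)) = (\<lambda>x. - r * prim f x)"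
  proof (rule same_DERIV_imp_eq[where a = 0])
    fix x
    show "((\<lambda>x. prim f (- x)) has_real_derivative - r * f x) (at x)"
      using DERIV_chain2[OF DERIV_prim[OF assms(1)] DERIV_minus[OF DERIV_ident]] assms(2) by simp
    show "((\<lambda>x. - r * prim f x) has_real_derivative - r * f x) (at x)"
      by (rule DERIV_cmult[OF DERIV_prim[OF assms(1)]])
  qed (simp add: prim_0[OF assms(1)])
  then show ?thesis by metis
qed

text \<open>Both \<open>H - F\<close> and \<open>H + F\<close> are nondecreasing. Estimates of
  integrals thus reduce to finding a majorant \<open>H\<close> with an explicit derivative.\<close>

lemma prim_bound_pos:
  fixes F H :: "real \<Rightarrow> real"
  assumes "\<And>x. (F has_real_derivative f x) (at x)"
    and "\<And>x. 0 \<le> x \<Longrightarrow> (H has_real_derivative h x) (at x)"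
    and "\<And>x. 0 \<le> x \<Longrightarrow> \<bar>f x\<bar> \<le> h x" and "0 \<le> a" "a \<le> b"
  shows "\<bar>F b - F a\<bar> \<le> H b - H a"
proof -
  have "H a - F a \<le> H b - F b"
  proof (rule DERIV_nonneg_imp_nondecreasing[OF assms(5)])
    fix x assume "a \<le> x" "x \<le> b"
    then have x: "0 \<le> x" using assms(4) by simp
    show "\<exists>y. ((\<lambda>x. H x - F x) has_real_derivative y) (at x) \<and> y \<ge> 0"
      using DERIV_diff[OF assms(2)[OF x] assms(1)] assms(3)[OF x] by (intro exI) auto
  qed
  moreover have "H a + F a \<le> H b + F b"
  proof (rule DERIV_nonneg_imp_nondecreasing[OF assms(5)])
    fix x assume "a \<le> x" "x \<le> b"
    then have x: "0 \<le> x" using assms(4) by simp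
    show "\<exists>y. ((\<lambda>x. H x + F x) has_real_derivative y) (at x) \<and> y \<ge> 0"
      using DERIV_add[OF assms(2)[OF x] assms(1)] assms(3)[OF x] by (intro exI) auto
  qed
  ultimately show ?thesis by linarith
qed

lemma prim_bound:
  fixes F H :: "real \<Rightarrow> real"
  assumes F: "\<And>x. (F has_real_derivative f x) (at x)" "F 0 = 0"
    and H: "\<And>x. 0 \<le> x \<Longrightarrow> (H has_real_derivative h x) (at x)"
    and le: "\<And>x. \<bar>f x\<bar> \<le> h \<bar>x\<bar>"
  shows "\<bar>F x\<bar> \<le> H \<bar>x\<bar> - H 0"
proof (cases "0 \<le> x")
  case True
  have "\<bar>F x - F 0\<bar> \<le> H x - H 0"
    by (rule prim_bound_pos[OF F(1) H _ _ True]) (use le in \<open>auto simp: abs_of_nonneg\<close>, metis abs_of_nonneg le)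
  then show ?thesis using True F(2) by simp
next
  case False
  have d: "((\<lambda>x. F (- x)) has_real_derivative - f (- x)) (at x)" for x
    using DERIV_chain2[OF F(1) DERIV_minus[OF DERIV_ident]] by simp
  have "\<bar>- f (- x)\<bar> \<le> h x" if "0 \<le> x" for x
    using le[of "- x"] that by simp
  then have "\<bar>F (- (- x)) - F (- 0)\<bar> \<le> H (- x) - H 0"
    using prim_bound_pos[OF d H, of 0 "- x"] False by simp
  then show ?thesis using False F(2) by simp
qed

lemma grows_prim:
  assumes "grows d f" "0 \<le> d"
  shows "grows (d + 1) (prim f)"
proof -
  have c: "isCont f x" for x using DERIV_isCont[OF grows_DERIV[OF assms(1)]] .
  obtain C where C: "C > 0" "\<And>x. \<bar>f x\<bar> \<le> C * (1 + \<bar>x\<bar>) powr d"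
    using poly_boundedE[OF grows_bounded[OF assms(1)]] by blast
  have "\<bar>prim f x\<bar> \<le> C / (d + 1) * (1 + \<bar>x\<bar>) powr (d + 1) - C / (d + 1) * (1 + 0) powr (d + 1)" for x
  proof (rule prim_bound[OF DERIV_prim[OF c] prim_0[OF c] _ C(2)])
    fix x :: real assume "0 \<le> x"
    then show "((\<lambda>x. C / (d + 1) * (1 + x) powr (d + 1)) has_real_derivative C * (1 + x) powr d) (at x)"
      using assms(2) by (auto intro!: derivative_eq_intros)
  qed
  then have "\<bar>prim f x\<bar> \<le> C / (d + 1) * (1 + \<bar>x\<bar>) powr (d + 1)" for x
    by (smt (verit, ccfv_SIG) C(1) assms(2) divide_nonneg_nonneg powr_one_eq_one mult_nonneg_nonneg)
  then have "poly_bounded (d + 1) (prim f)" by (rule poly_boundedI)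
  then show ?thesis
    by (rule growsI[OF _ DERIV_prim[OF c]]) (use assms grows_mono in auto)
qed

lemma grows_prim_rapid:
  assumes "rapid f" shows "grows 0 (prim f)"
proof -
  have c: "isCont f x" for x using DERIV_isCont[OF grows_DERIV[OF rapid_grows[OF assms]]] .
  \<comment> \<open>Any exponent below -1 would be integrable; -2 has the simple primitive
    \<open>- C * (1 + x) powr (-1)\<close>.\<close>
  obtain C where C: "C > 0" "\<And>x. \<bar>f x\<bar> \<le> C * (1 + \<bar>x\<bar>) powr (-2)"
    using poly_boundedE[OF grows_bounded[OF rapid_grows[OF assms]]] by blast
  have "\<bar>prim f x\<bar> \<le> - C * (1 + \<bar>x\<bar>) powr (-1) - - C * (1 + 0) powr (-1)" for x
  proof (rule prim_bound[OF DERIV_prim[OF c] prim_0[OF c] _ C(2)])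
    fix x :: real assume "0 \<le> x"
    then show "((\<lambda>x. - C * (1 + x) powr (-1)) has_real_derivative C * (1 + x) powr (-2)) (at x)"
      using DERIV_cmult[OF DERIV_chain2[OF has_real_derivative_powr[of "1 + x" "-1"]
            DERIV_add[OF DERIV_const DERIV_ident]], where c = "- C"] by (simp del: powr_neg_one)
  qed
  then have "\<bar>prim f x\<bar> \<le> C * (1 + \<bar>x\<bar>) powr 0" for x
  proof -
    have "0 \<le> C * (1 + \<bar>x\<bar>) powr (-1)" using C(1) by simp
    have "\<bar>prim f x\<bar> \<le> - C * (1 + \<bar>x\<bar>) powr (-1) - - C * (1 + 0) powr (-1)" by fact
    have "1 + \<bar>x\<bar> \<noteq> 0" by linarith
    with \<open>\<bar>prim f x\<bar> \<le> - C * (1 + \<bar>x\<bar>) powr (-1) - - C * (1 + 0) powr (-1)\<close>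
      \<open>0 \<le> C * (1 + \<bar>x\<bar>) powr (-1)\<close>
    show ?thesis by simp
  qed
  then have "poly_bounded 0 (prim f)" by (rule poly_boundedI)
  then show ?thesis
    by (rule growsI[OF _ DERIV_prim[OF c]]) (use assms rapid_grows in auto)
qed

section \<open>The soliton and its linearized operator\<close>

lemma powr_le_exp:
  fixes d e :: real
  assumes "0 < e"
  obtains C where "C > 0" "\<And>x. 0 \<le> x \<Longrightarrow> (1 + x) powr d \<le> C * exp (e * x)"
proof -
  define N where "N = \<bar>d\<bar> + 1"
  \<comment> \<open>The inequality \<open>ln z \<le> z - 1\<close> at
    \<open>z = (1 + x) * e / N\<close>, multiplied by \<open>N\<close>, gives exactly this constant.
    The choice of \<open>N\<close> makes it positive and at least \<open>d\<close>.\<close>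
  define C where "C = exp (e - N + N * ln (N / e))"
  have N: "N > 0" "d \<le> N" by (auto simp: N_def)
  have "(1 + x) powr d \<le> C * exp (e * x)" if "0 \<le> x" for x
  proof -
    have "ln ((1 + x) / (N / e)) \<le> (1 + x) / (N / e) - 1"
      using N assms that by (intro ln_le_minus_one) auto
    then have "ln (1 + x) - ln (N / e) \<le> e * (1 + x) / N - 1"
      using N assms that by (subst (asm) ln_div) (auto simp: mult.commute)
    then have "N * (ln (1 + x) - ln (N / e)) \<le> N * (e * (1 + x) / N - 1)"
      using N by (intro mult_left_mono) auto
    moreover have "N * (e * (1 + x) / N - 1) = e * (1 + x) - N" using N by (simp add: right_diff_distrib)
    ultimately have "N * ln (1 + x) \<le> e * (1 + x) - N + N * ln (N / e)"
      by (simp add: right_diff_distrib)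
    moreover have "d * ln (1 + x) \<le> N * ln (1 + x)"
      using N that by (intro mult_right_mono) auto
    ultimately have "d * ln (1 + x) \<le> (e - N + N * ln (N / e)) + e * x"
      by (simp add: algebra_simps)
    then show ?thesis
      using that by (simp add: powr_def C_def exp_add[symmetric])
  qed
  then show ?thesis by (intro that[of C]) (auto simp: C_def)
qed

lemma poly_bounded_exp:
  assumes "\<And>x. \<bar>f x\<bar> \<le> C * exp (- \<bar>x\<bar>)"
  shows "poly_bounded d f"
proof -
  obtain D where D: "D > 0" "\<And>x. 0 \<le> x \<Longrightarrow> (1 + x) powr (- d) \<le> D * exp (1 * x)"
    using powr_le_exp[of 1 "- d"] by auto
  have C: "0 \<le> C" using assms[of 0] by simp
  have "\<bar>f x\<bar> \<le> C * D * (1 + \<bar>x\<bar>) powr d" for x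
  proof -
    have "1 \<le> D * exp \<bar>x\<bar> * (1 + \<bar>x\<bar>) powr d"
      using mult_right_mono[OF D(2)[of "\<bar>x\<bar>"], of "(1 + \<bar>x\<bar>) powr d"]
      by (simp add: powr_minus field_simps split: if_splits)
    then have "exp (- \<bar>x\<bar>) \<le> D * (1 + \<bar>x\<bar>) powr d"
      by (simp add: exp_minus field_simps)
    then have "C * exp (- \<bar>x\<bar>) \<le> C * (D * (1 + \<bar>x\<bar>) powr d)"
      using C by (intro mult_left_mono) auto
    then show ?thesis using assms[of x] by (simp add: mult.assoc)
  qed
  then show ?thesis by (rule poly_boundedI)
qed

text \<open>Since \<open>1 + x \<le> b + x \<le> b * (1 + x)\<close>, the two weights differ by at
  most the factor \<open>b powr \<bar>d\<bar>\<close>, whatever the sign of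
  \<open>d\<close>.\<close>

lemma shift_weight:
  fixes b d x :: real
  assumes "1 \<le> b" "0 \<le> x"
  shows "(1 + x) powr d \<le> b powr \<bar>d\<bar> * (b + x) powr d"
    and "(b + x) powr d \<le> b powr \<bar>d\<bar> * (1 + x) powr d"
proof -
  have b: "b + x \<le> b * (1 + x)" using assms by (simp add: algebra_simps mult_le_cancel_right1)
  have one: "1 \<le> b powr \<bar>d\<bar>" using assms by (simp add: ge_one_powr_ge_zero)
  show "(1 + x) powr d \<le> b powr \<bar>d\<bar> * (b + x) powr d"
  proof (cases "0 \<le> d")
    case True
    have "(1 + x) powr d \<le> 1 * (b + x) powr d" using True assms by (auto intro: powr_mono2)
    also have "\<dots> \<le> b powr \<bar>d\<bar> * (b + x) powr d" using one by (intro mult_right_mono) auto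
    finally show ?thesis .
  next
    case False
    have "(b * (1 + x)) powr d \<le> (b + x) powr d"
      using False assms b by (intro powr_mono2') auto
    then have "b powr d * (1 + x) powr d \<le> (b + x) powr d"
      using assms by (simp add: powr_mult)
    then have "b powr \<bar>d\<bar> * (b powr d * (1 + x) powr d) \<le> b powr \<bar>d\<bar> * (b + x) powr d"
      by (intro mult_left_mono) auto
    then show ?thesis using False assms by (simp add: powr_minus field_simps)
  qed
  show "(b + x) powr d \<le> b powr \<bar>d\<bar> * (1 + x) powr d"
  proof (cases "0 \<le> d")
    case True
    have "(b + x) powr d \<le> (b * (1 + x)) powr d"
      using True assms b by (intro powr_mono2) auto
    then show ?thesis using True assms by (simp add: powr_mult)
  next
    case False
    have "(b + x) powr d \<le> 1 * (1 + x) powr d" using False assms by (auto intro: powr_mono2')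
    also have "\<dots> \<le> b powr \<bar>d\<bar> * (1 + x) powr d" using one by (intro mult_right_mono) auto
    finally show ?thesis .
  qed
qed

text \<open>With the shift \<open>b = 1 + 2 * \<bar>d\<bar>\<close> the weight \<open>(b + x) powr d\<close> varies slowly compared with
  \<open>exp x\<close>, so that integrating it against \<open>exp\<close> only costs a factor 2.\<close>

lemma slow_weight_deriv:
  fixes d x :: real
  defines "b \<equiv> 1 + 2 * \<bar>d\<bar>"
  assumes "0 \<le> x"
  shows "\<bar>d * (b + x) powr (d - 1)\<bar> \<le> (b + x) powr d / 2"
proof -
  have b: "b + x > 0" using assms by (simp add: b_def add_pos_nonneg)
  have "\<bar>d\<bar> \<le> (b + x) / 2" using assms by (simp add: b_def)
  then have "\<bar>d\<bar> * (b + x) powr (d - 1) \<le> (b + x) / 2 * (b + x) powr (d - 1)"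
    by (intro mult_right_mono) auto
  also have "\<dots> = ((b + x) powr 1 * (b + x) powr (d - 1)) / 2" using b by simp
  also have "\<dots> = (b + x) powr d / 2" unfolding powr_add[symmetric] by simp
  finally show ?thesis by (simp add: abs_mult)
qed

lemma exp_growth_primitive:
  fixes d C :: real and F :: "real \<Rightarrow> real"
  defines "b \<equiv> 1 + 2 * \<bar>d\<bar>"
  assumes F: "\<And>x. (F has_real_derivative f x) (at x)" "F 0 = 0"
    and le: "\<And>x. \<bar>f x\<bar> \<le> C * ((b + \<bar>x\<bar>) powr d * exp \<bar>x\<bar>)"
  shows "\<bar>F x\<bar> \<le> 2 * C * ((b + \<bar>x\<bar>) powr d * exp \<bar>x\<bar>)"
proof -
  have b: "b + x > 0" if "0 \<le> x" for x using that by (simp add: b_def add_pos_nonneg)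
  have "\<bar>f 0\<bar> \<le> C * (b powr d)" using le[of 0] by simp
  then have C: "0 \<le> C" using b[of 0] by (smt (verit) mult_neg_pos powr_gt_zero)
  let ?H = "\<lambda>x. 2 * C * ((b + x) powr d * exp x)"
  let ?h = "\<lambda>x. 2 * C * ((d * (b + x) powr (d - 1) + (b + x) powr d) * exp x)"
  have "\<bar>F x\<bar> \<le> ?H \<bar>x\<bar> - ?H 0"
  proof (rule prim_bound[OF F, where h = ?h])
    show "(?H has_real_derivative ?h x) (at x)" if "0 \<le> x" for x
      using b[OF that] by (auto intro!: derivative_eq_intros simp: algebra_simps)
    show "\<bar>f x\<bar> \<le> ?h \<bar>x\<bar>" for x
    proof -
      have "(b + \<bar>x\<bar>) powr d \<le> 2 * (d * (b + \<bar>x\<bar>) powr (d - 1) + (b + \<bar>x\<bar>) powr d)"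
        using slow_weight_deriv[of "\<bar>x\<bar>" d] unfolding b_def by simp
      then have "C * ((b + \<bar>x\<bar>) powr d * exp \<bar>x\<bar>) \<le>
          C * (2 * (d * (b + \<bar>x\<bar>) powr (d - 1) + (b + \<bar>x\<bar>) powr d) * exp \<bar>x\<bar>)"
        using C by (intro mult_left_mono mult_right_mono) auto
      then show ?thesis using le[of x] by (simp add: mult_ac)
    qed
  qed
  moreover have "0 \<le> ?H 0" using C by simp
  ultimately show ?thesis by linarith
qed

text \<open>Here the primitive is normalised at infinity, so the comparison runs over
  \<open>{x..R}\<close> with \<open>R\<close> tending to infinity; starting from 0 would give
  boundedness but no decay.\<close>

lemma exp_decay_primitive:
  fixes d C :: real and F :: "real \<Rightarrow> real"
  defines "b \<equiv> 1 + 2 * \<bar>d\<bar>"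
  assumes F: "\<And>x. (F has_real_derivative f x) (at x)" "(F \<longlongrightarrow> 0) at_top"
    and le: "\<And>x. 0 \<le> x \<Longrightarrow> \<bar>f x\<bar> \<le> C * ((b + x) powr d * exp (- x))"
    and x: "0 \<le> x"
  shows "\<bar>F x\<bar> \<le> 2 * C * ((b + x) powr d * exp (- x))"
proof -
  have b: "b + x > 0" if "0 \<le> x" for x using that by (simp add: b_def add_pos_nonneg)
  have "\<bar>f 0\<bar> \<le> C * (b powr d)" using le[of 0] by simp
  then have C: "0 \<le> C" using b[of 0] by (smt (verit) mult_neg_pos powr_gt_zero)
  let ?H = "\<lambda>x. - (2 * C * ((b + x) powr d * exp (- x)))"
  let ?h = "\<lambda>x. 2 * C * (((b + x) powr d - d * (b + x) powr (d - 1)) * exp (- x))"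
  have *: "\<bar>F R - F x\<bar> \<le> 2 * C * ((b + x) powr d * exp (- x))" if "x \<le> R" for R
  proof -
    have "\<bar>F R - F x\<bar> \<le> ?H R - ?H x"
    proof (rule prim_bound_pos[OF F(1) _ _ x that, where h = ?h])
      show "(?H has_real_derivative ?h x) (at x)" if "0 \<le> x" for x
        using b[OF that] by (auto intro!: derivative_eq_intros simp: algebra_simps)
      show "\<bar>f x\<bar> \<le> ?h x" if x: "0 \<le> x" for x
      proof -
        have "(b + x) powr d \<le> 2 * ((b + x) powr d - d * (b + x) powr (d - 1))"
          using slow_weight_deriv[of x d] x unfolding b_def by simp
        then have "C * ((b + x) powr d * exp (- x)) \<le>
            C * (2 * ((b + x) powr d - d * (b + x) powr (d - 1)) * exp (- x))"
          using C by (intro mult_left_mono mult_right_mono) auto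
        then show ?thesis using le[OF x] by (simp add: mult_ac)
      qed
    qed
    moreover have "?H R \<le> 0" using C by simp
    ultimately show ?thesis by linarith
  qed
  have "((\<lambda>R. \<bar>F R - F x\<bar>) \<longlongrightarrow> \<bar>0 - F x\<bar>) at_top"
    by (intro tendsto_intros F(2))
  moreover have "eventually (\<lambda>R. \<bar>F R - F x\<bar> \<le> 2 * C * ((b + x) powr d * exp (- x))) at_top"
    using eventually_ge_at_top[of x] by eventually_elim (rule *)
  ultimately have "\<bar>0 - F x\<bar> \<le> 2 * C * ((b + x) powr d * exp (- x))"
    by (intro tendsto_upperbound[of _ _ at_top]) auto
  then show ?thesis by simp
qed

section \<open>The soliton profile\<close>

locale gkdv =
  fixes p :: nat
  assumes p_cases: "p \<in> {2, 3, 4}"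
begin

definition m :: real where "m = (real p - 1) / 2"

abbreviation Q :: "real \<Rightarrow> real" where "Q \<equiv> Qsol p"

definition Qd :: "real \<Rightarrow> real" where "Qd x = - Q x * tanh (m * x)"

lemma m_pos: "m > 0" and p_m: "real p = 2 * m + 1" and p_ge2: "2 \<le> p"
  using p_cases by (auto simp: m_def)

lemma p_pos: "real p - 1 > 0" using p_cases by auto

lemma Q_eq: "Q x = (1 + m) powr (1 / (2 * m)) * cosh (m * x) powr (- (1 / m))"
proof -
  have "real p + 1 = 2 * (1 + m)" "real p - 1 = 2 * m" using p_m by auto
  moreover have "((cosh (m * x))\<^sup>2) powr (1 / (2 * m)) = cosh (m * x) powr (1 / m)"
  proof -
    have "(cosh (m * x))\<^sup>2 = cosh (m * x) powr 2" using cosh_real_pos[of "m * x"] by simp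
    then show ?thesis using m_pos by (simp only: powr_powr) simp
  qed
  moreover have "(2 * (1 + m)) / (2 * (cosh (m * x))\<^sup>2) = (1 + m) / (cosh (m * x))\<^sup>2"
    by (rule mult_divide_mult_cancel_left) simp
  ultimately have "Q x = ((1 + m) / (cosh (m * x))\<^sup>2) powr (1 / (2 * m))"
    unfolding Qsol_def m_def[symmetric] by (simp only:)
  also have "\<dots> = (1 + m) powr (1 / (2 * m)) / (cosh (m * x) powr (1 / m))"
    using m_pos \<open>((cosh (m * x))\<^sup>2) powr (1 / (2 * m)) = cosh (m * x) powr (1 / m)\<close>
    by (subst powr_divide) auto
  finally show ?thesis by (simp add: powr_minus_divide)
qed

lemma Q_pos: "Q x > 0"
  using m_pos cosh_real_pos[of "m * x"] by (simp add: Q_eq)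

lemma DERIV_Q: "(Q has_real_derivative Qd x) (at x)"
proof -
  have "((\<lambda>x. (1 + m) powr (1 / (2 * m)) * cosh (m * x) powr (- (1 / m))) has_real_derivative
     (1 + m) powr (1 / (2 * m)) * ((- (1 / m)) * cosh (m * x) powr (- (1 / m) - 1) * (sinh (m * x) * m))) (at x)"
    by (intro DERIV_cmult DERIV_chain2[where f = "\<lambda>z. z powr (- (1 / m))" and g = "\<lambda>x. cosh (m * x)"]
          has_real_derivative_powr cosh_real_pos) (auto intro!: derivative_eq_intros)
  moreover have "(1 + m) powr (1 / (2 * m)) * ((- (1 / m)) * cosh (m * x) powr (- (1 / m) - 1) * (sinh (m * x) * m)) = Qd x"
  proof -
    have "cosh (m * x) powr (- (1 / m) - 1) = cosh (m * x) powr (- (1 / m)) / cosh (m * x)"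
      using cosh_real_pos[of "m * x"] by (subst powr_diff) simp
    then show ?thesis unfolding Qd_def Q_eq tanh_def using m_pos by simp
  qed
  moreover have "Q = (\<lambda>x. (1 + m) powr (1 / (2 * m)) * cosh (m * x) powr (- (1 / m)))"
    using Q_eq by auto
  ultimately show ?thesis by simp
qed

lemma tanh_sq: "1 - (tanh z)\<^sup>2 = 1 / (cosh z)\<^sup>2" for z :: real
proof -
  have "(cosh z)\<^sup>2 \<noteq> 0" using cosh_real_pos[of z] by simp
  then have "1 - (tanh z)\<^sup>2 = ((cosh z)\<^sup>2 - (sinh z)\<^sup>2) / (cosh z)\<^sup>2"
    by (simp add: tanh_def power_divide diff_divide_distrib)
  then show ?thesis by (simp add: hyperbolic_pythagoras)
qed

text \<open>This removes the powers of \<open>cosh\<close>: the identities for \<open>Q\<close>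
  below become polynomial or rational identities in \<open>Q x\<close> and
  \<open>tanh (m * x)\<close>.\<close>

lemma Q_power: "Q x ^ (p - 1) = (1 + m) * (1 - (tanh (m * x))\<^sup>2)"
proof -
  have "Q x ^ (p - 1) = Q x powr (2 * m)"
  proof -
    have "real (p - 1) = 2 * m" using p_m p_ge2 by simp
    then show ?thesis using powr_realpow[OF Q_pos, of x "p - 1"] by simp
  qed
  also have "\<dots> = (real p + 1) / (2 * (cosh (m * x))\<^sup>2)"
  proof -
    have "1 / (real p - 1) * (2 * m) = 1" using p_pos by (simp add: m_def)
    moreover have "0 \<le> (real p + 1) / (2 * (cosh (m * x))\<^sup>2)" by simp
    ultimately show ?thesis
      unfolding Qsol_def powr_powr m_def[symmetric] by (simp only: powr_one)
  qed
  also have "\<dots> = (1 + m) * (1 - (tanh (m * x))\<^sup>2)"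
  proof -
    have "real p + 1 = 2 * (1 + m)" using p_m by simp
    moreover have "2 * (1 + m) / (2 * (cosh (m * x))\<^sup>2) = (1 + m) / (cosh (m * x))\<^sup>2"
      by (rule mult_divide_mult_cancel_left) simp
    ultimately show ?thesis unfolding tanh_sq by (simp only: times_divide_eq_right mult_1_right)
  qed
  finally show ?thesis .
qed

lemma Q_pow_p: "Q x ^ p = Q x * ((1 + m) * (1 - (tanh (m * x))\<^sup>2))"
  using Q_power[of x] p_ge2 by (metis One_nat_def Suc_diff_1 less_le_trans pos2 power_Suc)

lemma DERIV_Qd: "(Qd has_real_derivative Q x - Q x ^ p) (at x)"
proof -
  have "((\<lambda>x. - Q x * tanh (m * x)) has_real_derivative Q x - Q x ^ p) (at x)"
    unfolding Q_pow_p
    by (rule derivative_eq_intros DERIV_Q refl | simp)+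
      (simp add: Qd_def tanh_sq power2_eq_square algebra_simps)
  then show ?thesis unfolding Qd_def[abs_def] by simp
qed

text \<open>The first integral of the soliton equation, with constant 0 as decay at infinity
  requires.\<close>

lemma Qd_sq: "(Qd x)\<^sup>2 = (Q x)\<^sup>2 - 2 / (real p + 1) * Q x ^ (p + 1)"
proof -
  have "Q x ^ (p + 1) = (Q x)\<^sup>2 * ((1 + m) * (1 - (tanh (m * x))\<^sup>2))"
    by (simp add: Q_pow_p power2_eq_square)
  moreover have "real p + 1 = 2 * (1 + m)" using p_m by simp
  ultimately show ?thesis
    using m_pos by (simp add: Qd_def power_mult_distrib field_simps)
qed

lemma Q_even: "Q (- x) = Q x" and Qd_odd: "Qd (- x) = - Qd x"
  by (simp_all add: Q_eq Qd_def)

text \<open>The lower bound matters as well: it controls \<open>1 / Q\<close> in the second solution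
  of the homogeneous equation.\<close>

lemma Q_bounds:
  obtains k K where "k > 0" "K > 0" "\<And>x. k * exp (- \<bar>x\<bar>) \<le> Q x" "\<And>x. Q x \<le> K * exp (- \<bar>x\<bar>)"
proof -
  define k where "k = (1 + m) powr (1 / (2 * m))"
  have k: "k > 0" using m_pos by (simp add: k_def)
  have c: "cosh (m * x) = (exp (m * \<bar>x\<bar>) + exp (- (m * \<bar>x\<bar>))) / 2" for x
    by (cases "0 \<le> x") (auto simp: cosh_def)
  have 1: "k * exp (- \<bar>x\<bar>) \<le> Q x" for x
  proof -
    have "exp (- (m * \<bar>x\<bar>)) \<le> exp (m * \<bar>x\<bar>)" using m_pos by simp
    then have "cosh (m * x) \<le> exp (m * \<bar>x\<bar>)" unfolding c by simp
    then have "exp (m * \<bar>x\<bar>) powr (- (1 / m)) \<le> cosh (m * x) powr (- (1 / m))"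
      using m_pos by (intro powr_mono2') (auto simp: cosh_real_pos)
    moreover have "exp (m * \<bar>x\<bar>) powr (- (1 / m)) = exp (- \<bar>x\<bar>)"
      using m_pos by (simp add: powr_def)
    ultimately show ?thesis using k by (simp add: Q_eq k_def[symmetric])
  qed
  have 2: "Q x \<le> (k * 2 powr (1 / m)) * exp (- \<bar>x\<bar>)" for x
  proof -
    have "exp (m * \<bar>x\<bar>) / 2 \<le> cosh (m * x)" unfolding c by simp
    then have "cosh (m * x) powr (- (1 / m)) \<le> (exp (m * \<bar>x\<bar>) / 2) powr (- (1 / m))"
      using m_pos by (intro powr_mono2') auto
    also have "\<dots> = 2 powr (1 / m) * exp (- \<bar>x\<bar>)"
      using m_pos by (simp add: powr_divide powr_minus) (simp add: powr_def exp_minus field_simps)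
    finally show ?thesis using k by (simp add: Q_eq k_def[symmetric] mult.assoc)
  qed
  show ?thesis using that[OF k _ 1 2] k by simp
qed

lemma Qd_le_Q: "\<bar>Qd x\<bar> \<le> Q x"
proof -
  have "\<bar>tanh (m * x)\<bar> \<le> 1" using tanh_real_bounds[of "m * x"] by (auto simp: abs_le_iff)
  then show ?thesis
    unfolding Qd_def using Q_pos[of x]
    by (simp add: abs_mult mult_left_le)
qed

lemma Qd_exp: obtains K where "K > 0" "\<And>x. \<bar>Qd x\<bar> \<le> K * exp (- \<bar>x\<bar>)"
  using Q_bounds Qd_le_Q by (metis order_trans)

text \<open>The equation \<open>Q'' = Q - Q ^ p\<close> closes the induction on the pair
  \<open>Q\<close>, \<open>Qd\<close>. In a power of \<open>Q\<close> one factor supplies the whole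
  exponent \<open>d\<close> and the others the exponent 0.\<close>

lemma growsn_Q: "(\<forall>d. growsn n d Q) \<and> (\<forall>d. growsn n d Qd)"
proof -
  obtain K where K: "K > 0" "\<And>x. Q x \<le> K * exp (- \<bar>x\<bar>)" by (rule Q_bounds) blast
  have b: "poly_bounded d Q" "poly_bounded d Qd" for d
    using K(2) Q_pos order_trans[OF Qd_le_Q K(2)] by (auto intro!: poly_bounded_exp[of _ K] simp: abs_of_pos)
  show ?thesis
  proof (induction n)
    case 0 then show ?case using b by simp
  next
    case (Suc n)
    have pow: "growsn n d (\<lambda>x. Q x ^ Suc k)" for d k
    proof (induction k arbitrary: d)
      case (Suc k)
      show ?case using growsn_mult[of n 0 Q d "\<lambda>x. Q x ^ Suc k"] \<open>(\<forall>d. growsn n d Q) \<and> _\<close> Suc by simp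
    qed (use Suc in simp)
    have "growsn n d (\<lambda>x. Q x + - 1 * Q x ^ p)" for d
      using growsn_add[of n d Q "\<lambda>x. - 1 * Q x ^ p"] Suc.IH
        growsn_mult[OF growsn_const[of 0 n "-1"] pow[of d "p - 1"]] p_ge2 by simp
    then show ?case
      using growsn_SucI[OF b(1) DERIV_Q] growsn_SucI[OF b(2) DERIV_Qd] Suc.IH
      by (simp del: growsn.simps)
  qed
qed

lemma rapid_Q: "rapid Q" and rapid_Qd: "rapid Qd"
  using growsn_Q unfolding rapid_def grows_def by blast+

lemma Qpp_bound: "\<bar>Q x - Q x ^ p\<bar> \<le> Q x * (1 + m)"
proof -
  define Z where "Z = (1 + m) * (1 - (tanh (m * x))\<^sup>2)"
  have "\<bar>tanh (m * x)\<bar> \<le> 1" using tanh_real_bounds[of "m * x"] by (auto simp: abs_le_iff)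
  then have T: "(tanh (m * x))\<^sup>2 \<le> 1" by (simp add: abs_square_le_1)
  have "Z \<le> (1 + m) * 1" unfolding Z_def using m_pos by (intro mult_left_mono) auto
  then have "Z \<le> 1 + m" by simp
  moreover have "0 \<le> Z" unfolding Z_def using m_pos T by simp
  ultimately have "\<bar>1 - Z\<bar> \<le> 1 + m" using m_pos by linarith
  moreover have "\<bar>Q x - Q x ^ p\<bar> = Q x * \<bar>1 - Z\<bar>"
  proof -
    have "Q x - Q x ^ p = Q x * (1 - Z)" unfolding Q_pow_p Z_def by (simp only: right_diff_distrib mult_1_right)
    then show ?thesis using Q_pos[of x] by (simp only: abs_mult abs_of_pos)
  qed
  ultimately show ?thesis using Q_pos[of x] by (metis mult_left_mono less_imp_le)
qed

lemma Qpp_exp: obtains K where "K > 0" "\<And>x. \<bar>Q x - Q x ^ p\<bar> \<le> K * exp (- \<bar>x\<bar>)"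
proof -
  obtain k K where K: "k > 0" "K > 0" "\<And>x. k * exp (- \<bar>x\<bar>) \<le> Q x" "\<And>x. Q x \<le> K * exp (- \<bar>x\<bar>)"
    by (rule Q_bounds) blast
  have "\<bar>Q x - Q x ^ p\<bar> \<le> (K * (1 + m)) * exp (- \<bar>x\<bar>)" for x
    using order_trans[OF Qpp_bound mult_right_mono[OF K(4)]] m_pos by (simp add: mult_ac)
  then show ?thesis using that[of "K * (1 + m)"] K(2) m_pos by simp
qed

section \<open>The second homogeneous solution\<close>

definition J :: "real \<Rightarrow> real" where "J = prim (\<lambda>x. 1 / (Q x)\<^sup>2)"

lemma isCont_Q: "isCont Q x" using DERIV_isCont[OF DERIV_Q] .

lemma isCont_inverse_Q_sq: "isCont (\<lambda>x. 1 / (Q x)\<^sup>2) x"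
proof -
  have "(Q x)\<^sup>2 \<noteq> 0" using Q_pos[of x] by simp
  then show ?thesis by (intro isCont_divide isCont_power isCont_Q continuous_const)
qed

lemma DERIV_J: "(J has_real_derivative 1 / (Q x)\<^sup>2) (at x)" and J_0: "J 0 = 0"
  unfolding J_def by (rule DERIV_prim prim_0, rule isCont_inverse_Q_sq)+

text \<open>The solution of the homogeneous equation that is independent of \<open>Qd\<close>, obtained by reduction of
  order. The singular part of the primitive of \<open>1 / Qd\<^sup>2\<close> at 0 is integrated explicitly.\<close>
definition R :: "real \<Rightarrow> real" where "R x = 1 / (m * Q x) + (1 + 2 / m) * (Qd x * J x)"

definition Rd :: "real \<Rightarrow> real" where
  "Rd x = (1 + 1 / m) * (Qd x / (Q x)\<^sup>2) + (1 + 2 / m) * ((Q x - Q x ^ p) * J x)"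

lemma DERIV_R: "(R has_real_derivative Rd x) (at x)"
proof -
  have "((\<lambda>x. 1 / (m * Q x) + (1 + 2 / m) * (Qd x * J x)) has_real_derivative
     - (m * Qd x) / (m * Q x)\<^sup>2 + (1 + 2 / m) * ((Q x - Q x ^ p) * J x + 1 / (Q x)\<^sup>2 * Qd x)) (at x)"
    using m_pos Q_pos[of x]
    by (auto intro!: derivative_eq_intros DERIV_Q DERIV_Qd DERIV_J simp: power2_eq_square)
  moreover have "- (m * Qd x) / (m * Q x)\<^sup>2 + (1 + 2 / m) * ((Q x - Q x ^ p) * J x + 1 / (Q x)\<^sup>2 * Qd x) = Rd x"
    using m_pos Q_pos[of x] by (simp add: Rd_def power2_eq_square field_simps)
  ultimately show ?thesis unfolding R_def[abs_def] by simp
qed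

lemma DERIV_Qpp: "((\<lambda>x. Q x - Q x ^ p) has_real_derivative (1 - real p * Q x ^ (p - 1)) * Qd x) (at x)"
  by (auto intro!: derivative_eq_intros DERIV_Q simp: algebra_simps)

text \<open>The terms with \<open>J\<close> reproduce the equation already satisfied by
  \<open>Qd\<close>. What remains, free of \<open>J\<close>, is a rational identity in
  \<open>Q x\<close> and \<open>tanh (m * x)\<close>.\<close>

lemma DERIV_Rd: "(Rd has_real_derivative (1 - real p * Q x ^ (p - 1)) * R x) (at x)"
proof -
  define T where "T = tanh (m * x)"
  have Q: "Q x > 0" by (rule Q_pos)
  have Qd: "Qd x = - Q x * T" by (simp add: Qd_def T_def)
  have Qpp: "Q x - Q x ^ p = Q x * (1 - (1 + m) * (1 - T\<^sup>2))" by (simp add: Q_pow_p T_def algebra_simps)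
  have rearrange: "c1 * X + c2 * (V * q * j + Y) = V * (W + c2 * (q * j))"
    if "c1 * X + c2 * Y = V * W" for c1 c2 X Y V W q j :: real
    using that by (simp add: algebra_simps)
  have "(Rd has_real_derivative (1 + 1 / m) * (((Q x - Q x ^ p) * (Q x)\<^sup>2 - Qd x * (2 * (Q x * Qd x))) / ((Q x)\<^sup>2 * (Q x)\<^sup>2))
     + (1 + 2 / m) * ((1 - real p * Q x ^ (p - 1)) * Qd x * J x + (Q x - Q x ^ p) * (1 / (Q x)\<^sup>2))) (at x)"
  proof -
    have "((\<lambda>x. (Q x)\<^sup>2) has_real_derivative 2 * (Q x * Qd x)) (at x)"
      using DERIV_power[OF DERIV_Q, of 2] by (simp add: mult_ac)
    then have 1: "((\<lambda>x. Qd x / (Q x)\<^sup>2) has_real_derivative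
        ((Q x - Q x ^ p) * (Q x)\<^sup>2 - Qd x * (2 * (Q x * Qd x))) / ((Q x)\<^sup>2 * (Q x)\<^sup>2)) (at x)"
      using Q by (intro DERIV_divide DERIV_Qd) auto
    have 2: "((\<lambda>x. (Q x - Q x ^ p) * J x) has_real_derivative
        (1 - real p * Q x ^ (p - 1)) * Qd x * J x + (Q x - Q x ^ p) * (1 / (Q x)\<^sup>2)) (at x)"
      using DERIV_mult[OF DERIV_Qpp DERIV_J] by (simp add: mult.commute)
    show ?thesis
      unfolding Rd_def[abs_def] by (rule DERIV_add[OF DERIV_cmult[OF 1] DERIV_cmult[OF 2]])
  qed
  moreover have "(1 + 1 / m) * (((Q x - Q x ^ p) * (Q x)\<^sup>2 - Qd x * (2 * (Q x * Qd x))) / ((Q x)\<^sup>2 * (Q x)\<^sup>2))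
     + (1 + 2 / m) * ((Q x - Q x ^ p) * (1 / (Q x)\<^sup>2)) = (1 - real p * Q x ^ (p - 1)) * (1 / (m * Q x))"
    unfolding Qpp unfolding Q_power Qd p_m T_def[symmetric]
  proof -
    define X where "X = Q x"
    define S where "S = 1 - (1 + m) * (1 - T\<^sup>2)"
    have X: "X > 0" using Q by (simp add: X_def)
    have 1: "(X * S * X\<^sup>2 - - X * T * (2 * (X * (- X * T)))) / (X\<^sup>2 * X\<^sup>2) = (S - 2 * T\<^sup>2) / X"
      using X by (simp add: field_simps power2_eq_square)
    have 2: "X * S * (1 / X\<^sup>2) = S / X" using X by (simp add: power2_eq_square)
    have "(1 + 1 / m) * (S - 2 * T\<^sup>2) + (1 + 2 / m) * S = (1 - (2 * m + 1) * ((1 + m) * (1 - T\<^sup>2))) / m"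
      using m_pos unfolding S_def by (simp add: divide_simps) algebra
    then have "((1 + 1 / m) * (S - 2 * T\<^sup>2) + (1 + 2 / m) * S) / X
        = (1 - (2 * m + 1) * ((1 + m) * (1 - T\<^sup>2))) * (1 / (m * X))" by simp
    then show "(1 + 1 / m) * ((Q x * (1 - (1 + m) * (1 - T\<^sup>2)) * (Q x)\<^sup>2 - - Q x * T * (2 * (Q x * (- Q x * T)))) / ((Q x)\<^sup>2 * (Q x)\<^sup>2)) +
      (1 + 2 / m) * (Q x * (1 - (1 + m) * (1 - T\<^sup>2)) * (1 / (Q x)\<^sup>2)) =
      (1 - (2 * m + 1) * ((1 + m) * (1 - T\<^sup>2))) * (1 / (m * Q x))"
      unfolding X_def[symmetric] S_def[symmetric] 1 2 by (simp add: add_divide_distrib)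
  qed
  ultimately show ?thesis unfolding R_def by (simp only: rearrange)
qed

text \<open>The terms with \<open>J\<close> cancel. The constants in \<open>R\<close> are normalised
  so that the value is exactly 1, and variation of constants then has no denominator.\<close>

lemma wronskian: "Qd x * Rd x - (Q x - Q x ^ p) * R x = 1"
proof -
  define T where "T = tanh (m * x)"
  have Q: "Q x > 0" by (rule Q_pos)
  have Qd: "Qd x = - Q x * T" by (simp add: Qd_def T_def)
  have Qpp: "Q x - Q x ^ p = Q x * (1 - (1 + m) * (1 - T\<^sup>2))" by (simp add: Q_pow_p T_def algebra_simps)
  define X where "X = Q x"
  define S where "S = 1 - (1 + m) * (1 - T\<^sup>2)"
  have X: "X > 0" using Q by (simp add: X_def)
  have 1: "- X * T * ((1 + 1 / m) * (- X * T / X\<^sup>2)) = (1 + 1 / m) * T\<^sup>2"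
    and 2: "X * S * (1 / (m * X)) = S / m"
    using X by (simp_all add: power2_eq_square)
  have "(1 + 1 / m) * T\<^sup>2 - S / m = 1"
    using m_pos unfolding S_def by (simp add: divide_simps) (simp add: algebra_simps)
  then have "- X * T * ((1 + 1 / m) * (- X * T / X\<^sup>2)) - X * S * (1 / (m * X)) = 1"
    unfolding 1 2 .
  then have "- X * T * ((1 + 1 / m) * (- X * T / X\<^sup>2) + (1 + 2 / m) * (X * S * J x)) -
      X * S * (1 / (m * X) + (1 + 2 / m) * (- X * T * J x)) = 1"
    unfolding distrib_left by (simp only: mult_ac)
  then show ?thesis
    unfolding R_def Rd_def Qpp unfolding Qd X_def[symmetric] S_def[symmetric] .
qed

text \<open>\<open>J\<close> grows at most like \<open>exp (2 * \<bar>x\<bar>)\<close> and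
  \<open>Qd\<close> decays like \<open>exp (- \<bar>x\<bar>)\<close>, so \<open>R\<close> grows at
  most at the rate that the decay of \<open>Qd\<close> can compensate.\<close>

lemma R_exp: obtains K where "K > 0" "\<And>x. \<bar>R x\<bar> \<le> K * exp \<bar>x\<bar>"  "\<And>x. \<bar>Rd x\<bar> \<le> K * exp \<bar>x\<bar>"
proof -
  obtain k K where k: "k > 0" "K > 0" "\<And>x. k * exp (- \<bar>x\<bar>) \<le> Q x" "\<And>x. Q x \<le> K * exp (- \<bar>x\<bar>)"
    by (rule Q_bounds) blast
  have inv: "1 / Q x \<le> 1 / k * exp \<bar>x\<bar>" for x
  proof -
    have "1 / Q x \<le> 1 / (k * exp (- \<bar>x\<bar>))"
      using k(3)[of x] k(1) by (intro divide_left_mono) (auto simp: Q_pos)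
    then show ?thesis by (simp add: exp_minus divide_inverse mult.commute)
  qed
  have inv2: "1 / (Q x)\<^sup>2 \<le> 1 / k\<^sup>2 * exp (2 * \<bar>x\<bar>)" for x
  proof -
    have "(1 / Q x)\<^sup>2 \<le> (1 / k * exp \<bar>x\<bar>)\<^sup>2"
      using Q_pos[of x] by (intro power_mono inv) (simp add: less_imp_le)
    moreover have "(exp \<bar>x\<bar>)\<^sup>2 = exp (2 * \<bar>x\<bar>)" by (rule exp_double[symmetric])
    ultimately show ?thesis by (simp only: power_divide power_mult_distrib power_one)
  qed
  have J: "\<bar>J x\<bar> \<le> 1 / k\<^sup>2 * exp (2 * \<bar>x\<bar>)" for x
  proof -
    have "\<bar>J x\<bar> \<le> 1 / (2 * k\<^sup>2) * exp (2 * \<bar>x\<bar>) - 1 / (2 * k\<^sup>2) * exp (2 * 0)"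
    proof (rule prim_bound[OF DERIV_J J_0, where h = "\<lambda>x. 1 / k\<^sup>2 * exp (2 * x)"])
      show "((\<lambda>x. 1 / (2 * k\<^sup>2) * exp (2 * x)) has_real_derivative 1 / k\<^sup>2 * exp (2 * x)) (at x)" for x
        by (rule DERIV_cong[OF DERIV_cmult[OF DERIV_chain2[OF DERIV_exp DERIV_cmult[OF DERIV_ident]]]]) simp
    qed (use inv2 Q_pos in simp)
    also have "\<dots> \<le> 1 / (2 * k\<^sup>2) * exp (2 * \<bar>x\<bar>)" using k by simp
    also have "\<dots> \<le> 1 / k\<^sup>2 * exp (2 * \<bar>x\<bar>)" using k by (simp add: field_simps)
    finally show ?thesis .
  qed
  have QJ: "Q x * \<bar>J x\<bar> \<le> K / k\<^sup>2 * exp \<bar>x\<bar>" for x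
  proof -
    have "Q x * \<bar>J x\<bar> \<le> K * exp (- \<bar>x\<bar>) * (1 / k\<^sup>2 * exp (2 * \<bar>x\<bar>))"
      using k(4)[of x] J[of x] Q_pos[of x] k by (intro mult_mono) auto
    also have "\<dots> = K / k\<^sup>2 * exp \<bar>x\<bar>"
    proof -
      have "exp (- \<bar>x\<bar>) * exp (2 * \<bar>x\<bar>) = exp \<bar>x\<bar>" by (simp flip: exp_add)
      moreover have "K * exp (- \<bar>x\<bar>) * (1 / k\<^sup>2 * exp (2 * \<bar>x\<bar>)) = K / k\<^sup>2 * (exp (- \<bar>x\<bar>) * exp (2 * \<bar>x\<bar>))"
        by simp
      ultimately show ?thesis by (simp only:)
    qed
    finally show ?thesis .
  qed
  define C where "C = (1 + 1 / m) * (1 / k) + (1 + 2 / m) * (1 + m) * (K / k\<^sup>2)"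
  have c: "\<bar>R x\<bar> \<le> C * exp \<bar>x\<bar>" "\<bar>Rd x\<bar> \<le> C * exp \<bar>x\<bar>" for x
  proof -
    have QdJ: "\<bar>Qd x * J x\<bar> \<le> K / k\<^sup>2 * exp \<bar>x\<bar>"
      using mult_right_mono[OF Qd_le_Q[of x], of "\<bar>J x\<bar>"] QJ[of x] by (simp add: abs_mult)
    have "\<bar>R x\<bar> \<le> 1 / m * (1 / Q x) + (1 + 2 / m) * \<bar>Qd x * J x\<bar>"
    proof -
      have "\<bar>1 / (m * Q x)\<bar> = 1 / m * (1 / Q x)" using m_pos Q_pos[of x] by (simp add: abs_mult)
      moreover have "\<bar>(1 + 2 / m) * (Qd x * J x)\<bar> = (1 + 2 / m) * \<bar>Qd x * J x\<bar>"
        using m_pos by (subst abs_mult) auto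
      ultimately show ?thesis unfolding R_def by (metis abs_triangle_ineq)
    qed
    also have "\<dots> \<le> 1 / m * (1 / k * exp \<bar>x\<bar>) + (1 + 2 / m) * (K / k\<^sup>2 * exp \<bar>x\<bar>)"
      using m_pos inv[of x] QdJ by (intro add_mono mult_left_mono) auto
    also have "\<dots> = (1 / m * (1 / k) + (1 + 2 / m) * (K / k\<^sup>2)) * exp \<bar>x\<bar>"
      by (simp only: distrib_right mult.assoc)
    also have "\<dots> \<le> C * exp \<bar>x\<bar>"
    proof -
      have "1 / m * (1 / k) \<le> (1 + 1 / m) * (1 / k)" using k by (intro mult_right_mono) auto
      moreover have "(1 + 2 / m) * (K / k\<^sup>2) \<le> (1 + 2 / m) * (1 + m) * (K / k\<^sup>2)"
      proof -
        have "(1 + 2 / m) * 1 \<le> (1 + 2 / m) * (1 + m)" using m_pos by (intro mult_left_mono) auto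
        then show ?thesis using k by (intro mult_right_mono) auto
      qed
      ultimately show ?thesis unfolding C_def by (intro mult_right_mono) auto
    qed
    finally show "\<bar>R x\<bar> \<le> C * exp \<bar>x\<bar>" .
    have 1: "\<bar>Qd x / (Q x)\<^sup>2\<bar> \<le> 1 / k * exp \<bar>x\<bar>"
    proof -
      have "\<bar>Qd x / (Q x)\<^sup>2\<bar> = \<bar>Qd x\<bar> / (Q x)\<^sup>2" by simp
      also have "\<dots> \<le> Q x / (Q x)\<^sup>2" by (intro divide_right_mono Qd_le_Q) simp
      also have "\<dots> = 1 / Q x" using Q_pos[of x] by (simp add: power2_eq_square)
      finally show ?thesis using inv[of x] by simp
    qed
    have 2: "\<bar>(Q x - Q x ^ p) * J x\<bar> \<le> (1 + m) * (K / k\<^sup>2 * exp \<bar>x\<bar>)"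
    proof -
      have "\<bar>(Q x - Q x ^ p) * J x\<bar> \<le> (Q x * (1 + m)) * \<bar>J x\<bar>"
        unfolding abs_mult by (intro mult_right_mono Qpp_bound) auto
      also have "\<dots> = (1 + m) * (Q x * \<bar>J x\<bar>)" by simp
      also have "\<dots> \<le> (1 + m) * (K / k\<^sup>2 * exp \<bar>x\<bar>)" using m_pos QJ[of x] by (intro mult_left_mono) auto
      finally show ?thesis .
    qed
    have "\<bar>Rd x\<bar> \<le> (1 + 1 / m) * \<bar>Qd x / (Q x)\<^sup>2\<bar> + (1 + 2 / m) * \<bar>(Q x - Q x ^ p) * J x\<bar>"
    proof -
      have "\<bar>(1 + 1 / m) * (Qd x / (Q x)\<^sup>2)\<bar> = (1 + 1 / m) * \<bar>Qd x / (Q x)\<^sup>2\<bar>"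
        using m_pos by (subst abs_mult) auto
      moreover have "\<bar>(1 + 2 / m) * ((Q x - Q x ^ p) * J x)\<bar> = (1 + 2 / m) * \<bar>(Q x - Q x ^ p) * J x\<bar>"
        using m_pos by (subst abs_mult) auto
      ultimately show ?thesis unfolding Rd_def by (metis abs_triangle_ineq)
    qed
    also have "\<dots> \<le> (1 + 1 / m) * (1 / k * exp \<bar>x\<bar>) + (1 + 2 / m) * ((1 + m) * (K / k\<^sup>2 * exp \<bar>x\<bar>))"
      using m_pos 1 2 by (intro add_mono mult_left_mono) auto
    also have "\<dots> = C * exp \<bar>x\<bar>" unfolding C_def by (simp only: distrib_right mult.assoc)
    finally show "\<bar>Rd x\<bar> \<le> C * exp \<bar>x\<bar>" .
  qed
  have "C > 0" using m_pos k by (simp add: C_def add_pos_pos)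
  then show ?thesis using that c by blast
qed

end

section \<open>Solving the linearized equation\<close>

lemma rapid_bound_inverse:
  assumes "rapid f"
  obtains C where "C > 0" "\<And>x. \<bar>f x\<bar> \<le> C / (1 + \<bar>x\<bar>)"
proof -
  obtain C where C: "C > 0" "\<And>x. \<bar>f x\<bar> \<le> C * (1 + \<bar>x\<bar>) powr (-1)"
    using poly_boundedE[OF grows_bounded[OF rapid_grows[OF assms]]] by blast
  have "(1 + \<bar>x\<bar>) powr (-1) = 1 / (1 + \<bar>x\<bar>)" for x :: real
    by (subst powr_minus_divide) (simp add: add_pos_nonneg)
  then show ?thesis using that[OF C(1)] C(2) by simp
qed

lemma inverse_shift_tendsto: "((\<lambda>x. C / (1 + x)) \<longlongrightarrow> 0) (at_top :: real filter)"
  by (intro tendsto_divide_0[OF tendsto_const] filterlim_at_top_imp_at_infinity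
      filterlim_tendsto_add_at_top[OF tendsto_const] filterlim_ident)

lemma rapid_tendsto_0:
  assumes "rapid f" shows "(f \<longlongrightarrow> 0) at_top"
proof -
  obtain C where C: "\<And>x. \<bar>f x\<bar> \<le> C / (1 + \<bar>x\<bar>)" using rapid_bound_inverse[OF assms] by blast
  have "eventually (\<lambda>x. \<bar>f x\<bar> \<le> C / (1 + x)) at_top"
    using eventually_ge_at_top[of 0] by eventually_elim (use C in \<open>metis abs_of_nonneg\<close>)
  then show ?thesis
    by (intro tendsto_rabs_zero_cancel[OF tendsto_sandwich[OF _ _ tendsto_const inverse_shift_tendsto]]) auto
qed

text \<open>The tail bound \<open>C / (1 + a)\<close> makes the values at the integers a Cauchy
  sequence, and the same bound carries their limit over to real arguments.\<close>

lemma prim_rapid_limit: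
  assumes "rapid h"
  obtains L where "(prim h \<longlongrightarrow> L) at_top"
proof -
  have c: "isCont h x" for x using DERIV_isCont[OF grows_DERIV[OF rapid_grows[OF assms]]] .
  obtain C where C: "C > 0" "\<And>x. \<bar>h x\<bar> \<le> C * (1 + \<bar>x\<bar>) powr (-2)"
    using poly_boundedE[OF grows_bounded[OF rapid_grows[OF assms]]] by blast
  have *: "\<bar>prim h b - prim h a\<bar> \<le> C / (1 + a)" if "0 \<le> a" "a \<le> b" for a b
  proof -
    have "\<bar>prim h b - prim h a\<bar> \<le> - C * (1 + b) powr (-1) - - C * (1 + a) powr (-1)"
    proof (rule prim_bound_pos[OF DERIV_prim[OF c] _ _ that])
      fix x :: real assume x: "0 \<le> x"
      show "\<bar>h x\<bar> \<le> C * (1 + x) powr (-2)" using C(2)[of x] x by simp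
      show "((\<lambda>x. - C * (1 + x) powr (-1)) has_real_derivative C * (1 + x) powr (-2)) (at x)"
        using x DERIV_cmult[OF DERIV_chain2[OF has_real_derivative_powr[of "1 + x" "-1"]
              DERIV_add[OF DERIV_const DERIV_ident]], where c = "- C"] by (simp del: powr_neg_one)
    qed
    also have "\<dots> \<le> C * (1 + a) powr (-1)" using C(1) by simp
    also have "\<dots> = C / (1 + a)" using that by (subst powr_minus_divide) simp
    finally show ?thesis .
  qed
  have small: "\<exists>a\<ge>0. C / (1 + a) < e" if "e > 0" for e
  proof (intro exI conjI)
    show "0 \<le> C / e" using that C(1) by simp
    have "e * (1 + C / e) = e + C" using that by (simp add: distrib_left)
    then have "C < e * (1 + C / e)" using that by simp
    moreover have "0 < 1 + C / e" using that C(1) by (simp add: add_pos_pos)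
    ultimately show "C / (1 + C / e) < e" by (simp add: pos_divide_less_eq)
  qed
  have "Cauchy (\<lambda>n. prim h (real n))"
  proof (rule metric_CauchyI)
    fix e :: real assume "e > 0"
    then obtain a where a: "a \<ge> 0" "C / (1 + a) < e / 2" using small[of "e / 2"] by auto
    have near: "\<bar>prim h (real n) - prim h a\<bar> < e / 2" if "n \<ge> nat \<lceil>a\<rceil>" for n
    proof -
      have "a \<le> real n" using that by (simp add: nat_le_iff ceiling_le_iff)
      from le_less_trans[OF *[OF a(1) this] a(2)] show ?thesis .
    qed
    have "dist (prim h (real m)) (prim h (real n)) < e" if "m \<ge> nat \<lceil>a\<rceil>" "n \<ge> nat \<lceil>a\<rceil>" for m n
      using near[OF that(1)] near[OF that(2)] unfolding dist_real_def by linarith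
    then show "\<exists>M. \<forall>m\<ge>M. \<forall>n\<ge>M. dist (prim h (real m)) (prim h (real n)) < e" by blast
  qed
  then obtain L where L: "(\<lambda>n. prim h (real n)) \<longlonglongrightarrow> L"
    using real_Cauchy_convergent unfolding convergent_def by blast
  have b: "\<bar>prim h a - L\<bar> \<le> C / (1 + a)" if "0 \<le> a" for a
  proof -
    have "(\<lambda>n. \<bar>prim h (real n) - prim h a\<bar>) \<longlonglongrightarrow> \<bar>L - prim h a\<bar>"
      by (intro tendsto_intros L)
    moreover have "eventually (\<lambda>n. \<bar>prim h (real n) - prim h a\<bar> \<le> C / (1 + a)) sequentially"
      using eventually_ge_at_top[of "nat \<lceil>a\<rceil>"]
    proof eventually_elim
      case (elim n)
      then have "a \<le> real n" by (simp add: nat_le_iff ceiling_le_iff)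
      then show ?case by (rule *[OF that])
    qed
    ultimately have "\<bar>L - prim h a\<bar> \<le> C / (1 + a)"
      by (intro tendsto_upperbound[of _ _ sequentially]) auto
    then show ?thesis by (simp add: abs_minus_commute)
  qed
  have "((\<lambda>x. \<bar>prim h x - L\<bar>) \<longlongrightarrow> 0) at_top"
  proof (rule tendsto_sandwich[OF _ _ tendsto_const inverse_shift_tendsto[of C]])
    show "eventually (\<lambda>x. \<bar>prim h x - L\<bar> \<le> C / (1 + x)) at_top"
      using eventually_ge_at_top[of 0] by eventually_elim (rule b)
  qed simp
  then have "(prim h \<longlongrightarrow> L) at_top"
    by (rule LIM_zero_cancel[OF tendsto_rabs_zero_cancel])
  then show ?thesis by (rule that)
qed

context gkdv
begin

section \<open>Variation of constants and parity\<close>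

definition V :: "real \<Rightarrow> real" where "V x = 1 - real p * Q x ^ (p - 1)"

text \<open>The equation \<open>L f = g\<close> as a first-order system: \<open>V\<close> is the
  potential of \<open>L\<close>, and carrying \<open>f'\<close> along allows both components to be
  estimated together.\<close>

definition solves :: "(real \<Rightarrow> real) \<Rightarrow> (real \<Rightarrow> real) \<Rightarrow> (real \<Rightarrow> real) \<Rightarrow> bool" where
  "solves g f f' \<longleftrightarrow> (\<forall>x. (f has_real_derivative f' x) (at x) \<and>
     (f' has_real_derivative V x * f x - g x) (at x))"

lemma rapid_Q_power: "0 < n \<Longrightarrow> rapid (\<lambda>x. Q x ^ n)"
  by (rule rapid_power[OF rapid_Q])

lemma grows_V: "grows 0 V"
proof -
  have "grows 0 (\<lambda>x. 1 - real p * Q x ^ (p - 1))"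
    using p_ge2 by (intro grows_diff grows_const grows_cmult rapid_grows rapid_Q_power) auto
  then show ?thesis by (simp add: V_def[abs_def])
qed

text \<open>Bootstrap: bounds on \<open>f\<close> and \<open>f'\<close> suffice, because the
  equation expresses every further derivative through these two, \<open>V\<close> and
  \<open>g\<close>.\<close>

lemma solves_bounded_imp_grows:
  assumes "solves g f f'" "grows d g" "poly_bounded d f" "poly_bounded d f'"
  shows "grows d f"
proof -
  have "growsn n d f \<and> growsn n d f'" for n
  proof (induction n)
    case 0 then show ?case using assms by simp
  next
    case (Suc n)
    have "growsn n d (\<lambda>x. V x * f x)"
      using growsn_mult[of n 0 V d f] grows_V Suc.IH by (simp add: grows_def)
    moreover have "growsn n d (\<lambda>x. - 1 * g x)"
      using growsn_mult[OF growsn_const[of 0 n "-1"], of d g] assms(2) by (simp add: grows_def)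
    ultimately have "growsn n d (\<lambda>x. V x * f x - g x)"
      using growsn_add[of n d "\<lambda>x. V x * f x" "\<lambda>x. - 1 * g x"] by simp
    then show ?case
      using assms(1) Suc.IH unfolding solves_def
      by (intro conjI growsn_SucI[OF assms(3), of f' n] growsn_SucI[OF assms(4), of "\<lambda>x. V x * f x - g x" n]) auto
  qed
  then show ?thesis by (simp add: grows_def)
qed

text \<open>Equality of the two limits of \<open>P\<close> says that \<open>g\<close> is orthogonal
  to the kernel \<open>Qd\<close>. It makes \<open>I1\<close> decay at both ends, which compensates
  the exponential growth of \<open>R\<close>. One and the same solution has to inherit every growth
  class of \<open>g\<close>, so \<open>d\<close> is quantified after \<open>f\<close>; this is what
  later turns rapid sources into rapid profiles.\<close>

lemma solve:
  assumes g: "grows e g"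
    and P: "\<And>x. (P has_real_derivative Qd x * g x) (at x)"
    and lim: "(P \<longlongrightarrow> L) at_top" "(P \<longlongrightarrow> L) at_bot"
  shows "\<exists>f f'. solves g f f' \<and> (\<forall>d. grows d g \<longrightarrow> grows d f)"
proof -
  define I2 where "I2 = prim (\<lambda>x. R x * g x)"
  \<comment> \<open>At \<open>x\<close> this is the integral of \<open>Qd * g\<close> from
    \<open>x\<close> to infinity.\<close>
  define I1 where "I1 x = L - P x" for x
  have cont: "isCont (\<lambda>x. R x * g x) x" for x
    by (intro isCont_mult DERIV_isCont[OF DERIV_R] DERIV_isCont[OF grows_DERIV[OF g]])
  have I2: "(I2 has_real_derivative R x * g x) (at x)" "I2 0 = 0" for x
    unfolding I2_def by (rule DERIV_prim prim_0, rule cont)+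
  have I1: "(I1 has_real_derivative - (Qd x * g x)) (at x)" for x
    unfolding I1_def using DERIV_diff[OF DERIV_const P] by simp
  define f where "f x = Qd x * I2 x + R x * I1 x" for x
  define f' where "f' x = (Q x - Q x ^ p) * I2 x + Rd x * I1 x" for x
  have "(f has_real_derivative f' x) (at x)" for x
  proof -
    have "(f has_real_derivative ((Q x - Q x ^ p) * I2 x + R x * g x * Qd x) + (Rd x * I1 x + - (Qd x * g x) * R x)) (at x)"
      unfolding f_def by (intro DERIV_add DERIV_mult DERIV_Qd I2 DERIV_R I1)
    then show ?thesis by (simp add: f'_def algebra_simps)
  qed
  moreover have "(f' has_real_derivative V x * f x - g x) (at x)" for x
  proof -
    have "(f' has_real_derivative (V x * Qd x * I2 x + R x * g x * (Q x - Q x ^ p)) + (V x * R x * I1 x + - (Qd x * g x) * Rd x)) (at x)"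
      unfolding f'_def V_def by (intro DERIV_add DERIV_mult DERIV_Qpp I2 DERIV_Rd I1)
    moreover have "(V x * Qd x * I2 x + R x * g x * (Q x - Q x ^ p)) + (V x * R x * I1 x + - (Qd x * g x) * Rd x)
       = V x * f x - (Qd x * Rd x - (Q x - Q x ^ p) * R x) * g x"
      unfolding f_def by (simp add: algebra_simps)
    ultimately show ?thesis unfolding wronskian by simp
  qed
  ultimately have s: "solves g f f'" by (simp add: solves_def)
  moreover have "grows d f" if gd: "grows d g" for d
  proof -
    obtain C where C: "C > 0" "\<And>x. \<bar>g x\<bar> \<le> C * (1 + \<bar>x\<bar>) powr d"
      using poly_boundedE[OF grows_bounded[OF gd]] by blast
    obtain K1 where K1: "K1 > 0" "\<And>x. \<bar>Qd x\<bar> \<le> K1 * exp (- \<bar>x\<bar>)" by (rule Qd_exp) blast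
    obtain K2 where K2: "K2 > 0" "\<And>x. \<bar>R x\<bar> \<le> K2 * exp \<bar>x\<bar>" "\<And>x. \<bar>Rd x\<bar> \<le> K2 * exp \<bar>x\<bar>"
      by (rule R_exp) blast
    obtain K3 where K3: "K3 > 0" "\<And>x. \<bar>Q x - Q x ^ p\<bar> \<le> K3 * exp (- \<bar>x\<bar>)"
      by (rule Qpp_exp) blast
    define b where "b = 1 + 2 * \<bar>d\<bar>"
    define w where "w x = (b + \<bar>x\<bar>) powr d" for x
    define D where "D = C * b powr \<bar>d\<bar>"
    have b1: "1 \<le> b" by (simp add: b_def)
    have D: "D > 0" using C b1 by (simp add: D_def)
    have gw: "\<bar>g x\<bar> \<le> D * w x" for x
    proof -
      have "C * (1 + \<bar>x\<bar>) powr d \<le> C * (b powr \<bar>d\<bar> * w x)"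
        unfolding w_def using C(1) shift_weight(1)[OF b1, of "\<bar>x\<bar>" d] by (intro mult_left_mono) auto
      then show ?thesis using C(2)[of x] by (simp add: D_def mult.assoc)
    qed
    have Qg: "\<bar>Qd x * g x\<bar> \<le> (K1 * D) * (w x * exp (- \<bar>x\<bar>))" for x
    proof -
      have "\<bar>Qd x\<bar> * \<bar>g x\<bar> \<le> (K1 * exp (- \<bar>x\<bar>)) * (D * w x)"
        using K1 gw by (intro mult_mono) auto
      then show ?thesis by (simp add: abs_mult mult_ac)
    qed
    have bI2: "\<bar>I2 x\<bar> \<le> 2 * (K2 * D) * (w x * exp \<bar>x\<bar>)" for x
      unfolding w_def b_def
    proof (rule exp_growth_primitive[OF I2])
      fix x
      have "\<bar>R x\<bar> * \<bar>g x\<bar> \<le> (K2 * exp \<bar>x\<bar>) * (D * w x)"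
        using K2 gw by (intro mult_mono) auto
      then show "\<bar>R x * g x\<bar> \<le> K2 * D * ((1 + 2 * \<bar>d\<bar> + \<bar>x\<bar>) powr d * exp \<bar>x\<bar>)"
        by (simp add: abs_mult mult_ac w_def b_def)
    qed
    have bI1: "\<bar>I1 x\<bar> \<le> 2 * (K1 * D) * (w x * exp (- \<bar>x\<bar>))" for x
    proof (cases "0 \<le> x")
      case True
      have "\<bar>I1 x\<bar> \<le> 2 * (K1 * D) * ((1 + 2 * \<bar>d\<bar> + x) powr d * exp (- x))"
      proof (rule exp_decay_primitive[OF I1 _ _ True])
        show "(I1 \<longlongrightarrow> 0) at_top" unfolding I1_def using tendsto_diff[OF tendsto_const lim(1), of L] by simp
        show "\<bar>- (Qd x * g x)\<bar> \<le> K1 * D * ((1 + 2 * \<bar>d\<bar> + x) powr d * exp (- x))" if "0 \<le> x" for x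
          using Qg[of x] that by (simp add: w_def b_def)
      qed
      then show ?thesis using True by (simp add: w_def b_def)
    next
      case False
      have d: "((\<lambda>x. I1 (- x)) has_real_derivative Qd (- x) * g (- x)) (at x)" for x
        using DERIV_chain2[OF I1 DERIV_minus[OF DERIV_ident]] by simp
      have "\<bar>I1 (- (- x))\<bar> \<le> 2 * (K1 * D) * ((1 + 2 * \<bar>d\<bar> + - x) powr d * exp (- (- x)))"
      proof (rule exp_decay_primitive[OF d])
        show "((\<lambda>x. I1 (- x)) \<longlongrightarrow> 0) at_top"
          unfolding I1_def using tendsto_diff[OF tendsto_const lim(2), of L]
          by (simp add: filterlim_at_bot_mirror)
        show "\<bar>Qd (- x) * g (- x)\<bar> \<le> K1 * D * ((1 + 2 * \<bar>d\<bar> + x) powr d * exp (- x))" if "0 \<le> x" for x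
          using Qg[of "- x"] that by (simp add: w_def b_def)
      qed (use False in simp)
      then show ?thesis using False by (simp add: w_def b_def)
    qed
    \<comment> \<open>The exponential rates cancel exactly, so the solution keeps the power weight
      \<open>w\<close> of the source.\<close>
    have cancel: "K * exp (- \<bar>x\<bar>) * (M * (w x * exp \<bar>x\<bar>)) = K * M * w x"
                 "K * exp \<bar>x\<bar> * (M * (w x * exp (- \<bar>x\<bar>))) = K * M * w x" for K M x
      by (simp_all add: exp_minus)
    have fin: "poly_bounded d (\<lambda>x. u x * I2 x + v x * I1 x)"
      if u: "\<And>x. \<bar>u x\<bar> \<le> K * exp (- \<bar>x\<bar>)" and v: "\<And>x. \<bar>v x\<bar> \<le> K2 * exp \<bar>x\<bar>" and K: "K > 0" for u v K
    proof -
      define E where "E = K * (2 * (K2 * D)) + K2 * (2 * (K1 * D))"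
      have E: "E > 0" using K K1 K2 D by (simp add: E_def add_pos_pos)
      have "\<bar>u x * I2 x + v x * I1 x\<bar> \<le> E * b powr \<bar>d\<bar> * (1 + \<bar>x\<bar>) powr d" for x
      proof -
        have 1: "\<bar>u x\<bar> * \<bar>I2 x\<bar> \<le> K * exp (- \<bar>x\<bar>) * (2 * (K2 * D) * (w x * exp \<bar>x\<bar>))"
          using u bI2 K by (intro mult_mono) auto
        have 2: "\<bar>v x\<bar> * \<bar>I1 x\<bar> \<le> K2 * exp \<bar>x\<bar> * (2 * (K1 * D) * (w x * exp (- \<bar>x\<bar>)))"
          using v bI1 K2 by (intro mult_mono) auto
        have "\<bar>u x * I2 x + v x * I1 x\<bar> \<le> \<bar>u x\<bar> * \<bar>I2 x\<bar> + \<bar>v x\<bar> * \<bar>I1 x\<bar>"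
          unfolding abs_mult[symmetric] by (rule abs_triangle_ineq)
        also have "\<dots> \<le> E * w x" using 1 2 unfolding cancel E_def distrib_right by linarith
        also have "\<dots> \<le> E * (b powr \<bar>d\<bar> * (1 + \<bar>x\<bar>) powr d)"
          unfolding w_def using E shift_weight(2)[OF b1, of "\<bar>x\<bar>" d] by (intro mult_left_mono) auto
        finally show ?thesis by (simp add: mult.assoc)
      qed
      then show ?thesis by (rule poly_boundedI)
    qed
    have "poly_bounded d f" unfolding f_def[abs_def] by (rule fin[OF K1(2) K2(2) K1(1)])
    moreover have "poly_bounded d f'" unfolding f'_def[abs_def] by (rule fin[OF K3(2) K2(3) K3(1)])
    ultimately show "grows d f" using solves_bounded_imp_grows[OF s gd] by blast
  qed
  ultimately show ?thesis by blast
qed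

lemma solves_reflect:
  assumes "solves g f f'"
  shows "solves (\<lambda>x. g (- x)) (\<lambda>x. f (- x)) (\<lambda>x. - f' (- x))"
proof -
  have f: "(f has_real_derivative f' x) (at x)" "(f' has_real_derivative V x * f x - g x) (at x)" for x
    using assms by (auto simp: solves_def)
  have 1: "((\<lambda>x. f (- x)) has_real_derivative f' (- x) * - 1) (at x)" for x
    by (rule DERIV_chain2[OF f(1) DERIV_minus[OF DERIV_ident]])
  have 2: "((\<lambda>x. - f' (- x)) has_real_derivative - ((V (- x) * f (- x) - g (- x)) * - 1)) (at x)" for x
    by (rule DERIV_minus[OF DERIV_chain2[OF f(2) DERIV_minus[OF DERIV_ident]]])
  show ?thesis
    unfolding solves_def using 1 2 by (simp add: V_def Q_even)
qed

lemma solves_add: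
  "solves g f f' \<Longrightarrow> solves h u u' \<Longrightarrow>
   solves (\<lambda>x. r * g x + s * h x) (\<lambda>x. r * f x + s * u x) (\<lambda>x. r * f' x + s * u' x)"
  unfolding solves_def
proof (intro allI conjI)
  fix x
  assume a: "\<forall>x. (f has_real_derivative f' x) (at x) \<and> (f' has_real_derivative V x * f x - g x) (at x)"
    "\<forall>x. (u has_real_derivative u' x) (at x) \<and> (u' has_real_derivative V x * u x - h x) (at x)"
  show "((\<lambda>x. r * f x + s * u x) has_real_derivative r * f' x + s * u' x) (at x)"
    using a by (intro DERIV_add DERIV_cmult) auto
  have "((\<lambda>x. r * f' x + s * u' x) has_real_derivative r * (V x * f x - g x) + s * (V x * u x - h x)) (at x)"
    using a by (intro DERIV_add DERIV_cmult) auto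
  then show "((\<lambda>x. r * f' x + s * u' x) has_real_derivative V x * (r * f x + s * u x) - (r * g x + s * h x)) (at x)"
    by (simp add: algebra_simps)
qed

text \<open>For even \<open>g\<close> the product \<open>Qd * g\<close> is odd and its primitive
  even, so the limits at both ends agree by themselves. For odd \<open>g\<close> the primitive is
  odd and the limits agree only if they vanish. Averaging a solution with its reflection then
  restores the parity.\<close>

lemma solve_parity:
  assumes g: "grows e g" "\<And>x. g (- x) = r * g x" and r: "r = 1 \<or> r = -1"
    and lim: "r = -1 \<Longrightarrow> (prim (\<lambda>x. Qd x * g x) \<longlongrightarrow> 0) at_top"
  shows "\<exists>f f'. solves g f f' \<and> (\<forall>x. f (- x) = r * f x) \<and> (\<forall>x. f' (- x) = - r * f' x) \<and>
      (\<forall>d. grows d g \<longrightarrow> grows d f)"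
proof -
  have rap: "rapid (\<lambda>x. Qd x * g x)" by (rule rapid_mult[OF rapid_Qd g(1)])
  have c: "isCont (\<lambda>x. Qd x * g x) x" for x using DERIV_isCont[OF grows_DERIV[OF rapid_grows[OF rap]]] .
  obtain L where L: "(prim (\<lambda>x. Qd x * g x) \<longlongrightarrow> L) at_top" by (rule prim_rapid_limit[OF rap])
  have sym: "prim (\<lambda>x. Qd x * g x) (- x) = - (- r) * prim (\<lambda>x. Qd x * g x) x" for x
    by (rule prim_reflect[OF c]) (simp add: Qd_odd g(2))
  have "((\<lambda>x. prim (\<lambda>x. Qd x * g x) (- x)) \<longlongrightarrow> L) at_top"
  proof (cases "r = 1")
    case True then show ?thesis using L by (simp add: sym)
  next
    case False
    then have r1: "r = -1" using r by simp
    have "L = 0" using tendsto_unique[OF _ L lim[OF r1]] by simp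
    moreover have "(\<lambda>x. prim (\<lambda>x. Qd x * g x) (- x)) = (\<lambda>x. - prim (\<lambda>x. Qd x * g x) x)"
      using sym r1 by auto
    ultimately show ?thesis using tendsto_minus[OF L] by simp
  qed
  then have "(prim (\<lambda>x. Qd x * g x) \<longlongrightarrow> L) at_bot" by (simp add: filterlim_at_bot_mirror)
  from solve[OF g(1) DERIV_prim[OF c] L this]
  obtain f f' where f: "solves g f f'" "\<And>d. grows d g \<Longrightarrow> grows d f" by blast
  define h where "h x = 1 / 2 * f x + r / 2 * f (- x)" for x
  define h' where "h' x = 1 / 2 * f' x + r / 2 * - f' (- x)" for x
  have "(\<lambda>x. 1 / 2 * g x + r / 2 * g (- x)) = g"
    using r by (auto simp: g(2))
  then have "solves g h h'"
    using solves_add[OF f(1) solves_reflect[OF f(1)], of "1/2" "r/2"] by (simp add: h_def[abs_def] h'_def[abs_def])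
  moreover have "h (- x) = r * h x" "h' (- x) = - r * h' x" for x
    using r by (auto simp: h_def h'_def)
  moreover have "grows d h" if "grows d g" for d
    unfolding h_def[abs_def] by (intro grows_add grows_cmult grows_reflect f(2) that)
  ultimately show ?thesis by blast
qed

text \<open>A combination of \<open>Q\<close> and the scaling generator \<open>Q / (p - 1) + x Qd / 2\<close>.\<close>

definition A1 :: "real \<Rightarrow> real" where
  "A1 x = - Q x / (real p - 1) - 3 / 2 * (x * Qd x)"

definition A1d :: "real \<Rightarrow> real" where
  "A1d x = - Qd x / (real p - 1) - 3 / 2 * (Qd x + x * (Q x - Q x ^ p))"

text \<open>With \<open>L\<close> as in the overview, \<open>L Q = - (p - 1) * Q ^ p\<close> and
  \<open>L (x * Qd) = 2 * Q ^ p - 2 * Q\<close>; \<open>A1\<close> is the combination of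
  \<open>Q\<close> and \<open>x * Qd\<close> matching the right-hand side, which is the source
  created by a unit phase coefficient.\<close>

lemma solves_A1: "solves (\<lambda>x. 3 * Q x - 2 * Q x ^ p) A1 A1d"
  unfolding solves_def
proof (intro allI conjI)
  fix x
  have "(A1 has_real_derivative - Qd x / (real p - 1) - 3 / 2 * (1 * Qd x + (Q x - Q x ^ p) * x)) (at x)"
    unfolding A1_def[abs_def]
    by (intro DERIV_diff DERIV_cmult DERIV_mult DERIV_ident DERIV_Qd DERIV_cdivide DERIV_minus DERIV_Q)
  then show "(A1 has_real_derivative A1d x) (at x)" by (simp add: A1d_def mult.commute)
  have "(A1d has_real_derivative - (Q x - Q x ^ p) / (real p - 1)
      - 3 / 2 * ((Q x - Q x ^ p) + (1 * (Q x - Q x ^ p) + V x * Qd x * x))) (at x)"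
    unfolding A1d_def[abs_def] V_def
    by (intro DERIV_diff DERIV_add DERIV_cmult DERIV_mult DERIV_ident DERIV_Qd DERIV_cdivide DERIV_minus DERIV_Qpp)
  moreover have "- (Q x - Q x ^ p) / (real p - 1)
      - 3 / 2 * ((Q x - Q x ^ p) + (1 * (Q x - Q x ^ p) + V x * Qd x * x)) = V x * A1 x - (3 * Q x - 2 * Q x ^ p)"
  proof -
    have VQ: "V x * Q x = Q x - real p * Q x ^ p"
      using p_ge2 power_minus_mult[of p "Q x"] by (simp add: V_def left_diff_distrib mult.assoc)
    have "- (q - z) / (r - 1) - 3 / 2 * ((q - z) + (1 * (q - z) + y)) = - (q - r * z) / (r - 1) - 3 / 2 * y - (3 * q - 2 * z)"
      if "r - 1 > 0" for q z y r :: real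
      using that by (simp add: field_simps)
    note this[OF p_pos, of "Q x" "Q x ^ p" "V x * Qd x * x"]
    moreover have "V x * A1 x = - (V x * Q x) / (real p - 1) - 3 / 2 * (V x * Qd x * x)"
      unfolding A1_def by (simp add: right_diff_distrib)
    ultimately show ?thesis by (simp only: VQ)
  qed
  ultimately show "(A1d has_real_derivative V x * A1 x - (3 * Q x - 2 * Q x ^ p)) (at x)" by simp
qed

lemma rapid_A1: "rapid A1"
proof -
  have "rapid (\<lambda>x. (- (1 / (real p - 1))) * Q x + (- (3 / 2)) * (Qd x * x))"
    by (intro rapid_add rapid_cmult rapid_Q rapid_mult[OF rapid_Qd grows_id])
  moreover have "A1 = (\<lambda>x. (- (1 / (real p - 1))) * Q x + (- (3 / 2)) * (Qd x * x))"
    by (rule ext) (simp add: A1_def)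
  ultimately show ?thesis by simp
qed

lemma A1_even: "A1 (- x) = A1 x"
  by (simp add: A1_def Q_even Qd_odd)

lemma solvesD:
  assumes "solves g f f'"
  shows "deriv f = f'" and "deriv f' x = V x * f x - g x"
  using assms DERIV_imp_deriv unfolding solves_def by blast+

lemma A1d_eq: "A1d = deriv A1"
  using solvesD(1)[OF solves_A1] by simp

text \<open>The contribution of the profile \<open>f\<close> of \<open>q ^ k\<close> to the equation
  for the profile of \<open>(q ^ k)'\<close>. The primitive appears because that equation is
  obtained after one integration in \<open>y\<close>.\<close>

definition Bsource :: "(real \<Rightarrow> real) \<Rightarrow> (real \<Rightarrow> real) \<Rightarrow> real \<Rightarrow> real" where
  "Bsource f f' x = 3 * f' x + real p * prim (\<lambda>x. Q x ^ (p - 1) * f x) x"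

lemma rapid_potential: "grows d f \<Longrightarrow> rapid (\<lambda>x. Q x ^ (p - 1) * f x)"
  using p_ge2 by (intro rapid_mult[OF rapid_Q_power]) auto

lemma rapid_isCont: "rapid f \<Longrightarrow> isCont f x"
  using DERIV_isCont[OF grows_DERIV[OF rapid_grows]] .

lemma Bsource_grows:
  assumes "grows d f" "0 \<le> d" shows "grows d (Bsource f (deriv f))"
proof -
  have "grows d (prim (\<lambda>x. Q x ^ (p - 1) * f x))"
    by (rule grows_mono[OF grows_prim_rapid[OF rapid_potential[OF assms(1)]] assms(2)])
  then show ?thesis
    unfolding Bsource_def[abs_def] by (intro grows_add grows_cmult grows_deriv assms(1))
qed

lemma Bsource_odd:
  assumes "grows d f" "\<And>x. f (- x) = f x" "\<And>x. f' (- x) = - f' x"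
  shows "Bsource f f' (- x) = - Bsource f f' x"
  using prim_reflect[OF rapid_isCont[OF rapid_potential[OF assms(1)]], of 1 x] assms
  by (simp add: Bsource_def Q_even)

text \<open>The constant \<open>(5 - p) / (4 * (p - 1))\<close>, a multiple of the integral of \<open>Q\<^sup>2\<close>, is the pairing of
  \<open>Qd\<close> with the right-hand side produced by a unit phase shift. It vanishes exactly for the critical
  exponent \<open>p = 5\<close>.\<close>

lemma phase_shift_pairing:
  obtains L where "L \<noteq> 0"
    "(prim (\<lambda>x. Qd x * (Bsource A1 A1d x + 3 * Qd x)) \<longlongrightarrow> L) at_top"
proof -
  define s where "s = 1 / (real p - 1)"
  define N where "N = prim (\<lambda>x. Q x ^ p)"
  define M where "M = prim (\<lambda>x. (Q x)\<^sup>2)"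
  \<comment> \<open>A primitive of \<open>Q ^ (p + 1)\<close>: the two equations for
    \<open>Q\<close> give
    \<open>(Q * Qd)' = 2 * Q\<^sup>2 - (p + 3) / (p + 1) * Q ^ (p + 1)\<close>. All integrals are
    thereby reduced to that of \<open>Q\<^sup>2\<close>.\<close>
  define X where "X x = (real p + 1) / (real p + 3) * (2 * M x - Q x * Qd x)" for x
  define cX where "cX = 3 / 2 / (real p + 1) - 3 / 2 + real p * s"
  \<comment> \<open>\<open>T\<close> collects the boundary terms of the integrations by parts, all
    vanishing at infinity, and \<open>H\<close> is the closed form of the primitive inside
    \<open>Bsource\<close>.\<close>
  define T where "T x = - 9 / 4 * (x * (Qd x)\<^sup>2) - 3 / 2 / (real p + 1) * (x * Q x ^ (p + 1))
     + (3 / 2 - real p * s) * (Q x * N x)" for x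
  define H where "H x = - 3 / 2 / real p * (x * Q x ^ p) + (3 / 2 / real p - s) * N x" for x
  have r1: "rapid (\<lambda>x. Q x ^ p)" and r2: "rapid (\<lambda>x. (Q x)\<^sup>2)" and r3: "rapid (\<lambda>x. Q x ^ (p + 1))"
    using rapid_Q_power[of p] rapid_Q_power[of 2] rapid_Q_power[of "p + 1"] p_ge2 by auto
  note DN = DERIV_prim[OF rapid_isCont[OF r1], folded N_def]
  note DM = DERIV_prim[OF rapid_isCont[OF r2], folded M_def]
  have Qp: "Q x ^ (p + 1) = Q x * Q x ^ p" "Q x * Q x ^ (p - 1) = Q x ^ p" for x
    using p_ge2 power_minus_mult[of p "Q x"] by (simp_all add: mult.commute)
  have p0: "real p > 0" using p_ge2 by simp
  have DX: "(X has_real_derivative Q x ^ (p + 1)) (at x)" for x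
  proof -
    have "(X has_real_derivative (real p + 1) / (real p + 3) * (2 * (Q x)\<^sup>2 - (Qd x * Qd x + (Q x - Q x ^ p) * Q x))) (at x)"
      unfolding X_def by (intro DERIV_cmult DERIV_diff DERIV_mult DM DERIV_Q DERIV_Qd)
    moreover have "(real p + 1) / (real p + 3) * (2 * (Q x)\<^sup>2 - (Qd x * Qd x + (Q x - Q x ^ p) * Q x)) = Q x ^ (p + 1)"
    proof -
      have "(r + 1) / (r + 3) * (2 * q2 - ((q2 - 2 / (r + 1) * z) + (q2 - z))) = z" if "r > 0" for r q2 z :: real
        using that by (simp add: divide_simps) (simp add: algebra_simps)
      note this[OF p0, of "(Q x)\<^sup>2" "Q x ^ (p + 1)"]
      moreover have "Qd x * Qd x = (Q x)\<^sup>2 - 2 / (real p + 1) * Q x ^ (p + 1)"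
        using Qd_sq[of x] by (simp only: power2_eq_square)
      moreover have "(Q x - Q x ^ p) * Q x = (Q x)\<^sup>2 - Q x ^ (p + 1)"
        by (simp add: power2_eq_square algebra_simps)
      ultimately show ?thesis by (simp only:)
    qed
    ultimately show ?thesis by simp
  qed
  have DQpow: "((\<lambda>x. Q x ^ p) has_real_derivative real p * (Q x ^ (p - 1) * Qd x)) (at x)" for x
    using DERIV_power[OF DERIV_Q, of p x] by (simp add: mult_ac)
  have DQpow1: "((\<lambda>x. Q x ^ (p + 1)) has_real_derivative (real p + 1) * (Q x ^ p * Qd x)) (at x)" for x
    using DERIV_power[OF DERIV_Q, of "p + 1" x] by (simp add: mult_ac add.commute)
  have H: "prim (\<lambda>x. Q x ^ (p - 1) * A1 x) = H"
  proof (rule same_DERIV_imp_eq[where a = 0])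
    fix x
    show "(prim (\<lambda>x. Q x ^ (p - 1) * A1 x) has_real_derivative Q x ^ (p - 1) * A1 x) (at x)"
      by (rule DERIV_prim[OF rapid_isCont[OF rapid_potential[OF rapid_grows[OF rapid_A1]]]])
    have "(H has_real_derivative - 3 / 2 / real p * (1 * Q x ^ p + real p * (Q x ^ (p - 1) * Qd x) * x)
       + (3 / 2 / real p - s) * Q x ^ p) (at x)"
      unfolding H_def by (intro DERIV_add DERIV_cmult DERIV_mult DERIV_ident DQpow DN)
    moreover have "- 3 / 2 / real p * (1 * Q x ^ p + real p * (Q x ^ (p - 1) * Qd x) * x)
       + (3 / 2 / real p - s) * Q x ^ p = - s * (Q x * Q x ^ (p - 1)) - 3 / 2 * (x * (Q x ^ (p - 1) * Qd x))"
      unfolding Qp(2) using p0 by (simp add: field_simps)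
    moreover have "\<dots> = Q x ^ (p - 1) * A1 x"
      by (simp add: A1_def s_def algebra_simps)
    ultimately show "(H has_real_derivative Q x ^ (p - 1) * A1 x) (at x)" by simp
  next
    show "prim (\<lambda>x. Q x ^ (p - 1) * A1 x) 0 = H 0"
      unfolding prim_0[OF rapid_isCont[OF rapid_potential[OF rapid_grows[OF rapid_A1]]]]
      by (simp add: H_def N_def prim_0[OF rapid_isCont[OF r1]])
  qed
  have rA: "rapid (\<lambda>x. Qd x * (Bsource A1 A1d x + 3 * Qd x))"
    by (intro rapid_mult[OF rapid_Qd, of 0] grows_add grows_cmult rapid_grows[OF rapid_Qd])
      (simp add: A1d_eq Bsource_grows rapid_grows rapid_A1)
  have P: "prim (\<lambda>x. Qd x * (Bsource A1 A1d x + 3 * Qd x)) =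
     (\<lambda>x. (3 / 4 - 3 * s) * (M x - 2 / (real p + 1) * X x) + cX * X x + T x)"
  proof (rule same_DERIV_imp_eq[where a = 0])
    fix x
    show "(prim (\<lambda>x. Qd x * (Bsource A1 A1d x + 3 * Qd x)) has_real_derivative Qd x * (Bsource A1 A1d x + 3 * Qd x)) (at x)"
      by (rule DERIV_prim[OF rapid_isCont[OF rA]])
    have "((\<lambda>x. (Qd x)\<^sup>2) has_real_derivative 2 * (Qd x * (Q x - Q x ^ p))) (at x)"
      using DERIV_power[OF DERIV_Qd, of 2 x] by (simp add: mult_ac)
    then have DT: "(T has_real_derivative - 9 / 4 * (1 * (Qd x)\<^sup>2 + 2 * (Qd x * (Q x - Q x ^ p)) * x)
       - 3 / 2 / (real p + 1) * (1 * Q x ^ (p + 1) + (real p + 1) * (Q x ^ p * Qd x) * x)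
       + (3 / 2 - real p * s) * (Qd x * N x + Q x ^ p * Q x)) (at x)"
      unfolding T_def by (intro DERIV_add DERIV_diff DERIV_cmult DERIV_mult DERIV_ident DQpow1 DN DERIV_Q)
    have "((\<lambda>x. (3 / 4 - 3 * s) * (M x - 2 / (real p + 1) * X x) + cX * X x + T x) has_real_derivative
       (3 / 4 - 3 * s) * ((Q x)\<^sup>2 - 2 / (real p + 1) * Q x ^ (p + 1)) + cX * Q x ^ (p + 1) +
       (- 9 / 4 * (1 * (Qd x)\<^sup>2 + 2 * (Qd x * (Q x - Q x ^ p)) * x)
       - 3 / 2 / (real p + 1) * (1 * Q x ^ (p + 1) + (real p + 1) * (Q x ^ p * Qd x) * x)
       + (3 / 2 - real p * s) * (Qd x * N x + Q x ^ p * Q x))) (at x)"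
      by (intro DERIV_add DERIV_diff DERIV_cmult DX DM DT)
    moreover have "(3 / 4 - 3 * s) * ((Q x)\<^sup>2 - 2 / (real p + 1) * Q x ^ (p + 1)) + cX * Q x ^ (p + 1) +
       (- 9 / 4 * (1 * (Qd x)\<^sup>2 + 2 * (Qd x * (Q x - Q x ^ p)) * x)
       - 3 / 2 / (real p + 1) * (1 * Q x ^ (p + 1) + (real p + 1) * (Q x ^ p * Qd x) * x)
       + (3 / 2 - real p * s) * (Qd x * N x + Q x ^ p * Q x)) = Qd x * (Bsource A1 A1d x + 3 * Qd x)"
    proof -
      have "(3 / 4 - 3 * s) * d\<^sup>2 + (3 / 2 / (r + 1) - 3 / 2 + r * s) * (q * z) +
         (- 9 / 4 * (1 * d\<^sup>2 + 2 * (d * (q - z)) * x)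
         - 3 / 2 / (r + 1) * (1 * (q * z) + (r + 1) * (z * d) * x)
         + (3 / 2 - r * s) * (d * n + z * q))
       = d * (3 * (- s * d - 3 / 2 * (d + x * (q - z))) + r * (- 3 / 2 / r * (x * z) + (3 / 2 / r - s) * n) + 3 * d)"
        if "r > 0" for r d q z n :: real
        using that by (simp add: divide_simps power2_eq_square) (simp add: algebra_simps)
      from this[OF p0, of "Qd x" "Q x" "Q x ^ p" "N x"]
      show ?thesis
        unfolding Bsource_def H Qd_sq[symmetric] cX_def unfolding Qp(1) H_def A1d_def
        by (simp add: s_def)
    qed
    ultimately show "((\<lambda>x. (3 / 4 - 3 * s) * (M x - 2 / (real p + 1) * X x) + cX * X x + T x)
        has_real_derivative Qd x * (Bsource A1 A1d x + 3 * Qd x)) (at x)" by simp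
  next
    show "prim (\<lambda>x. Qd x * (Bsource A1 A1d x + 3 * Qd x)) 0 =
      (3 / 4 - 3 * s) * (M 0 - 2 / (real p + 1) * X 0) + cX * X 0 + T 0"
      unfolding prim_0[OF rapid_isCont[OF rA]]
      by (simp add: T_def X_def M_def N_def Qd_def prim_0[OF rapid_isCont[OF r1]] prim_0[OF rapid_isCont[OF r2]])
  qed
  obtain Mi where Mi: "(M \<longlongrightarrow> Mi) at_top"
    unfolding M_def by (rule prim_rapid_limit[OF r2])
  have "Mi > 0"
  proof -
    have "0 < M 1 - M 0"
      using DERIV_pos_imp_increasing[of 0 1 M] DM Q_pos by (metis diff_gt_0_iff_gt zero_less_one zero_less_power)
    then have M1: "0 < M 1" by (simp add: M_def prim_0[OF rapid_isCont[OF r2]])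
    have "eventually (\<lambda>x. M 1 \<le> M x) at_top"
      using eventually_ge_at_top[of 1]
    proof eventually_elim
      case (elim x)
      show ?case by (rule DERIV_nonneg_imp_nondecreasing[OF elim]) (use DM in \<open>metis zero_le_power2\<close>)
    qed
    then have "M 1 \<le> Mi" by (intro tendsto_lowerbound[OF Mi]) auto
    then show ?thesis using M1 by simp
  qed
  have rQQd: "((\<lambda>x. Q x * Qd x) \<longlongrightarrow> 0) at_top"
    by (rule rapid_tendsto_0[OF rapid_mult[OF rapid_Q rapid_grows[OF rapid_Qd, of 0]]])
  have limX: "(X \<longlongrightarrow> (real p + 1) / (real p + 3) * (2 * Mi - 0)) at_top"
    unfolding X_def by (intro tendsto_intros Mi rQQd)
  have T0: "(T \<longlongrightarrow> 0) at_top"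
  proof -
    have 1: "((\<lambda>x. Qd x * (Qd x * x)) \<longlongrightarrow> 0) at_top"
      by (rule rapid_tendsto_0[OF rapid_mult[OF rapid_Qd rapid_grows[OF rapid_mult[OF rapid_Qd grows_id], of 0]]])
    have 2: "((\<lambda>x. Q x ^ (p + 1) * x) \<longlongrightarrow> 0) at_top"
      by (intro rapid_tendsto_0 rapid_mult[OF r3 grows_id])
    have 3: "((\<lambda>x. Q x * N x) \<longlongrightarrow> 0) at_top"
      unfolding N_def by (intro rapid_tendsto_0 rapid_mult[OF rapid_Q grows_prim_rapid[OF r1]])
    have "((\<lambda>x. - 9 / 4 * (Qd x * (Qd x * x)) - 3 / 2 / (real p + 1) * (Q x ^ (p + 1) * x)
       + (3 / 2 - real p * s) * (Q x * N x)) \<longlongrightarrow> - 9 / 4 * 0 - 3 / 2 / (real p + 1) * 0 + (3 / 2 - real p * s) * 0) at_top"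
      by (intro tendsto_add tendsto_diff tendsto_mult tendsto_const 1 2 3)
    moreover have "T = (\<lambda>x. - 9 / 4 * (Qd x * (Qd x * x)) - 3 / 2 / (real p + 1) * (Q x ^ (p + 1) * x)
       + (3 / 2 - real p * s) * (Q x * N x))"
      by (rule ext) (simp add: T_def power2_eq_square mult_ac)
    ultimately show ?thesis by simp
  qed
  define L where "L = (3 / 4 - 3 * s) * (Mi - 2 / (real p + 1) * ((real p + 1) / (real p + 3) * (2 * Mi - 0)))
     + cX * ((real p + 1) / (real p + 3) * (2 * Mi - 0)) + 0"
  have "(prim (\<lambda>x. Qd x * (Bsource A1 A1d x + 3 * Qd x)) \<longlongrightarrow> L) at_top"
    unfolding P L_def by (intro tendsto_add tendsto_diff tendsto_mult tendsto_const Mi limX T0)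
  moreover have "L = (5 - real p) / (4 * (real p - 1)) * Mi"
    using p_cases by (auto simp: L_def s_def cX_def)
  then have "L \<noteq> 0" using \<open>Mi > 0\<close> p_cases by auto
  ultimately show ?thesis using that by blast
qed

lemma Bsource_diff:
  assumes "grows d f" "grows e g"
  shows "Bsource (\<lambda>x. f x - a * g x) (\<lambda>x. f' x - a * g' x) x = Bsource f f' x - a * Bsource g g' x"
proof -
  note c = rapid_isCont[OF rapid_potential[OF assms(1)]] rapid_isCont[OF rapid_potential[OF assms(2)]]
  have c3: "isCont (\<lambda>x. Q x ^ (p - 1) * (f x - a * g x)) x" for x
    by (intro isCont_mult isCont_power isCont_Q isCont_diff continuous_const
        DERIV_isCont[OF grows_DERIV[OF assms(1)]] DERIV_isCont[OF grows_DERIV[OF assms(2)]])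
  have "prim (\<lambda>x. Q x ^ (p - 1) * (f x - a * g x)) =
     (\<lambda>x. prim (\<lambda>x. Q x ^ (p - 1) * f x) x - a * prim (\<lambda>x. Q x ^ (p - 1) * g x) x)"
  proof (rule same_DERIV_imp_eq[where a = 0])
    fix x
    show "(prim (\<lambda>x. Q x ^ (p - 1) * (f x - a * g x)) has_real_derivative Q x ^ (p - 1) * (f x - a * g x)) (at x)"
      by (rule DERIV_prim[OF c3])
    have "((\<lambda>x. prim (\<lambda>x. Q x ^ (p - 1) * f x) x - a * prim (\<lambda>x. Q x ^ (p - 1) * g x) x)
       has_real_derivative Q x ^ (p - 1) * f x - a * (Q x ^ (p - 1) * g x)) (at x)"
      by (intro DERIV_diff DERIV_cmult DERIV_prim c)
    then show "((\<lambda>x. prim (\<lambda>x. Q x ^ (p - 1) * f x) x - a * prim (\<lambda>x. Q x ^ (p - 1) * g x) x)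
       has_real_derivative Q x ^ (p - 1) * (f x - a * g x)) (at x)" by (simp add: algebra_simps)
  next
    have "prim (\<lambda>x. Q x ^ (p - 1) * f x) 0 = 0" by (rule prim_0[OF c(1)])
    moreover have "prim (\<lambda>x. Q x ^ (p - 1) * g x) 0 = 0" by (rule prim_0[OF c(2)])
    moreover have "prim (\<lambda>x. Q x ^ (p - 1) * (f x - a * g x)) 0 = 0" by (rule prim_0[OF c3])
    ultimately show "prim (\<lambda>x. Q x ^ (p - 1) * (f x - a * g x)) 0 =
       prim (\<lambda>x. Q x ^ (p - 1) * f x) 0 - a * prim (\<lambda>x. Q x ^ (p - 1) * g x) 0" by simp
  qed
  then show ?thesis by (simp add: Bsource_def algebra_simps)
qed

text \<open>The first equation is always solvable, its right-hand side being even. The number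
  \<open>a\<close> is the only freedom left for the second: it acts there through
  \<open>3 * a * Qd\<close> and, via the part \<open>- a * A1\<close> of \<open>A\<close>, through
  \<open>Bsource\<close>. Together these give \<open>R0 - a * R1\<close>, and \<open>a\<close> is
  the quotient of the two pairings with \<open>Qd\<close>. No degree is lost because
  \<open>Bsource\<close> integrates only against the rapid factor
  \<open>Q ^ (p - 1)\<close>.\<close>

lemma solve_pair:
  assumes F: "grows d F" "\<And>x. F (- x) = F x" and G: "grows d G" "\<And>x. G (- x) = - G x" and d: "0 \<le> d"
  shows "\<exists>a A B. grows d A \<and> (\<forall>x. A (- x) = A x) \<and> (rapid F \<longrightarrow> rapid A) \<and> grows d B \<and> (\<forall>x. B (- x) = - B x) \<and>
     (\<forall>x. deriv (deriv A) x = V x * A x - (F x - a * (3 * Q x - 2 * Q x ^ p))) \<and>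
     (\<forall>x. deriv (deriv B) x = V x * B x - (G x - 3 * a * Qd x + Bsource A (deriv A) x))"
proof -
  obtain AF AF' where AF: "solves F AF AF'" "\<And>x. AF (- x) = 1 * AF x" "\<And>x. AF' (- x) = - 1 * AF' x"
      "\<And>d. grows d F \<Longrightarrow> grows d AF"
    using solve_parity[of d F 1] F by auto
  have AF': "AF' = deriv AF" using solvesD(1)[OF AF(1)] by simp
  have gAF: "grows d AF" using AF(4) F(1) .
  define R0 where "R0 x = G x + Bsource AF AF' x" for x
  define R1 where "R1 x = Bsource A1 A1d x + 3 * Qd x" for x
  have gR0: "grows d R0" unfolding R0_def[abs_def] AF' by (intro grows_add G Bsource_grows gAF d)
  have gR1: "grows d R1" unfolding R1_def[abs_def] A1d_eq
    by (intro grows_add grows_cmult rapid_grows rapid_Qd Bsource_grows rapid_A1 d)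
  have oR0: "R0 (- x) = - R0 x" for x
    unfolding R0_def using G(2) AF Bsource_odd[OF gAF] by simp
  have oR1: "R1 (- x) = - R1 x" for x
  proof -
    have "A1d (- x) = - A1d x" for x by (simp add: A1d_def Qd_odd Q_even algebra_simps)
    then show ?thesis
      unfolding R1_def using Bsource_odd[OF rapid_grows[OF rapid_A1] A1_even] by (simp add: Qd_odd)
  qed
  have rap: "rapid (\<lambda>x. Qd x * R0 x)" "rapid (\<lambda>x. Qd x * R1 x)"
    using rapid_mult[OF rapid_Qd gR0] rapid_mult[OF rapid_Qd gR1] .
  obtain L0 where L0: "(prim (\<lambda>x. Qd x * R0 x) \<longlongrightarrow> L0) at_top" by (rule prim_rapid_limit[OF rap(1)])
  obtain L1 where L1: "L1 \<noteq> 0" "(prim (\<lambda>x. Qd x * R1 x) \<longlongrightarrow> L1) at_top"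
    unfolding R1_def by (rule phase_shift_pairing)
  define a where "a = L0 / L1"
  have gR: "grows d (\<lambda>x. R0 x - a * R1 x)" by (intro grows_diff grows_cmult gR0 gR1)
  have "prim (\<lambda>x. Qd x * (R0 x - a * R1 x)) = (\<lambda>x. prim (\<lambda>x. Qd x * R0 x) x - a * prim (\<lambda>x. Qd x * R1 x) x)"
  proof (rule same_DERIV_imp_eq[where a = 0])
    fix x
    show "(prim (\<lambda>x. Qd x * (R0 x - a * R1 x)) has_real_derivative Qd x * (R0 x - a * R1 x)) (at x)"
      by (rule DERIV_prim[OF rapid_isCont[OF rapid_mult[OF rapid_Qd gR]]])
    have "((\<lambda>x. prim (\<lambda>x. Qd x * R0 x) x - a * prim (\<lambda>x. Qd x * R1 x) x) has_real_derivative Qd x * R0 x - a * (Qd x * R1 x)) (at x)"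
      by (intro DERIV_diff DERIV_cmult DERIV_prim rapid_isCont rap)
    then show "((\<lambda>x. prim (\<lambda>x. Qd x * R0 x) x - a * prim (\<lambda>x. Qd x * R1 x) x) has_real_derivative Qd x * (R0 x - a * R1 x)) (at x)"
      by (simp add: algebra_simps)
  qed (simp add: prim_0 rapid_isCont rap rapid_mult[OF rapid_Qd gR])
  moreover have "((\<lambda>x. prim (\<lambda>x. Qd x * R0 x) x - a * prim (\<lambda>x. Qd x * R1 x) x) \<longlongrightarrow> L0 - a * L1) at_top"
    by (intro tendsto_intros L0 L1)
  moreover have "L0 - a * L1 = 0" using L1(1) by (simp add: a_def)
  ultimately have orth: "(prim (\<lambda>x. Qd x * (R0 x - a * R1 x)) \<longlongrightarrow> 0) at_top" by simp
  obtain B B' where B: "solves (\<lambda>x. R0 x - a * R1 x) B B'" "\<And>x. B (- x) = - 1 * B x"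
      "grows d (\<lambda>x. R0 x - a * R1 x) \<Longrightarrow> grows d B"
    using solve_parity[OF gR, of "-1"] orth by (auto simp: oR0 oR1)
  define A where "A x = AF x - a * A1 x" for x
  have gA: "grows d A" unfolding A_def[abs_def] by (intro grows_diff grows_cmult gAF rapid_grows rapid_A1)
  have sA: "solves (\<lambda>x. F x - a * (3 * Q x - 2 * Q x ^ p)) A (\<lambda>x. AF' x - a * A1d x)"
    using solves_add[OF AF(1) solves_A1, of 1 "- a"] by (simp add: A_def[abs_def])
  have A': "deriv A = (\<lambda>x. AF' x - a * A1d x)" by (rule solvesD(1)[OF sA])
  have B': "deriv B = B'" by (rule solvesD(1)[OF B(1)])
  have "A (- x) = A x" for x by (simp add: A_def AF(2) A1_even)
  moreover have "rapid A" if "rapid F"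
  proof -
    have "rapid AF" using that AF(4) by (simp add: rapid_def)
    then show ?thesis unfolding A_def[abs_def] by (intro rapid_diff rapid_cmult rapid_A1)
  qed
  moreover have "deriv (deriv A) x = V x * A x - (F x - a * (3 * Q x - 2 * Q x ^ p))" for x
    unfolding A' by (rule solvesD(2)[OF sA])
  moreover have "deriv (deriv B) x = V x * B x - (G x - 3 * a * Qd x + Bsource A (deriv A) x)" for x
  proof -
    have "deriv (deriv B) x = V x * B x - (R0 x - a * R1 x)"
      unfolding B' by (rule solvesD(2)[OF B(1)])
    moreover have "Bsource A (\<lambda>x. AF' x - a * A1d x) x = Bsource AF AF' x - a * Bsource A1 A1d x"
      unfolding A_def[abs_def] by (rule Bsource_diff[OF gAF rapid_grows[OF rapid_A1]])
    then have "Bsource A (deriv A) x = Bsource AF AF' x - a * Bsource A1 A1d x" unfolding A' .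
    ultimately show ?thesis by (simp add: R0_def R1_def algebra_simps)
  qed
  ultimately show ?thesis using gA B(2,3) gR by (intro exI[of _ a] exI[of _ A] exI[of _ B]) auto
qed

end

section \<open>The algebra of interaction terms\<close>

text \<open>Kept out of the simplifier, so that the ring laws act on whole functions and evaluation
  at a point happens only on request.\<close>

lemmas fun_app = plus_fun_apply zero_fun_apply times_fun_apply one_fun_apply

declare fun_app [simp del]

text \<open>Functions of \<open>(c, s, y)\<close>, where \<open>s\<close> stands for the paper's \<open>y_c\<close>.\<close>

type_synonym field3 = "real \<Rightarrow> real \<Rightarrow> real \<Rightarrow> real"

definition ds :: "field3 \<Rightarrow> field3" where "ds f = (\<lambda>c s y. deriv (\<lambda>s. f c s y) s)"
definition dy :: "field3 \<Rightarrow> field3" where "dy f = (\<lambda>c s y. deriv (\<lambda>y. f c s y) y)"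
definition cc :: field3 where "cc = (\<lambda>c s y. c)"
definition yfun :: "(real \<Rightarrow> real) \<Rightarrow> field3" where "yfun F = (\<lambda>c s y. F y)"
text \<open>The formal counterpart of the symmetry \<open>(t, x)\<close> to
  \<open>(- t, - x)\<close> of the equation.\<close>

definition reflect :: "field3 \<Rightarrow> field3" where "reflect f = (\<lambda>c s y. f c (- s) (- y))"

text \<open>Index sets closed upwards in the product order. For these the terms with index in
  \<open>I\<close> form an ideal that is also stable under \<open>ds\<close>.\<close>

definition up :: "(nat \<times> nat) set \<Rightarrow> bool" where
  "up I \<longleftrightarrow> (\<forall>k l u v. (k, l) \<in> I \<longrightarrow> (k + u, l + v) \<in> I)"

definition nz :: "(nat \<times> nat) set" where "nz = {(k, l). k + l > 0}"

context gkdv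
begin

text \<open>Zero for \<open>c \<le> 0\<close>, so that the differential equations of the soliton hold for every \<open>c\<close>.\<close>

definition q :: "real \<Rightarrow> real \<Rightarrow> real" where
  "q c s = (if c > 0 then Qc p c s else 0)"

definition qs :: "real \<Rightarrow> real \<Rightarrow> real" where
  "qs c s = (if c > 0 then c powr (1 / (real p - 1)) * (sqrt c * Qd (sqrt c * s)) else 0)"

lemma DERIV_q: "((\<lambda>s. q c s) has_real_derivative qs c s) (at s)"
proof (cases "c > 0")
  case True
  have "((\<lambda>s. c powr (1 / (real p - 1)) * Q (sqrt c * s)) has_real_derivative
     c powr (1 / (real p - 1)) * (Qd (sqrt c * s) * sqrt c)) (at s)"
    by (intro DERIV_cmult DERIV_chain2[OF DERIV_Q]) (use DERIV_cmult[OF DERIV_ident, of "sqrt c"] in simp)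
  then show ?thesis using True by (simp add: q_def qs_def Qc_def mult_ac)
qed (simp add: q_def qs_def)

lemma powr_p: "c > 0 \<Longrightarrow> (c powr (1 / (real p - 1))) ^ p = c * c powr (1 / (real p - 1))"
proof -
  assume c: "c > 0"
  have "(c powr (1 / (real p - 1))) ^ p = c powr (1 / (real p - 1) * real p)"
    using c powr_realpow[of "c powr (1 / (real p - 1))" p] by (simp add: powr_powr)
  also have "1 / (real p - 1) * real p = 1 + 1 / (real p - 1)"
    using p_pos by (simp add: field_simps)
  also have "c powr (1 + 1 / (real p - 1)) = c * c powr (1 / (real p - 1))"
    using c by (simp add: powr_add)
  finally show ?thesis .
qed

lemma DERIV_qs: "((\<lambda>s. qs c s) has_real_derivative c * q c s - q c s ^ p) (at s)"
proof (cases "c > 0")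
  case True
  define r where "r = c powr (1 / (real p - 1))"
  define z where "z = sqrt c * s"
  have "((\<lambda>s. r * (sqrt c * Qd (sqrt c * s))) has_real_derivative
     r * (sqrt c * ((Q z - Q z ^ p) * sqrt c))) (at s)"
    unfolding z_def
    by (intro DERIV_cmult DERIV_chain2[OF DERIV_Qd]) (use DERIV_cmult[OF DERIV_ident, of "sqrt c"] in simp)
  moreover have "r * (sqrt c * ((Q z - Q z ^ p) * sqrt c)) = c * (r * Q z) - (r * Q z) ^ p"
  proof -
    have "r * (sqrt c * ((Q z - Q z ^ p) * sqrt c)) = r * (sqrt c * sqrt c) * (Q z - Q z ^ p)" by (simp only: mult_ac)
    also have "\<dots> = c * (r * Q z) - (c * r) * Q z ^ p" using True by (simp add: right_diff_distrib)
    finally show ?thesis unfolding power_mult_distrib r_def powr_p[OF True] .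
  qed
  ultimately have "((\<lambda>s. r * (sqrt c * Qd (sqrt c * s))) has_real_derivative c * (r * Q z) - (r * Q z) ^ p) (at s)"
    by (simp only:)
  then show ?thesis using True by (simp add: q_def qs_def Qc_def r_def z_def)
qed (use p_ge2 in \<open>simp add: q_def qs_def power_0_left\<close>)

lemma qs_sq: "qs c s * qs c s = c * (q c s)\<^sup>2 - 2 / (real p + 1) * q c s ^ (p + 1)"
proof (cases "c > 0")
  case True
  define r where "r = c powr (1 / (real p - 1))"
  define z where "z = sqrt c * s"
  have "qs c s * qs c s = r\<^sup>2 * (sqrt c * sqrt c) * (Qd z)\<^sup>2"
    using True by (simp add: qs_def r_def z_def power2_eq_square mult_ac)
  also have "\<dots> = c * (r * Q z)\<^sup>2 - 2 / (real p + 1) * (r * (c * r) * Q z ^ (p + 1))"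
    using True unfolding Qd_sq by (simp add: power2_eq_square right_diff_distrib mult_ac)
  also have "r * (c * r) * Q z ^ (p + 1) = (r * Q z) ^ (p + 1)"
    unfolding power_mult_distrib by (simp add: powr_p[OF True, folded r_def])
  finally show ?thesis using True by (simp add: q_def Qc_def r_def z_def)
qed (simp add: q_def qs_def)

lemma q_even: "q c (- s) = q c s" and qs_odd: "qs c (- s) = - qs c s"
  by (simp_all add: q_def qs_def Qc_def Q_even Qd_odd)

section \<open>The graded span of interaction terms\<close>

definition termA :: "nat \<Rightarrow> nat \<Rightarrow> (real \<Rightarrow> real) \<Rightarrow> field3" where
  "termA k l F = (\<lambda>c s y. c ^ l * q c s ^ k * F y)"

text \<open>The truncated subtraction at \<open>k = 0\<close> is harmless because of the factor
  \<open>real k\<close>.\<close>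

definition termB :: "nat \<Rightarrow> nat \<Rightarrow> (real \<Rightarrow> real) \<Rightarrow> field3" where
  "termB k l F = (\<lambda>c s y. c ^ l * (real k * q c s ^ (k - 1) * qs c s) * F y)"

text \<open>In terms of powers of \<open>c powr (1 / (p - 1))\<close>, a polynomially growing coefficient of degree \<open>d\<close> must be
  accompanied by \<open>(p - 1) * d + n\<close> of them. An integration in \<open>y\<close> lowers \<open>n\<close> by \<open>p - 1\<close>, and \<open>ds (ds _)\<close> or a
  factor \<open>c\<close> raises it by \<open>p - 1\<close>.\<close>

definition coef :: "nat \<Rightarrow> (nat \<times> nat) set \<Rightarrow> nat \<Rightarrow> nat \<Rightarrow> (real \<Rightarrow> real) \<Rightarrow> bool" where
  "coef n I k l F \<longleftrightarrow> (k, l) \<in> I \<and>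
     ((\<exists>d. (p - 1) * d + n \<le> k + (p - 1) * l \<and> grows (real d) F) \<or> (k + l > 0 \<and> rapid F))"

text \<open>Scalar multiples require no rule of their own, as a constant can be absorbed into the
  coefficient function. Closure properties then follow by induction over generators.\<close>

inductive span3 :: "nat \<Rightarrow> (nat \<times> nat) set \<Rightarrow> field3 \<Rightarrow> bool" for n I where
  "span3 n I 0"
| "span3 n I f \<Longrightarrow> span3 n I g \<Longrightarrow> span3 n I (f + g)"
| "coef n I k l F \<Longrightarrow> span3 n I (termA k l F)"
| "coef n I k l F \<Longrightarrow> span3 n I (termB k l F)"

definition T :: "nat \<Rightarrow> (nat \<times> nat) set \<Rightarrow> field3 set" where
  "T n I = {f. span3 n I f}"

lemma T_zero: "0 \<in> T n I"
  and T_add: "f \<in> T n I \<Longrightarrow> g \<in> T n I \<Longrightarrow> f + g \<in> T n I"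
  and T_A: "coef n I k l F \<Longrightarrow> termA k l F \<in> T n I"
  and T_B: "coef n I k l F \<Longrightarrow> termB k l F \<in> T n I"
  by (simp_all add: T_def span3.intros)

lemmas T_intros = T_zero T_add T_A T_B

lemma T_induct [consumes 1, case_names zero add A B]:
  assumes "f \<in> T n I" and "P 0"
    and "\<And>f g. f \<in> T n I \<Longrightarrow> P f \<Longrightarrow> g \<in> T n I \<Longrightarrow> P g \<Longrightarrow> P (f + g)"
    and "\<And>k l F. coef n I k l F \<Longrightarrow> P (termA k l F)"
    and "\<And>k l F. coef n I k l F \<Longrightarrow> P (termB k l F)"
  shows "P f"
proof -
  have "span3 n I f" using assms(1) by (simp add: T_def)
  then show ?thesis
  proof (induction rule: span3.induct)
    case 1 show ?case by (rule assms(2))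
  next
    case (2 f g) then show ?case by (intro assms(3)) (simp_all add: T_def)
  next
    case (3 k l F) then show ?case by (rule assms(4))
  next
    case (4 k l F) then show ?case by (rule assms(5))
  qed
qed

lemma coef_grows:
  assumes "coef n I k l F"
  shows "\<exists>d. grows (real d) F"
  using assms rapid_grows by (auto simp: coef_def)

lemma coef_mono:
  assumes "coef n I k l F" "n' \<le> n" "(k + u, l + v) \<in> I'"
  shows "coef n' I' (k + u) (l + v) F"
proof -
  have "(p - 1) * d + n' \<le> k + u + (p - 1) * (l + v)" if "(p - 1) * d + n \<le> k + (p - 1) * l" for d
    using that assms(2) by (simp add: add_mult_distrib2)
  then show ?thesis using assms unfolding coef_def by (metis add_gr_0)
qed

lemma coef_cmult: "coef n I k l F \<Longrightarrow> coef n I k l (\<lambda>y. r * F y)"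
  unfolding coef_def using grows_cmult rapid_cmult by blast

lemma coef_deriv: "coef n I k l F \<Longrightarrow> coef n I k l (deriv F)"
  unfolding coef_def using grows_deriv rapid_deriv by blast

lemma coef_reflect: "coef n I k l F \<Longrightarrow> coef n I k l (\<lambda>y. F (- y))"
  unfolding coef_def using grows_reflect rapid_reflect by blast

lemma coef_mult:
  assumes F: "coef a I k l F" and G: "coef b I' k' l' G" and I: "(k + k' + u, l + l' + v) \<in> I''"
  shows "coef (a + b) I'' (k + k' + u) (l + l' + v) (\<lambda>y. F y * G y)"
proof -
  obtain d e where de: "grows d F" "grows e G" using coef_grows F G by blast
  consider "k + l > 0" "rapid F" | "k' + l' > 0" "rapid G"
    | d e where "(p - 1) * d + a \<le> k + (p - 1) * l" "grows (real d) F"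
        "(p - 1) * e + b \<le> k' + (p - 1) * l'" "grows (real e) G"
    using F G unfolding coef_def by blast
  then show ?thesis
  proof cases
    case 1 then show ?thesis
      unfolding coef_def using I rapid_mult[OF 1(2) de(2)] by (intro conjI disjI2) auto
  next
    case 2
    then show ?thesis
      unfolding coef_def using I rapid_mult[OF 2(2) de(1)] by (intro conjI disjI2) (auto simp: mult.commute)
  next
    case 3
    have "(p - 1) * (d + e) + (a + b) \<le> k + k' + u + (p - 1) * (l + l' + v)"
      using 3 by (simp add: add_mult_distrib2)
    moreover have "grows (real (d + e)) (\<lambda>y. F y * G y)"
      using grows_mult[OF 3(2,4)] by simp
    ultimately show ?thesis using I unfolding coef_def by blast
  qed
qed

text \<open>The bookkeeping is \<open>(p - 1) * (d + 1) + 1 = (p - 1) * d + p\<close>. The primitive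
  of a rapid coefficient is merely bounded; weight 1 admits that because \<open>(k, l)\<close> is
  not \<open>(0, 0)\<close>.\<close>

lemma coef_prim:
  assumes "coef p I k l F" "I \<subseteq> nz"
  shows "\<exists>d. grows d (prim F) \<and> coef 1 I k l (prim F) \<and> (\<forall>x. isCont F x)"
proof -
  obtain d where "grows (real d) F" using coef_grows assms(1) by blast
  then have cont: "\<forall>x. isCont F x" using DERIV_isCont grows_DERIV by blast
  have kl: "(k, l) \<in> I" "k + l > 0" using assms by (auto simp: coef_def nz_def)
  consider d where "(p - 1) * d + p \<le> k + (p - 1) * l" "grows (real d) F" | "rapid F"
    using assms(1) unfolding coef_def by blast
  then show ?thesis
  proof cases
    case (1 d)
    have "(p - 1) * (d + 1) + 1 = (p - 1) * d + p" using p_ge2 by simp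
    moreover have "grows (real (d + 1)) (prim F)" using grows_prim[OF 1(2)] by (simp add: add.commute)
    ultimately show ?thesis using kl cont 1(1) unfolding coef_def by metis
  next
    case 2
    have "1 \<le> k + (p - 1) * l"
    proof (cases "k = 0")
      case True
      then have "l \<noteq> 0" "p - 1 \<noteq> 0" using kl(2) p_ge2 by auto
      then show ?thesis by (simp add: Suc_le_eq)
    qed simp
    then have "(p - 1) * 0 + 1 \<le> k + (p - 1) * l" by simp
    moreover have "grows (real 0) (prim F)" using grows_prim_rapid[OF 2] by simp
    ultimately show ?thesis using kl cont unfolding coef_def by blast
  qed
qed

lemma T_mono: "f \<in> T n I \<Longrightarrow> n' \<le> n \<Longrightarrow> I \<subseteq> I' \<Longrightarrow> f \<in> T n' I'"
proof (induction rule: T_induct)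
  case (A k l F)
  have "(k, l) \<in> I" using A(1) by (simp add: coef_def)
  then have "coef n' I' (k + 0) (l + 0) F" using A by (intro coef_mono[of n I]) auto
  then show ?case by (simp add: T_A)
next
  case (B k l F)
  have "(k, l) \<in> I" using B(1) by (simp add: coef_def)
  then have "coef n' I' (k + 0) (l + 0) F" using B by (intro coef_mono[of n I]) auto
  then show ?case by (simp add: T_B)
qed (auto intro: T_intros)

lemma yfun_times_termA: "yfun F * termA k l G = termA k l (\<lambda>y. F y * G y)"
  and yfun_times_termB: "yfun F * termB k l G = termB k l (\<lambda>y. F y * G y)"
  by (auto simp: yfun_def termA_def termB_def fun_eq_iff fun_app)

lemma T_cmult: "f \<in> T n I \<Longrightarrow> yfun (\<lambda>_. r) * f \<in> T n I"
  by (induction rule: T_induct)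
    (auto simp: distrib_left yfun_times_termA yfun_times_termB intro: T_intros coef_cmult)

lemma T_uminus: "f \<in> T n I \<Longrightarrow> - f \<in> T n I"
  using T_cmult[of f n I "-1"] by (simp add: yfun_def fun_Compl_def times_fun_def fun_app)

lemma T_diff: "f \<in> T n I \<Longrightarrow> g \<in> T n I \<Longrightarrow> f - g \<in> T n I"
  using T_add[OF _ T_uminus, of f n I g] by simp

lemma T_sum: "(\<And>i. i \<in> X \<Longrightarrow> f i \<in> T n I) \<Longrightarrow> sum f X \<in> T n I"
  by (induction X rule: infinite_finite_induct) (auto intro: T_intros)

lemma termA_times_termA: "termA k l F * termA k' l' G = termA (k + k') (l + l') (\<lambda>y. F y * G y)"
  by (simp add: termA_def fun_eq_iff fun_app power_add mult_ac)

text \<open>A power of \<open>q\<close> times the derivative of another is a multiple of the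
  derivative of their product. For \<open>k' = 0\<close> both sides vanish, including the case where
  the quotient is \<open>0 / 0\<close>.\<close>

lemma termA_times_termB:
  "termA k l F * termB k' l' G = yfun (\<lambda>_. real k' / real (k + k')) * termB (k + k') (l + l') (\<lambda>y. F y * G y)"
proof (cases k')
  case (Suc j)
  then show ?thesis
    by (simp add: termA_def termB_def yfun_def fun_eq_iff fun_app power_add)
qed (simp add: termA_def termB_def yfun_def fun_eq_iff fun_app)

text \<open>The first integral eliminates \<open>qs * qs\<close>. The results sit at
  \<open>l + 1\<close> and at \<open>k + k' + (p - 1)\<close>, beyond the sum of the two indices;
  hence the extra shift \<open>(u, v)\<close> in the hypothesis of \<open>T_mult\<close>.\<close>

lemma termB_times_termB:
  "termB k l F * termB k' l' G =
     yfun (\<lambda>_. real k * real k') * termA (k + k') (l + l' + 1) (\<lambda>y. F y * G y) -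
     yfun (\<lambda>_. real k * real k' * (2 / (real p + 1))) * termA (k + k' + (p - 1)) (l + l') (\<lambda>y. F y * G y)"
proof (cases "k = 0 \<or> k' = 0")
  case True
  then show ?thesis by (auto simp: termA_def termB_def yfun_def fun_eq_iff fun_app)
next
  case False
  then obtain i j where ij: "k = Suc i" "k' = Suc j" by (metis not0_implies_Suc)
  have e: "k + k' + (p - 1) = i + j + (p + 1)" using p_ge2 ij by simp
  show ?thesis
  proof (intro ext)
    fix c s y
    have "termB k l F c s y * termB k' l' G c s y =
       real k * real k' * c ^ (l + l') * (q c s ^ (i + j) * (qs c s * qs c s)) * (F y * G y)"
      by (simp add: termB_def ij power_add mult_ac)
    also have "q c s ^ (i + j) * (qs c s * qs c s) = c * q c s ^ (k + k') - 2 / (real p + 1) * q c s ^ (k + k' + (p - 1))"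
      unfolding qs_sq e by (simp add: ij power_add power2_eq_square right_diff_distrib mult_ac)
    finally show "(termB k l F * termB k' l' G) c s y =
       (yfun (\<lambda>_. real k * real k') * termA (k + k') (l + l' + 1) (\<lambda>y. F y * G y) -
       yfun (\<lambda>_. real k * real k' * (2 / (real p + 1))) * termA (k + k' + (p - 1)) (l + l') (\<lambda>y. F y * G y)) c s y"
      by (simp add: termA_def yfun_def fun_app algebra_simps)
  qed
qed

lemma T_mult:
  assumes "f \<in> T a I" "g \<in> T b I'"
    and I: "\<And>k l k' l' u v. (k, l) \<in> I \<Longrightarrow> (k', l') \<in> I' \<Longrightarrow> (k + k' + u, l + l' + v) \<in> I''"
  shows "f * g \<in> T (a + b) I''"
  using assms(1)
proof (induction rule: T_induct)
  case zero then show ?case by (simp add: T_zero)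
next
  case (add f g') then show ?case by (simp add: distrib_right T_add)
next
  case (A k l F)
  note F = this
  have kl: "(k, l) \<in> I" using F by (simp add: coef_def)
  show ?case
    using assms(2)
  proof (induction rule: T_induct)
    case zero then show ?case by (simp add: T_zero)
  next
    case (add f g') then show ?case by (simp add: distrib_left T_add)
  next
    case (A k' l' G)
    then have kl': "(k', l') \<in> I'" by (simp add: coef_def)
    show ?case unfolding termA_times_termA
      using coef_mult[OF F A, of 0 0 I''] I[OF kl kl', of 0 0] by (intro T_A) simp
  next
    case (B k' l' G)
    then have kl': "(k', l') \<in> I'" by (simp add: coef_def)
    show ?case unfolding termA_times_termB
      using coef_mult[OF F B, of 0 0 I''] I[OF kl kl', of 0 0] by (intro T_cmult T_B) simp
  qed
next
  case (B k l F)
  note F = this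
  have kl: "(k, l) \<in> I" using F by (simp add: coef_def)
  show ?case
    using assms(2)
  proof (induction rule: T_induct)
    case zero then show ?case by (simp add: T_zero)
  next
    case (add f g') then show ?case by (simp add: distrib_left T_add)
  next
    case (A k' l' G)
    then have kl': "(k', l') \<in> I'" by (simp add: coef_def)
    have "termB k l F * termA k' l' G = yfun (\<lambda>_. real k / real (k' + k)) * termB (k + k') (l + l') (\<lambda>y. F y * G y)"
      using termA_times_termB[of k' l' G k l F] by (simp add: mult.commute add.commute)
    then show ?case
      using coef_mult[OF F A, of 0 0 I''] I[OF kl kl', of 0 0] by (auto intro: T_cmult T_B)
  next
    case (B k' l' G)
    then have kl': "(k', l') \<in> I'" by (simp add: coef_def)
    show ?case unfolding termB_times_termB
      using coef_mult[OF F B, of 0 1 I''] I[OF kl kl', of 0 1]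
        coef_mult[OF F B, of "p - 1" 0 I''] I[OF kl kl', of "p - 1" 0]
      by (intro T_diff T_cmult T_A) simp_all
  qed
qed

abbreviation \<A> :: "field3 set" where "\<A> \<equiv> T 0 UNIV"

lemma T_subset: "f \<in> T n I \<Longrightarrow> f \<in> \<A>"
  by (rule T_mono) auto

lemma \<A>_mult: "f \<in> \<A> \<Longrightarrow> g \<in> \<A> \<Longrightarrow> f * g \<in> \<A>"
  using T_mult[of f 0 UNIV g 0 UNIV UNIV] by simp

lemma \<A>_yfun: "grows 0 F \<Longrightarrow> yfun F \<in> \<A>"
proof -
  assume "grows 0 F"
  then have "coef 0 UNIV 0 0 F" by (auto simp: coef_def intro: exI[of _ 0])
  moreover have "yfun F = termA 0 0 F" by (simp add: yfun_def termA_def)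
  ultimately show ?thesis using T_A by simp
qed

lemma one_yfun: "(1 :: field3) = yfun (\<lambda>_. 1)" by (simp add: yfun_def fun_eq_iff fun_app)

lemma \<A>_one: "1 \<in> \<A>" unfolding one_yfun by (intro \<A>_yfun grows_const) simp

lemma cc_T: "cc \<in> T (p - 1) nz"
proof -
  have "coef (p - 1) nz 0 1 (\<lambda>_. 1)"
    using grows_const[of 0 1] by (auto simp: coef_def nz_def intro: exI[of _ 0])
  moreover have "cc = termA 0 1 (\<lambda>_. 1)" by (simp add: cc_def termA_def)
  ultimately show ?thesis using T_A by metis
qed

lemma \<A>_power: "f \<in> \<A> \<Longrightarrow> f ^ n \<in> \<A>"
  by (induction n) (auto intro: \<A>_one \<A>_mult)

lemmas \<A>_intros = \<A>_mult \<A>_one \<A>_power T_add T_diff T_uminus T_subset[OF cc_T]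

text \<open>This second-order relation for \<open>q ^ k\<close> is what closes the span under \<open>ds\<close>.\<close>

lemma
  shows DERIV_termA_s: "((\<lambda>s. termA k l F c s y) has_real_derivative termB k l F c s y) (at s)"
    and DERIV_termB_s: "((\<lambda>s. termB k l F c s y) has_real_derivative
      (yfun (\<lambda>_. (real k)\<^sup>2) * termA k (l + 1) F -
       yfun (\<lambda>_. real k * (2 * (real k - 1) / (real p + 1) + 1)) * termA (k + (p - 1)) l F) c s y) (at s)"
proof -
  have "((\<lambda>s. c ^ l * q c s ^ k * F y) has_real_derivative c ^ l * (real k * (qs c s * q c s ^ (k - 1))) * F y) (at s)"
    using DERIV_power[OF DERIV_q, where n = k] by (intro DERIV_cmult DERIV_cmult_right) simp
  then show "((\<lambda>s. termA k l F c s y) has_real_derivative termB k l F c s y) (at s)"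
    by (simp add: termA_def termB_def mult_ac)
  show "((\<lambda>s. termB k l F c s y) has_real_derivative
      (yfun (\<lambda>_. (real k)\<^sup>2) * termA k (l + 1) F -
       yfun (\<lambda>_. real k * (2 * (real k - 1) / (real p + 1) + 1)) * termA (k + (p - 1)) l F) c s y) (at s)"
  proof (cases k)
    case 0
    then show ?thesis by (simp add: termB_def yfun_def fun_app)
  next
    case (Suc j)
    define z where "z = q c s"
    have 1: "((\<lambda>s. c ^ l * (real k * q c s ^ j * qs c s) * F y) has_real_derivative
        c ^ l * ((real k * (real j * (qs c s * z ^ (j - 1)))) * qs c s + (c * z - z ^ p) * (real k * z ^ j)) * F y) (at s)"
      unfolding z_def using DERIV_power[OF DERIV_q, where n = j]
      by (intro DERIV_cmult DERIV_cmult_right DERIV_mult DERIV_qs) simp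
    have 2: "real j * (qs c s * z ^ (j - 1)) * qs c s = real j * (c * z ^ k - 2 / (real p + 1) * z ^ (j + p))"
    proof (cases j)
      case (Suc i)
      have "real j * (qs c s * z ^ (j - 1)) * qs c s = real j * (z ^ i * (qs c s * qs c s))"
        using Suc by (simp add: mult_ac)
      also have "z ^ i * (qs c s * qs c s) = c * z ^ k - 2 / (real p + 1) * z ^ (j + p)"
        unfolding qs_sq z_def[symmetric] using Suc \<open>k = Suc j\<close>
        by (simp add: power_add power2_eq_square right_diff_distrib mult_ac)
      finally show ?thesis .
    qed simp
    have 3: "k + (p - 1) = j + p" using Suc p_ge2 by simp
    have "c ^ l * ((real k * (real j * (qs c s * z ^ (j - 1)))) * qs c s + (c * z - z ^ p) * (real k * z ^ j)) * F y
       = c ^ l * real k * (real j * (qs c s * z ^ (j - 1)) * qs c s + (c * z - z ^ p) * z ^ j) * F y"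
      by (simp add: algebra_simps)
    also have "\<dots> = c ^ l * real k * (real j * (c * z ^ k - 2 / (real p + 1) * z ^ (j + p)) + (c * z ^ k - z ^ (j + p))) * F y"
      unfolding 2 by (simp add: Suc power_add left_diff_distrib right_diff_distrib mult_ac)
    also have "\<dots> = (real k)\<^sup>2 * (c ^ (l + 1) * z ^ k * F y) - real k * (2 * (real k - 1) / (real p + 1) + 1) * (c ^ l * z ^ (k + (p - 1)) * F y)"
      unfolding 3 by (simp add: Suc power2_eq_square algebra_simps)
    finally show ?thesis
      using 1 unfolding termB_def termA_def yfun_def z_def by (simp add: Suc fun_app)
  qed
qed

section \<open>Closure of the span under differentiation\<close>

lemma ds_termA: "ds (termA k l F) = termB k l F"
  unfolding ds_def by (intro ext DERIV_imp_deriv DERIV_termA_s)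

lemma ds_termB: "ds (termB k l F) = yfun (\<lambda>_. (real k)\<^sup>2) * termA k (l + 1) F -
       yfun (\<lambda>_. real k * (2 * (real k - 1) / (real p + 1) + 1)) * termA (k + (p - 1)) l F"
  unfolding ds_def by (intro ext DERIV_imp_deriv DERIV_termB_s)

lemma DERIV_termA_y: "grows d F \<Longrightarrow> ((\<lambda>y. termA k l F c s y) has_real_derivative termA k l (deriv F) c s y) (at y)"
  unfolding termA_def by (intro DERIV_cmult grows_DERIV)

lemma DERIV_termB_y: "grows d F \<Longrightarrow> ((\<lambda>y. termB k l F c s y) has_real_derivative termB k l (deriv F) c s y) (at y)"
  unfolding termB_def by (intro DERIV_cmult grows_DERIV)

lemma dy_termA: "grows d F \<Longrightarrow> dy (termA k l F) = termA k l (deriv F)"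
  unfolding dy_def by (intro ext DERIV_imp_deriv DERIV_termA_y)

lemma dy_termB: "grows d F \<Longrightarrow> dy (termB k l F) = termB k l (deriv F)"
  unfolding dy_def by (intro ext DERIV_imp_deriv DERIV_termB_y)

lemma DERIV_ds: "f \<in> T n I \<Longrightarrow> ((\<lambda>s. f c s y) has_real_derivative ds f c s y) (at s)"
proof (induction arbitrary: s rule: T_induct)
  case zero then show ?case by (simp add: ds_def fun_app)
next
  case (add f g)
  from DERIV_add[OF add.IH] have *: "((\<lambda>s. (f + g) c s y) has_real_derivative ds f c s y + ds g c s y) (at s)" for s
    by (simp add: fun_app)
  then have e: "ds (f + g) c s y = ds f c s y + ds g c s y" unfolding ds_def[of "f + g"] by (rule DERIV_imp_deriv)
  show ?case by (rule DERIV_cong[OF * e[symmetric]])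
next
  case (A k l F) then show ?case by (simp add: ds_termA DERIV_termA_s)
next
  case (B k l F) show ?case unfolding ds_termB by (rule DERIV_termB_s)
qed

lemma DERIV_dy: "f \<in> T n I \<Longrightarrow> ((\<lambda>y. f c s y) has_real_derivative dy f c s y) (at y)"
proof (induction arbitrary: y rule: T_induct)
  case zero then show ?case by (simp add: dy_def fun_app)
next
  case (add f g)
  from DERIV_add[OF add.IH] have *: "((\<lambda>y. (f + g) c s y) has_real_derivative dy f c s y + dy g c s y) (at y)" for y
    by (simp add: fun_app)
  then have e: "dy (f + g) c s y = dy f c s y + dy g c s y" unfolding dy_def[of "f + g"] by (rule DERIV_imp_deriv)
  show ?case by (rule DERIV_cong[OF * e[symmetric]])
next
  case (A k l F)
  then obtain d where d: "grows (real d) F" using coef_grows by blast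
  show ?case unfolding dy_termA[OF d] by (rule DERIV_termA_y[OF d])
next
  case (B k l F)
  then obtain d where d: "grows (real d) F" using coef_grows by blast
  show ?case unfolding dy_termB[OF d] by (rule DERIV_termB_y[OF d])
qed

lemma ds_add: "f \<in> \<A> \<Longrightarrow> g \<in> \<A> \<Longrightarrow> ds (f + g) = ds f + ds g"
proof (intro ext)
  fix c s y assume "f \<in> \<A>" "g \<in> \<A>"
  from DERIV_add[OF DERIV_ds[OF this(1)] DERIV_ds[OF this(2)]]
  have "((\<lambda>s. (f + g) c s y) has_real_derivative ds f c s y + ds g c s y) (at s)" by (simp add: fun_app)
  then have "ds (f + g) c s y = ds f c s y + ds g c s y" unfolding ds_def[of "f + g"] by (rule DERIV_imp_deriv)
  then show "ds (f + g) c s y = (ds f + ds g) c s y" by (simp add: mult.commute fun_app)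
qed

lemma ds_diff: "f \<in> \<A> \<Longrightarrow> g \<in> \<A> \<Longrightarrow> ds (f - g) = ds f - ds g"
proof (intro ext)
  fix c s y assume "f \<in> \<A>" "g \<in> \<A>"
  from DERIV_diff[OF DERIV_ds[OF this(1)] DERIV_ds[OF this(2)]]
  have "((\<lambda>s. (f - g) c s y) has_real_derivative ds f c s y - ds g c s y) (at s)" by (simp add: fun_app)
  then have "ds (f - g) c s y = ds f c s y - ds g c s y" unfolding ds_def[of "f - g"] by (rule DERIV_imp_deriv)
  then show "ds (f - g) c s y = (ds f - ds g) c s y" by (simp add: mult.commute fun_app)
qed

lemma ds_mult: "f \<in> \<A> \<Longrightarrow> g \<in> \<A> \<Longrightarrow> ds (f * g) = ds f * g + f * ds g"
proof (intro ext)
  fix c s y assume "f \<in> \<A>" "g \<in> \<A>"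
  from DERIV_mult[OF DERIV_ds[OF this(1)] DERIV_ds[OF this(2)]]
  have "((\<lambda>s. (f * g) c s y) has_real_derivative ds f c s y * g c s y + ds g c s y * f c s y) (at s)" by (simp add: fun_app)
  then have "ds (f * g) c s y = ds f c s y * g c s y + ds g c s y * f c s y" unfolding ds_def[of "f * g"] by (rule DERIV_imp_deriv)
  then show "ds (f * g) c s y = (ds f * g + f * ds g) c s y" by (simp add: mult.commute fun_app)
qed

lemma dy_add: "f \<in> \<A> \<Longrightarrow> g \<in> \<A> \<Longrightarrow> dy (f + g) = dy f + dy g"
proof (intro ext)
  fix c s y assume "f \<in> \<A>" "g \<in> \<A>"
  from DERIV_add[OF DERIV_dy[OF this(1)] DERIV_dy[OF this(2)]]
  have "((\<lambda>y. (f + g) c s y) has_real_derivative dy f c s y + dy g c s y) (at y)" by (simp add: fun_app)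
  then have "dy (f + g) c s y = dy f c s y + dy g c s y" unfolding dy_def[of "f + g"] by (rule DERIV_imp_deriv)
  then show "dy (f + g) c s y = (dy f + dy g) c s y" by (simp add: mult.commute fun_app)
qed

lemma dy_diff: "f \<in> \<A> \<Longrightarrow> g \<in> \<A> \<Longrightarrow> dy (f - g) = dy f - dy g"
proof (intro ext)
  fix c s y assume "f \<in> \<A>" "g \<in> \<A>"
  from DERIV_diff[OF DERIV_dy[OF this(1)] DERIV_dy[OF this(2)]]
  have "((\<lambda>y. (f - g) c s y) has_real_derivative dy f c s y - dy g c s y) (at y)" by (simp add: fun_app)
  then have "dy (f - g) c s y = dy f c s y - dy g c s y" unfolding dy_def[of "f - g"] by (rule DERIV_imp_deriv)
  then show "dy (f - g) c s y = (dy f - dy g) c s y" by (simp add: mult.commute fun_app)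
qed

lemma dy_mult: "f \<in> \<A> \<Longrightarrow> g \<in> \<A> \<Longrightarrow> dy (f * g) = dy f * g + f * dy g"
proof (intro ext)
  fix c s y assume "f \<in> \<A>" "g \<in> \<A>"
  from DERIV_mult[OF DERIV_dy[OF this(1)] DERIV_dy[OF this(2)]]
  have "((\<lambda>y. (f * g) c s y) has_real_derivative dy f c s y * g c s y + dy g c s y * f c s y) (at y)" by (simp add: fun_app)
  then have "dy (f * g) c s y = dy f c s y * g c s y + dy g c s y * f c s y" unfolding dy_def[of "f * g"] by (rule DERIV_imp_deriv)
  then show "dy (f * g) c s y = (dy f * g + f * dy g) c s y" by (simp add: mult.commute fun_app)
qed

lemma ds_yfun: "ds (yfun F) = 0"
  by (simp add: ds_def yfun_def fun_eq_iff fun_app)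

lemma dy_yfun: "dy (yfun F) = yfun (deriv F)"
  by (simp add: dy_def yfun_def fun_eq_iff fun_app)

lemma ds_zero: "ds 0 = 0" and dy_zero: "dy 0 = 0" and ds_one: "ds 1 = 0" and dy_one: "dy 1 = 0"
  and ds_cc: "ds cc = 0" and dy_cc: "dy cc = 0"
  by (simp_all add: ds_def dy_def cc_def fun_eq_iff fun_app)

lemma ds_T: "f \<in> T n I \<Longrightarrow> up I \<Longrightarrow> ds f \<in> T n I"
proof (induction rule: T_induct)
  case zero then show ?case by (simp add: ds_zero T_zero)
next
  case (add f g)
  then show ?case using ds_add[OF T_subset T_subset, of f n I g n I] by (simp add: T_add)
next
  case (A k l F) then show ?case by (simp add: ds_termA T_B)
next
  case (B k l F)
  then have "(k, l + 1) \<in> I" "(k + (p - 1), l) \<in> I" unfolding up_def coef_def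
    by (metis add_0_right)+
  then have "coef n I (k + 0) (l + 1) F" "coef n I (k + (p - 1)) (l + 0) F"
    using coef_mono[OF B(1), of n 0 1 I] coef_mono[OF B(1), of n "p - 1" 0 I] by auto
  then show ?case unfolding ds_termB by (intro T_diff T_cmult T_A) auto
qed

lemma dy_T: "f \<in> T n I \<Longrightarrow> dy f \<in> T n I"
proof (induction rule: T_induct)
  case zero then show ?case by (simp add: dy_zero T_zero)
next
  case (add f g)
  then show ?case using dy_add[OF T_subset T_subset, of f n I g n I] by (simp add: T_add)
next
  case (A k l F)
  then obtain d where d: "grows (real d) F" using coef_grows by blast
  show ?case unfolding dy_termA[OF d] using A by (intro T_A coef_deriv)
next
  case (B k l F)
  then obtain d where d: "grows (real d) F" using coef_grows by blast
  show ?case unfolding dy_termB[OF d] using B by (intro T_B coef_deriv)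
qed

lemma up_UNIV: "up UNIV" and up_nz: "up nz"
  by (auto simp: up_def nz_def)

lemma ds_\<A>: "f \<in> \<A> \<Longrightarrow> ds f \<in> \<A>" by (rule ds_T[OF _ up_UNIV])

lemma dy_ds: "f \<in> T n I \<Longrightarrow> dy (ds f) = ds (dy f)"
proof (induction rule: T_induct)
  case zero then show ?case by (simp add: ds_zero dy_zero)
next
  case (add f g)
  then have "f \<in> \<A>" "g \<in> \<A>" by (auto intro: T_subset)
  with add show ?case by (simp add: ds_add dy_add ds_\<A> dy_T)
next
  case (A k l F)
  then obtain d where d: "grows (real d) F" using coef_grows by blast
  show ?case by (simp add: ds_termA dy_termA[OF d] dy_termB[OF d])
next
  case (B k l F)
  then obtain d where d: "grows (real d) F" using coef_grows by blast
  have "coef 0 UNIV (k + 0) (l + 1) F" "coef 0 UNIV (k + (p - 1)) (l + 0) F"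
    by (rule coef_mono[OF B]; simp)+
  then have mem: "termA k (l + 1) (\<lambda>y. r * F y) \<in> \<A>" "termA (k + (p - 1)) l (\<lambda>y. r * F y) \<in> \<A>" for r
    using coef_cmult by (auto intro: T_A)
  have "dy (termA k' l' (\<lambda>y. r * F y)) = termA k' l' (\<lambda>y. r * deriv F y)" for k' l' r
  proof -
    have "deriv (\<lambda>y. r * F y) = (\<lambda>y. r * deriv F y)"
      by (intro ext DERIV_imp_deriv DERIV_cmult grows_DERIV[OF d])
    then show ?thesis using dy_termA[OF grows_cmult[OF d, of r]] by simp
  qed
  then show ?case
    unfolding ds_termB dy_termB[OF d] yfun_times_termA by (simp only: dy_diff[OF mem])
qed

text \<open>A rapid coefficient enters through the second alternative of \<open>coef\<close>, which
  does not mention the weight. A factor such as \<open>Q\<close> therefore lifts a term to any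
  weight, in particular to weight \<open>p\<close>.\<close>

lemma T_yfun_rapid:
  assumes "f \<in> T n I" "rapid F" "I \<subseteq> nz"
  shows "yfun F * f \<in> T n1 I"
  using assms(1)
proof (induction rule: T_induct)
  case (A k l G)
  then obtain d where "grows (real d) G" using coef_grows by blast
  then have "coef n1 I k l (\<lambda>y. F y * G y)"
    using A assms(3) rapid_mult[OF assms(2)] by (auto simp: coef_def nz_def)
  then show ?case unfolding yfun_times_termA by (rule T_A)
next
  case (B k l G)
  then obtain d where "grows (real d) G" using coef_grows by blast
  then have "coef n1 I k l (\<lambda>y. F y * G y)"
    using B assms(3) rapid_mult[OF assms(2)] by (auto simp: coef_def nz_def)
  then show ?case unfolding yfun_times_termB by (rule T_B)
qed (auto simp: distrib_left intro: T_zero T_add)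

lemma coef_gain:
  assumes "coef n I k l F" "(k + u, l + v) \<in> I'" "n' \<le> n + u + (p - 1) * v"
  shows "coef n' I' (k + u) (l + v) F"
proof -
  have "(p - 1) * d + n' \<le> k + u + (p - 1) * (l + v)" if "(p - 1) * d + n \<le> k + (p - 1) * l" for d
    using that assms(3) by (simp add: add_mult_distrib2)
  then show ?thesis using assms unfolding coef_def by (metis add_gr_0)
qed

text \<open>Two \<open>s\<close>-derivatives replace \<open>q ^ k\<close> by
  \<open>c * q ^ k\<close> and \<open>q ^ (k + (p - 1))\<close>. Either change gains weight
  \<open>p - 1\<close> and leaves the corner \<open>(k, l)\<close>, so weight 1 becomes the weight
  \<open>p\<close> required for integrating in \<open>y\<close>.\<close>

lemma dss_T:
  assumes "f \<in> T n I"
    and I: "\<And>k l u v. (k, l) \<in> I \<Longrightarrow> u + v > 0 \<Longrightarrow> (k + u, l + v) \<in> I'"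
  shows "ds (ds f) \<in> T (n + (p - 1)) I'"
  using assms(1)
proof (induction rule: T_induct)
  case zero then show ?case by (simp add: ds_zero T_zero)
next
  case (add f g)
  then have "f \<in> \<A>" "g \<in> \<A>" by (auto intro: T_subset)
  with add show ?case by (simp add: ds_add ds_\<A> T_add)
next
  case (A k l F)
  then have kl: "(k, l) \<in> I" by (simp add: coef_def)
  have "coef (n + (p - 1)) I' (k + 0) (l + 1) F" "coef (n + (p - 1)) I' (k + (p - 1)) (l + 0) F"
    using coef_gain[OF A, of 0 1 I'] coef_gain[OF A, of "p - 1" 0 I'] I[OF kl, of 0 1] I[OF kl, of "p - 1" 0] p_ge2
    by auto
  then show ?case unfolding ds_termA ds_termB by (intro T_diff T_cmult T_A) auto
next
  case (B k l F)
  then have kl: "(k, l) \<in> I" by (simp add: coef_def)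
  have c: "coef (n + (p - 1)) I' (k + 0) (l + 1) F" "coef (n + (p - 1)) I' (k + (p - 1)) (l + 0) F"
    using coef_gain[OF B, of 0 1 I'] coef_gain[OF B, of "p - 1" 0 I'] I[OF kl, of 0 1] I[OF kl, of "p - 1" 0] p_ge2
    by auto
  have "coef 0 UNIV (k + 0) (l + 1) F" "coef 0 UNIV (k + (p - 1)) (l + 0) F"
    by (rule coef_mono[OF B]; simp)+
  then have mem: "termA k (l + 1) (\<lambda>y. r * F y) \<in> \<A>" "termA (k + (p - 1)) l (\<lambda>y. r * F y) \<in> \<A>" for r
    using coef_cmult by (auto intro: T_A)
  show ?case
    unfolding ds_termB yfun_times_termA ds_diff[OF mem] ds_termA
    using c by (intro T_diff T_B coef_cmult) auto
qed

text \<open>The only place where interaction terms without a rapid coefficient are integrated in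
  \<open>y\<close>; the price is the drop from weight \<open>p\<close> to weight 1.\<close>

lemma dy_surj:
  assumes "f \<in> T p I" "I \<subseteq> nz"
  shows "\<exists>z \<in> T 1 I. dy z = f"
  using assms(1)
proof (induction rule: T_induct)
  case zero then show ?case using dy_zero T_zero by blast
next
  case (add f g)
  then obtain z w where "z \<in> T 1 I" "dy z = f" "w \<in> T 1 I" "dy w = g" by blast
  then show ?case using dy_add[OF T_subset T_subset] T_add by blast
next
  case (A k l F)
  then obtain d where d: "grows d (prim F)" "coef 1 I k l (prim F)" "\<And>x. isCont F x"
    using coef_prim assms(2) by blast
  show ?case
    using dy_termA[OF d(1)] T_A[OF d(2)] DERIV_imp_deriv[OF DERIV_prim[OF d(3)]] by (metis ext)
next
  case (B k l F)
  then obtain d where d: "grows d (prim F)" "coef 1 I k l (prim F)" "\<And>x. isCont F x"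
    using coef_prim assms(2) by blast
  show ?case
    using dy_termB[OF d(1)] T_B[OF d(2)] DERIV_imp_deriv[OF DERIV_prim[OF d(3)]] by (metis ext)
qed

text \<open>The largest degree that weight 1 permits at \<open>(k, l)\<close>; for
  \<open>k > 0\<close> it is the integer part of \<open>(k - 1) / (p - 1)\<close>, plus
  \<open>l\<close>.\<close>

definition D :: "nat \<Rightarrow> nat \<Rightarrow> nat" where "D k l = (k + (p - 1) * l - 1) div (p - 1)"

lemma coef_D: "coef 1 I k l F \<Longrightarrow> grows (real (D k l)) F"
proof -
  assume F: "coef 1 I k l F"
  have "d \<le> D k l" if "(p - 1) * d + 1 \<le> k + (p - 1) * l" for d
    unfolding D_def using that p_ge2 by (subst less_eq_div_iff_mult_less_eq) (auto simp: mult.commute)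
  then show ?thesis
    using F unfolding coef_def by (auto intro: rapid_grows grows_mono[of "real d" for d])
qed

lemma D_coef:
  assumes "grows (real (D k l)) F" "(k, l) \<in> I" "k > 0"
  shows "coef 1 I k l F"
proof -
  have "(p - 1) * D k l \<le> k + (p - 1) * l - 1" unfolding D_def by (rule times_div_less_eq_dividend)
  then have "(p - 1) * D k l + 1 \<le> k + (p - 1) * l" using assms(3) by linarith
  then show ?thesis using assms unfolding coef_def by blast
qed

lemma termA_add: "termA k l (\<lambda>y. F y + G y) = termA k l F + termA k l G"
  and termB_add: "termB k l (\<lambda>y. F y + G y) = termB k l F + termB k l G"
  by (simp_all add: termA_def termB_def fun_eq_iff fun_app distrib_left)

lemma T_extract:
  assumes "f \<in> T 1 I"
  shows "\<exists>F G. grows (real (D k l)) F \<and> grows (real (D k l)) G \<and>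
    f - termA k l F - termB k l G \<in> T 1 (I - {(k, l)})"
  using assms
proof (induction rule: T_induct)
  case zero
  have "0 - termA k l (\<lambda>_. 0) - termB k l (\<lambda>_. 0) = 0"
    by (simp add: termA_def termB_def fun_eq_iff fun_app)
  then show ?case using T_zero grows_const[of "real (D k l)" 0] by (metis of_nat_0_le_iff)
next
  case (add f g)
  then obtain F G F' G' where
    *: "grows (real (D k l)) F" "grows (real (D k l)) G" "f - termA k l F - termB k l G \<in> T 1 (I - {(k, l)})"
      "grows (real (D k l)) F'" "grows (real (D k l)) G'" "g - termA k l F' - termB k l G' \<in> T 1 (I - {(k, l)})"
    by blast
  have "f + g - termA k l (\<lambda>y. F y + F' y) - termB k l (\<lambda>y. G y + G' y) =
    (f - termA k l F - termB k l G) + (g - termA k l F' - termB k l G')"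
    unfolding termA_add termB_add by simp
  also have "\<dots> \<in> T 1 (I - {(k, l)})" using * by (intro T_add)
  finally show ?case using * grows_add by blast
next
  case (A k' l' F)
  have z: "termB k l (\<lambda>_. 0) = 0" "termA k l (\<lambda>_. 0) = 0"
    by (simp_all add: termA_def termB_def fun_eq_iff fun_app)
  have g0: "grows (real (D k l)) (\<lambda>_. 0)" by (rule grows_const) simp
  show ?case
  proof (cases "(k', l') = (k, l)")
    case True
    have "termA k' l' F - termA k l F - termB k l (\<lambda>_. 0) \<in> T 1 (I - {(k, l)})"
      using True by (simp add: z T_zero)
    then show ?thesis using coef_D[OF A] g0 True by blast
  next
    case False
    have "termA k' l' F - termA k l (\<lambda>_. 0) - termB k l (\<lambda>_. 0) \<in> T 1 (I - {(k, l)})"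
    proof -
      have "coef 1 (I - {(k, l)}) k' l' F" using A False by (simp add: coef_def)
      then show ?thesis unfolding z by (simp add: T_A)
    qed
    then show ?thesis using g0 by blast
  qed
next
  case (B k' l' F)
  have z: "termB k l (\<lambda>_. 0) = 0" "termA k l (\<lambda>_. 0) = 0"
    by (simp_all add: termA_def termB_def fun_eq_iff fun_app)
  have g0: "grows (real (D k l)) (\<lambda>_. 0)" by (rule grows_const) simp
  show ?case
  proof (cases "(k', l') = (k, l)")
    case True
    have "termB k' l' F - termA k l (\<lambda>_. 0) - termB k l F \<in> T 1 (I - {(k, l)})"
      using True by (simp add: z T_zero)
    then show ?thesis using coef_D[OF B] g0 True by blast
  next
    case False
    have "termB k' l' F - termA k l (\<lambda>_. 0) - termB k l (\<lambda>_. 0) \<in> T 1 (I - {(k, l)})"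
    proof -
      have "coef 1 (I - {(k, l)}) k' l' F" using B False by (simp add: coef_def)
      then show ?thesis unfolding z by (simp add: T_B)
    qed
    then show ?thesis using g0 by blast
  qed
qed

section \<open>Reflection symmetry\<close>

lemma reflect_termA: "reflect (termA k l F) = termA k l (\<lambda>y. F (- y))"
  and reflect_termB: "reflect (termB k l F) = termB k l (\<lambda>y. - 1 * F (- y))"
  by (simp_all add: reflect_def termA_def termB_def q_even qs_odd)

lemma reflect_add: "reflect (f + g) = reflect f + reflect g"
  and reflect_diff: "reflect (f - g) = reflect f - reflect g"
  and reflect_mult: "reflect (f * g) = reflect f * reflect g"
  and reflect_zero: "reflect 0 = 0" and reflect_one: "reflect 1 = 1" and reflect_cc: "reflect cc = cc"
  by (simp_all add: reflect_def cc_def fun_eq_iff fun_app)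

lemma reflect_power: "reflect (f ^ n) = reflect f ^ n"
  by (induction n) (simp_all add: reflect_one reflect_mult)

lemma reflect_T: "f \<in> T n I \<Longrightarrow> reflect f \<in> T n I"
proof (induction rule: T_induct)
  case (A k l F) then show ?case unfolding reflect_termA by (intro T_A coef_reflect)
next
  case (B k l F)
  show ?case unfolding reflect_termB by (rule T_B[OF coef_cmult[OF coef_reflect[OF B]]])
qed (simp_all add: reflect_zero reflect_add T_zero T_add)

lemma ds_reflect: "f \<in> T n I \<Longrightarrow> ds (reflect f) = - reflect (ds f)"
proof (intro ext)
  fix c s y assume f: "f \<in> T n I"
  have "((\<lambda>s. reflect f c s y) has_real_derivative ds f c (- s) (- y) * - 1) (at s)"
    unfolding reflect_def by (rule DERIV_chain2[OF DERIV_ds[OF f] DERIV_minus[OF DERIV_ident]])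
  from DERIV_imp_deriv[OF this] show "ds (reflect f) c s y = (- reflect (ds f)) c s y"
    unfolding ds_def[of "reflect f"] by (simp add: reflect_def)
qed

lemma dy_reflect: "f \<in> T n I \<Longrightarrow> dy (reflect f) = - reflect (dy f)"
proof (intro ext)
  fix c s y assume f: "f \<in> T n I"
  have "((\<lambda>y. reflect f c s y) has_real_derivative dy f c (- s) (- y) * - 1) (at y)"
    unfolding reflect_def by (rule DERIV_chain2[OF DERIV_dy[OF f] DERIV_minus[OF DERIV_ident]])
  from DERIV_imp_deriv[OF this] show "dy (reflect f) c s y = (- reflect (dy f)) c s y"
    unfolding dy_def[of "reflect f"] by (simp add: reflect_def)
qed

end

section \<open>Residual of the approximate solution\<close>

declare minus_apply [simp del] uminus_apply [simp del]

context gkdv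
begin

definition Iup :: "nat \<Rightarrow> nat \<Rightarrow> (nat \<times> nat) set" where "Iup k l = {(k', l'). k \<le> k' \<and> l \<le> l'}"
definition Iup' :: "nat \<Rightarrow> nat \<Rightarrow> (nat \<times> nat) set" where "Iup' k l = Iup k l - {(k, l)}"

lemma Iup'_subset: "Iup' k l \<subseteq> Iup k l" by (auto simp: Iup'_def)
lemma Iup_nz: "k > 0 \<Longrightarrow> Iup k l \<subseteq> nz" and Iup'_nz: "k > 0 \<Longrightarrow> Iup' k l \<subseteq> nz"
  by (auto simp: Iup_def Iup'_def nz_def)
lemma up_Iup: "up (Iup k l)" by (auto simp: up_def Iup_def)
lemma up_Iup': "up (Iup' k l)" by (auto simp: up_def Iup_def Iup'_def)

lemma T_mult_nz: "f \<in> T a (Iup k l) \<Longrightarrow> g \<in> T b nz \<Longrightarrow> f * g \<in> T (a + b) (Iup' k l)"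
  by (rule T_mult) (auto simp: Iup_def Iup'_def nz_def)
lemma T_mult_Iup': "f \<in> T a (Iup' k l) \<Longrightarrow> g \<in> T b I \<Longrightarrow> f * g \<in> T (a + b) (Iup' k l)"
  by (rule T_mult) (auto simp: Iup_def Iup'_def)
lemma T_mult_Iup: "f \<in> T a (Iup k l) \<Longrightarrow> g \<in> T b I \<Longrightarrow> f * g \<in> T (a + b) (Iup k l)"
  by (rule T_mult) (auto simp: Iup_def)
lemma T_mult_nz_nz: "f \<in> T a nz \<Longrightarrow> g \<in> T b I \<Longrightarrow> f * g \<in> T (a + b) nz"
  by (rule T_mult) (auto simp: nz_def)

lemma dss_Iup: "f \<in> T n (Iup k l) \<Longrightarrow> ds (ds f) \<in> T (n + (p - 1)) (Iup' k l)"
  by (rule dss_T) (auto simp: Iup_def Iup'_def)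

text \<open>The chain rule along \<open>s = x + (1 - c) * t\<close> and
  \<open>y = x - \<alpha>(s)\<close> with \<open>\<beta>\<close> the derivative of
  \<open>\<alpha>\<close>: \<open>Dop\<close> is the \<open>x\<close>-derivative, and the first
  summand of \<open>Sop\<close> is the \<open>t\<close>-derivative.\<close>

definition Dop :: "field3 \<Rightarrow> field3 \<Rightarrow> field3" where "Dop \<beta> f = ds f + (1 - \<beta>) * dy f"

definition Sop :: "field3 \<Rightarrow> field3 \<Rightarrow> field3" where
  "Sop v \<beta> = (1 - cc) * (ds v - \<beta> * dy v) + Dop \<beta> (Dop \<beta> (Dop \<beta> v) - v + v ^ p)"

text \<open>\<open>Sop\<close> is split into a total \<open>y\<close>-derivative and a remainder in which every term without a factor
  \<open>Q\<close> carries enough powers of \<open>q\<close> and \<open>c\<close> to be integrated in \<open>y\<close>.\<close>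

definition Wop :: "field3 \<Rightarrow> field3 \<Rightarrow> field3" where
  "Wop v \<beta> = (1 - \<beta>) * ds v + (1 - \<beta>) * ds v - ds \<beta> * v + (1 - \<beta>) * ((1 - \<beta>) * dy v)"

definition Nop :: "field3 \<Rightarrow> field3 \<Rightarrow> field3" where
  "Nop v \<beta> = ds (ds v) + dy (Wop v \<beta>) - v + v ^ p"

definition Eop :: "field3 \<Rightarrow> field3 \<Rightarrow> field3" where
  "Eop v \<beta> = ds (Wop v \<beta>) + (1 - \<beta>) * Nop v \<beta> - (1 - cc) * (\<beta> * v)"

lemma dy_\<A>: "f \<in> \<A> \<Longrightarrow> dy f \<in> \<A>" by (rule dy_T)

lemma numeral_yfun: "(numeral n :: field3) = yfun (\<lambda>_. numeral n)"
  by (simp add: yfun_def fun_eq_iff)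

lemma \<A>_numeral: "(numeral n :: field3) \<in> \<A>"
  unfolding numeral_yfun by (intro \<A>_yfun grows_const) simp

lemma ds_numeral: "ds (numeral n) = 0" and dy_numeral: "dy (numeral n) = 0"
  unfolding numeral_yfun ds_yfun dy_yfun by (simp_all add: yfun_def fun_eq_iff fun_app)

lemmas mem_simps = ds_\<A> dy_\<A> \<A>_numeral \<A>_intros
lemmas diff_simps = ds_add ds_diff ds_mult dy_add dy_diff dy_mult ds_one dy_one ds_cc dy_cc ds_zero dy_zero
  ds_numeral dy_numeral

text \<open>As \<open>\<beta>\<close> is independent of \<open>y\<close>, factors
  \<open>1 - \<beta>\<close> pass under \<open>dy\<close>; the summand
  \<open>- ds \<beta> * v\<close> of \<open>Wop\<close> stems from \<open>ds\<close> hitting such a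
  factor.\<close>

lemma Dop_Dop:
  assumes "v \<in> \<A>" "\<beta> \<in> \<A>" "dy \<beta> = 0"
  shows "Dop \<beta> (Dop \<beta> v) = ds (ds v) + dy (Wop v \<beta>)"
proof -
  have "dy (ds \<beta>) = 0" using dy_ds[OF assms(2)] assms(3) ds_zero by simp
  moreover have "dy (ds v) = ds (dy v)" by (rule dy_ds[OF assms(1)])
  ultimately show ?thesis
    using assms by (simp add: Dop_def Wop_def diff_simps mem_simps algebra_simps)
qed

lemma Wop_\<A>: "v \<in> \<A> \<Longrightarrow> \<beta> \<in> \<A> \<Longrightarrow> Wop v \<beta> \<in> \<A>"
  unfolding Wop_def by (simp add: mem_simps)

lemma Nop_\<A>: "v \<in> \<A> \<Longrightarrow> \<beta> \<in> \<A> \<Longrightarrow> Nop v \<beta> \<in> \<A>"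
  unfolding Nop_def by (simp add: mem_simps Wop_\<A>)

text \<open>The \<open>ds v\<close> from the time derivative cancels against the one from
  \<open>- v\<close> and leaves \<open>- cc * ds v\<close>. The part that is not yet a
  \<open>y\<close>-derivative is thus the slow soliton's own equation in \<open>s\<close>, which
  \<open>q\<close> satisfies exactly.\<close>

lemma Sop_eq:
  assumes v: "v \<in> \<A>" and b: "\<beta> \<in> \<A>" "dy \<beta> = 0"
  shows "Sop v \<beta> = ds (ds (ds v) - cc * v + v ^ p) + dy (Eop v \<beta>)"
proof -
  define P where "P = v ^ p"
  define W where "W = Wop v \<beta>"
  define N where "N = Nop v \<beta>"
  have mem: "P \<in> \<A>" "W \<in> \<A>" "N \<in> \<A>"
    using v b by (simp_all add: P_def W_def N_def mem_simps Wop_\<A> Nop_\<A>)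
  have N: "N = ds (ds v) + dy W - v + P" by (simp add: N_def Nop_def W_def P_def)
  have "Dop \<beta> (Dop \<beta> v) - v + v ^ p = N"
    unfolding Dop_Dop[OF assms] N P_def W_def ..
  then have S: "Sop v \<beta> = (1 - cc) * (ds v - \<beta> * dy v) + (ds N + (1 - \<beta>) * dy N)"
    unfolding Sop_def Dop_def[of \<beta> N, symmetric] by simp
  have dsN: "ds N = ds (ds (ds v)) + ds (dy W) - ds v + ds P"
    unfolding N using v b mem by (simp add: diff_simps mem_simps)
  have 1: "dy (Eop v \<beta>) = ds (dy W) + (1 - \<beta>) * dy N - (1 - cc) * (\<beta> * dy v)"
    unfolding Eop_def W_def[symmetric] N_def[symmetric] using v b mem dy_ds[OF mem(2)]
    by (simp add: diff_simps mem_simps)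
  have 2: "ds (ds (ds v) - cc * v + v ^ p) = ds (ds (ds v)) - cc * ds v + ds P"
    unfolding P_def[symmetric] using v mem by (simp add: diff_simps mem_simps)
  show ?thesis unfolding S dsN 1 2 by (simp add: algebra_simps)
qed

text \<open>First-order calculus of a perturbation: \<open>f0\<close> is the part of \<open>f\<close> that does not decay in \<open>s\<close>, and
  \<open>\<delta>\<close> is the change from \<open>f\<close> to \<open>f'\<close> up to terms of higher order than \<open>c ^ l * q ^ k\<close>.\<close>

definition tang :: "nat \<Rightarrow> nat \<Rightarrow> (real \<Rightarrow> real) \<Rightarrow> field3 \<Rightarrow> field3 \<Rightarrow> field3 \<Rightarrow> bool" where
  "tang k l f0 \<delta> f f' \<longleftrightarrow> k > 0 \<and> f \<in> \<A> \<and> f' \<in> \<A> \<and> grows 0 f0 \<and> f - yfun f0 \<in> T 1 nz \<and>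
     \<delta> \<in> T 1 (Iup k l) \<and> f' - f - \<delta> \<in> T 1 (Iup' k l)"

lemma yfun_add: "yfun (\<lambda>y. F y + G y) = yfun F + yfun G"
  and yfun_diff: "yfun (\<lambda>y. F y - G y) = yfun F - yfun G"
  and yfun_mult: "yfun (\<lambda>y. F y * G y) = yfun F * yfun G"
  by (simp_all add: yfun_def fun_eq_iff fun_app minus_apply)

lemma yfun_0: "yfun (\<lambda>_. 0) = 0" and yfun_1: "yfun (\<lambda>_. 1) = 1"
  by (simp_all add: yfun_def fun_eq_iff fun_app)

lemma tang_cong:
  "tang k l f0 \<delta> f f' \<Longrightarrow> f0 = g0 \<Longrightarrow> \<delta> = \<gamma> \<Longrightarrow> tang k l g0 \<gamma> f f'"
  by simp

lemma tang_add:
  assumes "tang k l f0 \<delta> f f'" "tang k l g0 \<gamma> g g'"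
  shows "tang k l (\<lambda>y. f0 y + g0 y) (\<delta> + \<gamma>) (f + g) (f' + g')"
proof -
  have e: "f + g - yfun (\<lambda>y. f0 y + g0 y) = (f - yfun f0) + (g - yfun g0)"
    "f' + g' - (f + g) - (\<delta> + \<gamma>) = (f' - f - \<delta>) + (g' - g - \<gamma>)"
    by (simp_all add: yfun_add)
  show ?thesis using assms unfolding tang_def e by (blast intro: T_add grows_add)
qed

lemma tang_diff:
  assumes "tang k l f0 \<delta> f f'" "tang k l g0 \<gamma> g g'"
  shows "tang k l (\<lambda>y. f0 y - g0 y) (\<delta> - \<gamma>) (f - g) (f' - g')"
proof -
  have e: "f - g - yfun (\<lambda>y. f0 y - g0 y) = (f - yfun f0) - (g - yfun g0)"
    "f' - g' - (f - g) - (\<delta> - \<gamma>) = (f' - f - \<delta>) - (g' - g - \<gamma>)"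
    by (simp_all add: yfun_diff)
  show ?thesis using assms unfolding tang_def e by (blast intro: T_diff grows_diff)
qed

lemma T_1_mult: "f \<in> T a (Iup' k l) \<Longrightarrow> 1 \<le> a \<Longrightarrow> f \<in> T 1 (Iup' k l)"
  by (rule T_mono) auto

text \<open>The product rule. An increment multiplied by another increment, or by a decaying part
  \<open>f - yfun f0\<close>, moves strictly above \<open>(k, l)\<close>; only the limits
  \<open>f0\<close> and \<open>g0\<close> survive as factors.\<close>

lemma tang_mult:
  assumes f: "tang k l f0 \<delta> f f'" and g: "tang k l g0 \<gamma> g g'"
  shows "tang k l (\<lambda>y. f0 y * g0 y) (yfun f0 * \<gamma> + yfun g0 * \<delta>) (f * g) (f' * g')"
  unfolding tang_def
proof (intro conjI)
  have F: "f \<in> \<A>" "f' \<in> \<A>" "grows 0 f0" "f - yfun f0 \<in> T 1 nz" "\<delta> \<in> T 1 (Iup k l)" "f' - f - \<delta> \<in> T 1 (Iup' k l)"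
    and G: "g \<in> \<A>" "g' \<in> \<A>" "grows 0 g0" "g - yfun g0 \<in> T 1 nz" "\<gamma> \<in> T 1 (Iup k l)" "g' - g - \<gamma> \<in> T 1 (Iup' k l)"
    using f g by (auto simp: tang_def)
  note yf = \<A>_yfun[OF F(3)] and yg = \<A>_yfun[OF G(3)]
  show "k > 0" using f by (simp add: tang_def)
  show "f * g \<in> \<A>" "f' * g' \<in> \<A>" using F G by (auto intro: \<A>_mult)
  show "grows 0 (\<lambda>y. f0 y * g0 y)" using grows_mult[OF F(3) G(3)] by simp
  have "f * g - yfun (\<lambda>y. f0 y * g0 y) = (f - yfun f0) * g + (g - yfun g0) * yfun f0"
    unfolding yfun_mult by (simp add: algebra_simps)
  then show "f * g - yfun (\<lambda>y. f0 y * g0 y) \<in> T 1 nz"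
    using T_mult_nz_nz[OF F(4) G(1)] T_mult_nz_nz[OF G(4) yf] by (simp add: T_add)
  show "yfun f0 * \<gamma> + yfun g0 * \<delta> \<in> T 1 (Iup k l)"
    using T_mult_Iup[OF G(5) yf] T_mult_Iup[OF F(5) yg] by (simp add: T_add mult.commute)
  have "f' * g' - f * g - (yfun f0 * \<gamma> + yfun g0 * \<delta>) =
     (f' - f - \<delta>) * g' + (\<delta> * (g - yfun g0) + \<delta> * \<gamma> + (g' - g - \<gamma>) * \<delta>)
     + (g' - g - \<gamma>) * f + \<gamma> * (f - yfun f0)"
    by (simp add: algebra_simps)
  also have "\<dots> \<in> T 1 (Iup' k l)"
  proof (intro T_add)
    show "(f' - f - \<delta>) * g' \<in> T 1 (Iup' k l)" using T_mult_Iup'[OF F(6) G(2)] by simp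
    show "\<delta> * (g - yfun g0) \<in> T 1 (Iup' k l)" using T_mult_nz[OF F(5) G(4)] by (intro T_1_mult[of _ 2]) (simp_all add: numeral_2_eq_2)
    show "\<gamma> * (f - yfun f0) \<in> T 1 (Iup' k l)" using T_mult_nz[OF G(5) F(4)] by (intro T_1_mult[of _ 2]) (simp_all add: numeral_2_eq_2)
    show "(g' - g - \<gamma>) * \<delta> \<in> T 1 (Iup' k l)" using T_mult_Iup'[OF G(6) T_subset[OF F(5)]] by simp
    show "(g' - g - \<gamma>) * f \<in> T 1 (Iup' k l)" using T_mult_Iup'[OF G(6) F(1)] by simp
    show "\<delta> * \<gamma> \<in> T 1 (Iup' k l)"
      using T_mult_nz[OF F(5) T_mono[OF G(5) order.refl Iup_nz]] f
      by (intro T_1_mult[of _ 2]) (simp_all add: numeral_2_eq_2 tang_def)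
  qed
  finally show "f' * g' - f * g - (yfun f0 * \<gamma> + yfun g0 * \<delta>) \<in> T 1 (Iup' k l)" .
qed

lemma tang_const:
  assumes "k > 0" "f \<in> \<A>" "grows 0 f0" "f - yfun f0 \<in> T 1 nz"
  shows "tang k l f0 0 f f"
  using assms by (simp add: tang_def T_zero)

lemma tang_one: "k > 0 \<Longrightarrow> tang k l (\<lambda>_. 1) 0 1 1"
  by (rule tang_const) (simp_all add: \<A>_one grows_const yfun_1 T_zero)

lemma tang_cc: "k > 0 \<Longrightarrow> tang k l (\<lambda>_. 0) 0 cc cc"
  using p_ge2 T_mono[OF cc_T, of 1 nz]
  by (intro tang_const) (simp_all add: T_subset[OF cc_T] grows_const yfun_0)

lemma tang_ds:
  assumes "tang k l f0 \<delta> f f'" shows "tang k l (\<lambda>_. 0) (ds \<delta>) (ds f) (ds f')"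
proof -
  have F: "k > 0" "f \<in> \<A>" "f' \<in> \<A>" "grows 0 f0" "f - yfun f0 \<in> T 1 nz" "\<delta> \<in> T 1 (Iup k l)" "f' - f - \<delta> \<in> T 1 (Iup' k l)"
    using assms by (auto simp: tang_def)
  have "ds (f - yfun f0) = ds f - yfun (\<lambda>_. 0)"
    by (simp add: ds_diff F \<A>_yfun ds_yfun yfun_0)
  then have "ds f - yfun (\<lambda>_. 0) \<in> T 1 nz" using ds_T[OF F(5) up_nz] by simp
  moreover have "ds (f' - f - \<delta>) = ds f' - ds f - ds \<delta>"
    using F T_subset[OF F(6)] by (simp add: ds_diff \<A>_intros)
  then have "ds f' - ds f - ds \<delta> \<in> T 1 (Iup' k l)" using ds_T[OF F(7) up_Iup'] by simp
  ultimately show ?thesis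
    using F ds_T[OF F(6) up_Iup] by (simp add: tang_def ds_\<A> grows_const)
qed

lemma tang_dy:
  assumes "tang k l f0 \<delta> f f'" shows "tang k l (deriv f0) (dy \<delta>) (dy f) (dy f')"
proof -
  have F: "k > 0" "f \<in> \<A>" "f' \<in> \<A>" "grows 0 f0" "f - yfun f0 \<in> T 1 nz" "\<delta> \<in> T 1 (Iup k l)" "f' - f - \<delta> \<in> T 1 (Iup' k l)"
    using assms by (auto simp: tang_def)
  have "dy (f - yfun f0) = dy f - yfun (deriv f0)"
    by (simp add: dy_diff F \<A>_yfun dy_yfun)
  then have "dy f - yfun (deriv f0) \<in> T 1 nz" using dy_T[OF F(5)] by simp
  moreover have "dy (f' - f - \<delta>) = dy f' - dy f - dy \<delta>"
    using F T_subset[OF F(6)] by (simp add: dy_diff \<A>_intros)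
  then have "dy f' - dy f - dy \<delta> \<in> T 1 (Iup' k l)" using dy_T[OF F(7)] by simp
  ultimately show ?thesis
    using F dy_T[OF F(6)] by (simp add: tang_def dy_\<A> grows_deriv)
qed

lemma deriv_Q: "deriv Q = Qd" and deriv_Qd: "deriv Qd = (\<lambda>y. Q y - Q y ^ p)"
  by (auto intro: DERIV_imp_deriv DERIV_Q DERIV_Qd)

lemma grows_Q_power: "grows 0 (\<lambda>y. Q y ^ n)"
  using rapid_grows[OF rapid_Q_power, of n 0] grows_const[of 0 1] by (cases n) auto

lemma yfun_power: "yfun (\<lambda>y. F y ^ n) = yfun F ^ n"
  by (induction n) (simp_all add: yfun_1 yfun_mult)

text \<open>In the expansion around \<open>Q\<close> each term either contains a power of
  \<open>Q\<close>, and is rapid, or is the pure \<open>n\<close>-th power of the deviation, of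
  weight \<open>n\<close>. For \<open>n = p\<close> this is precisely what integration in
  \<open>y\<close> demands.\<close>

lemma power_deviation:
  assumes "v - yfun Q \<in> T 1 nz" "n \<ge> 1"
  shows "v ^ n - yfun (\<lambda>y. Q y ^ n) \<in> T n nz"
  using assms(2)
proof (induction n rule: dec_induct)
  case base show ?case unfolding power_one_right by (rule assms(1))
next
  case (step n)
  let ?u = "v - yfun Q" and ?Y = "v ^ n - yfun (\<lambda>y. Q y ^ n)"
  have "rapid (\<lambda>y. Q y ^ n)" using step by (intro rapid_Q_power) simp
  then have 1: "yfun (\<lambda>y. Q y ^ n) * ?u \<in> T (Suc n) nz"
    using T_yfun_rapid[OF assms(1)] by simp
  have 2: "?u * ?Y \<in> T (Suc n) nz" using T_mult_nz_nz[OF assms(1) step.IH] by simp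
  have 3: "yfun Q * ?Y \<in> T (Suc n) nz" by (rule T_yfun_rapid[OF step.IH rapid_Q]) simp
  have "v ^ Suc n - yfun (\<lambda>y. Q y ^ Suc n) = yfun (\<lambda>y. Q y ^ n) * ?u + ?u * ?Y + yfun Q * ?Y"
    by (simp add: yfun_mult algebra_simps)
  then show ?case using 1 2 3 by (simp add: T_add)
qed

text \<open>The same dichotomy for the second-order remainder. Bounding it by weight 1 alone would
  not suffice, since its \<open>s\<close>-derivative must later be integrated in
  \<open>y\<close>.\<close>

lemma power_increment:
  assumes v: "v - yfun Q \<in> T 1 nz" and w: "w \<in> T 1 (Iup k l)" and k: "k > 0" and n: "n \<ge> 1"
  shows "(v + w) ^ n - v ^ n - yfun (\<lambda>y. real n * Q y ^ (n - 1)) * w \<in> T n (Iup' k l)"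
  using n
proof (induction n rule: dec_induct)
  case base
  have "(v + w) ^ 1 - v ^ 1 - yfun (\<lambda>y. real 1 * Q y ^ (1 - 1)) * w = 0" by (simp add: yfun_1)
  then show ?case using T_zero by simp
next
  case (step n)
  let ?u = "v - yfun Q" and ?G = "yfun (\<lambda>y. real n * Q y ^ (n - 1))"
  let ?Y = "(v + w) ^ n - yfun (\<lambda>y. Q y ^ n)"
  let ?X = "(v + w) ^ n - v ^ n - ?G * w"
  have "w \<in> T 1 nz" using T_mono[OF w order.refl Iup_nz[OF k]] .
  then have "w + (v - yfun Q) \<in> T 1 nz" using v by (rule T_add)
  moreover have "w + (v - yfun Q) = (v + w) - yfun Q" by simp
  ultimately have "(v + w) - yfun Q \<in> T 1 nz" by simp
  from power_deviation[OF this step.hyps(1)] have Y: "?Y \<in> T n nz" .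
  have 1: "w * ?Y \<in> T (Suc n) (Iup' k l)" using T_mult_nz[OF w Y] by simp
  have 2: "yfun Q * ?X \<in> T (Suc n) (Iup' k l)" by (rule T_yfun_rapid[OF step.IH rapid_Q Iup'_nz[OF k]])
  have 3: "?X * ?u \<in> T (Suc n) (Iup' k l)" using T_mult_Iup'[OF step.IH v] by simp
  have wu: "w * ?u \<in> T 2 (Iup' k l)" using T_mult_nz[OF w v] by (simp add: numeral_2_eq_2)
  have 4: "?G * (w * ?u) \<in> T (Suc n) (Iup' k l)"
  proof (cases "n = 1")
    case True
    then have "?G * (w * ?u) = w * ?u" by (simp add: yfun_1)
    then show ?thesis using wu True by (simp add: numeral_2_eq_2)
  next
    case False
    then have "rapid (\<lambda>y. real n * Q y ^ (n - 1))" using step.hyps by (intro rapid_cmult rapid_Q_power) simp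
    then show ?thesis by (rule T_yfun_rapid[OF wu _ Iup'_nz[OF k]])
  qed
  obtain j where j: "n = Suc j" using step.hyps by (cases n) auto
  have "yfun (\<lambda>y. real (Suc n) * Q y ^ (Suc n - 1)) = yfun (\<lambda>y. Q y ^ n) + yfun Q * ?G"
    unfolding yfun_mult[symmetric] yfun_add[symmetric] j by (simp add: algebra_simps)
  then have "(v + w) ^ Suc n - v ^ Suc n - yfun (\<lambda>y. real (Suc n) * Q y ^ (Suc n - 1)) * w =
     w * ?Y + yfun Q * ?X + ?X * ?u + ?G * (w * ?u)"
    by (simp add: algebra_simps)
  then show ?case using 1 2 3 4 by (simp add: T_add)
qed

lemma tang_power:
  assumes "tang k l Q \<delta> f f'" "n \<ge> 1"
  shows "tang k l (\<lambda>y. Q y ^ n) (yfun (\<lambda>y. real n * Q y ^ (n - 1)) * \<delta>) (f ^ n) (f' ^ n)"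
  using assms(2)
proof (induction n rule: dec_induct)
  case base then show ?case using assms(1) by (simp add: yfun_1)
next
  case (step n)
  obtain j where j: "n = Suc j" using step.hyps by (cases n) auto
  have 1: "yfun (\<lambda>y. real (Suc n) * Q y ^ (Suc n - 1)) * \<delta> =
     yfun Q * (yfun (\<lambda>y. real n * Q y ^ (n - 1)) * \<delta>) + yfun (\<lambda>y. Q y ^ n) * \<delta>"
  proof -
    have "yfun (\<lambda>y. real (Suc n) * Q y ^ (Suc n - 1)) = yfun (\<lambda>y. Q y ^ n) + yfun Q * yfun (\<lambda>y. real n * Q y ^ (n - 1))"
      unfolding yfun_mult[symmetric] yfun_add[symmetric] j by (simp add: algebra_simps)
    then show ?thesis by (simp add: algebra_simps)
  qed
  show ?case
    unfolding 1 using tang_mult[OF assms(1) step.IH] by simp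
qed

lemma tang_Wop:
  assumes v: "tang k l Q w v v'" and b: "tang k l (\<lambda>_. 0) b \<beta> \<beta>'"
  shows "tang k l Qd (ds w + ds w - yfun Q * ds b + (dy w - yfun Qd * b - yfun Qd * b)) (Wop v \<beta>) (Wop v' \<beta>')"
proof -
  have k: "k > 0" using v by (simp add: tang_def)
  have 1: "tang k l (\<lambda>_. 1) (- b) (1 - \<beta>) (1 - \<beta>')"
    by (rule tang_cong[OF tang_diff[OF tang_one[OF k] b]]) auto
  have 2: "tang k l (\<lambda>_. 0) (ds w) ((1 - \<beta>) * ds v) ((1 - \<beta>') * ds v')"
    by (rule tang_cong[OF tang_mult[OF 1 tang_ds[OF v]]]) (auto simp: yfun_0 yfun_1)
  have 3: "tang k l (\<lambda>_. 0) (yfun Q * ds b) (ds \<beta> * v) (ds \<beta>' * v')"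
    by (rule tang_cong[OF tang_mult[OF tang_ds[OF b] v]]) (auto simp: yfun_0)
  have 4: "tang k l Qd (dy w) (dy v) (dy v')"
    using tang_dy[OF v] by (simp add: deriv_Q)
  have 5: "tang k l Qd (dy w - yfun Qd * b) ((1 - \<beta>) * dy v) ((1 - \<beta>') * dy v')"
    by (rule tang_cong[OF tang_mult[OF 1 4]]) (auto simp: yfun_1)
  have 6: "tang k l Qd (dy w - yfun Qd * b - yfun Qd * b) ((1 - \<beta>) * ((1 - \<beta>) * dy v)) ((1 - \<beta>') * ((1 - \<beta>') * dy v'))"
    by (rule tang_cong[OF tang_mult[OF 1 5]]) (auto simp: yfun_1)
  show ?thesis
    unfolding Wop_def
    by (rule tang_cong[OF tang_add[OF tang_diff[OF tang_add[OF 2 2] 3] 6]]) auto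
qed

text \<open>The limit of \<open>Nop v \<beta>\<close> is \<open>Q'' - Q + Q ^ p = 0\<close>, so
  varying the factor \<open>1 - \<beta>\<close> in front of it has no first-order effect. The phase
  acts through \<open>Wop\<close> and through the transport term \<open>yfun Q * b\<close>.\<close>

lemma tang_Eop:
  assumes v: "tang k l Q w v v'" and b: "tang k l (\<lambda>_. 0) b \<beta> \<beta>'"
  defines "\<delta> \<equiv> ds w + ds w - yfun Q * ds b + (dy w - yfun Qd * b - yfun Qd * b)"
  shows "Eop v' \<beta>' - Eop v \<beta> -
      (ds \<delta> + (ds (ds w) + dy \<delta> - w + yfun (\<lambda>y. real p * Q y ^ (p - 1)) * w) - yfun Q * b) \<in> T 1 (Iup' k l)"
proof -
  have k: "k > 0" using v by (simp add: tang_def)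
  have W: "tang k l Qd \<delta> (Wop v \<beta>) (Wop v' \<beta>')" unfolding \<delta>_def by (rule tang_Wop[OF v b])
  have P: "tang k l (\<lambda>y. Q y ^ p) (yfun (\<lambda>y. real p * Q y ^ (p - 1)) * w) (v ^ p) (v' ^ p)"
    by (rule tang_power[OF v]) (use p_ge2 in simp)
  have N: "tang k l (\<lambda>_. 0) (ds (ds w) + dy \<delta> - w + yfun (\<lambda>y. real p * Q y ^ (p - 1)) * w) (Nop v \<beta>) (Nop v' \<beta>')"
    unfolding Nop_def
    by (rule tang_cong[OF tang_add[OF tang_diff[OF tang_add[OF tang_ds[OF tang_ds[OF v]] tang_dy[OF W]] v] P]])
      (auto simp: deriv_Qd)
  have 1: "tang k l (\<lambda>_. 1) (- b) (1 - \<beta>) (1 - \<beta>')"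
    by (rule tang_cong[OF tang_diff[OF tang_one[OF k] b]]) auto
  have c: "tang k l (\<lambda>_. 1) 0 (1 - cc) (1 - cc)"
    by (rule tang_cong[OF tang_diff[OF tang_one[OF k] tang_cc[OF k]]]) auto
  have bv: "tang k l (\<lambda>_. 0) (yfun Q * b) (\<beta> * v) (\<beta>' * v')"
    by (rule tang_cong[OF tang_mult[OF b v]]) (auto simp: yfun_0)
  have cbv: "tang k l (\<lambda>_. 0) (yfun Q * b) ((1 - cc) * (\<beta> * v)) ((1 - cc) * (\<beta>' * v'))"
    by (rule tang_cong[OF tang_mult[OF c bv]]) (auto simp: yfun_0 yfun_1)
  have bN: "tang k l (\<lambda>_. 0) (ds (ds w) + dy \<delta> - w + yfun (\<lambda>y. real p * Q y ^ (p - 1)) * w)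
      ((1 - \<beta>) * Nop v \<beta>) ((1 - \<beta>') * Nop v' \<beta>')"
    by (rule tang_cong[OF tang_mult[OF 1 N]]) (auto simp: yfun_0 yfun_1)
  have "tang k l (\<lambda>_. 0) (ds \<delta> + (ds (ds w) + dy \<delta> - w + yfun (\<lambda>y. real p * Q y ^ (p - 1)) * w) - yfun Q * b)
     (Eop v \<beta>) (Eop v' \<beta>')"
    unfolding Eop_def
    by (rule tang_cong[OF tang_diff[OF tang_add[OF tang_ds[OF W] bN] cbv]]) auto
  then show ?thesis by (simp add: tang_def)
qed

lemma ds_termB_higher: "coef 1 (Iup k l) k l F \<Longrightarrow> ds (termB k l F) \<in> T p (Iup' k l)"
  using dss_Iup[OF T_A, of 1 k l k l F] p_ge2 by (simp add: ds_termA)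

text \<open>The change is the \<open>y\<close>-derivative of its leading terms at
  \<open>(k, l)\<close>, whose coefficients are those of the two profile equations, and of a
  remainder strictly above. One of the leading terms comes from \<open>p * Q ^ (p - 1) * w\<close>
  under \<open>ds\<close>.\<close>

lemma step_difference:
  assumes k: "k > 0" and v: "v \<in> \<A>" "v - yfun Q \<in> T 1 nz"
    and b: "\<beta> \<in> T 1 nz" "dy \<beta> = 0"
    and A: "grows (real (D k l)) A" and B: "grows (real (D k l)) B"
  defines "w \<equiv> termA k l A + termB k l B"
  shows "\<exists>z \<in> T 1 (Iup' k l). Sop (v + w) (\<beta> + termA k l (\<lambda>_. a)) - Sop v \<beta> =
    dy (termA k l (\<lambda>y. deriv (deriv A) y - V y * A y - a * (3 * Q y - 2 * Q y ^ p)) +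
        termB k l (\<lambda>y. deriv (deriv B) y - V y * B y - 3 * a * Qd y + Bsource A (deriv A) y) + z)"
proof -
  let ?I = "Iup k l" and ?I' = "Iup' k l"
  define b where "b = termA k l (\<lambda>_. a)"
  define G where "G y = real p * Q y ^ (p - 1)" for y
  have kl: "(k, l) \<in> ?I" by (simp add: Iup_def)
  note cA = D_coef[OF A kl k] and cB = D_coef[OF B kl k]
  have "grows (real (D k l)) (\<lambda>_. a)" by (rule grows_const) simp
  then have ca: "coef 1 ?I k l (\<lambda>_. a)" by (rule D_coef[OF _ kl k])
  have wT: "w \<in> T 1 ?I" unfolding w_def by (intro T_add T_A T_B cA cB)
  have bT: "b \<in> T 1 ?I" unfolding b_def by (intro T_A ca)
  have w\<A>: "w \<in> \<A>" "b \<in> \<A>" "\<beta> \<in> \<A>" using T_subset wT bT b by blast+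
  have rG: "rapid G" unfolding G_def using p_ge2 by (intro rapid_cmult rapid_Q_power) simp
  have gQ: "grows 0 Q" "grows 0 Qd" using rapid_grows rapid_Q rapid_Qd by blast+
  have dyb: "dy b = 0"
    unfolding b_def using dy_termA[OF grows_const[of 0 a]] by (simp add: termA_def fun_eq_iff fun_app)
  have tv: "tang k l Q w v (v + w)"
    using k v w\<A> wT gQ by (simp add: tang_def \<A>_intros T_zero)
  have tb: "tang k l (\<lambda>_. 0) b \<beta> (\<beta> + b)"
    using k b w\<A> bT by (simp add: tang_def \<A>_intros T_zero yfun_0 grows_const)
  define \<delta> where "\<delta> = ds w + ds w - yfun Q * ds b + (dy w - yfun Qd * b - yfun Qd * b)"
  define \<epsilon> where "\<epsilon> = ds \<delta> + (ds (ds w) + dy \<delta> - w + yfun G * w) - yfun Q * b"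
  define E where "E = Eop (v + w) (\<beta> + b) - Eop v \<beta>"
  have E: "E - \<epsilon> \<in> T 1 ?I'"
    unfolding E_def \<epsilon>_def \<delta>_def G_def by (rule tang_Eop[OF tv tb])
  have Ep: "E - \<epsilon> \<in> \<A>" by (rule T_subset[OF E])
  have v'\<A>: "v + w \<in> \<A>" "\<beta> + b \<in> \<A>" using v w\<A> by (auto intro: T_add)
  have E\<A>: "Eop v \<beta> \<in> \<A>" "Eop (v + w) (\<beta> + b) \<in> \<A>"
    unfolding Eop_def using v w\<A> v'\<A> by (simp_all add: mem_simps Wop_\<A> Nop_\<A>)
  \<comment> \<open>Everything under \<open>ds\<close> except the linear potential term; it has
    weight \<open>p\<close> and hence a \<open>y\<close>-primitive after differentiation.\<close>
  define X where "X = ds (ds w) - cc * w + ((v + w) ^ p - v ^ p - yfun G * w)"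
  have X: "X \<in> T p ?I'"
  proof -
    have "ds (ds w) \<in> T p ?I'" using dss_Iup[OF wT] p_ge2 by simp
    moreover have "cc * w \<in> T p ?I'" using T_mult_nz[OF wT cc_T] p_ge2 by (simp add: mult.commute)
    moreover have "(v + w) ^ p - v ^ p - yfun G * w \<in> T p ?I'"
      unfolding G_def using power_increment[OF v(2) wT k] p_ge2 by simp
    ultimately show ?thesis unfolding X_def by (rule T_add[OF T_diff])
  qed
  define GA where "GA y = G y * A y" for y
  have rGA: "rapid GA" unfolding GA_def by (rule rapid_mult[OF rG A])
  \<comment> \<open>The remaining leading term under \<open>ds\<close> is \<open>(q ^ k)'\<close>
    times \<open>GA\<close>. Written as a \<open>y\<close>-derivative it yields \<open>H\<close>,
    the origin of the primitive in \<open>Bsource\<close>.\<close>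
  define H where "H y = real p * prim (\<lambda>y. Q y ^ (p - 1) * A y) y" for y
  have H: "grows 0 H" unfolding H_def by (intro grows_cmult grows_prim_rapid rapid_potential[OF A])
  have "deriv H = GA"
    unfolding H_def GA_def G_def
    using DERIV_imp_deriv[OF DERIV_cmult[OF DERIV_prim[OF rapid_isCont[OF rapid_potential[OF A]]]]]
    by (simp add: fun_eq_iff mult.assoc)
  then have dyH: "dy (termB k l H) = termB k l GA" using dy_termB[OF H] by simp
  have H\<A>: "termB k l H \<in> \<A>"
    using D_coef[OF grows_mono[OF H] kl k] by (intro T_subset[OF T_B]) simp
  have Gw: "ds (yfun G * w) = termB k l GA + yfun G * ds (termB k l B)"
  proof -
    have "ds (yfun G * w) = yfun G * ds w"
      using w\<A> rapid_grows[OF rG, of 0] by (simp add: ds_mult \<A>_yfun ds_yfun)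
    also have "ds w = termB k l A + ds (termB k l B)"
      unfolding w_def using cA cB by (simp add: ds_add T_subset[OF T_A] T_subset[OF T_B] ds_termA)
    finally show ?thesis by (simp add: distrib_left yfun_times_termB GA_def[abs_def])
  qed
  have "yfun G * ds (termB k l B) \<in> T p ?I'"
    by (rule T_yfun_rapid[OF ds_termB_higher[OF cB] rG Iup'_nz[OF k]])
  then have "ds X + yfun G * ds (termB k l B) \<in> T p ?I'"
    using ds_T[OF X up_Iup'] by (intro T_add)
  then obtain z1 where z1: "z1 \<in> T 1 ?I'" "dy z1 = ds X + yfun G * ds (termB k l B)"
    using dy_surj[OF _ Iup'_nz[OF k]] by blast
  \<comment> \<open>The coefficients of \<open>\<epsilon>\<close> at \<open>(k, l)\<close>. The
    square \<open>(1 - \<beta>) * (1 - \<beta>)\<close> contributes \<open>- 2 * a * Q''\<close> and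
    the transport term \<open>- a * Q\<close>, which together make
    \<open>- a * (3 * Q - 2 * Q ^ p)\<close>. In \<open>B2\<close> the factor 3 counts one mixed
    derivative from \<open>ds \<delta>\<close> and two from \<open>dy \<delta>\<close>.\<close>
  define A2 where "A2 y = deriv (deriv A) y - 2 * a * (Q y - Q y ^ p) - A y + G y * A y - a * Q y" for y
  define B2 where "B2 y = deriv (deriv B) y + 3 * deriv A y - 3 * a * Qd y - B y + G y * B y" for y
  have eps: "\<epsilon> - termA k l A2 - termB k l B2 \<in> T 1 ?I'"
  proof -
    have le: "f \<in> T p ?I' \<Longrightarrow> f \<in> T 1 ?I'" for f using p_ge2 by (intro T_1_mult) auto
    have dw: "ds w = termB k l A + ds (termB k l B)"
      unfolding w_def using cA cB by (simp add: ds_add T_subset[OF T_A] T_subset[OF T_B] ds_termA)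
    have dyw: "dy w = termA k l (deriv A) + termB k l (deriv B)"
      unfolding w_def using cA cB
      by (simp add: dy_add T_subset[OF T_A] T_subset[OF T_B] dy_termA[OF A] dy_termB[OF B])
    have dyyw: "dy (dy w) = termA k l (deriv (deriv A)) + termB k l (deriv (deriv B))"
      unfolding dyw using coef_deriv[OF cA] coef_deriv[OF cB] grows_deriv[OF A] grows_deriv[OF B]
      by (simp add: dy_add T_subset[OF T_A] T_subset[OF T_B] dy_termA dy_termB)
    have dydsw: "dy (ds w) = termB k l (deriv A) + ds (termB k l (deriv B))"
      using dy_ds[OF w\<A>(1)] coef_deriv[OF cA] coef_deriv[OF cB]
      by (simp add: dyw ds_add T_subset[OF T_A] T_subset[OF T_B] ds_termA)
    have db: "ds b = termB k l (\<lambda>_. a)" by (simp add: b_def ds_termA)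
    have mQ: "yfun Q \<in> \<A>" "yfun Qd \<in> \<A>" by (intro \<A>_yfun gQ)+
    have dydb: "dy (ds b) = 0" using dy_ds[OF w\<A>(2)] dyb ds_zero by simp
    have d\<delta>: "ds \<delta> = ds (ds w) + ds (ds w) - yfun Q * ds (ds b) + (ds (dy w) - yfun Qd * ds b - yfun Qd * ds b)"
      unfolding \<delta>_def using w\<A> mQ by (simp add: ds_add ds_diff ds_mult ds_yfun ds_numeral mem_simps)
    have dy\<delta>: "dy \<delta> = dy (ds w) + dy (ds w) - yfun Qd * ds b + (dy (dy w) - yfun (\<lambda>y. Q y - Q y ^ p) * b - yfun (\<lambda>y. Q y - Q y ^ p) * b)"
      unfolding \<delta>_def using w\<A> mQ
      by (simp add: dy_add dy_diff dy_mult dy_yfun dy_numeral mem_simps deriv_Q deriv_Qd dydb dyb)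
    have A2: "termA k l A2 = termA k l (deriv (deriv A)) - (yfun (\<lambda>y. Q y - Q y ^ p) * b + yfun (\<lambda>y. Q y - Q y ^ p) * b)
        - termA k l A + yfun G * termA k l A - yfun Q * b"
      by (simp add: A2_def termA_def b_def yfun_def fun_eq_iff fun_app minus_apply algebra_simps)
    have B2: "termB k l B2 = termB k l (deriv (deriv B)) + (termB k l (deriv A) + termB k l (deriv A) + termB k l (deriv A))
        - (yfun Qd * ds b + yfun Qd * ds b + yfun Qd * ds b) - termB k l B + yfun G * termB k l B"
      unfolding db
      by (simp add: B2_def termB_def yfun_def fun_eq_iff fun_app minus_apply algebra_simps)
    define H1 where "H1 = ds (ds w) + ds (ds w) + ds (ds w)"
    define H2 where "H2 = ds (termB k l (deriv B))"
    have "\<epsilon> - termA k l A2 - termB k l B2 = H1 - yfun Q * ds (ds b) + (H2 + H2 + H2)"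
      unfolding \<epsilon>_def d\<delta> dy\<delta> A2 B2 dyyw dydsw dy_ds[OF w\<A>(1), symmetric]
      by (simp add: H1_def H2_def w_def algebra_simps)
    moreover have "H1 \<in> T 1 ?I'"
    proof -
      have "ds (ds w) \<in> T 1 ?I'" using le[of "ds (ds w)"] dss_Iup[OF wT] p_ge2 by simp
      then show ?thesis unfolding H1_def by (intro T_add)
    qed
    moreover have "H2 \<in> T 1 ?I'" unfolding H2_def by (intro le ds_termB_higher coef_deriv cB)
    moreover have "ds (ds b) \<in> T p ?I'" using dss_Iup[OF bT] p_ge2 by simp
    then have "yfun Q * ds (ds b) \<in> T 1 ?I'" by (rule T_yfun_rapid[OF _ rapid_Q Iup'_nz[OF k]])
    moreover have "H2 + H2 + H2 \<in> T 1 ?I'" using \<open>H2 \<in> T 1 ?I'\<close> by (intro T_add)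
    ultimately show ?thesis by (simp only: T_add T_diff)
  qed
  define z where "z = (E - \<epsilon>) + (\<epsilon> - termA k l A2 - termB k l B2) + z1"
  have z: "z \<in> T 1 ?I'" unfolding z_def using E eps z1 by (intro T_add)
  have "dy (\<beta> + b) = 0" using b(2) dyb w\<A> by (simp add: dy_add)
  then have "Sop (v + w) (\<beta> + b) - Sop v \<beta> =
     (ds (ds (ds (v + w)) - cc * (v + w) + (v + w) ^ p) + dy (Eop (v + w) (\<beta> + b)))
     - (ds (ds (ds v) - cc * v + v ^ p) + dy (Eop v \<beta>))"
    using Sop_eq[OF v(1) w\<A>(3) b(2)] Sop_eq[OF v'\<A>] by simp
  also have "\<dots> = ds (X + yfun G * w) + dy E"
  proof -
    have 1: "dy E = dy (Eop (v + w) (\<beta> + b)) - dy (Eop v \<beta>)" unfolding E_def by (rule dy_diff[OF E\<A>(2,1)])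
    have 2: "X + yfun G * w = (ds (ds (v + w)) - cc * (v + w) + (v + w) ^ p) - (ds (ds v) - cc * v + v ^ p)"
      unfolding X_def using v w\<A> by (simp add: ds_add mem_simps algebra_simps)
    have 3: "ds (ds v) - cc * v + v ^ p \<in> \<A>" "ds (ds (v + w)) - cc * (v + w) + (v + w) ^ p \<in> \<A>"
      using v v'\<A> by (simp_all add: mem_simps)
    show ?thesis unfolding 1 2 ds_diff[OF 3(2,1)] by (simp add: algebra_simps)
  qed
  also have "ds (X + yfun G * w) = ds X + ds (yfun G * w)"
    using T_subset[OF X] w\<A> rapid_grows[OF rG, of 0] by (intro ds_add) (auto intro: \<A>_mult \<A>_yfun)
  also have "\<dots> = dy z1 + dy (termB k l H)" unfolding Gw dyH z1(2) by (simp add: algebra_simps)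
  also have "\<dots> + dy E = dy (z1 + termB k l H + E)"
  proof -
    have "E \<in> \<A>" unfolding E_def by (rule T_diff[OF E\<A>(2,1)])
    then show ?thesis using T_subset[OF z1(1)] H\<A> by (simp add: dy_add T_add)
  qed
  also have "z1 + termB k l H + E = termA k l A2 + (termB k l B2 + termB k l H) + z"
    by (simp add: z_def)
  also have "termA k l A2 = termA k l (\<lambda>y. deriv (deriv A) y - V y * A y - a * (3 * Q y - 2 * Q y ^ p))"
    by (rule arg_cong[of _ _ "termA k l"]) (auto simp: A2_def V_def G_def algebra_simps)
  also have "termB k l B2 + termB k l H =
     termB k l (\<lambda>y. deriv (deriv B) y - V y * B y - 3 * a * Qd y + Bsource A (deriv A) y)"
    unfolding termB_add[symmetric]
    by (rule arg_cong[of _ _ "termB k l"]) (auto simp: B2_def V_def G_def H_def Bsource_def algebra_simps)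
  finally show ?thesis using z unfolding b_def by blast
qed

section \<open>The formal solution\<close>

lemma ds_uminus: "f \<in> \<A> \<Longrightarrow> ds (- f) = - ds f"
  using ds_diff[OF T_zero, of f] by (simp add: ds_zero)

lemma dy_uminus: "f \<in> \<A> \<Longrightarrow> dy (- f) = - dy f"
  using dy_diff[OF T_zero, of f] by (simp add: dy_zero)

lemma reflect_Dop: "f \<in> \<A> \<Longrightarrow> reflect \<beta> = \<beta> \<Longrightarrow> reflect (Dop \<beta> f) = - Dop \<beta> (reflect f)"
  by (simp add: Dop_def reflect_add reflect_mult reflect_diff reflect_one ds_reflect dy_reflect)

lemma Dop_uminus: "f \<in> \<A> \<Longrightarrow> Dop \<beta> (- f) = - Dop \<beta> f"
  by (simp add: Dop_def ds_uminus dy_uminus)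

lemma Dop_\<A>: "f \<in> \<A> \<Longrightarrow> \<beta> \<in> \<A> \<Longrightarrow> Dop \<beta> f \<in> \<A>"
  unfolding Dop_def by (simp add: mem_simps)

lemma reflect_Sop:
  assumes "v \<in> \<A>" "\<beta> \<in> \<A>" "reflect v = v" "reflect \<beta> = \<beta>"
  shows "reflect (Sop v \<beta>) = - Sop v \<beta>"
proof -
  have D: "reflect (Dop \<beta> v) = - Dop \<beta> v" using reflect_Dop[OF assms(1,4)] assms(3) by simp
  have DD: "reflect (Dop \<beta> (Dop \<beta> v)) = Dop \<beta> (Dop \<beta> v)"
    using reflect_Dop[OF Dop_\<A>[OF assms(1,2)] assms(4)] by (simp add: D Dop_uminus Dop_\<A> assms)
  define N where "N = Dop \<beta> (Dop \<beta> v) - v + v ^ p"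
  have N: "N \<in> \<A>" "reflect N = N"
    using assms by (simp_all add: N_def Dop_\<A> mem_simps reflect_add reflect_diff reflect_power DD)
  have "reflect (ds v) = - ds v" "reflect (dy v) = - dy v"
    using ds_reflect[OF assms(1)] dy_reflect[OF assms(1)] assms(3) by (metis minus_minus)+
  then show ?thesis
    unfolding Sop_def N_def[symmetric]
    using reflect_Dop[OF N(1) assms(4)] N(2) assms
    by (simp add: reflect_add reflect_mult reflect_diff reflect_one reflect_cc algebra_simps)
qed

section \<open>Enumeration of the index pairs\<close>

definition idx :: "nat \<Rightarrow> nat \<times> nat" where
  "idx n = (Suc (fst (prod_decode n)), snd (prod_decode n))"

definition rest :: "nat \<Rightarrow> (nat \<times> nat) set" where
  "rest n = {(k, l). k > 0 \<and> n \<le> prod_encode (k - 1, l)}"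

text \<open>Cantor's diagonal pairing extends the product order linearly: whatever lies above
  \<open>(k, l)\<close> is enumerated later. Hence the side effects of a correction never disturb an
  index already treated.\<close>

lemma prod_encode_mono: "i \<le> i' \<Longrightarrow> j \<le> j' \<Longrightarrow> prod_encode (i, j) \<le> prod_encode (i', j')"
proof -
  assume "i \<le> i'" "j \<le> j'"
  have "triangle a \<le> triangle b" if "a \<le> b" for a b
    using that by (induction b rule: dec_induct) auto
  then show ?thesis
    using \<open>i \<le> i'\<close> \<open>j \<le> j'\<close> by (simp add: prod_encode_def add_mono)
qed

lemma idx_eq_iff: "k > 0 \<Longrightarrow> idx n = (k, l) \<longleftrightarrow> n = prod_encode (k - 1, l)"
proof
  assume k: "k > 0"
  { assume "idx n = (k, l)"
    then have "prod_decode n = (k - 1, l)" by (auto simp: idx_def prod_eq_iff)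
    then show "n = prod_encode (k - 1, l)" by (metis prod_decode_inverse) }
  { assume "n = prod_encode (k - 1, l)"
    then show "idx n = (k, l)" using k by (simp add: idx_def) }
qed

lemma idx_pos: "idx n = (k, l) \<Longrightarrow> k > 0" by (auto simp: idx_def)

lemma Iup'_rest:
  assumes "idx n = (k, l)" shows "Iup' k l \<subseteq> rest (Suc n)"
proof
  fix x assume x: "x \<in> Iup' k l"
  obtain k' l' where kl': "x = (k', l')" by (cases x)
  have k: "k > 0" using idx_pos[OF assms] .
  have n: "n = prod_encode (k - 1, l)" using idx_eq_iff[OF k] assms by blast
  have ge: "k \<le> k'" "l \<le> l'" "(k', l') \<noteq> (k, l)" using x kl' by (auto simp: Iup'_def Iup_def)
  then have "n \<le> prod_encode (k' - 1, l')" unfolding n by (intro prod_encode_mono) auto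
  moreover have "n \<noteq> prod_encode (k' - 1, l')" using idx_eq_iff[of k' n l'] ge k assms by auto
  ultimately show "x \<in> rest (Suc n)" using k ge by (auto simp: rest_def kl')
qed

lemma rest_Suc: "rest n - {idx n} \<subseteq> rest (Suc n)"
proof
  fix x assume x: "x \<in> rest n - {idx n}"
  obtain k l where kl: "x = (k, l)" by (cases x)
  have k: "k > 0" "n \<le> prod_encode (k - 1, l)" "idx n \<noteq> (k, l)" using x by (auto simp: rest_def kl)
  then have "n \<noteq> prod_encode (k - 1, l)" using idx_eq_iff[OF k(1)] by blast
  then show "x \<in> rest (Suc n)" using k by (simp add: rest_def kl)
qed

lemma yfun_half: "yfun (\<lambda>_. 1 / 2) * (f + f) = f"
  by (simp add: yfun_def fun_eq_iff fun_app)

text \<open>The primitive \<open>Z\<close> need not be symmetric, but \<open>S\<close> is odd under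
  reflection, so \<open>reflect Z\<close> is another \<open>y\<close>-primitive of \<open>S\<close>.
  Averaging the two makes the extracted \<open>F\<close> even and \<open>G\<close> odd, as the
  solvability of the profile equations requires.\<close>

lemma symmetric_extract:
  assumes Z: "Z \<in> T 1 (rest n)" "S = dy Z" "reflect S = - S" and kl: "idx n = (k, l)"
  shows "\<exists>F G Z'. grows (real (D k l)) F \<and> (\<forall>y. F (- y) = F y) \<and> grows (real (D k l)) G \<and> (\<forall>y. G (- y) = - G y)
    \<and> Z' \<in> T 1 (rest (Suc n)) \<and> S = dy (termA k l F + termB k l G + Z')"
proof -
  obtain F G where FG: "grows (real (D k l)) F" "grows (real (D k l)) G"
      "Z - termA k l F - termB k l G \<in> T 1 (rest n - {(k, l)})"
    using T_extract[OF Z(1)] by blast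
  define Z0 where "Z0 = Z - termA k l F - termB k l G"
  have Z0: "Z0 \<in> T 1 (rest (Suc n))"
    unfolding Z0_def using T_mono[OF FG(3) order.refl] rest_Suc[of n] kl by simp
  define F' where "F' y = 1 / 2 * (F y + F (- y))" for y
  define G' where "G' y = 1 / 2 * (G y + - 1 * G (- y))" for y
  define Z' where "Z' = yfun (\<lambda>_. 1 / 2) * (Z0 + reflect Z0)"
  have "Z = termA k l F + termB k l G + Z0" by (simp add: Z0_def)
  then have "yfun (\<lambda>_. 1 / 2) * (Z + reflect Z) = termA k l F' + termB k l G' + Z'"
    unfolding \<open>Z = _\<close> Z'_def reflect_add reflect_termA reflect_termB F'_def G'_def
    by (simp add: termA_def termB_def yfun_def fun_eq_iff fun_app algebra_simps)
  moreover have "dy (yfun (\<lambda>_. 1 / 2) * (Z + reflect Z)) = S"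
  proof -
    have "reflect Z \<in> \<A>" "Z \<in> \<A>" using reflect_T[OF Z(1)] Z(1) by (auto intro: T_subset)
    then have "dy (yfun (\<lambda>_. 1 / 2) * (Z + reflect Z)) = yfun (\<lambda>_. 1 / 2) * (dy Z + dy (reflect Z))"
      using \<A>_yfun[OF grows_const[of 0 "1/2"]] by (simp add: dy_mult dy_add dy_yfun yfun_0 T_add)
    also have "dy (reflect Z) = S" using dy_reflect[OF Z(1)] Z by simp
    finally show ?thesis by (simp only: Z(2)[symmetric] yfun_half)
  qed
  moreover have "grows (real (D k l)) F'" "grows (real (D k l)) G'"
    unfolding F'_def[abs_def] G'_def[abs_def] by (intro grows_cmult grows_add grows_reflect FG)+
  moreover have "F' (- y) = F' y" "G' (- y) = - G' y" for y by (simp_all add: F'_def G'_def field_simps)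
  moreover have "Z' \<in> T 1 (rest (Suc n))"
    unfolding Z'_def by (intro T_cmult T_add Z0 reflect_T)
  ultimately show ?thesis by metis
qed

section \<open>The residual of the plain sum of solitons\<close>

definition qf :: field3 where "qf = termA 1 0 (\<lambda>_. 1)"

lemma qf_T: "qf \<in> T 1 nz"
proof -
  have "coef 1 nz 1 0 (\<lambda>_. 1)"
    unfolding coef_def using grows_const[of "real 0" 1] by (auto simp: nz_def intro!: exI[of _ 0])
  then show ?thesis unfolding qf_def by (rule T_A)
qed

lemma qf_power: "qf ^ n = termA n 0 (\<lambda>_. 1)"
  by (simp add: qf_def termA_def fun_eq_iff) (induction n, simp_all add: fun_app)

lemma of_nat_yfun: "(of_nat n :: field3) = yfun (\<lambda>_. real n)"
  by (simp add: yfun_def fun_eq_iff)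

definition cross :: "nat \<Rightarrow> real \<Rightarrow> real" where
  "cross j y = real (p choose j) * Q y ^ (p - j)"

lemma v0_power:
  "(yfun Q + qf) ^ p = yfun (\<lambda>y. Q y ^ p) + qf ^ p + (\<Sum>j\<in>{1..<p}. termA j 0 (cross j))"
proof -
  have "(yfun Q + qf) ^ p = (\<Sum>j\<le>p. of_nat (p choose j) * qf ^ j * yfun Q ^ (p - j))"
    unfolding add.commute[of "yfun Q"] by (rule binomial_ring)
  also have "\<dots> = (\<Sum>j\<le>p. termA j 0 (cross j))"
    unfolding qf_power of_nat_yfun yfun_power[symmetric]
    by (intro sum.cong arg_cong[of _ _ "termA _ 0"] refl)
      (simp add: cross_def termA_def yfun_def fun_eq_iff fun_app)
  also have "{..p} = insert 0 (insert p {1..<p})" using p_ge2 by auto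
  also have "(\<Sum>j\<in>insert 0 (insert p {1..<p}). termA j 0 (cross j)) =
      termA 0 0 (cross 0) + (termA p 0 (cross p) + (\<Sum>j\<in>{1..<p}. termA j 0 (cross j)))"
    using p_ge2 by (subst sum.insert, simp, simp, subst sum.insert) auto
  also have "termA 0 0 (cross 0) = yfun (\<lambda>y. Q y ^ p)"
    by (simp add: termA_def yfun_def cross_def fun_eq_iff)
  also have "termA p 0 (cross p) = qf ^ p" by (simp add: qf_power cross_def[abs_def])
  finally show ?thesis by (simp add: add.assoc)
qed

lemma rapid_cross: "j < p \<Longrightarrow> rapid (cross j)"
  unfolding cross_def[abs_def] by (intro rapid_cmult rapid_Q_power) simp

lemma dy_sum: "(\<And>i. i \<in> X \<Longrightarrow> f i \<in> \<A>) \<Longrightarrow> dy (sum f X) = (\<Sum>i\<in>X. dy (f i))"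
  by (induction X rule: infinite_finite_induct) (simp_all add: dy_zero dy_add T_sum)

lemma ds_sum: "(\<And>i. i \<in> X \<Longrightarrow> f i \<in> \<A>) \<Longrightarrow> ds (sum f X) = (\<Sum>i\<in>X. ds (f i))"
  by (induction X rule: infinite_finite_induct) (simp_all add: ds_zero ds_add T_sum)

lemma D_0: "0 < j \<Longrightarrow> j < p \<Longrightarrow> D j 0 = 0"
  using p_ge2 by (simp add: D_def)

lemma termA_const_dy: "dy (termA k l (\<lambda>_. r)) = 0"
  using dy_termA[OF grows_const[of 0 r]] by (simp add: termA_def fun_eq_iff fun_app)

text \<open>Each soliton solves its own equation exactly, so only the mixed binomial terms
  \<open>M\<close> survive. They all carry a power of \<open>Q\<close>, whence \<open>ds M\<close>
  has a \<open>y\<close>-primitive with bounded coefficients and the first even source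
  \<open>cross 1\<close> is rapid.\<close>

lemma base_residual:
  "\<exists>G Z. grows 0 G \<and> (\<forall>y. G (- y) = - G y) \<and> Z \<in> T 1 (rest 1) \<and>
     Sop (yfun Q + qf) 0 = dy (termA 1 0 (cross 1) + termB 1 0 G + Z)"
proof -
  let ?v = "yfun Q + qf"
  define M where "M = (\<Sum>j\<in>{1..<p}. termA j 0 (cross j))"
  define M' where "M' = (\<Sum>j\<in>{1..<p}. termB j 0 (prim (cross j)))"
  have cross_coef: "coef 1 I j 0 (cross j)" "coef 1 I j 0 (prim (cross j))"
    if "0 < j" "j < p" "(j, 0) \<in> I" for j I
    using that rapid_grows[OF rapid_cross[OF that(2)]] grows_prim_rapid[OF rapid_cross[OF that(2)]]
      D_coef[of j 0 "cross j" I] D_coef[of j 0 "prim (cross j)" I] by (simp_all add: D_0)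
  have cA: "coef 1 nz j 0 (cross j)" "coef 1 nz j 0 (prim (cross j))" if "0 < j" "j < p" for j
    using cross_coef[OF that, of nz] that by (simp_all add: nz_def)
  have Q\<A>: "yfun Q \<in> \<A>" "yfun (\<lambda>y. Q y ^ p) \<in> \<A>"
    by (intro \<A>_yfun rapid_grows[OF rapid_Q] grows_Q_power)+
  have qf\<A>: "qf \<in> \<A>" using qf_T by (rule T_subset)
  have M\<A>: "M \<in> \<A>" "M' \<in> \<A>"
    unfolding M_def M'_def
    by (rule T_sum, rule T_subset[OF T_A[OF cA(1)]], simp, simp)
      (rule T_sum, rule T_subset[OF T_B[OF cA(2)]], simp, simp)
  have dsM: "dy M' = ds M"
  proof -
    have "dy (termB j 0 (prim (cross j))) = termB j 0 (cross j)" if "j < p" for j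
    proof -
      have "deriv (prim (cross j)) = cross j"
        by (intro ext DERIV_imp_deriv DERIV_prim rapid_isCont[OF rapid_cross[OF that]])
      then show ?thesis using dy_termB[OF grows_prim_rapid[OF rapid_cross[OF that]]] by simp
    qed
    then have "(\<Sum>j\<in>{1..<p}. dy (termB j 0 (prim (cross j)))) = (\<Sum>j\<in>{1..<p}. ds (termA j 0 (cross j)))"
      by (intro sum.cong refl) (simp add: ds_termA)
    moreover have "dy M' = (\<Sum>j\<in>{1..<p}. dy (termB j 0 (prim (cross j))))"
      unfolding M'_def by (rule dy_sum, rule T_subset[OF T_B[OF cA(2)]]) auto
    moreover have "ds M = (\<Sum>j\<in>{1..<p}. ds (termA j 0 (cross j)))"
      unfolding M_def by (rule ds_sum, rule T_subset[OF T_A[OF cA(1)]]) auto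
    ultimately show ?thesis by simp
  qed
  have dsqf: "ds (ds qf) = cc * qf - qf ^ p"
    unfolding qf_power unfolding qf_def ds_termA ds_termB using p_ge2
    by (simp add: termA_def cc_def yfun_def fun_eq_iff fun_app minus_apply)
  have dyqf: "dy qf = 0" "dy (qf ^ p) = 0" unfolding qf_power by (simp_all add: qf_def termA_const_dy)
  have dsv: "ds ?v = ds qf" using Q\<A> qf\<A> by (simp add: ds_add ds_yfun)
  have dyv: "dy ?v = yfun Qd" using Q\<A> qf\<A> by (simp add: dy_add dy_yfun dyqf deriv_Q)
  have dydsqf: "dy (ds qf) = 0" using dy_ds[OF qf_T] dyqf ds_zero by simp
  have v\<A>: "?v \<in> \<A>" using Q\<A>(1) qf\<A> by (rule T_add)
  have "Sop ?v 0 = ds (ds (ds ?v) - cc * ?v + ?v ^ p) + dy (Eop ?v 0)"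
    by (rule Sop_eq[OF v\<A> T_zero dy_zero])
  also have "ds (ds (ds ?v) - cc * ?v + ?v ^ p) = ds M"
  proof -
    have "ds (ds ?v) - cc * ?v + ?v ^ p = (M - cc * yfun Q) + yfun (\<lambda>y. Q y ^ p)"
      unfolding v0_power dsv dsqf M_def[symmetric] by (simp add: algebra_simps)
    then show ?thesis using M\<A> Q\<A> by (simp add: diff_simps ds_yfun mem_simps)
  qed
  also have "dy (Eop ?v 0) = dy M"
  proof -
    have W: "Wop ?v 0 = ds qf + ds qf + yfun Qd"
      by (simp add: Wop_def dsv dyv ds_zero)
    have Qd\<A>: "yfun Qd \<in> \<A>" by (intro \<A>_yfun rapid_grows[OF rapid_Qd])
    have dW: "dy (Wop ?v 0) = yfun (\<lambda>y. Q y - Q y ^ p)"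
      unfolding W using qf\<A> Qd\<A> by (simp add: dy_add mem_simps dy_yfun deriv_Qd dydsqf dy_mult dy_numeral)
    have "Eop ?v 0 = (ds (ds qf) + ds (ds qf) + ds (ds qf)) - qf + qf ^ p + M"
    proof -
      have "ds (Wop ?v 0) = ds (ds qf) + ds (ds qf)"
        unfolding W using qf\<A> Qd\<A> by (simp only: ds_add mem_simps ds_yfun add_0_right)
      then show ?thesis
        unfolding Eop_def Nop_def dW v0_power M_def[symmetric] dsv
        by (simp add: yfun_diff algebra_simps)
    qed
    moreover have "dy (ds (ds qf)) = 0"
      using dy_ds[OF ds_T[OF qf_T up_nz]] dydsqf ds_zero by simp
    ultimately show ?thesis
      using qf\<A> M\<A> by (simp add: dy_add dy_diff dy_mult dy_numeral mem_simps dyqf)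
  qed
  also have "ds M + dy M = dy (M + M')" using M\<A> by (simp add: dy_add dsM)
  finally have S: "Sop ?v 0 = dy (M + M')" .
  define Z where "Z = (\<Sum>j\<in>{2..<p}. termA j 0 (cross j) + termB j 0 (prim (cross j)))"
  have "{1..<p} = insert 1 {2..<p}" using p_ge2 by auto
  then have "M + M' = termA 1 0 (cross 1) + termB 1 0 (prim (cross 1)) + Z"
    unfolding M_def M'_def Z_def by (simp add: sum.distrib)
  moreover have "Z \<in> T 1 (rest 1)"
    unfolding Z_def
  proof (intro T_sum T_add T_A T_B)
    fix j assume j: "j \<in> {2..<p}"
    \<comment> \<open>The pair \<open>(1, 0)\<close> has number 0, and every \<open>(j, 0)\<close>
      with \<open>j \<ge> 2\<close> comes later.\<close>
    have "prod_encode (j - 1, 0) \<noteq> prod_encode (0, 0)" using j by (simp del: prod_encode_def)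
    moreover have "prod_encode (0, 0) = 0" by (simp add: prod_encode_def)
    ultimately have "(j, 0) \<in> rest 1" using j by (auto simp: rest_def)
    then show "coef 1 (rest 1) j 0 (cross j)" "coef 1 (rest 1) j 0 (prim (cross j))"
      using j cross_coef[of j "rest 1"] by simp_all
  qed
  moreover have "prim (cross 1) (- y) = - prim (cross 1) y" for y
    using prim_reflect[OF rapid_isCont[OF rapid_cross[of 1]], of 1 y] p_ge2 by (simp add: cross_def Q_even)
  moreover have "grows 0 (prim (cross 1))" using p_ge2 by (intro grows_prim_rapid rapid_cross) simp
  ultimately show ?thesis using S by auto
qed

text \<open>The state of the recursion: \<open>v\<close> and \<open>\<beta>\<close> contain the corrections with the first \<open>n\<close> indices, and the
  residual consists of the remaining indices.\<close>

definition ready :: "nat \<Rightarrow> field3 \<Rightarrow> field3 \<Rightarrow> bool" where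
  "ready n v \<beta> \<longleftrightarrow> v \<in> \<A> \<and> v - yfun Q \<in> T 1 nz \<and> \<beta> \<in> T 1 nz \<and> dy \<beta> = 0 \<and> reflect v = v \<and> reflect \<beta> = \<beta> \<and>
    (\<exists>k l F G Z. idx n = (k, l) \<and> grows (real (D k l)) F \<and> (\<forall>y. F (- y) = F y) \<and>
      grows (real (D k l)) G \<and> (\<forall>y. G (- y) = - G y) \<and> Z \<in> T 1 (rest (Suc n)) \<and>
      Sop v \<beta> = dy (termA k l F + termB k l G + Z) \<and> (n = 0 \<longrightarrow> rapid F))"

definition corr :: "nat \<times> nat \<Rightarrow> real \<times> (real \<Rightarrow> real) \<times> (real \<Rightarrow> real) \<Rightarrow> field3" where
  "corr i x = termA (fst i) (snd i) (fst (snd x)) + termB (fst i) (snd i) (snd (snd x))"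

definition phase :: "nat \<times> nat \<Rightarrow> real \<times> (real \<Rightarrow> real) \<times> (real \<Rightarrow> real) \<Rightarrow> field3" where
  "phase i x = termA (fst i) (snd i) (\<lambda>_. fst x)"

text \<open>Rapid decay is recorded at \<open>(1, 0)\<close> because \<open>q * A(y)\<close> is the
  one correction for which the general estimate misses the order
  \<open>c powr (1 / (p - 1))\<close>.\<close>

definition good :: "nat \<times> nat \<Rightarrow> real \<times> (real \<Rightarrow> real) \<times> (real \<Rightarrow> real) \<Rightarrow> bool" where
  "good i x \<longleftrightarrow> grows (real (D (fst i) (snd i))) (fst (snd x)) \<and> grows (real (D (fst i) (snd i))) (snd (snd x)) \<and>
     (i = (1, 0) \<longrightarrow> rapid (fst (snd x)))"

lemma idx_0: "idx 0 = (1, 0)"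
proof -
  have "prod_encode (0, 0) = 0" by (simp add: prod_encode_def)
  then show ?thesis using idx_eq_iff[of 1 0 0] by simp
qed

lemma ready_0: "ready 0 (yfun Q + qf) 0"
proof -
  obtain G Z where GZ: "grows 0 G" "\<forall>y. G (- y) = - G y" "Z \<in> T 1 (rest 1)"
     "Sop (yfun Q + qf) 0 = dy (termA 1 0 (cross 1) + termB 1 0 G + Z)"
    using base_residual by blast
  have "yfun Q + qf \<in> \<A>"
    using T_subset[OF qf_T] by (intro T_add \<A>_yfun rapid_grows[OF rapid_Q])
  moreover have "reflect (yfun Q + qf) = yfun Q + qf"
    by (simp add: reflect_add qf_def reflect_termA) (simp add: reflect_def yfun_def Q_even)
  moreover have "rapid (cross 1)" using p_ge2 by (intro rapid_cross) simp
  moreover have "\<forall>y. cross 1 (- y) = cross 1 y" by (simp add: cross_def Q_even)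
  moreover have D: "real (D 1 0) = 0" using p_ge2 D_0[of 1] by simp
  then have "grows (real (D 1 0)) (cross 1)" "grows (real (D 1 0)) G"
    using rapid_grows[OF \<open>rapid (cross 1)\<close>] GZ(1) by simp_all
  moreover have "yfun Q + qf - yfun Q \<in> T 1 nz" using qf_T by simp
  moreover have "Z \<in> T 1 (rest (Suc 0))" using GZ(3) by simp
  ultimately show ?thesis
    unfolding ready_def using GZ(2,4) T_zero dy_zero reflect_zero idx_0 by blast
qed

text \<open>The profile equations turn the leading terms of the change into \<open>- F\<close> and
  \<open>- G\<close>, which cancels the index \<open>idx n\<close>; the side effects
  \<open>z\<close> lie strictly above it and hence later. The new pair is again reflection
  invariant, which restores the parities for the next index.\<close>

lemma ready_Suc:
  assumes "ready n v \<beta>"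
  shows "\<exists>x. good (idx n) x \<and> ready (Suc n) (v + corr (idx n) x) (\<beta> + phase (idx n) x)"
proof -
  obtain k l F G Z where kl: "idx n = (k, l)" and F: "grows (real (D k l)) F" "\<And>y. F (- y) = F y"
    and G: "grows (real (D k l)) G" "\<And>y. G (- y) = - G y" and Z: "Z \<in> T 1 (rest (Suc n))"
    and S: "Sop v \<beta> = dy (termA k l F + termB k l G + Z)" and r: "n = 0 \<Longrightarrow> rapid F"
    using assms unfolding ready_def by blast
  have v: "v \<in> \<A>" "v - yfun Q \<in> T 1 nz" "\<beta> \<in> T 1 nz" "dy \<beta> = 0" "reflect v = v" "reflect \<beta> = \<beta>"
    using assms by (auto simp: ready_def)
  have k: "k > 0" by (rule idx_pos[OF kl])
  obtain a A B where A: "grows (real (D k l)) A" "\<And>x. A (- x) = A x" "rapid F \<Longrightarrow> rapid A"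
    and B: "grows (real (D k l)) B" "\<And>x. B (- x) = - B x"
    and eqA: "\<And>x. deriv (deriv A) x = V x * A x - (F x - a * (3 * Q x - 2 * Q x ^ p))"
    and eqB: "\<And>x. deriv (deriv B) x = V x * B x - (G x - 3 * a * Qd x + Bsource A (deriv A) x)"
    using solve_pair[OF F G] by auto
  define x where "x = (a, A, B)"
  define v' where "v' = v + (termA k l A + termB k l B)"
  define \<beta>' where "\<beta>' = \<beta> + termA k l (\<lambda>_. a)"
  have klI: "(k, l) \<in> nz" using k by (simp add: nz_def)
  note cA = D_coef[OF A(1) klI k] and cB = D_coef[OF B(1) klI k]
  have ca: "coef 1 nz k l (\<lambda>_. a)" by (rule D_coef[OF grows_const klI k]) simp
  obtain z where z: "z \<in> T 1 (Iup' k l)" and d: "Sop v' \<beta>' - Sop v \<beta> =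
    dy (termA k l (\<lambda>y. deriv (deriv A) y - V y * A y - a * (3 * Q y - 2 * Q y ^ p)) +
        termB k l (\<lambda>y. deriv (deriv B) y - V y * B y - 3 * a * Qd y + Bsource A (deriv A) y) + z)"
    unfolding v'_def \<beta>'_def using step_difference[OF k v(1-4) A(1) B(1)] by blast
  have "(\<lambda>y. deriv (deriv A) y - V y * A y - a * (3 * Q y - 2 * Q y ^ p)) = (\<lambda>y. - 1 * F y)"
    by (rule ext) (simp add: eqA)
  moreover have "(\<lambda>y. deriv (deriv B) y - V y * B y - 3 * a * Qd y + Bsource A (deriv A) y) = (\<lambda>y. - 1 * G y)"
    by (rule ext) (simp add: eqB)
  ultimately have d: "Sop v' \<beta>' - Sop v \<beta> = dy (termA k l (\<lambda>y. - 1 * F y) + termB k l (\<lambda>y. - 1 * G y) + z)"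
    using d by simp
  have FA: "termA k l (\<lambda>y. - 1 * F y) = - termA k l F" "termB k l (\<lambda>y. - 1 * G y) = - termB k l G"
    by (simp_all add: termA_def termB_def fun_eq_iff uminus_apply)
  have S': "Sop v' \<beta>' = dy (Z + z)"
  proof -
    have mem: "termA k l F \<in> \<A>" "termB k l G \<in> \<A>" "Z \<in> \<A>" "z \<in> \<A>"
      using D_coef[OF F(1) klI k] D_coef[OF G(1) klI k] Z z by (auto intro: T_subset T_A T_B)
    have "Sop v' \<beta>' = Sop v \<beta> + (Sop v' \<beta>' - Sop v \<beta>)" by simp
    also have "\<dots> = dy ((termA k l F + termB k l G + Z) + (- termA k l F + - termB k l G + z))"
      unfolding S d[unfolded FA S] by (rule dy_add[symmetric]) (intro T_add T_uminus mem)+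
    also have "(termA k l F + termB k l G + Z) + (- termA k l F + - termB k l G + z) = Z + z" by simp
    finally show ?thesis .
  qed
  have Zz: "Z + z \<in> T 1 (rest (Suc n))"
    using Z T_mono[OF z order.refl Iup'_rest[OF kl]] by (rule T_add)
  have v': "v' \<in> \<A>" "v' - yfun Q \<in> T 1 nz"
  proof -
    have w: "termA k l A + termB k l B \<in> T 1 nz" by (intro T_add T_A T_B cA cB)
    show "v' \<in> \<A>" unfolding v'_def using v(1) T_subset[OF w] by (rule T_add)
    have "v' - yfun Q = (v - yfun Q) + (termA k l A + termB k l B)" by (simp add: v'_def)
    then show "v' - yfun Q \<in> T 1 nz" using T_add[OF v(2) w] by (simp only:)
  qed
  have \<beta>': "\<beta>' \<in> T 1 nz" "dy \<beta>' = 0"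
    unfolding \<beta>'_def using v T_A[OF ca] T_subset[OF v(3)] T_subset[OF T_A[OF ca]]
    by (auto intro: T_add simp: dy_add termA_const_dy)
  have rf: "reflect v' = v'" "reflect \<beta>' = \<beta>'"
    unfolding v'_def \<beta>'_def by (simp_all add: reflect_add reflect_termA reflect_termB v A B)
  obtain k1 l1 where kl1: "idx (Suc n) = (k1, l1)" by (cases "idx (Suc n)")
  obtain F1 G1 Z1 where "grows (real (D k1 l1)) F1" "\<forall>y. F1 (- y) = F1 y" "grows (real (D k1 l1)) G1"
     "\<forall>y. G1 (- y) = - G1 y" "Z1 \<in> T 1 (rest (Suc (Suc n)))" "Sop v' \<beta>' = dy (termA k1 l1 F1 + termB k1 l1 G1 + Z1)"
    using symmetric_extract[OF Zz S' reflect_Sop[OF v'(1) T_subset[OF \<beta>'(1)] rf] kl1] by blast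
  then have "ready (Suc n) v' \<beta>'" unfolding ready_def using v' \<beta>' rf kl1 by blast
  moreover have "n = 0" if "(k, l) = (1, 0)" using that kl idx_0 idx_eq_iff[of 1 n 0] idx_eq_iff[of 1 0 0] by simp
  then have "good (idx n) x" unfolding good_def kl x_def using A B r by auto
  ultimately show ?thesis
    unfolding v'_def \<beta>'_def by (intro exI[of _ x]) (simp add: corr_def phase_def kl x_def)
qed

section \<open>Truncation to a rectangle\<close>

definition Irect :: "nat \<Rightarrow> nat \<Rightarrow> (nat \<times> nat) set" where
  "Irect k0 l0 = {(k, l). k > 0 \<and> (k > k0 \<or> l > l0)}"

lemma up_Irect: "up (Irect k0 l0)" by (auto simp: up_def Irect_def)

text \<open>Congruence modulo the terms with index in \<open>I\<close>. For \<open>up I\<close> it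
  is compatible with products and derivatives, hence with \<open>Sop\<close>.\<close>

definition approx :: "(nat \<times> nat) set \<Rightarrow> field3 \<Rightarrow> field3 \<Rightarrow> bool" where
  "approx I f g \<longleftrightarrow> f \<in> \<A> \<and> g \<in> \<A> \<and> f - g \<in> T 1 I"

lemma approx_refl: "f \<in> \<A> \<Longrightarrow> approx I f f" by (simp add: approx_def T_zero)

lemma approx_add: "approx I f g \<Longrightarrow> approx I f' g' \<Longrightarrow> approx I (f + f') (g + g')"
proof -
  assume *: "approx I f g" "approx I f' g'"
  have "f + f' - (g + g') = (f - g) + (f' - g')" by simp
  then show ?thesis using * by (simp only: approx_def T_add simp_thms)
qed

lemma approx_diff: "approx I f g \<Longrightarrow> approx I f' g' \<Longrightarrow> approx I (f - f') (g - g')"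
proof -
  assume *: "approx I f g" "approx I f' g'"
  have "f - f' - (g - g') = (f - g) - (f' - g')" by simp
  then show ?thesis using * by (simp only: approx_def T_diff simp_thms)
qed

lemma approx_mult: "up I \<Longrightarrow> approx I f g \<Longrightarrow> approx I f' g' \<Longrightarrow> approx I (f * f') (g * g')"
proof -
  assume I: "up I" and *: "approx I f g" "approx I f' g'"
  have up2: "(k + k' + u, l + l' + v) \<in> I" if "(k, l) \<in> I" for k l k' l' u v
    using I that unfolding up_def by (metis add.assoc)
  have "(f - g) * f' \<in> T (1 + 0) I" "(f' - g') * g \<in> T (1 + 0) I"
    using * up2 by (auto simp: approx_def intro!: T_mult[of _ 1 I _ 0 UNIV I, simplified])
  moreover have "f * f' - g * g' = (f - g) * f' + (f' - g') * g" by (simp add: algebra_simps)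
  ultimately have "f * f' - g * g' \<in> T 1 I" by (simp only: T_add add_0_right)
  then show ?thesis using * by (simp add: approx_def \<A>_mult)
qed

lemma approx_power: "up I \<Longrightarrow> approx I f g \<Longrightarrow> approx I (f ^ n) (g ^ n)"
  by (induction n) (auto intro: approx_mult approx_refl \<A>_one)

lemma approx_ds: "up I \<Longrightarrow> approx I f g \<Longrightarrow> approx I (ds f) (ds g)"
  using ds_T[of "f - g" 1 I] by (auto simp: approx_def ds_diff ds_\<A>)

lemma approx_dy: "approx I f g \<Longrightarrow> approx I (dy f) (dy g)"
  using dy_T[of "f - g" 1 I] by (auto simp: approx_def dy_diff dy_\<A>)

lemma approx_Dop: "up I \<Longrightarrow> approx I \<beta> \<beta>' \<Longrightarrow> approx I f g \<Longrightarrow> approx I (Dop \<beta> f) (Dop \<beta>' g)"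
  unfolding Dop_def by (intro approx_add approx_mult approx_diff approx_ds approx_dy approx_refl \<A>_one)

lemma approx_Sop: "up I \<Longrightarrow> approx I \<beta> \<beta>' \<Longrightarrow> approx I f g \<Longrightarrow> approx I (Sop f \<beta>) (Sop g \<beta>')"
  unfolding Sop_def
  by (intro approx_add approx_mult approx_diff approx_ds approx_dy approx_refl approx_Dop approx_power
      \<A>_one T_subset[OF cc_T])

definition vform :: "(nat \<Rightarrow> nat \<Rightarrow> real \<Rightarrow> real) \<Rightarrow> (nat \<Rightarrow> nat \<Rightarrow> real \<Rightarrow> real) \<Rightarrow> nat \<Rightarrow> nat \<Rightarrow> field3" where
  "vform A B k0 l0 = yfun Q + qf + (\<Sum>k\<in>{1..k0}. \<Sum>l\<in>{0..l0}. termA k l (A k l) + termB k l (B k l))"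

definition bform :: "(nat \<Rightarrow> nat \<Rightarrow> real) \<Rightarrow> nat \<Rightarrow> nat \<Rightarrow> field3" where
  "bform a k0 l0 = (\<Sum>k\<in>{1..k0}. \<Sum>l\<in>{0..l0}. termA k l (\<lambda>_. a k l))"

text \<open>One infinite sequence of corrections is built independently of \<open>k0\<close> and
  \<open>l0\<close>. For a given rectangle a stage containing it is taken; the surplus corrections
  of that stage lie outside the rectangle, and dropping them changes \<open>Sop\<close> only by such
  terms.\<close>

theorem formal_solution:
  "\<exists>a A B. (\<forall>k l. k > 0 \<longrightarrow> grows (real (D k l)) (A k l) \<and> grows (real (D k l)) (B k l)) \<and> rapid (A 1 0) \<and>
     (\<forall>k0 l0. Sop (vform A B k0 l0) (bform a k0 l0) \<in> T 1 (Irect k0 l0))"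
proof -
  \<comment> \<open>The state keeps the latest correction as a third component, so that the
    coefficients can be read off the chosen sequence of states.\<close>
  define P where "P n st = ready n (fst st) (fst (snd st))"
    for n and st :: "field3 \<times> field3 \<times> (real \<times> (real \<Rightarrow> real) \<times> (real \<Rightarrow> real))"
  define N where "N n st st' \<longleftrightarrow> (fst st' = fst st + corr (idx n) (snd (snd st')) \<and>
      fst (snd st') = fst (snd st) + phase (idx n) (snd (snd st')) \<and> good (idx n) (snd (snd st')))"
    for n and st st' :: "field3 \<times> field3 \<times> (real \<times> (real \<Rightarrow> real) \<times> (real \<Rightarrow> real))"
  have "\<exists>st. \<forall>n. (P n (st n) \<and> (n = 0 \<longrightarrow> fst (st n) = yfun Q + qf \<and> fst (snd (st n)) = 0)) \<and> N n (st n) (st (Suc n))"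
  proof (rule dependent_nat_choice)
    show "\<exists>x. P 0 x \<and> (0 = (0::nat) \<longrightarrow> fst x = yfun Q + qf \<and> fst (snd x) = 0)"
      using ready_0 by (intro exI[of _ "(yfun Q + qf, 0, undefined)"]) (simp add: P_def)
    fix st n assume "P n st \<and> (n = 0 \<longrightarrow> fst st = yfun Q + qf \<and> fst (snd st) = 0)"
    then obtain x where "good (idx n) x" "ready (Suc n) (fst st + corr (idx n) x) (fst (snd st) + phase (idx n) x)"
      unfolding P_def using ready_Suc by blast
    then show "\<exists>y. (P (Suc n) y \<and> (Suc n = 0 \<longrightarrow> fst y = yfun Q + qf \<and> fst (snd y) = 0)) \<and> N n st y"
      by (intro exI[of _ "(fst st + corr (idx n) x, fst (snd st) + phase (idx n) x, x)"]) (simp add: P_def N_def)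
  qed
  then obtain st where st: "\<And>n. P n (st n)" "\<And>n. N n (st n) (st (Suc n))"
     "fst (st 0) = yfun Q + qf" "fst (snd (st 0)) = 0" by blast
  \<comment> \<open>The correction for \<open>idx n\<close> is stored in state
    \<open>Suc n\<close>.\<close>
  define X where "X n = snd (snd (st (Suc n)))" for n
  define xx where "xx i = X (prod_encode (fst i - 1, snd i))" for i
  have xx: "xx (idx n) = X n" for n
    using idx_eq_iff[of "fst (idx n)" n "snd (idx n)"] by (simp add: xx_def idx_pos[of n "fst (idx n)" "snd (idx n)"])
  have vn: "fst (st n) = yfun Q + qf + (\<Sum>i<n. corr (idx i) (X i))" for n
    by (induction n) (use st in \<open>simp_all add: N_def X_def add.assoc\<close>)
  have bn: "fst (snd (st n)) = (\<Sum>i<n. phase (idx i) (X i))" for n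
    by (induction n) (use st in \<open>simp_all add: N_def X_def\<close>)
  have inj: "inj_on idx A" for A
    unfolding inj_on_def idx_def by (auto simp: prod_eq_iff[symmetric] inj_eq[OF inj_prod_decode])
  have reindex: "(\<Sum>i<n. f (idx i) (X i)) = (\<Sum>i\<in>idx ` {..<n}. f i (xx i))" for n and f :: "_ \<Rightarrow> _ \<Rightarrow> field3"
    by (subst sum.reindex[OF inj]) (simp add: xx)
  have good: "good (k, l) (xx (k, l))" if "k > 0" for k l
  proof -
    have "idx (prod_encode (k - 1, l)) = (k, l)" using idx_eq_iff[OF that] by blast
    then show ?thesis using st(2)[of "prod_encode (k - 1, l)"] by (simp add: N_def xx_def X_def)
  qed
  define a where "a k l = fst (xx (k, l))" for k l
  define A where "A k l = fst (snd (xx (k, l)))" for k l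
  define B where "B k l = snd (snd (xx (k, l)))" for k l
  have gr: "grows (real (D k l)) (A k l)" "grows (real (D k l)) (B k l)" if "k > 0" for k l
    using good[OF that] by (auto simp: good_def A_def B_def)
  have rap: "rapid (A 1 0)" using good[of 1 0] by (simp add: good_def A_def)
  have "Sop (vform A B k0 l0) (bform a k0 l0) \<in> T 1 (Irect k0 l0)" for k0 l0
  proof -
    \<comment> \<open>Large enough for two purposes: the first \<open>n\<close> pairs contain the
      rectangle, and every pair that is left over lies outside it.\<close>
    define n where "n = Suc (prod_encode (k0, l0))"
    define L where "L = idx ` {..<n}"
    define R where "R = {1..k0} \<times> {0..l0}"
    have RL: "R \<subseteq> L"
    proof
      fix x assume "x \<in> R"
      then obtain k l where x: "x = (k, l)" "1 \<le> k" "k \<le> k0" "l \<le> l0" by (auto simp: R_def)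
      then have "prod_encode (k - 1, l) < n" unfolding n_def by (auto intro!: le_imp_less_Suc prod_encode_mono)
      moreover have "idx (prod_encode (k - 1, l)) = x" using x idx_eq_iff[of k] by simp
      ultimately show "x \<in> L" unfolding L_def by (metis imageI lessThan_iff)
    qed
    have rest: "rest n \<subseteq> Irect k0 l0"
    proof
      fix x assume x: "x \<in> rest n"
      obtain k l where kl: "x = (k, l)" by (cases x)
      have "\<not> (k \<le> k0 \<and> l \<le> l0)"
      proof
        assume "k \<le> k0 \<and> l \<le> l0"
        then have "prod_encode (k - 1, l) \<le> prod_encode (k0, l0)" by (intro prod_encode_mono) auto
        then show False using x by (simp add: kl rest_def n_def)
      qed
      then show "x \<in> Irect k0 l0" using x by (auto simp: kl rest_def Irect_def)
    qed
    have diff: "(\<Sum>i\<in>L. f i) - (\<Sum>i\<in>R. f i) = (\<Sum>i\<in>L - R. f i)" for f :: "_ \<Rightarrow> field3"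
      using sum.subset_diff[OF RL, of f] by (simp add: L_def)
    have LR: "(k, l) \<in> Irect k0 l0 \<and> k > 0" if "(k, l) \<in> L - R" for k l
    proof -
      have "k > 0" using that idx_pos unfolding L_def by (metis DiffD1 imageE)
      then show ?thesis using that by (auto simp: R_def Irect_def)
    qed
    have c: "coef 1 (Irect k0 l0) k l F" if "(k, l) \<in> L - R" "grows (real (D k l)) F" for k l F
      using LR[OF that(1)] D_coef[OF that(2)] by blast
    have v: "vform A B k0 l0 = yfun Q + qf + (\<Sum>i\<in>R. corr i (xx i))"
      unfolding vform_def R_def sum.cartesian_product corr_def A_def B_def by (simp add: case_prod_unfold)
    have b: "bform a k0 l0 = (\<Sum>i\<in>R. phase i (xx i))"
      unfolding bform_def R_def sum.cartesian_product phase_def a_def by (simp add: case_prod_unfold)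
    have vL: "fst (st n) = yfun Q + qf + (\<Sum>i\<in>L. corr i (xx i))" unfolding vn reindex L_def ..
    have bL: "fst (snd (st n)) = (\<Sum>i\<in>L. phase i (xx i))" unfolding bn reindex L_def ..
    have rd: "ready n (fst (st n)) (fst (snd (st n)))" using st(1) by (simp add: P_def)
    have mem: "fst (st n) \<in> \<A>" "fst (snd (st n)) \<in> \<A>" using rd T_subset by (auto simp: ready_def)
    have vd: "fst (st n) - vform A B k0 l0 \<in> T 1 (Irect k0 l0)"
    proof -
      have "fst (st n) - vform A B k0 l0 = (\<Sum>i\<in>L - R. corr i (xx i))" unfolding v vL diff[symmetric] by simp
      also have "\<dots> \<in> T 1 (Irect k0 l0)"
      proof (rule T_sum)
        fix i assume i: "i \<in> L - R"
        obtain k l where kl: "i = (k, l)" by (cases i)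
        show "corr i (xx i) \<in> T 1 (Irect k0 l0)"
          unfolding kl corr_def using c[of k l] i gr[of k l] LR[of k l]
          by (auto simp: kl A_def B_def intro!: T_add T_A T_B)
      qed
      finally show ?thesis .
    qed
    have bd: "fst (snd (st n)) - bform a k0 l0 \<in> T 1 (Irect k0 l0)"
    proof -
      have "fst (snd (st n)) - bform a k0 l0 = (\<Sum>i\<in>L - R. phase i (xx i))" unfolding b bL diff[symmetric] by simp
      also have "\<dots> \<in> T 1 (Irect k0 l0)"
      proof (rule T_sum)
        fix i assume i: "i \<in> L - R"
        obtain k l where kl: "i = (k, l)" by (cases i)
        show "phase i (xx i) \<in> T 1 (Irect k0 l0)"
          unfolding kl phase_def
          using c[of k l "\<lambda>_. fst (xx (k, l))"] i grows_const[of "real (D k l)" "fst (xx (k, l))"]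
          by (auto simp: kl intro!: T_A)
      qed
      finally show ?thesis .
    qed
    have "vform A B k0 l0 \<in> \<A>" "bform a k0 l0 \<in> \<A>"
      using T_diff[OF mem(1) T_subset[OF vd]] T_diff[OF mem(2) T_subset[OF bd]] by simp_all
    then have "approx (Irect k0 l0) (fst (st n)) (vform A B k0 l0)" "approx (Irect k0 l0) (fst (snd (st n))) (bform a k0 l0)"
      using mem vd bd by (simp_all add: approx_def)
    then have "approx (Irect k0 l0) (Sop (fst (st n)) (fst (snd (st n)))) (Sop (vform A B k0 l0) (bform a k0 l0))"
      by (intro approx_Sop up_Irect)
    moreover have "Sop (fst (st n)) (fst (snd (st n))) \<in> T 1 (Irect k0 l0)"
    proof -
      obtain k l F G Z where kl: "idx n = (k, l)" "grows (real (D k l)) F" "grows (real (D k l)) G"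
        "Z \<in> T 1 (rest (Suc n))" "Sop (fst (st n)) (fst (snd (st n))) = dy (termA k l F + termB k l G + Z)"
        using rd unfolding ready_def by blast
      have k: "k > 0" by (rule idx_pos[OF kl(1)])
      have klr: "(k, l) \<in> rest n" using idx_eq_iff[OF k, of n l] kl(1) k by (simp add: rest_def)
      have "rest (Suc n) \<subseteq> rest n" by (auto simp: rest_def)
      then have "termA k l F + termB k l G + Z \<in> T 1 (rest n)"
        using T_mono[OF kl(4) order.refl] D_coef[OF kl(2) klr k] D_coef[OF kl(3) klr k]
        by (intro T_add T_A T_B) auto
      then show ?thesis unfolding kl(5) by (intro dy_T T_mono[OF _ order.refl rest])
    qed
    ultimately have "Sop (fst (st n)) (fst (snd (st n))) -
       (Sop (fst (st n)) (fst (snd (st n))) - Sop (vform A B k0 l0) (bform a k0 l0)) \<in> T 1 (Irect k0 l0)"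
      unfolding approx_def by (elim conjE) (rule T_diff)
    then show ?thesis by simp
  qed
  then show ?thesis using gr rap by blast
qed

end

section \<open>Evaluation along the trajectory\<close>

lemma sum_field3: "(sum f X :: field3) c s y = (\<Sum>i\<in>X. f i c s y)"
  by (induction X rule: infinite_finite_induct) (simp_all add: fun_app)

text \<open>Restriction of a formal expression to a fixed time. It preserves sums and products and
  turns \<open>Dop\<close> into the \<open>x\<close>-derivative.\<close>

definition lift :: "(real \<Rightarrow> real) \<Rightarrow> real \<Rightarrow> real \<Rightarrow> field3 \<Rightarrow> real \<Rightarrow> real" where
  "lift al c t f x = f c (x + (1 - c) * t) (x - al (x + (1 - c) * t))"

lemma lift_add: "lift al c t (f + g) x = lift al c t f x + lift al c t g x"
  and lift_diff: "lift al c t (f - g) x = lift al c t f x - lift al c t g x"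
  and lift_mult: "lift al c t (f * g) x = lift al c t f x * lift al c t g x"
  by (simp_all add: lift_def fun_app minus_apply)

lemma lift_power: "lift al c t (f ^ n) x = lift al c t f x ^ n"
  by (induction n) (simp_all add: lift_mult, simp add: lift_def fun_app)

context gkdv
begin

definition pos :: "(nat \<times> nat) set" where "pos = {(k, l). k > 0}"

lemma up_pos: "up pos" and pos_nz: "pos \<subseteq> nz" by (auto simp: up_def pos_def nz_def)

text \<open>Every element is a finite sum of products of a function of \<open>s\<close> and a
  function of \<open>y\<close>, so the one-variable product and chain rules replace
  differentiability in two variables.\<close>

lemma DERIV_compose:
  assumes "f \<in> T n I" "(g has_real_derivative g') (at x)" "(h has_real_derivative h') (at x)"
  shows "((\<lambda>x. f c (g x) (h x)) has_real_derivative ds f c (g x) (h x) * g' + dy f c (g x) (h x) * h') (at x)"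
  using assms(1)
proof (induction rule: T_induct)
  case zero
  have "((\<lambda>x. (0 :: field3) c (g x) (h x)) has_real_derivative ds 0 c (g x) (h x) * g' + dy 0 c (g x) (h x) * h') (at x)"
    unfolding ds_zero dy_zero by (simp add: fun_app)
  then show ?case .
next
  case (add f1 f2)
  have "f1 \<in> \<A>" "f2 \<in> \<A>" using add by (auto intro: T_subset)
  then have e: "ds (f1 + f2) c (g x) (h x) * g' + dy (f1 + f2) c (g x) (h x) * h' =
    (ds f1 c (g x) (h x) * g' + dy f1 c (g x) (h x) * h') + (ds f2 c (g x) (h x) * g' + dy f2 c (g x) (h x) * h')"
    by (simp add: ds_add dy_add fun_app algebra_simps)
  have "((\<lambda>x. (f1 + f2) c (g x) (h x)) has_real_derivative
    (ds f1 c (g x) (h x) * g' + dy f1 c (g x) (h x) * h') + (ds f2 c (g x) (h x) * g' + dy f2 c (g x) (h x) * h')) (at x)"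
    using DERIV_add[OF add.IH] by (simp add: fun_app)
  then show ?case by (rule DERIV_cong) (rule e[symmetric])
next
  case (A k l F)
  then obtain d where d: "grows (real d) F" using coef_grows by blast
  have 1: "((\<lambda>s. c ^ l * q c s ^ k) has_real_derivative c ^ l * (real k * (q c s ^ (k - 1) * qs c s))) (at s)" for s
    using DERIV_power[OF DERIV_q, where n = k] by (intro DERIV_cmult) (simp add: mult_ac)
  have "((\<lambda>x. c ^ l * q c (g x) ^ k * F (h x)) has_real_derivative
     c ^ l * (real k * (q c (g x) ^ (k - 1) * qs c (g x))) * g' * F (h x) + deriv F (h x) * h' * (c ^ l * q c (g x) ^ k)) (at x)"
    by (intro DERIV_mult DERIV_chain2[OF 1] DERIV_chain2[OF grows_DERIV[OF d]] assms)
  then have "((\<lambda>x. termA k l F c (g x) (h x)) has_real_derivative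
     c ^ l * (real k * (q c (g x) ^ (k - 1) * qs c (g x))) * g' * F (h x) + deriv F (h x) * h' * (c ^ l * q c (g x) ^ k)) (at x)"
    by (simp only: termA_def)
  then show ?case
    by (rule DERIV_cong) (simp only: ds_termA dy_termA[OF d], simp add: termA_def termB_def mult_ac)
next
  case (B k l F)
  then obtain d where d: "grows (real d) F" using coef_grows by blast
  \<comment> \<open>With the constant coefficient 1 the term reduces to its factor in
    \<open>s\<close>, whose derivative is then available from \<open>DERIV_termB_s\<close>.\<close>
  define w where "w = (\<lambda>_::real. 1::real)"
  have 1: "((\<lambda>s. c ^ l * (real k * q c s ^ (k - 1) * qs c s)) has_real_derivative ds (termB k l w) c s 0) (at s)" for s
    using DERIV_termB_s[of k l w c 0 s] unfolding ds_termB by (simp add: termB_def w_def)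
  have e: "ds (termB k l F) c s y = ds (termB k l w) c s 0 * F y" for s y
    unfolding ds_termB by (simp add: termA_def yfun_def w_def fun_app minus_apply algebra_simps)
  have "((\<lambda>x. c ^ l * (real k * q c (g x) ^ (k - 1) * qs c (g x)) * F (h x)) has_real_derivative
     ds (termB k l w) c (g x) 0 * g' * F (h x) + deriv F (h x) * h' * (c ^ l * (real k * q c (g x) ^ (k - 1) * qs c (g x)))) (at x)"
    by (intro DERIV_mult DERIV_chain2[OF 1] DERIV_chain2[OF grows_DERIV[OF d]] assms)
  then have "((\<lambda>x. termB k l F c (g x) (h x)) has_real_derivative
     ds (termB k l w) c (g x) 0 * g' * F (h x) + deriv F (h x) * h' * (c ^ l * (real k * q c (g x) ^ (k - 1) * qs c (g x)))) (at x)"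
    by (simp only: termB_def)
  then show ?case
    by (rule DERIV_cong) (simp only: e dy_termB[OF d], simp add: termB_def mult_ac)
qed

lemma DERIV_lift:
  assumes f: "f \<in> \<A>" and al: "\<And>s y. (al has_real_derivative \<beta> c s y) (at s)"
  shows "(lift al c t f has_real_derivative lift al c t (Dop \<beta> f) x) (at x)"
proof -
  have g: "((\<lambda>x. x + (1 - c) * t) has_real_derivative 1) (at x)" for x
    using DERIV_add[OF DERIV_ident DERIV_const] by simp
  have h: "((\<lambda>x. x - al (x + (1 - c) * t)) has_real_derivative 1 - \<beta> c (x + (1 - c) * t) (x - al (x + (1 - c) * t)) * 1) (at x)"
    by (intro DERIV_diff DERIV_ident DERIV_chain2[OF al g])
  show ?thesis
    unfolding lift_def[abs_def]
    by (rule DERIV_cong[OF DERIV_compose[OF f g h]]) (simp add: Dop_def fun_app minus_apply mult.commute)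
qed

lemma DERIV_lift_t:
  assumes f: "f \<in> \<A>" and al: "\<And>s y. (al has_real_derivative \<beta> c s y) (at s)"
  shows "((\<lambda>t. lift al c t f x) has_real_derivative lift al c t ((1 - cc) * (ds f - \<beta> * dy f)) x) (at t)"
proof -
  have g: "((\<lambda>t. x + (1 - c) * t) has_real_derivative (1 - c)) (at t)" for t
    using DERIV_add[OF DERIV_const DERIV_cmult[OF DERIV_ident]] by simp
  have h: "((\<lambda>t. x - al (x + (1 - c) * t)) has_real_derivative 0 - \<beta> c (x + (1 - c) * t) (x - al (x + (1 - c) * t)) * (1 - c)) (at t)"
    by (intro DERIV_diff DERIV_const DERIV_chain2[OF al g])
  show ?thesis
    unfolding lift_def
    by (rule DERIV_cong[OF DERIV_compose[OF f g h]]) (simp add: fun_app minus_apply cc_def algebra_simps)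
qed

lemma Dop_pow_\<A>: "f \<in> \<A> \<Longrightarrow> \<beta> \<in> \<A> \<Longrightarrow> (Dop \<beta> ^^ j) f \<in> \<A>"
  by (induction j) (simp_all add: Dop_\<A>)

lemma deriv_lift:
  assumes "f \<in> \<A>" "\<And>s y. (al has_real_derivative \<beta> c s y) (at s)"
  shows "deriv (lift al c t f) = lift al c t (Dop \<beta> f)"
  by (intro ext DERIV_imp_deriv DERIV_lift assms)

lemma deriv_pow_lift:
  assumes "f \<in> \<A>" "\<beta> \<in> \<A>" "\<And>s y. (al has_real_derivative \<beta> c s y) (at s)"
  shows "(deriv ^^ j) (lift al c t f) = lift al c t ((Dop \<beta> ^^ j) f)"
  by (induction j) (simp_all add: deriv_lift Dop_pow_\<A> assms)

lemma isCont_q: "isCont (\<lambda>s. q c s) s" by (rule DERIV_isCont[OF DERIV_q])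

lemma bform_apply: "bform a k0 l0 c s y = (\<Sum>k\<in>{1..k0}. \<Sum>l\<in>{0..l0}. c ^ l * q c s ^ k * a k l)"
  by (simp add: bform_def sum_field3 termA_def)

lemma DERIV_alpha:
  assumes "c > 0"
  shows "(alpha p a c k0 l0 has_real_derivative bform a k0 l0 c s y) (at s)"
proof -
  have e: "(\<lambda>s. Qc p c s ^ k) = (\<lambda>s. q c s ^ k)" for k using assms by (simp add: q_def)
  have "((\<lambda>s. LBINT s'=0..s. (Qc p c s') ^ k) has_real_derivative q c s ^ k) (at s)" for k
    unfolding e by (rule DERIV_LBINT) (intro isCont_power isCont_q)
  then have "((\<lambda>s. \<Sum>k\<in>{1..k0}. \<Sum>l\<in>{0..l0}. a k l * c ^ l * (LBINT s'=0..s. (Qc p c s') ^ k)) has_real_derivative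
     (\<Sum>k\<in>{1..k0}. \<Sum>l\<in>{0..l0}. a k l * c ^ l * q c s ^ k)) (at s)"
    by (intro DERIV_sum DERIV_cmult)
  then show ?thesis unfolding alpha_def[abs_def] bform_apply by (simp add: mult_ac)
qed

lemma vfun_eq:
  assumes "c > 0"
  shows "vfun p a A B c k0 l0 t x = lift (alpha p a c k0 l0) c t (vform A B k0 l0) x"
proof -
  have "deriv (\<lambda>s. Qc p c s ^ k) s = real k * q c s ^ (k - 1) * qs c s" for k s
  proof -
    have e: "(\<lambda>s. Qc p c s ^ k) = (\<lambda>s. q c s ^ k)" using assms by (simp add: q_def)
    show ?thesis unfolding e using DERIV_imp_deriv[OF DERIV_power[OF DERIV_q, where n = k]]
      by (simp add: mult_ac)
  qed
  moreover have "Qc p c s = q c s" for s using assms by (simp add: q_def)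
  ultimately show ?thesis
    unfolding vfun_def Let_def lift_def vform_def
    by (simp add: fun_app sum_field3 yfun_def qf_def termA_def termB_def algebra_simps)
qed

lemma
  assumes g: "\<And>k l. k > 0 \<Longrightarrow> grows (real (D k l)) (A k l) \<and> grows (real (D k l)) (B k l)"
  shows vform_T: "vform A B k0 l0 - yfun Q \<in> T 1 pos" and vform_\<A>: "vform A B k0 l0 \<in> \<A>"
    and bform_T: "bform a k0 l0 \<in> T 1 pos"
proof -
  have 1: "coef 1 pos 1 0 (\<lambda>_. 1)"
    by (rule D_coef[OF grows_const]) (auto simp: pos_def)
  have c: "coef 1 pos k l F" if "grows (real (D k l)) F" "k \<in> {1..k0}" for k l F
    by (rule D_coef[OF that(1)]) (use that in \<open>auto simp: pos_def\<close>)
  have "vform A B k0 l0 - yfun Q = qf + (\<Sum>k\<in>{1..k0}. \<Sum>l\<in>{0..l0}. termA k l (A k l) + termB k l (B k l))"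
    by (simp add: vform_def)
  also have "\<dots> \<in> T 1 pos"
    unfolding qf_def using g by (intro T_add T_sum T_A T_B 1 c) auto
  finally show v: "vform A B k0 l0 - yfun Q \<in> T 1 pos" .
  have "yfun Q + (vform A B k0 l0 - yfun Q) \<in> \<A>"
    by (rule T_add[OF \<A>_yfun[OF rapid_grows[OF rapid_Q]] T_subset[OF v]])
  then show "vform A B k0 l0 \<in> \<A>" by simp
  show "bform a k0 l0 \<in> T 1 pos"
    unfolding bform_def by (intro T_sum T_A c grows_const) auto
qed

lemma Sfun_eq:
  assumes c: "c > 0" and v: "vform A B k0 l0 \<in> \<A>" and b: "bform a k0 l0 \<in> \<A>"
  shows "Sfun p a A B c k0 l0 t x = lift (alpha p a c k0 l0) c t (Sop (vform A B k0 l0) (bform a k0 l0)) x"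
proof -
  let ?al = "alpha p a c k0 l0" and ?v = "vform A B k0 l0" and ?b = "bform a k0 l0"
  let ?N = "Dop ?b (Dop ?b ?v) - ?v + ?v ^ p"
  have al: "(?al has_real_derivative ?b c s y) (at s)" for s y by (rule DERIV_alpha[OF c])
  have N: "?N \<in> \<A>" using v b by (simp add: mem_simps Dop_\<A>)
  have "deriv (\<lambda>\<tau>. vfun p a A B c k0 l0 \<tau> x) t = lift ?al c t ((1 - cc) * (ds ?v - ?b * dy ?v)) x"
    unfolding vfun_eq[OF c] by (rule DERIV_imp_deriv[OF DERIV_lift_t[where \<beta> = ?b, OF v al]])
  moreover have "(\<lambda>z. (deriv ^^ 2) (\<lambda>w. vfun p a A B c k0 l0 t w) z - vfun p a A B c k0 l0 t z
      + (vfun p a A B c k0 l0 t z) ^ p) = lift ?al c t ?N"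
  proof -
    have e: "(deriv ^^ 2) (lift ?al c t ?v) = lift ?al c t (Dop ?b (Dop ?b ?v))"
      using deriv_pow_lift[where \<beta> = ?b and j = 2, OF v b al] by (simp add: numeral_2_eq_2)
    show ?thesis
      unfolding vfun_eq[OF c] e by (rule ext) (simp add: lift_add lift_diff lift_power)
  qed
  moreover have "deriv (lift ?al c t ?N) x = lift ?al c t (Dop ?b ?N) x"
    by (simp only: deriv_lift[where \<beta> = ?b, OF N al])
  ultimately show ?thesis unfolding Sfun_def Sop_def lift_add by simp
qed

end

section \<open>Square integrability\<close>

text \<open>Integrability is part of the bound because the integral of a non-integrable function is
  0 by convention.\<close>

definition sq_le :: "(real \<Rightarrow> real) \<Rightarrow> real \<Rightarrow> bool" where
  "sq_le f M \<longleftrightarrow> sq_integrable f \<and> (\<integral>x. (f x)\<^sup>2 \<partial>lborel) \<le> M"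

text \<open>A change of variables in disguise: \<open>arctan (u x) / \<mu>\<close> has a derivative
  dominating the integrand, and its increment over any interval is at most
  \<open>pi / \<mu>\<close>. Two choices of \<open>u\<close> matter, the slow variable
  \<open>sqrt c * s\<close> and the fast variable \<open>y\<close>.\<close>

lemma nn_integral_arctan_le:
  fixes u u' :: "real \<Rightarrow> real"
  assumes u: "\<And>x. (u has_real_derivative u' x) (at x)" "\<And>x. isCont u' x"
    and m: "0 < \<mu>" "\<And>x. \<mu> \<le> u' x"
  shows "(\<integral>\<^sup>+x. ennreal (1 / (1 + (u x)\<^sup>2)) \<partial>lborel) \<le> ennreal (pi / \<mu>)"
proof -
  define g where "g x = u' x / (\<mu> * (1 + (u x)\<^sup>2))" for x
  define f where "f x = 1 / (1 + (u x)\<^sup>2)" for x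
  have pos: "0 < 1 + (u x)\<^sup>2" for x by (simp add: add_pos_nonneg)
  have cu: "isCont u x" for x using DERIV_isCont[OF u(1)] .
  have "isCont f x" for x
    unfolding f_def using pos[of x] by (intro continuous_intros cu) auto
  then have f[measurable]: "f \<in> borel_measurable borel"
    by (intro borel_measurable_continuous_onI continuous_at_imp_continuous_on) auto
  have "isCont g x" for x
    unfolding g_def using pos[of x] m(1) by (intro continuous_intros cu u(2)) auto
  then have g[measurable]: "g \<in> borel_measurable borel"
    by (intro borel_measurable_continuous_onI continuous_at_imp_continuous_on) auto
  have fg: "f x \<le> g x" for x
  proof -
    have "g x = u' x / \<mu> * f x" by (simp add: g_def f_def)
    moreover have "1 \<le> u' x / \<mu>" using m by simp
    moreover have "0 \<le> f x" using pos[of x] by (simp add: f_def)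
    ultimately show ?thesis using mult_right_mono[of 1 "u' x / \<mu>" "f x"] by simp
  qed
  have f0: "0 \<le> f x" for x using pos[of x] by (simp add: f_def)
  have F: "((\<lambda>x. arctan (u x) / \<mu>) has_real_derivative g x) (at x)" for x
  proof -
    have "((\<lambda>x. arctan (u x) / \<mu>) has_real_derivative inverse (1 + (u x)\<^sup>2) * u' x / \<mu>) (at x)"
      by (intro DERIV_cdivide DERIV_chain2[OF DERIV_arctan u(1)])
    then show ?thesis by (rule DERIV_cong) (simp add: g_def divide_inverse)
  qed
  have bound: "(\<integral>\<^sup>+x. ennreal (f x) * indicator {- real n..real n} x \<partial>lborel) \<le> ennreal (pi / \<mu>)" for n
  proof -
    have "(\<integral>\<^sup>+x. ennreal (f x) * indicator {- real n..real n} x \<partial>lborel)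
        \<le> (\<integral>\<^sup>+x. ennreal (g x) * indicator {- real n..real n} x \<partial>lborel)"
      by (intro nn_integral_mono mult_right_mono ennreal_leI fg) simp
    also have "\<dots> = ennreal (arctan (u (real n)) / \<mu> - arctan (u (- real n)) / \<mu>)"
      by (rule nn_integral_FTC_Icc[OF g F]) (use order_trans[OF f0 fg] in auto)
    also have "\<dots> \<le> ennreal (pi / \<mu>)"
    proof (rule ennreal_leI)
      have "arctan (u (real n)) - arctan (u (- real n)) \<le> pi"
        using arctan_ubound[of "u (real n)"] arctan_lbound[of "u (- real n)"] by linarith
      then show "arctan (u (real n)) / \<mu> - arctan (u (- real n)) / \<mu> \<le> pi / \<mu>"
        unfolding diff_divide_distrib[symmetric] using m(1) by (intro divide_right_mono) auto
    qed
    finally show ?thesis .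
  qed
  have "(\<integral>\<^sup>+x. ennreal (f x) \<partial>lborel) = (\<integral>\<^sup>+x. (SUP n. ennreal (f x) * indicator {- real n..real n} x) \<partial>lborel)"
  proof (rule nn_integral_cong)
    fix x
    obtain n where n: "\<bar>x\<bar> \<le> real n" using real_arch_simple by blast
    have "(SUP n. ennreal (f x) * indicator {- real n..real n} x) = ennreal (f x)"
    proof (rule antisym)
      show "(SUP n. ennreal (f x) * indicator {- real n..real n} x) \<le> ennreal (f x)"
        by (rule SUP_least) (auto split: split_indicator)
      have "ennreal (f x) = ennreal (f x) * indicator {- real n..real n} x" using n by (auto split: split_indicator)
      also have "\<dots> \<le> (SUP n. ennreal (f x) * indicator {- real n..real n} x)" by (rule SUP_upper) simp
      finally show "ennreal (f x) \<le> (SUP n. ennreal (f x) * indicator {- real n..real n} x)" .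
    qed
    then show "ennreal (f x) = (SUP n. ennreal (f x) * indicator {- real n..real n} x)" by simp
  qed
  also have "\<dots> = (SUP n. \<integral>\<^sup>+x. ennreal (f x) * indicator {- real n..real n} x \<partial>lborel)"
    by (rule nn_integral_monotone_convergence_SUP)
      (auto simp: incseq_def le_fun_def split: split_indicator)
  also have "\<dots> \<le> ennreal (pi / \<mu>)" by (rule SUP_least) (rule bound)
  finally show ?thesis unfolding f_def .
qed

lemma sq_le_arctan:
  fixes f u u' :: "real \<Rightarrow> real"
  assumes u: "\<And>x. (u has_real_derivative u' x) (at x)" "\<And>x. isCont u' x"
    and m: "0 < \<mu>" "\<And>x. \<mu> \<le> u' x"
    and f: "\<And>x. isCont f x" "\<And>x. (f x)\<^sup>2 \<le> E / (1 + (u x)\<^sup>2)" and E: "0 \<le> E"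
  shows "sq_le f (E * pi / \<mu>)"
proof -
  have fm[measurable]: "f \<in> borel_measurable borel"
    using f(1) by (intro borel_measurable_continuous_onI continuous_at_imp_continuous_on) auto
  have cu: "isCont u x" for x using DERIV_isCont[OF u(1)] .
  then have [measurable]: "u \<in> borel_measurable borel"
    by (intro borel_measurable_continuous_onI continuous_at_imp_continuous_on) auto
  have "(\<integral>\<^sup>+x. ennreal ((f x)\<^sup>2) \<partial>lborel) \<le> (\<integral>\<^sup>+x. ennreal E * ennreal (1 / (1 + (u x)\<^sup>2)) \<partial>lborel)"
    using f(2) E by (intro nn_integral_mono) (simp add: ennreal_mult[symmetric] ennreal_leI)
  also have "\<dots> = ennreal E * (\<integral>\<^sup>+x. ennreal (1 / (1 + (u x)\<^sup>2)) \<partial>lborel)"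
    by (rule nn_integral_cmult) simp
  also have "\<dots> \<le> ennreal E * ennreal (pi / \<mu>)"
    by (intro mult_left_mono nn_integral_arctan_le[OF u m]) simp
  also have "\<dots> = ennreal (E * pi / \<mu>)" using E m(1) by (simp add: ennreal_mult[symmetric])
  finally have le: "(\<integral>\<^sup>+x. ennreal ((f x)\<^sup>2) \<partial>lborel) \<le> ennreal (E * pi / \<mu>)" .
  have int: "integrable lborel (\<lambda>x. (f x)\<^sup>2)"
    using le by (intro integrableI_nonneg) (auto intro: le_less_trans)
  have "ennreal (\<integral>x. (f x)\<^sup>2 \<partial>lborel) \<le> ennreal (E * pi / \<mu>)"
    using nn_integral_eq_integral[OF int] le by simp
  then have "(\<integral>x. (f x)\<^sup>2 \<partial>lborel) \<le> E * pi / \<mu>"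
    using E m(1) by (subst (asm) ennreal_le_iff) auto
  then show ?thesis using int by (simp add: sq_le_def sq_integrable_def)
qed

lemma sq_le_mono: "sq_le f M \<Longrightarrow> M \<le> N \<Longrightarrow> sq_le f N" by (simp add: sq_le_def)

lemma sq_le_add:
  assumes "sq_le f M" "sq_le g N" shows "sq_le (\<lambda>x. f x + g x) (2 * M + 2 * N)"
proof -
  have [measurable]: "f \<in> borel_measurable borel" "g \<in> borel_measurable borel"
    and int: "integrable lborel (\<lambda>x. (f x)\<^sup>2)" "integrable lborel (\<lambda>x. (g x)\<^sup>2)"
    using assms by (auto simp: sq_le_def sq_integrable_def)
  have le: "(f x + g x)\<^sup>2 \<le> 2 * (f x)\<^sup>2 + 2 * (g x)\<^sup>2" for x
    using zero_le_power2[of "f x - g x"] unfolding power2_sum power2_diff by linarith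
  have int2: "integrable lborel (\<lambda>x. 2 * (f x)\<^sup>2 + 2 * (g x)\<^sup>2)" using int by simp
  have int3: "integrable lborel (\<lambda>x. (f x + g x)\<^sup>2)"
    by (rule Bochner_Integration.integrable_bound[OF int2]) (use le in auto)
  have "(\<integral>x. (f x + g x)\<^sup>2 \<partial>lborel) \<le> (\<integral>x. 2 * (f x)\<^sup>2 + 2 * (g x)\<^sup>2 \<partial>lborel)"
    by (rule integral_mono[OF int3 int2]) (rule le)
  also have "\<dots> = 2 * (\<integral>x. (f x)\<^sup>2 \<partial>lborel) + 2 * (\<integral>x. (g x)\<^sup>2 \<partial>lborel)" using int by simp
  also have "\<dots> \<le> 2 * M + 2 * N" using assms by (simp add: sq_le_def)
  finally show ?thesis using int3 by (simp add: sq_le_def sq_integrable_def)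
qed

lemma sq_le_zero: "sq_le (\<lambda>x. 0) 0"
  by (simp add: sq_le_def sq_integrable_def)

lemma powr_le_one: "0 < c \<Longrightarrow> c < 1 \<Longrightarrow> 0 \<le> e \<Longrightarrow> c powr e \<le> (1 :: real)"
  using powr_mono'[of 0 e c] by simp

lemma weight_exp:
  obtains C where "C > 0" "\<And>u::real. 0 \<le> u \<Longrightarrow> (1 + u) ^ d * exp (- u) \<le> C / (1 + u\<^sup>2)"
proof -
  obtain C where C: "C > 0" "\<And>x. 0 \<le> x \<Longrightarrow> (1 + x) powr (real d + 2) \<le> C * exp (1 * x)"
    using powr_le_exp[of 1 "real d + 2"] by auto
  have "(1 + u) ^ d * exp (- u) \<le> C / (1 + u\<^sup>2)" if u: "0 \<le> u" for u :: real
  proof -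
    have "(1 + u) powr (real d + 2) = (1 + u) ^ d * (1 + u)\<^sup>2"
      using u by (simp add: powr_add powr_realpow)
    then have "(1 + u) ^ d * (1 + u)\<^sup>2 \<le> C * exp u" using C(2)[OF u] by simp
    moreover have "1 + u\<^sup>2 \<le> (1 + u)\<^sup>2" using u by (simp add: power2_sum)
    then have "(1 + u) ^ d * (1 + u\<^sup>2) \<le> (1 + u) ^ d * (1 + u)\<^sup>2" using u by (intro mult_left_mono) auto
    ultimately have "(1 + u) ^ d * (1 + u\<^sup>2) \<le> C * exp u" by linarith
    then have "(1 + u) ^ d * (1 + u\<^sup>2) * exp (- u) \<le> C * exp u * exp (- u)" by (rule mult_right_mono) simp
    then have "(1 + u) ^ d * exp (- u) * (1 + u\<^sup>2) \<le> C" by (simp add: exp_minus mult_ac)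
    moreover have "0 < 1 + u\<^sup>2" by (simp add: add_pos_nonneg)
    ultimately show ?thesis by (simp add: pos_le_divide_eq)
  qed
  then show ?thesis using that C(1) by blast
qed

context gkdv
begin

section \<open>Pointwise bounds for the slow soliton and the phase\<close>

definition e1 :: real where "e1 = 1 / (real p - 1)"

lemma e1: "1 / 3 \<le> e1" "0 < e1" "e1 * real (p - 1) = 1"
  using p_cases by (auto simp: e1_def)

lemma q_bounds:
  obtains K where "K \<ge> 1"
    "\<And>c s. 0 < c \<Longrightarrow> c < 1 \<Longrightarrow> \<bar>q c s\<bar> \<le> K * c powr e1 * exp (- (sqrt c * \<bar>s\<bar>))"
    "\<And>c s. 0 < c \<Longrightarrow> c < 1 \<Longrightarrow> \<bar>qs c s\<bar> \<le> K * c powr (e1 + 1 / 2) * exp (- (sqrt c * \<bar>s\<bar>))"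
proof -
  obtain K where K: "K > 0" "\<And>x. Q x \<le> K * exp (- \<bar>x\<bar>)" by (rule Q_bounds) blast
  define M where "M = max 1 K"
  have M: "1 \<le> M" "Q x \<le> M * exp (- \<bar>x\<bar>)" for x
    using order_trans[OF K(2) mult_right_mono[of K M "exp (- \<bar>x\<bar>)" for x]] by (auto simp: M_def)
  have ab: "\<bar>sqrt c * s\<bar> = sqrt c * \<bar>s\<bar>" if "0 < c" for c s using that by (simp add: abs_mult)
  have 1: "\<bar>q c s\<bar> \<le> M * c powr e1 * exp (- (sqrt c * \<bar>s\<bar>))" if "0 < c" "c < 1" for c s
  proof -
    have "\<bar>q c s\<bar> = c powr e1 * Q (sqrt c * s)"
      using that Q_pos by (simp add: q_def Qc_def e1_def abs_mult less_imp_le)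
    also have "\<dots> \<le> c powr e1 * (M * exp (- \<bar>sqrt c * s\<bar>))" by (intro mult_left_mono M) simp
    finally show ?thesis using ab[OF that(1)] by (simp add: mult_ac)
  qed
  have 2: "\<bar>qs c s\<bar> \<le> M * c powr (e1 + 1 / 2) * exp (- (sqrt c * \<bar>s\<bar>))" if "0 < c" "c < 1" for c s
  proof -
    have "c powr (e1 + 1 / 2) = c powr e1 * sqrt c" using that by (simp add: powr_add powr_half_sqrt)
    moreover have "\<bar>qs c s\<bar> = c powr e1 * sqrt c * \<bar>Qd (sqrt c * s)\<bar>"
      using that by (simp add: qs_def e1_def abs_mult)
    moreover have "c powr e1 * sqrt c * \<bar>Qd (sqrt c * s)\<bar> \<le> c powr e1 * sqrt c * (M * exp (- \<bar>sqrt c * s\<bar>))"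
      using that by (intro mult_left_mono order_trans[OF Qd_le_Q M(2)]) simp
    ultimately show ?thesis using ab[OF that(1)] by (simp add: mult_ac)
  qed
  show ?thesis using that[OF M(1) 1 2] .
qed

lemma q_power_bounds:
  assumes "k > 0"
  obtains K where "K \<ge> 1"
    "\<And>c s. 0 < c \<Longrightarrow> c < 1 \<Longrightarrow> \<bar>q c s ^ k\<bar> \<le> K * c powr (real k * e1) * exp (- (sqrt c * \<bar>s\<bar>))"
    "\<And>c s. 0 < c \<Longrightarrow> c < 1 \<Longrightarrow> \<bar>real k * q c s ^ (k - 1) * qs c s\<bar> \<le> K * c powr (real k * e1 + 1 / 2) * exp (- (sqrt c * \<bar>s\<bar>))"
proof -
  obtain M where M: "M \<ge> 1"
    "\<And>c s. 0 < c \<Longrightarrow> c < 1 \<Longrightarrow> \<bar>q c s\<bar> \<le> M * c powr e1 * exp (- (sqrt c * \<bar>s\<bar>))"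
    "\<And>c s. 0 < c \<Longrightarrow> c < 1 \<Longrightarrow> \<bar>qs c s\<bar> \<le> M * c powr (e1 + 1 / 2) * exp (- (sqrt c * \<bar>s\<bar>))"
    by (rule q_bounds) blast
  obtain j where j: "k = Suc j" using assms by (cases k) auto
  have pw: "\<bar>q c s ^ j\<bar> \<le> M ^ j * c powr (real j * e1)" if c: "0 < c" "c < 1" for c s
  proof -
    have "M * c powr e1 * exp (- (sqrt c * \<bar>s\<bar>)) \<le> M * c powr e1 * 1"
      using M(1) c by (intro mult_left_mono) auto
    then have "\<bar>q c s\<bar> \<le> M * c powr e1" using M(2)[OF c, of s] by linarith
    then have "\<bar>q c s\<bar> ^ j \<le> (M * c powr e1) ^ j" by (intro power_mono) auto
    also have "\<dots> = M ^ j * c powr (real j * e1)"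
      using c by (simp add: power_mult_distrib powr_power mult.commute)
    finally show ?thesis by (simp add: power_abs)
  qed
  have 1: "\<bar>q c s ^ k\<bar> \<le> real k * M ^ k * c powr (real k * e1) * exp (- (sqrt c * \<bar>s\<bar>))" if c: "0 < c" "c < 1" for c s
  proof -
    have "\<bar>q c s ^ j\<bar> * \<bar>q c s\<bar> \<le> (M ^ j * c powr (real j * e1)) * (M * c powr e1 * exp (- (sqrt c * \<bar>s\<bar>)))"
      using pw[OF c] M(2)[OF c] M(1) by (intro mult_mono) auto
    also have "\<dots> = 1 * (M ^ k * (c powr (real j * e1) * c powr e1) * exp (- (sqrt c * \<bar>s\<bar>)))" by (simp add: j mult_ac)
    also have "c powr (real j * e1) * c powr e1 = c powr (real k * e1)"
      by (simp add: powr_add[symmetric] j distrib_right add.commute)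
    also have "1 * (M ^ k * c powr (real k * e1) * exp (- (sqrt c * \<bar>s\<bar>))) \<le>
        real k * (M ^ k * c powr (real k * e1) * exp (- (sqrt c * \<bar>s\<bar>)))"
      using assms M(1) by (intro mult_right_mono) auto
    finally show ?thesis by (simp add: j abs_mult mult_ac)
  qed
  have 2: "\<bar>real k * q c s ^ (k - 1) * qs c s\<bar> \<le> real k * M ^ k * c powr (real k * e1 + 1 / 2) * exp (- (sqrt c * \<bar>s\<bar>))"
    if c: "0 < c" "c < 1" for c s
  proof -
    have "\<bar>q c s ^ j\<bar> * \<bar>qs c s\<bar> \<le> (M ^ j * c powr (real j * e1)) * (M * c powr (e1 + 1 / 2) * exp (- (sqrt c * \<bar>s\<bar>)))"
      using pw[OF c] M(3)[OF c] M(1) by (intro mult_mono) auto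
    also have "\<dots> = M ^ k * (c powr (real j * e1) * c powr (e1 + 1 / 2)) * exp (- (sqrt c * \<bar>s\<bar>))" by (simp add: j mult_ac)
    also have "c powr (real j * e1) * c powr (e1 + 1 / 2) = c powr (real k * e1 + 1 / 2)"
      unfolding powr_add[symmetric] by (simp add: j distrib_right add_ac)
    finally have "real k * (\<bar>q c s ^ j\<bar> * \<bar>qs c s\<bar>) \<le> real k * (M ^ k * c powr (real k * e1 + 1 / 2) * exp (- (sqrt c * \<bar>s\<bar>)))"
      by (rule mult_left_mono) simp
    then show ?thesis by (simp add: j abs_mult mult_ac)
  qed
  have "1 * 1 \<le> real k * M ^ k" using assms M(1) by (intro mult_mono one_le_power) auto
  then show ?thesis using that[OF _ 1 2] by simp
qed

lemma bform_bound:
  obtains C where "C > 0" "\<And>c s y. 0 < c \<Longrightarrow> c < 1 \<Longrightarrow> \<bar>bform a k0 l0 c s y\<bar> \<le> C * c powr e1 * exp (- (sqrt c * \<bar>s\<bar>))"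
proof -
  \<comment> \<open>The guard \<open>k > 0\<close> makes a constant exist for every
    \<open>k\<close>, as the axiom of choice requires.\<close>
  define P where "P k K \<longleftrightarrow> (k > 0 \<longrightarrow> K \<ge> 1 \<and>
      (\<forall>c s. 0 < c \<and> c < 1 \<longrightarrow> \<bar>q c s ^ k\<bar> \<le> K * c powr (real k * e1) * exp (- (sqrt c * \<bar>s\<bar>))))" for k K
  have "\<exists>K. P k K" for k
  proof (cases "k > 0")
    case True
    obtain K where "K \<ge> 1"
      "\<And>c s. 0 < c \<Longrightarrow> c < 1 \<Longrightarrow> \<bar>q c s ^ k\<bar> \<le> K * c powr (real k * e1) * exp (- (sqrt c * \<bar>s\<bar>))"
      by (rule q_power_bounds[OF True]) blast
    then show ?thesis by (intro exI[of _ K]) (simp add: P_def)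
  qed (simp add: P_def)
  then have "\<exists>K. \<forall>k. P k (K k)" by (intro choice) blast
  then obtain K where KP: "\<And>k. P k (K k)" by blast
  have K: "K k \<ge> 1" if "k > 0" for k using KP[of k] that by (simp add: P_def)
  have Kq: "\<bar>q c s ^ k\<bar> \<le> K k * c powr (real k * e1) * exp (- (sqrt c * \<bar>s\<bar>))" if "k > 0" "0 < c" "c < 1" for k c s
    using KP[of k] that by (simp add: P_def)
  define C where "C = 1 + (\<Sum>k\<in>{1..k0}. \<Sum>l\<in>{0..l0}. \<bar>a k l\<bar> * K k)"
  have S0: "0 \<le> (\<Sum>k\<in>{1..k0}. \<Sum>l\<in>{0..l0}. \<bar>a k l\<bar> * K k)"
  proof (intro sum_nonneg mult_nonneg_nonneg)
    show "0 \<le> K k" if "k \<in> {1..k0}" for k using K[of k] that by simp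
  qed simp
  have "\<bar>bform a k0 l0 c s y\<bar> \<le> C * c powr e1 * exp (- (sqrt c * \<bar>s\<bar>))" if c: "0 < c" "c < 1" for c s y
  proof -
    define E where "E = c powr e1 * exp (- (sqrt c * \<bar>s\<bar>))"
    have E: "0 \<le> E" by (simp add: E_def)
    have tm: "\<bar>c ^ l * q c s ^ k * a k l\<bar> \<le> \<bar>a k l\<bar> * K k * E" if k: "k \<in> {1..k0}" for k l
    proof -
      have k': "k > 0" using k by simp
      have "c powr (real k * e1) \<le> c powr e1"
        using c k' e1(2) by (intro powr_mono') auto
      then have "K k * c powr (real k * e1) * exp (- (sqrt c * \<bar>s\<bar>)) \<le> K k * c powr e1 * exp (- (sqrt c * \<bar>s\<bar>))"
        using K[OF k'] by (intro mult_right_mono mult_left_mono) auto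
      then have "\<bar>q c s ^ k\<bar> \<le> K k * E" using Kq[OF k' c, of s] by (simp add: E_def mult_ac)
      moreover have "c ^ l \<le> 1" using c by (simp add: power_le_one)
      ultimately have "c ^ l * \<bar>q c s ^ k\<bar> \<le> 1 * (K k * E)" using c by (intro mult_mono) auto
      then have "c ^ l * \<bar>q c s ^ k\<bar> * \<bar>a k l\<bar> \<le> K k * E * \<bar>a k l\<bar>" by (intro mult_right_mono) auto
      then show ?thesis using c by (simp add: abs_mult mult_ac)
    qed
    have "\<bar>bform a k0 l0 c s y\<bar> \<le> (\<Sum>k\<in>{1..k0}. \<Sum>l\<in>{0..l0}. \<bar>a k l\<bar> * K k * E)"
      unfolding bform_apply by (intro order_trans[OF sum_abs] sum_mono tm)
    also have "\<dots> = (\<Sum>k\<in>{1..k0}. \<Sum>l\<in>{0..l0}. \<bar>a k l\<bar> * K k) * E" by (simp add: sum_distrib_right)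
    also have "\<dots> \<le> C * E" unfolding C_def using E by (intro mult_right_mono) auto
    finally show ?thesis by (simp add: E_def mult.assoc)
  qed
  then show ?thesis using that[of C] S0 by (simp add: C_def)
qed

lemma alpha_0: "alpha p a c k0 l0 0 = 0"
  by (simp add: alpha_def zero_ereal_def)

text \<open>Integrating the decay \<open>exp (- (sqrt c * \<bar>s\<bar>))\<close> costs
  \<open>1 / sqrt c\<close>. The small factor \<open>c powr e1\<close> is given away, since a bound
  of order \<open>Tc c\<close> is enough.\<close>

lemma alpha_bound:
  obtains C where "C > 0" "\<And>c s. 0 < c \<Longrightarrow> c < 1 \<Longrightarrow> \<bar>alpha p a c k0 l0 s\<bar> \<le> C * c powr (- 1 / 2)"
proof -
  obtain C where C: "C > 0" "\<And>c s y. 0 < c \<Longrightarrow> c < 1 \<Longrightarrow> \<bar>bform a k0 l0 c s y\<bar> \<le> C * c powr e1 * exp (- (sqrt c * \<bar>s\<bar>))"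
    using bform_bound[of a k0 l0] by blast
  have "\<bar>alpha p a c k0 l0 s\<bar> \<le> C * c powr (- 1 / 2)" if c: "0 < c" "c < 1" for c s
  proof -
    have sc: "sqrt c > 0" using c by simp
    have le: "\<bar>bform a k0 l0 c s 0\<bar> \<le> C * exp (- (sqrt c * \<bar>s\<bar>))" for s
    proof -
      have "C * c powr e1 * exp (- (sqrt c * \<bar>s\<bar>)) \<le> C * 1 * exp (- (sqrt c * \<bar>s\<bar>))"
        using C(1) powr_le_one[OF c, of e1] e1 by (intro mult_right_mono mult_left_mono) auto
      then show ?thesis using C(2)[OF c, of s 0] by simp
    qed
    have "\<bar>alpha p a c k0 l0 s\<bar> \<le> - (C / sqrt c) * exp (- (sqrt c * \<bar>s\<bar>)) - - (C / sqrt c) * exp (- (sqrt c * 0))"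
    proof (rule prim_bound[OF DERIV_alpha[OF c(1)] alpha_0, where h = "\<lambda>s. C * exp (- (sqrt c * s))"])
      fix x
      have "((\<lambda>x. - (C / sqrt c) * exp (- (sqrt c * x))) has_real_derivative - (C / sqrt c) * (exp (- (sqrt c * x)) * (- (sqrt c * 1)))) (at x)"
        by (intro DERIV_cmult DERIV_chain2[OF DERIV_exp] DERIV_minus DERIV_ident)
      then show "((\<lambda>x. - (C / sqrt c) * exp (- (sqrt c * x))) has_real_derivative C * exp (- (sqrt c * x))) (at x)"
        using sc by (simp add: mult_ac)
    qed (rule le)
    also have "\<dots> \<le> C / sqrt c" using C(1) sc by simp
    also have "\<dots> = C * c powr (- 1 / 2)"
      using c powr_minus_divide[of c "1 / 2"] powr_half_sqrt[of c] by simp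
    finally show ?thesis .
  qed
  then show ?thesis using that C(1) by blast
qed

text \<open>Growth in \<open>y\<close> is split into a factor \<open>N\<close>, which costs
  \<open>N ^ d\<close>, and growth in the slow variable \<open>sqrt c * s\<close>, which the
  exponential decay of \<open>q\<close> absorbs. The derivative \<open>(q ^ k)'\<close> gains an
  additional \<open>c powr (1 / 2)\<close>.\<close>

lemma term_bounds:
  assumes F: "grows (real d) F" and k: "k > 0"
  obtains C where "C > 0"
    "\<And>c s y N. 0 < c \<Longrightarrow> c < 1 \<Longrightarrow> 1 + \<bar>y\<bar> \<le> N * (1 + sqrt c * \<bar>s\<bar>) \<Longrightarrow>
       \<bar>termA k l F c s y\<bar> \<le> C * c powr (real l + real k * e1) * N ^ d / (1 + (sqrt c * s)\<^sup>2)"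
    "\<And>c s y N. 0 < c \<Longrightarrow> c < 1 \<Longrightarrow> 1 + \<bar>y\<bar> \<le> N * (1 + sqrt c * \<bar>s\<bar>) \<Longrightarrow>
       \<bar>termB k l F c s y\<bar> \<le> C * c powr (real l + real k * e1 + 1 / 2) * N ^ d / (1 + (sqrt c * s)\<^sup>2)"
proof -
  obtain K where K: "K \<ge> 1"
    "\<And>c s. 0 < c \<Longrightarrow> c < 1 \<Longrightarrow> \<bar>q c s ^ k\<bar> \<le> K * c powr (real k * e1) * exp (- (sqrt c * \<bar>s\<bar>))"
    "\<And>c s. 0 < c \<Longrightarrow> c < 1 \<Longrightarrow> \<bar>real k * q c s ^ (k - 1) * qs c s\<bar> \<le> K * c powr (real k * e1 + 1 / 2) * exp (- (sqrt c * \<bar>s\<bar>))"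
    by (rule q_power_bounds[OF k]) blast
  obtain B where B: "B > 0" "\<And>x. \<bar>F x\<bar> \<le> B * (1 + \<bar>x\<bar>) powr real d"
    by (rule poly_boundedE[OF grows_bounded[OF F]]) blast
  obtain W :: real where W: "W > 0" "\<And>u. 0 \<le> u \<Longrightarrow> (1 + u) ^ d * exp (- u) \<le> W / (1 + u\<^sup>2)"
    by (rule weight_exp[of d]) blast
  have main: "\<bar>c ^ l * z * F y\<bar> \<le> (K * B * W) * c powr (real l + e) * N ^ d / (1 + (sqrt c * s)\<^sup>2)"
    if c: "0 < c" "c < 1" and N: "1 + \<bar>y\<bar> \<le> N * (1 + sqrt c * \<bar>s\<bar>)"
      and z: "\<bar>z\<bar> \<le> K * c powr e * exp (- (sqrt c * \<bar>s\<bar>))" for c s y N z e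
  proof -
    define u where "u = sqrt c * \<bar>s\<bar>"
    have u: "0 \<le> u" "u\<^sup>2 = (sqrt c * s)\<^sup>2" using c by (simp_all add: u_def power_mult_distrib)
    have "0 < N * (1 + u)" using N unfolding u_def by linarith
    then have N0: "0 \<le> N" using u(1) by (simp add: zero_less_mult_iff)
    have nn: "0 \<le> B * N ^ d * (1 + u) ^ d" "0 \<le> K * B * c powr (real l + e) * N ^ d"
      using B(1) K(1) N0 u(1) by simp_all
    have z': "\<bar>z\<bar> \<le> K * c powr e * exp (- u)" using z unfolding u_def .
    have "\<bar>F y\<bar> \<le> B * (1 + \<bar>y\<bar>) ^ d" using B(2)[of y] by (simp add: powr_realpow)
    also have "\<dots> \<le> B * (N * (1 + u)) ^ d"
      using B(1) by (intro mult_left_mono power_mono N[folded u_def]) simp_all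
    finally have Fy: "\<bar>F y\<bar> \<le> B * N ^ d * (1 + u) ^ d" by (simp add: power_mult_distrib mult_ac)
    have "\<bar>c ^ l * z * F y\<bar> = c powr real l * (\<bar>z\<bar> * \<bar>F y\<bar>)"
      using c by (simp add: abs_mult powr_realpow)
    also have "\<dots> \<le> c powr real l * ((K * c powr e * exp (- u)) * (B * N ^ d * (1 + u) ^ d))"
      by (intro mult_left_mono mult_mono'[OF z' Fy]) simp_all
    also have "\<dots> = (K * B * c powr (real l + e) * N ^ d) * ((1 + u) ^ d * exp (- u))"
      by (simp add: powr_add mult_ac)
    also have "\<dots> \<le> (K * B * c powr (real l + e) * N ^ d) * (W / (1 + u\<^sup>2))"
      by (rule mult_left_mono[OF W(2)[OF u(1)] nn(2)])
    also have "\<dots> = (K * B * W) * c powr (real l + e) * N ^ d / (1 + (sqrt c * s)\<^sup>2)"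
      unfolding u(2) by simp
    finally show ?thesis .
  qed
  have "K * B * W > 0" using K(1) B(1) W(1) by simp
  then show ?thesis
  proof (rule that)
    fix c s y N :: real assume c: "0 < c" "c < 1" "1 + \<bar>y\<bar> \<le> N * (1 + sqrt c * \<bar>s\<bar>)"
    show "\<bar>termA k l F c s y\<bar> \<le> K * B * W * c powr (real l + real k * e1) * N ^ d / (1 + (sqrt c * s)\<^sup>2)"
      unfolding termA_def by (rule main[OF c K(2)[OF c(1,2)]])
    show "\<bar>termB k l F c s y\<bar> \<le> K * B * W * c powr (real l + real k * e1 + 1 / 2) * N ^ d / (1 + (sqrt c * s)\<^sup>2)"
      unfolding termB_def using main[OF c K(3)[OF c(1,2)]] by (simp add: add.assoc)
  qed
qed

end

section \<open>Size of the interaction terms\<close>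

text \<open>The slow variable has derivative \<open>sqrt c\<close>; the resulting loss
  \<open>1 / sqrt c\<close> in the squared norm is the \<open>1 / 4\<close> in the exponents
  below.\<close>

lemma sq_le_decay:
  fixes f :: "real \<Rightarrow> real"
  assumes c: "0 < c" and f: "\<And>x. isCont f x" "\<And>x. \<bar>f x\<bar> \<le> E / (1 + (sqrt c * (x + \<tau>))\<^sup>2)" and E: "0 \<le> E"
  shows "sq_le f (E\<^sup>2 * pi / sqrt c)"
proof (rule sq_le_arctan[where u = "\<lambda>x. sqrt c * (x + \<tau>)" and u' = "\<lambda>_. sqrt c"])
  show "((\<lambda>x. sqrt c * (x + \<tau>)) has_real_derivative sqrt c) (at x)" for x
    using DERIV_cmult[OF DERIV_add[OF DERIV_ident DERIV_const[of \<tau>]], of "sqrt c"] by simp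
  show "(f x)\<^sup>2 \<le> E\<^sup>2 / (1 + (sqrt c * (x + \<tau>))\<^sup>2)" for x
  proof -
    define w where "w = 1 + (sqrt c * (x + \<tau>))\<^sup>2"
    have w: "1 \<le> w" by (simp add: w_def)
    have "\<bar>f x\<bar>\<^sup>2 \<le> (E / w)\<^sup>2" using f(2)[of x] unfolding w_def[symmetric] by (intro power_mono) auto
    also have "\<dots> = E\<^sup>2 / (w * w)" by (simp add: power_divide power2_eq_square)
    also have "\<dots> \<le> E\<^sup>2 / (1 * w)" using w by (intro divide_left_mono mult_right_mono) auto
    finally show ?thesis by (simp add: w_def)
  qed
qed (use c f in auto)

lemma Tc_ge_1: "0 < c \<Longrightarrow> c < 1 \<Longrightarrow> 1 \<le> Tc c"
  using powr_mono'[of "-(1/2 + 1/100)" 0 c] by (simp add: Tc_def)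

lemma Tc_ge_inverse_sqrt: "0 < c \<Longrightarrow> c < 1 \<Longrightarrow> c powr (- 1 / 2) \<le> Tc c"
  unfolding Tc_def by (rule powr_mono') auto

context gkdv
begin

lemma D_le: "k > 0 \<Longrightarrow> real (D k l) \<le> (real k - 1) * e1 + real l"
proof -
  assume k: "k > 0"
  have "(p - 1) * D k l \<le> k + (p - 1) * l - 1" unfolding D_def by (rule times_div_less_eq_dividend)
  then have "(p - 1) * D k l + 1 \<le> k + (p - 1) * l" using k by linarith
  then have "real ((p - 1) * D k l + 1) \<le> real (k + (p - 1) * l)" by (rule of_nat_mono)
  then have "real (p - 1) * real (D k l) \<le> (real k - 1) + real (p - 1) * real l" by simp
  then have "e1 * (real (p - 1) * real (D k l)) \<le> e1 * ((real k - 1) + real (p - 1) * real l)"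
    using e1(2) by (intro mult_left_mono) auto
  moreover have "e1 * (real (p - 1) * real (D k l)) = real (D k l)" "e1 * (real (p - 1) * real l) = real l"
    using e1(3) by (simp_all only: mult.assoc[symmetric] mult_1_left)
  ultimately have "real (D k l) \<le> e1 * (real k - 1) + real l" by (simp only: distrib_left)
  then show ?thesis by (simp only: mult.commute)
qed

lemma isCont_lift: "0 < c \<Longrightarrow> f \<in> \<A> \<Longrightarrow> isCont (lift (alpha p a c k0 l0) c t f) x"
  by (rule DERIV_isCont[OF DERIV_lift[where \<beta> = "bform a k0 l0"]]) (auto intro: DERIV_alpha)

text \<open>Uniformly in \<open>c\<close> and in the admissible times the norm is of order
  \<open>c powr e\<close>; the exponent is doubled because \<open>sq_le\<close> bounds the
  square.\<close>

definition uL :: "(nat \<Rightarrow> nat \<Rightarrow> real) \<Rightarrow> nat \<Rightarrow> nat \<Rightarrow> real \<Rightarrow> field3 \<Rightarrow> bool" where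
  "uL a k0 l0 e f \<longleftrightarrow> (\<exists>K. \<forall>c t. 0 < c \<and> c < 1 \<and> - Tc c \<le> t \<and> t \<le> Tc c \<longrightarrow>
     sq_le (lift (alpha p a c k0 l0) c t f) (K * c powr (2 * e)))"

lemma uL_zero: "uL a k0 l0 e 0"
  unfolding uL_def by (intro exI[of _ 0]) (simp add: lift_def[abs_def] fun_app sq_le_zero)

lemma uL_add:
  assumes "uL a k0 l0 e f" "uL a k0 l0 e g" shows "uL a k0 l0 e (f + g)"
proof -
  obtain K L where
    K: "\<And>c t. 0 < c \<and> c < 1 \<and> - Tc c \<le> t \<and> t \<le> Tc c \<Longrightarrow> sq_le (lift (alpha p a c k0 l0) c t f) (K * c powr (2 * e))"
    and L: "\<And>c t. 0 < c \<and> c < 1 \<and> - Tc c \<le> t \<and> t \<le> Tc c \<Longrightarrow> sq_le (lift (alpha p a c k0 l0) c t g) (L * c powr (2 * e))"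
    using assms unfolding uL_def by blast
  have "sq_le (lift (alpha p a c k0 l0) c t (f + g)) ((2 * K + 2 * L) * c powr (2 * e))"
    if "0 < c \<and> c < 1 \<and> - Tc c \<le> t \<and> t \<le> Tc c" for c t
  proof -
    have "sq_le (\<lambda>x. lift (alpha p a c k0 l0) c t f x + lift (alpha p a c k0 l0) c t g x)
        (2 * (K * c powr (2 * e)) + 2 * (L * c powr (2 * e)))"
      by (rule sq_le_add[OF K[OF that] L[OF that]])
    then show ?thesis by (simp add: lift_add[abs_def] algebra_simps)
  qed
  then show ?thesis unfolding uL_def by blast
qed

text \<open>For admissible times \<open>y\<close> differs from \<open>s\<close> by at most
  \<open>\<bar>t\<bar> + \<bar>\<alpha>\<bar>\<close>, of order \<open>Tc c\<close>, and
  \<open>\<bar>s\<bar>\<close> is at most \<open>Tc c * (sqrt c * \<bar>s\<bar>)\<close> since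
  \<open>Tc c\<close> exceeds \<open>1 / sqrt c\<close>. This supplies \<open>N = M * Tc c\<close>
  for \<open>term_bounds\<close>.\<close>

lemma position_bound:
  obtains M where "M > 0" "\<And>c t x. 0 < c \<Longrightarrow> c < 1 \<Longrightarrow> - Tc c \<le> t \<Longrightarrow> t \<le> Tc c \<Longrightarrow>
     1 + \<bar>x - alpha p a c k0 l0 (x + (1 - c) * t)\<bar> \<le> (M * Tc c) * (1 + sqrt c * \<bar>x + (1 - c) * t\<bar>)"
proof -
  obtain C where C: "C > 0" "\<And>c s. 0 < c \<Longrightarrow> c < 1 \<Longrightarrow> \<bar>alpha p a c k0 l0 s\<bar> \<le> C * c powr (- 1 / 2)"
    by (rule alpha_bound) blast
  have "1 + \<bar>x - alpha p a c k0 l0 (x + (1 - c) * t)\<bar> \<le> ((2 + C) * Tc c) * (1 + sqrt c * \<bar>x + (1 - c) * t\<bar>)"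
    if c: "0 < c" "c < 1" and t: "- Tc c \<le> t" "t \<le> Tc c" for c t x
  proof -
    define s where "s = x + (1 - c) * t"
    define w where "w = sqrt c * \<bar>s\<bar>"
    have w: "0 \<le> w" using c by (simp add: w_def)
    have i: "c powr (- 1 / 2) * sqrt c = 1"
      using c powr_half_sqrt[of c] powr_add[of c "-1/2" "1/2"] by simp
    have "\<bar>s\<bar> = c powr (- 1 / 2) * w"
      using i by (simp add: w_def mult.assoc[symmetric])
    also have "\<dots> \<le> Tc c * w" using w by (intro mult_right_mono Tc_ge_inverse_sqrt c)
    finally have s: "\<bar>s\<bar> \<le> Tc c * w" .
    have "\<bar>(1 - c) * t\<bar> \<le> 1 * Tc c"
      unfolding abs_mult using c t by (intro mult_mono) (auto simp: abs_le_iff)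
    moreover have "\<bar>x\<bar> \<le> \<bar>s\<bar> + \<bar>(1 - c) * t\<bar>" unfolding s_def by linarith
    ultimately have x: "\<bar>x\<bar> \<le> Tc c * w + Tc c" using s by linarith
    have "C * c powr (- 1 / 2) \<le> C * Tc c" using C(1) by (intro mult_left_mono Tc_ge_inverse_sqrt c) simp
    then have "\<bar>alpha p a c k0 l0 s\<bar> \<le> C * Tc c" using C(2)[OF c, of s] by linarith
    then have "1 + \<bar>x - alpha p a c k0 l0 s\<bar> \<le> Tc c + (Tc c * w + Tc c) + C * Tc c"
      using x Tc_ge_1[OF c] abs_triangle_ineq4[of x "alpha p a c k0 l0 s"] by linarith
    also have "\<dots> = (2 + C) * Tc c * 1 + 1 * Tc c * w" by (simp add: algebra_simps)
    also have "\<dots> \<le> (2 + C) * Tc c * 1 + (2 + C) * Tc c * w"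
      using C(1) Tc_ge_1[OF c] w by (intro add_left_mono mult_right_mono) auto
    finally show ?thesis by (simp add: distrib_left s_def w_def)
  qed
  then show ?thesis using that[of "2 + C"] C(1) by simp
qed

text \<open>Each degree costs \<open>51 / 100\<close>, the exponent of \<open>Tc\<close>, and the
  norm of the slow profile costs \<open>1 / 4\<close>.\<close>

lemma uL_of_bound:
  assumes f: "f \<in> \<A>" and C: "C > 0"
    and b: "\<And>c s y N. 0 < c \<Longrightarrow> c < 1 \<Longrightarrow> 1 + \<bar>y\<bar> \<le> N * (1 + sqrt c * \<bar>s\<bar>) \<Longrightarrow>
       \<bar>f c s y\<bar> \<le> C * c powr E * N ^ d / (1 + (sqrt c * s)\<^sup>2)"
    and e: "e \<le> E - 51 / 100 * real d - 1 / 4"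
  shows "uL a k0 l0 e f"
proof -
  obtain M where M: "M > 0" "\<And>c t x. 0 < c \<Longrightarrow> c < 1 \<Longrightarrow> - Tc c \<le> t \<Longrightarrow> t \<le> Tc c \<Longrightarrow>
     1 + \<bar>x - alpha p a c k0 l0 (x + (1 - c) * t)\<bar> \<le> (M * Tc c) * (1 + sqrt c * \<bar>x + (1 - c) * t\<bar>)"
    by (rule position_bound) blast
  have "sq_le (lift (alpha p a c k0 l0) c t f) ((C * M ^ d)\<^sup>2 * pi * c powr (2 * e))"
    if ct: "0 < c \<and> c < 1 \<and> - Tc c \<le> t \<and> t \<le> Tc c" for c t
  proof -
    have c: "0 < c" "c < 1" using ct by auto
    define B where "B = C * c powr E * (M * Tc c) ^ d"
    have "sq_le (lift (alpha p a c k0 l0) c t f) (B\<^sup>2 * pi / sqrt c)"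
    proof (rule sq_le_decay[OF c(1) isCont_lift[OF c(1) f], where \<tau> = "(1 - c) * t"])
      show "\<bar>lift (alpha p a c k0 l0) c t f x\<bar> \<le> B / (1 + (sqrt c * (x + (1 - c) * t))\<^sup>2)" for x
        unfolding lift_def B_def by (rule b[OF c M(2)]) (use ct in auto)
      show "0 \<le> B" using C M(1) Tc_ge_1[OF c] by (simp add: B_def)
    qed
    moreover have "B\<^sup>2 * pi / sqrt c \<le> (C * M ^ d)\<^sup>2 * pi * c powr (2 * e)"
    proof -
      have T: "Tc c ^ d = c powr (- (51 / 100) * real d)"
      proof -
        have "Tc c ^ d = (c powr - (51 / 100)) ^ d" by (simp add: Tc_def)
        also have "\<dots> = c powr (real d * - (51 / 100))" using c by (simp only: powr_power)
        finally show ?thesis by (simp only: mult.commute)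
      qed
      have "B = (C * M ^ d) * c powr (E - 51 / 100 * real d)"
      proof -
        have "c powr E * c powr (- (51 / 100) * real d) = c powr (E - 51 / 100 * real d)"
          unfolding powr_add[symmetric] by (rule arg_cong[of _ _ "(powr) c"]) simp
        moreover have "B = (C * M ^ d) * (c powr E * c powr (- (51 / 100) * real d))"
          unfolding B_def power_mult_distrib T by (simp only: mult_ac)
        ultimately show ?thesis by (simp only:)
      qed
      then have "B\<^sup>2 = (C * M ^ d)\<^sup>2 * (c powr (E - 51 / 100 * real d))\<^sup>2" by (simp only: power_mult_distrib)
      also have "(c powr (E - 51 / 100 * real d))\<^sup>2 = c powr (2 * (E - 51 / 100 * real d))"
        using c powr_power[of c "E - 51 / 100 * real d" 2] by simp
      finally have "B\<^sup>2 * pi / sqrt c = (C * M ^ d)\<^sup>2 * pi * (c powr (2 * (E - 51 / 100 * real d)) / c powr (1 / 2))"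
        using c by (simp add: powr_half_sqrt)
      also have "c powr (2 * (E - 51 / 100 * real d)) / c powr (1 / 2) = c powr (2 * (E - 51 / 100 * real d) - 1 / 2)"
        by (rule powr_diff[symmetric])
      also have "(C * M ^ d)\<^sup>2 * pi * c powr (2 * (E - 51 / 100 * real d) - 1 / 2) \<le> (C * M ^ d)\<^sup>2 * pi * c powr (2 * e)"
        using c e by (intro mult_left_mono powr_mono') auto
      finally show ?thesis .
    qed
    ultimately show ?thesis by (rule sq_le_mono)
  qed
  then show ?thesis unfolding uL_def by blast
qed

lemma uL_termA:
  assumes "grows (real d) F" "k > 0" "termA k l F \<in> \<A>" "e \<le> real l + real k * e1 - 51 / 100 * real d - 1 / 4"
  shows "uL a k0 l0 e (termA k l F)"
proof -
  obtain C where C: "C > 0"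
    "\<And>c s y N. 0 < c \<Longrightarrow> c < 1 \<Longrightarrow> 1 + \<bar>y\<bar> \<le> N * (1 + sqrt c * \<bar>s\<bar>) \<Longrightarrow>
       \<bar>termA k l F c s y\<bar> \<le> C * c powr (real l + real k * e1) * N ^ d / (1 + (sqrt c * s)\<^sup>2)"
    by (rule term_bounds[OF assms(1,2)]) blast
  show ?thesis by (rule uL_of_bound[OF assms(3) C assms(4)])
qed

lemma uL_termB:
  assumes "grows (real d) F" "k > 0" "termB k l F \<in> \<A>" "e \<le> real l + real k * e1 + 1 / 2 - 51 / 100 * real d - 1 / 4"
  shows "uL a k0 l0 e (termB k l F)"
proof -
  obtain C where C: "C > 0"
    "\<And>c s y N. 0 < c \<Longrightarrow> c < 1 \<Longrightarrow> 1 + \<bar>y\<bar> \<le> N * (1 + sqrt c * \<bar>s\<bar>) \<Longrightarrow>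
       \<bar>termB k l F c s y\<bar> \<le> C * c powr (real l + real k * e1 + 1 / 2) * N ^ d / (1 + (sqrt c * s)\<^sup>2)"
    by (rule term_bounds[OF assms(1,2)]) blast
  show ?thesis by (rule uL_of_bound[OF assms(3) C assms(4)])
qed

lemma uL_T:
  assumes "f \<in> T 1 I" "I \<subseteq> pos"
    and e: "\<And>k l. (k, l) \<in> I \<Longrightarrow> e \<le> real l + real k * e1 - 51 / 100 * real (D k l) - 1 / 4"
  shows "uL a k0 l0 e f"
  using assms(1)
proof (induction rule: T_induct)
  case zero show ?case by (rule uL_zero)
next
  case (add f g) then show ?case by (intro uL_add)
next
  case (A k l F)
  then have kl: "(k, l) \<in> I" "k > 0" using assms(2) by (auto simp: coef_def pos_def)
  show ?case by (rule uL_termA[OF coef_D[OF A] kl(2) T_subset[OF T_A[OF A]] e[OF kl(1)]])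
next
  case (B k l F)
  then have kl: "(k, l) \<in> I" "k > 0" using assms(2) by (auto simp: coef_def pos_def)
  show ?case using e[OF kl(1)] by (intro uL_termB[OF coef_D[OF B] kl(2) T_subset[OF T_B[OF B]]]) linarith
qed

text \<open>With \<open>r\<close> as defined below, \<open>D k l \<le> r\<close> leaves at least
  \<open>49 / 100 * r + e1 - 1 / 4\<close>. Outside the rectangle \<open>r\<close> dominates the
  minimum, and \<open>e1 \<ge> 1 / 3\<close> covers the \<open>1 / 4\<close>.\<close>

lemma Irect_exponent:
  assumes "(k, l) \<in> Irect k0 l0"
  shows "(1/2 - 1/100) * min (real k0 / (real p - 1)) (1 + real l0) \<le> real l + real k * e1 - 51 / 100 * real (D k l) - 1 / 4"
proof -
  have k: "k > 0" "k > k0 \<or> l > l0" using assms by (auto simp: Irect_def)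
  define r where "r = (real k - 1) * e1 + real l"
  have D: "real (D k l) \<le> r" unfolding r_def by (rule D_le[OF k(1)])
  have "min (real k0 / (real p - 1)) (1 + real l0) \<le> r"
  proof (cases "k > k0")
    case True
    then have "real k0 * e1 \<le> (real k - 1) * e1" using e1(2) by (intro mult_right_mono) auto
    moreover have "real k0 / (real p - 1) = real k0 * e1" by (simp add: e1_def)
    ultimately have "real k0 / (real p - 1) \<le> r" unfolding r_def by simp
    then show ?thesis by simp
  next
    case False
    then have "1 + real l0 \<le> real l" using k(2) by simp
    moreover have "0 \<le> (real k - 1) * e1" using k(1) e1(2) by simp
    ultimately have "1 + real l0 \<le> r" unfolding r_def by linarith
    then show ?thesis by simp
  qed
  moreover have "real k * e1 + real l = r + e1" by (simp add: r_def algebra_simps)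
  moreover have "49 / 100 * \<mu> \<le> b + a - 51 / 100 * d - 1 / 4"
    if "\<mu> \<le> r" "a + b = r + e1" "d \<le> r" for \<mu> a b d using that e1(1) by linarith
  ultimately show ?thesis using D by simp
qed

lemma Iup_1_0: "Iup 1 0 = pos" by (auto simp: Iup_def pos_def)

text \<open>Away from \<open>(1, 0)\<close> the surplus \<open>r - 51 / 100 * D k l\<close> alone
  pays the \<open>1 / 4\<close>: it is at least \<open>1 / 3\<close> when the degree is 0, and at
  least \<open>49 / 100\<close> otherwise.\<close>

lemma Iup'_exponent:
  assumes "(k, l) \<in> Iup' 1 0"
  shows "e1 \<le> real l + real k * e1 - 51 / 100 * real (D k l) - 1 / 4"
proof -
  have k: "k > 0" "(k, l) \<noteq> (1, 0)" using assms by (auto simp: Iup'_def Iup_def)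
  define r where "r = (real k - 1) * e1 + real l"
  have D: "real (D k l) \<le> r" unfolding r_def by (rule D_le[OF k(1)])
  have "1 / 4 \<le> r - 51 / 100 * real (D k l)"
  proof (cases "D k l = 0")
    case True
    have "1 / 3 \<le> r"
    proof (cases "l = 0")
      case l: True
      then have "1 \<le> real k - 1" using k by auto
      then have "1 * e1 \<le> (real k - 1) * e1" using e1(2) by (intro mult_right_mono) auto
      then have "e1 \<le> r" unfolding r_def l by simp
      then show ?thesis using e1(1) by linarith
    next
      case False
      moreover have "0 \<le> (real k - 1) * e1" using k(1) e1(2) by simp
      ultimately show ?thesis unfolding r_def by simp
    qed
    then show ?thesis using True by simp
  next
    case False
    then have "1 \<le> real (D k l)" by simp
    then show ?thesis using D by linarith
  qed
  moreover have "real k * e1 + real l = r + e1" by (simp add: r_def algebra_simps)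
  ultimately show ?thesis by linarith
qed

text \<open>The term \<open>q * F(y)\<close> would lose a factor \<open>c powr (-1/4)\<close> in the previous bounds. For small \<open>c\<close> the
  decay of \<open>F\<close> is used instead, with \<open>y\<close> as the integration variable; for \<open>c\<close> away from 0 the loss
  is harmless.\<close>

lemma uL_rapid:
  assumes F: "rapid F"
  shows "uL a k0 l0 e1 (termA 1 0 F)"
proof -
  have F0: "grows (real 0) F" using rapid_grows[OF F] by simp
  have "coef 0 UNIV 1 0 F" using F unfolding coef_def by auto
  then have mem: "termA 1 0 F \<in> \<A>" by (rule T_A)
  have "uL a k0 l0 (e1 - 1 / 4) (termA 1 0 F)"
    by (rule uL_termA[OF F0 _ mem]) auto
  then obtain K where K: "\<And>c t. 0 < c \<and> c < 1 \<and> - Tc c \<le> t \<and> t \<le> Tc c \<Longrightarrow>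
      sq_le (lift (alpha p a c k0 l0) c t (termA 1 0 F)) (K * c powr (2 * (e1 - 1 / 4)))"
    unfolding uL_def by blast
  obtain Cb where Cb: "Cb > 0" "\<And>c s y. 0 < c \<Longrightarrow> c < 1 \<Longrightarrow> \<bar>bform a k0 l0 c s y\<bar> \<le> Cb * c powr e1 * exp (- (sqrt c * \<bar>s\<bar>))"
    by (rule bform_bound) blast
  obtain Kq where Kq: "Kq \<ge> 1" "\<And>c s. 0 < c \<Longrightarrow> c < 1 \<Longrightarrow> \<bar>q c s\<bar> \<le> Kq * c powr e1 * exp (- (sqrt c * \<bar>s\<bar>))"
    by (rule q_bounds) blast
  obtain B where B: "B > 0" "\<And>x. \<bar>F x\<bar> \<le> B / (1 + \<bar>x\<bar>)" by (rule rapid_bound_inverse[OF F]) blast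
  \<comment> \<open>Below \<open>c0\<close> the slope \<open>1 - \<beta>\<close> of \<open>y\<close>
    as a function of \<open>x\<close> is at least \<open>1 / 2\<close>, which makes \<open>y\<close>
    admissible as the integration variable.\<close>
  define c0 where "c0 = (1 / (2 * Cb)) powr (1 / e1)"
  have c0: "c0 > 0" using Cb(1) by (simp add: c0_def)
  have small: "Cb * c powr e1 \<le> 1 / 2" if "0 < c" "c \<le> c0" for c
  proof -
    have "c powr e1 \<le> c0 powr e1" using that e1(2) by (intro powr_mono2) auto
    also have "\<dots> = 1 / (2 * Cb)" using Cb(1) e1(2) by (simp add: c0_def powr_powr)
    finally show ?thesis using Cb(1) by (simp add: field_simps)
  qed
  \<comment> \<open>The first entry serves \<open>c \<le> c0\<close>; the second replaces the lost
    factor \<open>c powr (- 1 / 2)\<close> of the squared norm by its value at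
    \<open>c0\<close>.\<close>
  define L where "L = max ((Kq * B)\<^sup>2 * pi / (1 / 2)) (\<bar>K\<bar> * c0 powr (- 1 / 2))"
  have "sq_le (lift (alpha p a c k0 l0) c t (termA 1 0 F)) (L * c powr (2 * e1))"
    if ct: "0 < c \<and> c < 1 \<and> - Tc c \<le> t \<and> t \<le> Tc c" for c t
  proof (cases "c \<le> c0")
    case True
    have c: "0 < c" "c < 1" using ct by auto
    have 1: "(1 :: field3) - bform a k0 l0 \<in> \<A>"
      unfolding bform_def by (intro T_diff \<A>_one T_sum T_A) (auto simp: coef_def intro!: exI[of _ 0] grows_const)
    have al: "(alpha p a c k0 l0 has_real_derivative bform a k0 l0 c s y) (at s)" for s y by (rule DERIV_alpha[OF c(1)])
    let ?u = "\<lambda>x. x - alpha p a c k0 l0 (x + (1 - c) * t)"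
    let ?E = "(Kq * B * c powr e1)\<^sup>2"
    have "sq_le (lift (alpha p a c k0 l0) c t (termA 1 0 F)) (?E * pi / (1 / 2))"
    proof (rule sq_le_arctan[where u = ?u and u' = "lift (alpha p a c k0 l0) c t (1 - bform a k0 l0)"])
      fix x
      have g: "((\<lambda>x. x + (1 - c) * t) has_real_derivative 1) (at x)"
        using DERIV_add[OF DERIV_ident DERIV_const] by simp
      show "(?u has_real_derivative lift (alpha p a c k0 l0) c t (1 - bform a k0 l0) x) (at x)"
        by (rule DERIV_cong[OF DERIV_diff[OF DERIV_ident DERIV_chain2[OF al g]]])
          (simp add: lift_def fun_app minus_apply)
      show "isCont (lift (alpha p a c k0 l0) c t (1 - bform a k0 l0)) x" by (rule isCont_lift[OF c(1) 1])
      show "isCont (lift (alpha p a c k0 l0) c t (termA 1 0 F)) x" by (rule isCont_lift[OF c(1) mem])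
      have "Cb * c powr e1 * exp (- (sqrt c * \<bar>x + (1 - c) * t\<bar>)) \<le> Cb * c powr e1 * 1"
        using Cb(1) c by (intro mult_left_mono) auto
      then have "\<bar>bform a k0 l0 c (x + (1 - c) * t) (?u x)\<bar> \<le> 1 / 2"
        using Cb(2)[OF c, of "x + (1 - c) * t" "?u x"] small[OF c(1) True] by linarith
      then show "1 / 2 \<le> lift (alpha p a c k0 l0) c t (1 - bform a k0 l0) x"
        by (simp add: lift_def fun_app minus_apply abs_le_iff)
      have "\<bar>q c s\<bar> \<le> Kq * c powr e1" for s
      proof -
        have "Kq * c powr e1 * exp (- (sqrt c * \<bar>s\<bar>)) \<le> Kq * c powr e1 * 1"
          using Kq(1) c by (intro mult_left_mono) auto
        then show ?thesis using Kq(2)[OF c, of s] by linarith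
      qed
      then have "\<bar>q c (x + (1 - c) * t)\<bar> * \<bar>F (?u x)\<bar> \<le> (Kq * c powr e1) * (B / (1 + \<bar>?u x\<bar>))"
        using Kq(1) by (intro mult_mono B) auto
      then have "\<bar>lift (alpha p a c k0 l0) c t (termA 1 0 F) x\<bar> \<le> (Kq * B * c powr e1) / (1 + \<bar>?u x\<bar>)"
        by (simp add: lift_def termA_def abs_mult mult_ac)
      then have "\<bar>lift (alpha p a c k0 l0) c t (termA 1 0 F) x\<bar>\<^sup>2 \<le> ((Kq * B * c powr e1) / (1 + \<bar>?u x\<bar>))\<^sup>2"
        by (intro power_mono) auto
      also have "\<dots> = ?E / (1 + \<bar>?u x\<bar>)\<^sup>2" by (rule power_divide)
      also have "\<dots> \<le> ?E / (1 + (?u x)\<^sup>2)"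
      proof (rule divide_left_mono)
        show "1 + (?u x)\<^sup>2 \<le> (1 + \<bar>?u x\<bar>)\<^sup>2" by (simp add: power2_sum)
        have "0 < 1 + (?u x)\<^sup>2" "0 < (1 + \<bar>?u x\<bar>)\<^sup>2" by (simp_all add: add_pos_nonneg)
        then show "0 < (1 + \<bar>?u x\<bar>)\<^sup>2 * (1 + (?u x)\<^sup>2)" by (rule mult_pos_pos[rotated])
      qed simp
      finally show "(lift (alpha p a c k0 l0) c t (termA 1 0 F) x)\<^sup>2 \<le> ?E / (1 + (?u x)\<^sup>2)" by simp
    qed simp_all
    moreover have "?E * pi / (1 / 2) \<le> L * c powr (2 * e1)"
    proof -
      have "?E * pi / (1 / 2) = ((Kq * B)\<^sup>2 * pi / (1 / 2)) * c powr (2 * e1)"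
        using c by (simp add: power_mult_distrib powr_power mult.commute)
      also have "\<dots> \<le> L * c powr (2 * e1)" unfolding L_def by (intro mult_right_mono) auto
      finally show ?thesis .
    qed
    ultimately show ?thesis by (rule sq_le_mono)
  next
    case False
    have c: "0 < c" "c < 1" using ct by auto
    have "c powr (2 * (e1 - 1 / 4)) = c powr (- 1 / 2) * c powr (2 * e1)"
      unfolding powr_add[symmetric] by (rule arg_cong[of _ _ "(powr) c"]) simp
    also have "\<dots> \<le> c0 powr (- 1 / 2) * c powr (2 * e1)"
      using False c0 by (intro mult_right_mono powr_mono2') auto
    finally have p: "c powr (2 * (e1 - 1 / 4)) \<le> c0 powr (- 1 / 2) * c powr (2 * e1)" .
    have "K * c powr (2 * (e1 - 1 / 4)) \<le> \<bar>K\<bar> * c powr (2 * (e1 - 1 / 4))"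
      by (intro mult_right_mono) auto
    also have "\<dots> \<le> \<bar>K\<bar> * (c0 powr (- 1 / 2) * c powr (2 * e1))" by (intro mult_left_mono p) simp
    also have "\<dots> \<le> L * c powr (2 * e1)"
      unfolding L_def mult.assoc[symmetric] by (intro mult_right_mono) auto
    finally show ?thesis by (rule sq_le_mono[OF K[OF ct]])
  qed
  then show ?thesis unfolding uL_def by blast
qed

section \<open>Shape of the correction and of its derivative\<close>

lemma uL_form:
  assumes F: "rapid F" and G: "grows 0 G" and h: "h \<in> T 1 (Iup' 1 0)"
  shows "uL a k0 l0 e1 (termA 1 0 F + termB 1 0 G + h)"
proof (intro uL_add)
  show "uL a k0 l0 e1 (termA 1 0 F)" by (rule uL_rapid[OF F])
  have "coef 0 UNIV 1 0 G" using G unfolding coef_def by (auto intro!: exI[of _ 0])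
  then have "termB 1 0 G \<in> \<A>" by (rule T_B)
  then show "uL a k0 l0 e1 (termB 1 0 G)" using G by (intro uL_termB[of 0]) auto
  show "uL a k0 l0 e1 h"
    using Iup'_subset[of 1 0] Iup_1_0 by (intro uL_T[OF h _ Iup'_exponent]) auto
qed

text \<open>The shape required by \<open>uL_form\<close> survives one \<open>x\<close>-derivative:
  \<open>q * F(y)\<close> produces \<open>q * F'(y)\<close>, still rapid, and
  \<open>q' * F(y)\<close>, which joins the \<open>termB\<close> part. All other new terms lie
  strictly above \<open>(1, 0)\<close>.\<close>

lemma Dop_form:
  assumes F: "rapid F" and G: "grows 0 G" and h: "h \<in> T 1 (Iup' 1 0)" and b: "\<beta> \<in> T 1 pos"
  shows "\<exists>F' G' h'. rapid F' \<and> grows 0 G' \<and> h' \<in> T 1 (Iup' 1 0) \<and>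
    Dop \<beta> (termA 1 0 F + termB 1 0 G + h) = termA 1 0 F' + termB 1 0 G' + h'"
proof -
  let ?f = "termA 1 0 F + termB 1 0 G + h"
  have D: "D 1 0 = 0" using p_ge2 by (intro D_0) auto
  have gF: "grows 0 F" by (rule rapid_grows[OF F])
  have pos: "(1, 0) \<in> Iup 1 0" by (simp add: Iup_def)
  have cF: "coef 1 (Iup 1 0) 1 0 F" and cG: "coef 1 (Iup 1 0) 1 0 G"
    using D_coef[OF _ pos, of F] D_coef[OF _ pos, of G] gF G D by simp_all
  have mem: "termA 1 0 F \<in> \<A>" "termB 1 0 G \<in> \<A>" "h \<in> \<A>"
    using T_subset T_A[OF cF] T_B[OF cG] h by blast+
  have fT: "?f \<in> T 1 (Iup 1 0)"
    using T_A[OF cF] T_B[OF cG] T_mono[OF h order.refl Iup'_subset] by (intro T_add)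
  have dyf: "dy ?f = termA 1 0 (deriv F) + termB 1 0 (deriv G) + dy h"
    using mem by (simp add: dy_add T_add dy_termA[OF gF] dy_termB[OF G])
  have dsf: "ds ?f = termB 1 0 F + ds (termB 1 0 G) + ds h"
    using mem by (simp add: ds_add T_add ds_termA)
  define h' where "h' = ds (termB 1 0 G) + ds h + dy h - dy ?f * \<beta>"
  have "dy ?f * \<beta> \<in> T (1 + 1) (Iup' 1 0)"
    using T_mult_nz[OF dy_T[OF fT] T_mono[OF b order.refl pos_nz]] .
  then have "dy ?f * \<beta> \<in> T 1 (Iup' 1 0)" by (rule T_1_mult) simp
  moreover have "ds (termB 1 0 G) \<in> T 1 (Iup' 1 0)"
    using ds_termB_higher[OF cG] p_ge2 by (intro T_1_mult) auto
  ultimately have "h' \<in> T 1 (Iup' 1 0)"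
    unfolding h'_def using ds_T[OF h up_Iup'] dy_T[OF h] by (intro T_diff T_add)
  moreover have "Dop \<beta> ?f = termA 1 0 (deriv F) + termB 1 0 (\<lambda>y. F y + deriv G y) + h'"
  proof -
    have e: "(1 - \<beta>) * X = X - X * \<beta>" for X by (simp add: algebra_simps)
    show ?thesis unfolding Dop_def e h'_def dsf dyf termB_add by simp
  qed
  moreover have "rapid (deriv F)" "grows 0 (\<lambda>y. F y + deriv G y)"
    using F G gF by (auto intro: rapid_deriv grows_add grows_deriv)
  ultimately show ?thesis by blast
qed

text \<open>For a single pair \<open>c\<close>, \<open>t\<close> the constant may depend on
  \<open>t\<close>, so the comparison of \<open>y\<close> with the slow variable holds at every time
  and not only up to \<open>Tc c\<close>.\<close>

lemma sq_integrable_lift_T: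
  assumes f: "f \<in> T 1 I" "I \<subseteq> pos" and c: "0 < c" "c < 1"
  shows "\<exists>M. sq_le (lift (alpha p a c k0 l0) c t f) M"
  using f(1)
proof -
  obtain C where C: "C > 0" "\<And>c s. 0 < c \<Longrightarrow> c < 1 \<Longrightarrow> \<bar>alpha p a c k0 l0 s\<bar> \<le> C * c powr (- 1 / 2)"
    by (rule alpha_bound) blast
  define A where "A = C * c powr (- 1 / 2)"
  define N where "N = 1 + \<bar>t\<bar> + A + 1 / sqrt c"
  have A: "0 \<le> A" "\<bar>alpha p a c k0 l0 s\<bar> \<le> A" for s using C c by (auto simp: A_def)
  have N: "1 + \<bar>x - alpha p a c k0 l0 (x + (1 - c) * t)\<bar> \<le> N * (1 + sqrt c * \<bar>x + (1 - c) * t\<bar>)" for x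
  proof -
    define s where "s = x + (1 - c) * t"
    have sc: "sqrt c > 0" using c by simp
    have "\<bar>(1 - c) * t\<bar> \<le> 1 * \<bar>t\<bar>" unfolding abs_mult using c by (intro mult_right_mono) auto
    moreover have "\<bar>x\<bar> \<le> \<bar>s\<bar> + \<bar>(1 - c) * t\<bar>" unfolding s_def by linarith
    ultimately have "1 + \<bar>x - alpha p a c k0 l0 s\<bar> \<le> (1 + \<bar>t\<bar> + A) + \<bar>s\<bar>"
      using A(2)[of s] abs_triangle_ineq4[of x "alpha p a c k0 l0 s"] by linarith
    also have "\<dots> = (1 + \<bar>t\<bar> + A) * 1 + 1 / sqrt c * (sqrt c * \<bar>s\<bar>)" using sc by simp
    also have "\<dots> \<le> N * 1 + N * (sqrt c * \<bar>s\<bar>)"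
    proof (intro add_mono mult_right_mono)
      show "1 + \<bar>t\<bar> + A \<le> N" unfolding N_def using sc by simp
      have "0 \<le> 1 + \<bar>t\<bar> + A" using A(1) by linarith
      then show "1 / sqrt c \<le> N" unfolding N_def by linarith
    qed (use sc in simp_all)
    finally show ?thesis by (simp add: distrib_left s_def)
  qed
  have N0: "0 \<le> N" using A(1) c by (simp add: N_def)
  have key: "\<exists>M. sq_le (lift (alpha p a c k0 l0) c t g) M"
    if g: "g \<in> \<A>" and K: "K > 0" and b: "\<And>s y. 1 + \<bar>y\<bar> \<le> N * (1 + sqrt c * \<bar>s\<bar>) \<Longrightarrow>
       \<bar>g c s y\<bar> \<le> K * c powr E * N ^ d / (1 + (sqrt c * s)\<^sup>2)" for g K E d
  proof -
    have "sq_le (lift (alpha p a c k0 l0) c t g) ((K * c powr E * N ^ d)\<^sup>2 * pi / sqrt c)"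
      using sq_le_decay[OF c(1) isCont_lift[OF c(1) g], of a k0 l0 t "K * c powr E * N ^ d" "(1 - c) * t"] b[OF N] K N0
      by (simp add: lift_def)
    then show ?thesis by blast
  qed
  show ?thesis
    using f(1)
  proof (induction rule: T_induct)
    case zero
    have "sq_le (lift (alpha p a c k0 l0) c t 0) 0" by (simp add: lift_def[abs_def] fun_app sq_le_zero)
    then show ?case by blast
  next
    case (add f g)
    then show ?case unfolding lift_add[abs_def] using sq_le_add by blast
  next
    case (A k l F)
    then have k: "k > 0" using f(2) by (auto simp: coef_def pos_def)
    obtain K where K: "K > 0"
      "\<And>c s y N. 0 < c \<Longrightarrow> c < 1 \<Longrightarrow> 1 + \<bar>y\<bar> \<le> N * (1 + sqrt c * \<bar>s\<bar>) \<Longrightarrow>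
       \<bar>termA k l F c s y\<bar> \<le> K * c powr (real l + real k * e1) * N ^ D k l / (1 + (sqrt c * s)\<^sup>2)"
      by (rule term_bounds[OF coef_D[OF A] k]) blast
    show ?case by (rule key[OF T_subset[OF T_A[OF A]] K(1) K(2)[OF c]])
  next
    case (B k l F)
    then have k: "k > 0" using f(2) by (auto simp: coef_def pos_def)
    obtain K where K: "K > 0"
      "\<And>c s y N. 0 < c \<Longrightarrow> c < 1 \<Longrightarrow> 1 + \<bar>y\<bar> \<le> N * (1 + sqrt c * \<bar>s\<bar>) \<Longrightarrow>
       \<bar>termB k l F c s y\<bar> \<le> K * c powr (real l + real k * e1 + 1 / 2) * N ^ D k l / (1 + (sqrt c * s)\<^sup>2)"
      by (rule term_bounds[OF coef_D[OF B] k]) blast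
    show ?case by (rule key[OF T_subset[OF T_B[OF B]] K(1) K(2)[OF c]])
  qed
qed

text \<open>For fixed \<open>c\<close> the phase is bounded, so \<open>1 + \<bar>x\<bar>\<close> and
  \<open>1 + \<bar>y\<bar>\<close> are comparable and decay in \<open>y\<close> is decay in
  \<open>x\<close>.\<close>

lemma sq_integrable_lift_rapid:
  assumes F: "rapid F" and c: "0 < c" "c < 1"
  shows "\<exists>M. sq_le (lift (alpha p a c k0 l0) c t (yfun F)) M"
proof -
  obtain C where C: "C > 0" "\<And>c s. 0 < c \<Longrightarrow> c < 1 \<Longrightarrow> \<bar>alpha p a c k0 l0 s\<bar> \<le> C * c powr (- 1 / 2)"
    by (rule alpha_bound) blast
  define A where "A = C * c powr (- 1 / 2)"
  have A: "0 \<le> A" "\<bar>alpha p a c k0 l0 s\<bar> \<le> A" for s using C c by (auto simp: A_def)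
  obtain B where B: "B > 0" "\<And>x. \<bar>F x\<bar> \<le> B / (1 + \<bar>x\<bar>)" by (rule rapid_bound_inverse[OF F]) blast
  let ?E = "B * (1 + A)"
  have mem: "yfun F \<in> \<A>" by (intro \<A>_yfun rapid_grows[OF F])
  have "sq_le (lift (alpha p a c k0 l0) c t (yfun F)) (?E\<^sup>2 * pi / 1)"
  proof (rule sq_le_arctan[where u = "\<lambda>x. x" and u' = "\<lambda>_. 1"])
    fix x
    define y where "y = x - alpha p a c k0 l0 (x + (1 - c) * t)"
    have "\<bar>x\<bar> \<le> \<bar>y\<bar> + A" using A(2)[of "x + (1 - c) * t"] unfolding y_def by linarith
    moreover have "(1 + \<bar>y\<bar>) * (1 + A) = 1 + \<bar>y\<bar> + A + \<bar>y\<bar> * A" by (simp add: algebra_simps)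
    moreover have "0 \<le> \<bar>y\<bar> * A" using A(1) by simp
    ultimately have xy: "1 + \<bar>x\<bar> \<le> (1 + \<bar>y\<bar>) * (1 + A)" by linarith
    have p: "0 < 1 + \<bar>x\<bar>" "0 < 1 + \<bar>y\<bar>" by linarith+
    have "\<bar>F y\<bar> \<le> B / (1 + \<bar>y\<bar>)" by (rule B(2))
    also have "\<dots> \<le> ?E / (1 + \<bar>x\<bar>)"
    proof -
      have "B * (1 + \<bar>x\<bar>) \<le> B * ((1 + \<bar>y\<bar>) * (1 + A))" using B(1) xy by (intro mult_left_mono) auto
      then show ?thesis using p by (simp add: divide_simps mult_ac)
    qed
    finally have "\<bar>F y\<bar>\<^sup>2 \<le> (?E / (1 + \<bar>x\<bar>))\<^sup>2" by (intro power_mono) auto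
    also have "\<dots> = ?E\<^sup>2 / (1 + \<bar>x\<bar>)\<^sup>2" by (rule power_divide)
    also have "\<dots> \<le> ?E\<^sup>2 / (1 + x\<^sup>2)"
    proof (rule divide_left_mono)
      show "1 + x\<^sup>2 \<le> (1 + \<bar>x\<bar>)\<^sup>2" by (simp add: power2_sum)
      have "0 < 1 + x\<^sup>2" "0 < (1 + \<bar>x\<bar>)\<^sup>2" using p by (simp_all add: add_pos_nonneg)
      then show "0 < (1 + \<bar>x\<bar>)\<^sup>2 * (1 + x\<^sup>2)" by (rule mult_pos_pos[rotated])
    qed simp
    finally show "(lift (alpha p a c k0 l0) c t (yfun F) x)\<^sup>2 \<le> ?E\<^sup>2 / (1 + x\<^sup>2)"
      by (simp add: lift_def yfun_def y_def)
    show "isCont (lift (alpha p a c k0 l0) c t (yfun F)) x" by (rule isCont_lift[OF c(1) mem])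
  qed auto
  then show ?thesis by blast
qed

end

section \<open>Weak derivatives\<close>

text \<open>Counting derivatives gives an induction in which the product and chain rules pass to the
  derivative; \<open>smooth_fun\<close> is recovered at the end.\<close>

primrec difn :: "nat \<Rightarrow> (real \<Rightarrow> real) \<Rightarrow> bool" where
  "difn 0 f \<longleftrightarrow> True"
| "difn (Suc n) f \<longleftrightarrow> (\<forall>x. f differentiable (at x)) \<and> difn n (deriv f)"

lemma difn_SucI:
  assumes "\<And>x. (f has_real_derivative f' x) (at x)" "difn n f'" shows "difn (Suc n) f"
proof -
  have "deriv f = f'" using assms(1) by (auto simp: DERIV_imp_deriv)
  then show ?thesis using assms by (auto simp: real_differentiable_def)
qed

lemma difn_SucE:
  assumes "difn (Suc n) f"
  shows "(f has_real_derivative deriv f x) (at x)" "difn n (deriv f)"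
  using assms by (auto simp: DERIV_deriv_iff_real_differentiable)

lemma difn_SucD: "difn (Suc n) f \<Longrightarrow> difn n f"
  by (induction n arbitrary: f) auto

lemma difn_add: "difn n f \<Longrightarrow> difn n g \<Longrightarrow> difn n (\<lambda>x. f x + g x)"
proof (induction n arbitrary: f g)
  case (Suc n)
  show ?case
    by (rule difn_SucI[OF DERIV_add[OF difn_SucE(1)[OF Suc.prems(1)] difn_SucE(1)[OF Suc.prems(2)]]])
      (intro Suc.IH difn_SucE(2) Suc.prems)
qed simp

lemma difn_mult: "difn n f \<Longrightarrow> difn n g \<Longrightarrow> difn n (\<lambda>x. f x * g x)"
proof (induction n arbitrary: f g)
  case (Suc n)
  show ?case
    by (rule difn_SucI[OF DERIV_mult[OF difn_SucE(1)[OF Suc.prems(1)] difn_SucE(1)[OF Suc.prems(2)]]])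
      (intro difn_add Suc.IH difn_SucE(2) Suc.prems difn_SucD[OF Suc.prems(1)] difn_SucD[OF Suc.prems(2)])
qed simp

lemma difn_const: "difn n (\<lambda>x. r)"
proof (induction n arbitrary: r)
  case (Suc n)
  show ?case by (rule difn_SucI[OF DERIV_const Suc.IH])
qed simp

lemma difn_affine: "difn n f \<Longrightarrow> difn n (\<lambda>x. f (r * x + s))"
proof (induction n arbitrary: f)
  case (Suc n)
  have d: "((\<lambda>x. r * x + s) has_real_derivative r) (at x)" for x
    using DERIV_add[OF DERIV_cmult[OF DERIV_ident] DERIV_const[of s], of r] by simp
  show ?case
    by (rule difn_SucI[OF DERIV_chain2[OF difn_SucE(1)[OF Suc.prems] d]])
      (intro difn_mult difn_const Suc.IH difn_SucE(2) Suc.prems)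
qed simp

lemma difn_smooth:
  assumes "\<And>n. difn n f" shows "smooth_fun f"
proof -
  have "\<forall>n. difn n ((deriv ^^ k) f)" for k
  proof (induction k)
    case (Suc k)
    show ?case
    proof
      show "difn n ((deriv ^^ Suc k) f)" for n using difn_SucE(2)[of n "(deriv ^^ k) f"] Suc by simp
    qed
  qed (use assms in simp)
  then show ?thesis
    unfolding smooth_fun_def
    using difn.simps(2)[of 0] by blast
qed

section \<open>Smooth cutoffs\<close>

definition bump :: "nat \<Rightarrow> real \<Rightarrow> real" where
  "bump k x = (if 0 < x then inverse x ^ k * exp (- inverse x) else 0)"

lemma bump_le: obtains C where "\<And>x. \<bar>bump k x\<bar> \<le> C * x\<^sup>2"
proof -
  obtain C where C: "C > 0" "\<And>x. 0 \<le> x \<Longrightarrow> (1 + x) powr real (k + 2) \<le> C * exp (1 * x)"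
    using powr_le_exp[of 1 "real (k + 2)"] by auto
  have "\<bar>bump k x\<bar> \<le> C * x\<^sup>2" for x
  proof (cases "0 < x")
    case True
    define z where "z = inverse x"
    have z: "0 < z" "z * x = 1" using True by (simp_all add: z_def)
    have "z ^ (k + 2) \<le> (1 + z) ^ (k + 2)" using z(1) by (intro power_mono) auto
    also have "\<dots> \<le> C * exp z" using C(2)[of z] z(1) powr_realpow[of "1 + z" "k + 2"] by (simp del: of_nat_add)
    finally have "z ^ (k + 2) * exp (- z) \<le> C * exp z * exp (- z)" by (intro mult_right_mono) auto
    then have "z ^ (k + 2) * exp (- z) \<le> C" by (simp add: mult.assoc flip: exp_add)
    then have "z ^ (k + 2) * exp (- z) * x\<^sup>2 \<le> C * x\<^sup>2" by (intro mult_right_mono) auto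
    moreover have "z ^ (k + 2) * exp (- z) * x\<^sup>2 = z ^ k * exp (- z) * (z * x)\<^sup>2"
      by (simp add: power_add power_mult_distrib power2_eq_square)
    ultimately have "z ^ k * exp (- z) \<le> C * x\<^sup>2" unfolding z(2) power_one mult_1_right by (simp only:)
    then show ?thesis using True z(1) by (simp add: bump_def z_def[symmetric])
  next
    case False
    then show ?thesis using C(1) by (simp add: bump_def)
  qed
  then show ?thesis by (rule that)
qed

text \<open>The extra powers of \<open>inverse x\<close> make the family closed under
  differentiation, whence smoothness. At 0 the quadratic bound forces the difference quotient to
  0.\<close>

lemma DERIV_bump: "(bump k has_real_derivative - real k * bump (k + 1) x + bump (k + 2) x) (at x)"
proof -
  consider "0 < x" | "x < 0" | "x = 0" by linarith
  then show ?thesis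
  proof cases
    case 1
    have "((\<lambda>x. inverse x ^ k * exp (- inverse x)) has_real_derivative
       (real k * (- (inverse x * 1 * inverse x) * inverse x ^ (k - 1))) * exp (- inverse x)
       + (exp (- inverse x) * - (- (inverse x * 1 * inverse x))) * inverse x ^ k) (at x)"
    proof -
      have i: "(inverse has_real_derivative - (inverse x * 1 * inverse x)) (at x)"
        using DERIV_inverse'[OF DERIV_ident, of x] 1 by simp
      show ?thesis
        using DERIV_power[OF i, of k] by (intro DERIV_mult DERIV_chain2[OF DERIV_exp] DERIV_minus i) simp
    qed
    moreover have "(real k * (- (inverse x * 1 * inverse x) * inverse x ^ (k - 1))) * exp (- inverse x)
       + (exp (- inverse x) * - (- (inverse x * 1 * inverse x))) * inverse x ^ k =
       - real k * bump (k + 1) x + bump (k + 2) x"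
      using 1 by (cases k) (simp_all add: bump_def power_add power2_eq_square algebra_simps)
    ultimately have "((\<lambda>x. inverse x ^ k * exp (- inverse x)) has_real_derivative
       - real k * bump (k + 1) x + bump (k + 2) x) (at x)" by (simp only:)
    then show ?thesis
      by (rule has_field_derivative_transform_within_open[where S = "{0<..}"]) (use 1 in \<open>auto simp: bump_def\<close>)
  next
    case 2
    have "((\<lambda>x. 0) has_real_derivative - real k * bump (k + 1) x + bump (k + 2) x) (at x)"
      using 2 by (simp add: bump_def)
    then show ?thesis
      by (rule has_field_derivative_transform_within_open[where S = "{..<0}"]) (use 2 in \<open>auto simp: bump_def\<close>)
  next
    case 3
    obtain C where C: "\<And>x. \<bar>bump k x\<bar> \<le> C * x\<^sup>2" by (rule bump_le) blast
    have "((\<lambda>h. (bump k (0 + h) - bump k 0) / h) \<longlongrightarrow> 0) (at 0)"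
    proof (rule tendsto_rabs_zero_cancel, rule tendsto_sandwich)
      show "eventually (\<lambda>h. 0 \<le> \<bar>(bump k (0 + h) - bump k 0) / h\<bar>) (at 0)" by simp
      show "eventually (\<lambda>h. \<bar>(bump k (0 + h) - bump k 0) / h\<bar> \<le> C * \<bar>h\<bar>) (at 0)"
        using eventually_neq_at_within[of 0 0 UNIV]
      proof eventually_elim
        case (elim h)
        have "\<bar>bump k h\<bar> \<le> (C * \<bar>h\<bar>) * \<bar>h\<bar>" using C[of h] by (simp add: power2_eq_square)
        then have "\<bar>bump k h\<bar> / \<bar>h\<bar> \<le> C * \<bar>h\<bar>" using elim by (simp add: pos_divide_le_eq)
        then show ?case by (simp add: bump_def)
      qed
      show "((\<lambda>h. C * \<bar>h\<bar>) \<longlongrightarrow> 0) (at 0)"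
        using tendsto_mult_right_zero[OF tendsto_rabs_zero[OF tendsto_ident_at]] by simp
    qed simp
    then have "DERIV (bump k) 0 :> 0" by (simp add: DERIV_def)
    then show ?thesis using 3 by (simp add: bump_def)
  qed
qed

lemma difn_bump: "difn n (bump k)"
proof (induction n arbitrary: k)
  case (Suc n)
  show ?case by (rule difn_SucI[OF DERIV_bump]) (intro difn_add difn_mult difn_const Suc.IH)
qed simp

lemma bump_0: "0 \<le> bump 0 x" "bump 0 x \<le> 1"
  by (auto simp: bump_def)

lemma bump_tendsto_1:
  assumes "0 < x" shows "(\<lambda>n. bump 0 (real (Suc n) * x)) \<longlonglongrightarrow> 1"
proof -
  have "(\<lambda>n. exp (- (inverse (real (Suc n)) * inverse x))) \<longlonglongrightarrow> exp (- (0 * inverse x))"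
    by (intro tendsto_intros LIMSEQ_inverse_real_of_nat)
  moreover have "bump 0 (real (Suc n) * x) = exp (- (inverse (real (Suc n)) * inverse x))" for n
  proof -
    have "0 < real (Suc n) * x" using assms by (intro mult_pos_pos) auto
    then show ?thesis unfolding bump_def by (simp only: if_True power_0 mult_1_left inverse_mult_distrib)
  qed
  ultimately show ?thesis by simp
qed

text \<open>Stretching the argument by \<open>Suc n\<close> sharpens both edges, so these test
  functions converge pointwise to the indicator of the open interval while staying supported in
  \<open>{a..b}\<close>.\<close>

definition plateau :: "real \<Rightarrow> real \<Rightarrow> nat \<Rightarrow> real \<Rightarrow> real" where
  "plateau a b n x = bump 0 (real (Suc n) * (x - a)) * bump 0 (real (Suc n) * (b - x))"

lemma plateau_outside: "x \<notin> {a<..<b} \<Longrightarrow> plateau a b n x = 0"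
  by (auto simp: plateau_def bump_def zero_less_mult_iff)

lemma plateau_bounds: "0 \<le> plateau a b n x" "plateau a b n x \<le> 1"
  unfolding plateau_def using bump_0 by (auto intro!: mult_nonneg_nonneg mult_le_one)

lemma plateau_tendsto:
  "(\<lambda>n. plateau a b n x) \<longlonglongrightarrow> indicator {a<..<b} x"
proof (cases "x \<in> {a<..<b}")
  case True
  then have "(\<lambda>n. plateau a b n x) \<longlonglongrightarrow> 1 * 1"
    unfolding plateau_def by (intro tendsto_mult bump_tendsto_1) auto
  then show ?thesis using True by simp
qed (simp add: plateau_outside)

lemma test_fun_plateau: "test_fun (plateau a b n)"
proof -
  have "difn k (plateau a b n)" for k
  proof -
    have "difn k (\<lambda>x. bump 0 (real (Suc n) * x + - real (Suc n) * a) * bump 0 (- real (Suc n) * x + real (Suc n) * b))"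
      by (intro difn_mult difn_affine difn_bump)
    moreover have "plateau a b n = (\<lambda>x. bump 0 (real (Suc n) * x + - real (Suc n) * a) * bump 0 (- real (Suc n) * x + real (Suc n) * b))"
      by (rule ext) (simp only: plateau_def distrib_left mult_minus_left mult_minus_right diff_conv_add_uminus add.commute)
    ultimately show ?thesis by (simp only:)
  qed
  then have "smooth_fun (plateau a b n)" by (rule difn_smooth)
  moreover have "{x. plateau a b n x \<noteq> 0} \<subseteq> {a..b}"
  proof
    fix x assume "x \<in> {x. plateau a b n x \<noteq> 0}"
    then show "x \<in> {a..b}" using plateau_outside[of x a b n] by (cases "x \<in> {a<..<b}") auto
  qed
  then have "closure {x. plateau a b n x \<noteq> 0} \<subseteq> {a..b}" by (rule closure_minimal) simp
  then have "compact (closure {x. plateau a b n x \<noteq> 0})"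
    using compact_Int_closed[of "{a..b}" "closure {x. plateau a b n x \<noteq> 0}"]
    by (simp add: Int_absorb1)
  ultimately show ?thesis by (simp add: test_fun_def)
qed

lemma test_fun_support:
  assumes "test_fun \<phi>"
  obtains R where "R > 0" "\<And>x. R \<le> \<bar>x\<bar> \<Longrightarrow> \<phi> x = 0" "\<And>x. R \<le> \<bar>x\<bar> \<Longrightarrow> deriv \<phi> x = 0"
proof -
  have "bounded (closure {x. \<phi> x \<noteq> 0})" using assms compact_imp_bounded by (auto simp: test_fun_def)
  then obtain B where B: "\<And>x. x \<in> closure {x. \<phi> x \<noteq> 0} \<Longrightarrow> \<bar>x\<bar> \<le> B"
    unfolding bounded_iff by auto
  have z: "\<phi> x = 0" if "\<bar>x\<bar> > B" for x
  proof (rule ccontr)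
    assume "\<phi> x \<noteq> 0"
    then have "x \<in> closure {x. \<phi> x \<noteq> 0}" using closure_subset[of "{x. \<phi> x \<noteq> 0}"] by auto
    then have "\<bar>x\<bar> \<le> B" by (rule B)
    then show False using that by simp
  qed
  have d: "deriv \<phi> x = 0" if x: "\<bar>x\<bar> > B" for x
  proof -
    have "open {x::real. \<bar>x\<bar> > B}" by (intro open_Collect_less continuous_intros)
    moreover have "((\<lambda>_. 0) has_real_derivative 0) (at x)" by simp
    ultimately have "(\<phi> has_real_derivative 0) (at x)"
      using has_field_derivative_transform_within_open[of "\<lambda>_. 0" 0 x "{x. \<bar>x\<bar> > B}" \<phi>] x z by simp
    then show ?thesis by (rule DERIV_imp_deriv)
  qed
  show ?thesis
  proof (rule that[of "\<bar>B\<bar> + 1"])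
    show "\<phi> x = 0" "deriv \<phi> x = 0" if "\<bar>B\<bar> + 1 \<le> \<bar>x\<bar>" for x
      using that by (auto intro!: z d)
  qed simp
qed

lemma test_fun_DERIV:
  assumes "test_fun \<phi>"
  shows "(\<phi> has_real_derivative deriv \<phi> x) (at x)" "isCont (deriv \<phi>) x"
proof -
  have s: "\<forall>n x. ((deriv ^^ n) \<phi>) differentiable (at x)" using assms by (simp add: test_fun_def smooth_fun_def)
  have "((deriv ^^ 0) \<phi>) differentiable (at x)" "((deriv ^^ Suc 0) \<phi>) differentiable (at x)" using s by blast+
  then have "\<phi> differentiable (at x)" "deriv \<phi> differentiable (at x)" by simp_all
  then show "(\<phi> has_real_derivative deriv \<phi> x) (at x)" "isCont (deriv \<phi>) x"
    by (simp_all add: DERIV_deriv_iff_real_differentiable differentiable_imp_continuous_within)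
qed

lemma mult_indicator_support:
  fixes g :: "real \<Rightarrow> real"
  assumes "\<And>x. R \<le> \<bar>x\<bar> \<Longrightarrow> g x = 0" shows "(\<lambda>x. g x * indicator {- R..R} x) = g"
proof
  fix x show "g x * indicator {- R..R} x = g x"
    using assms[of x] by (cases "R \<le> \<bar>x\<bar>") (auto simp: indicator_def)
qed

lemma weak_deriv_classical:
  assumes f: "\<And>x. (f has_real_derivative f' x) (at x)" "\<And>x. isCont f' x"
  shows "weak_deriv f f'"
  unfolding weak_deriv_def
proof (intro allI impI)
  fix \<phi> assume t: "test_fun \<phi>"
  obtain R where R: "R > 0" "\<And>x. R \<le> \<bar>x\<bar> \<Longrightarrow> \<phi> x = 0" "\<And>x. R \<le> \<bar>x\<bar> \<Longrightarrow> deriv \<phi> x = 0"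
    by (rule test_fun_support[OF t]) blast
  have "(\<integral>x. (f x * deriv \<phi> x) * indicator {- R..R} x \<partial>lborel) =
     f R * \<phi> R - f (- R) * \<phi> (- R) - (\<integral>x. (f' x * \<phi> x) * indicator {- R..R} x \<partial>lborel)"
    by (rule integral_by_parts) (use R(1) f test_fun_DERIV[OF t] in auto)
  moreover have "(\<lambda>x. (f x * deriv \<phi> x) * indicator {- R..R} x) = (\<lambda>x. f x * deriv \<phi> x)"
    by (rule mult_indicator_support) (simp add: R(3))
  moreover have "(\<lambda>x. (f' x * \<phi> x) * indicator {- R..R} x) = (\<lambda>x. f' x * \<phi> x)"
    by (rule mult_indicator_support) (simp add: R(2))
  moreover have "\<phi> R = 0" "\<phi> (- R) = 0" using R(1) by (auto intro!: R(2))
  ultimately show "(\<integral>x. f x * deriv \<phi> x \<partial>lborel) = - (\<integral>x. f' x * \<phi> x \<partial>lborel)" by simp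
qed

section \<open>Uniqueness of weak derivatives\<close>

lemma sq_integrable_diff:
  assumes "sq_integrable f" "sq_integrable g" shows "sq_integrable (\<lambda>x. f x - g x)"
proof -
  have [measurable]: "f \<in> borel_measurable borel" "g \<in> borel_measurable borel"
    and int: "integrable lborel (\<lambda>x. (f x)\<^sup>2)" "integrable lborel (\<lambda>x. (g x)\<^sup>2)"
    using assms by (auto simp: sq_integrable_def)
  have le: "(f x - g x)\<^sup>2 \<le> 2 * (f x)\<^sup>2 + 2 * (g x)\<^sup>2" for x
    using zero_le_power2[of "f x + g x"] unfolding power2_sum power2_diff by linarith
  have int2: "integrable lborel (\<lambda>x. 2 * (f x)\<^sup>2 + 2 * (g x)\<^sup>2)" using int by simp
  have "integrable lborel (\<lambda>x. (f x - g x)\<^sup>2)"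
    by (rule Bochner_Integration.integrable_bound[OF int2]) (use le in auto)
  then show ?thesis by (simp add: sq_integrable_def)
qed

lemma sq_integrable_mult:
  assumes "sq_integrable f" "sq_integrable g" shows "integrable lborel (\<lambda>x. f x * g x)"
proof -
  have [measurable]: "f \<in> borel_measurable borel" "g \<in> borel_measurable borel"
    and int: "integrable lborel (\<lambda>x. (f x)\<^sup>2)" "integrable lborel (\<lambda>x. (g x)\<^sup>2)"
    using assms by (auto simp: sq_integrable_def)
  have le: "\<bar>f x * g x\<bar> \<le> (f x)\<^sup>2 + (g x)\<^sup>2" for x
  proof -
    have "0 \<le> (\<bar>f x\<bar> - \<bar>g x\<bar>)\<^sup>2" by simp
    moreover have "0 \<le> \<bar>f x\<bar> * \<bar>g x\<bar>" by simp
    ultimately show ?thesis unfolding power2_diff abs_mult power2_abs by linarith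
  qed
  show ?thesis
    by (rule Bochner_Integration.integrable_bound[OF Bochner_Integration.integrable_add[OF int]]) (use le in auto)
qed

lemma sq_integrable_indicator: "sq_integrable (indicator {a..b} :: real \<Rightarrow> real)"
proof -
  have "integrable lborel (indicator {a..b} :: real \<Rightarrow> real)"
    by (simp add: integrable_indicator_iff emeasure_lborel_Icc_eq)
  moreover have "(\<lambda>x. (indicator {a..b} x :: real)\<^sup>2) = indicator {a..b}" by (auto simp: indicator_def)
  ultimately show ?thesis by (simp add: sq_integrable_def)
qed

lemma sq_integrable_test_fun:
  assumes t: "test_fun \<phi>" shows "sq_integrable \<phi>"
proof -
  obtain R where R: "R > 0" "\<And>x. R \<le> \<bar>x\<bar> \<Longrightarrow> \<phi> x = 0" by (rule test_fun_support[OF t]) blast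
  have c: "isCont \<phi> x" for x using DERIV_isCont[OF test_fun_DERIV(1)[OF t]] .
  have "\<phi> \<in> borel_measurable borel"
    using c by (intro borel_measurable_continuous_onI continuous_at_imp_continuous_on) auto
  moreover have "integrable lborel (\<lambda>x. (\<phi> x)\<^sup>2 * indicator {- R..R} x)"
    by (rule borel_integrable_atLeastAtMost) (intro isCont_power c)
  moreover have "(\<lambda>x. (\<phi> x)\<^sup>2 * indicator {- R..R} x) = (\<lambda>x. (\<phi> x)\<^sup>2)"
    by (rule mult_indicator_support) (simp add: R(2))
  ultimately show ?thesis by (simp add: sq_integrable_def)
qed

text \<open>Dominated convergence along the plateaus, with \<open>\<bar>h\<bar>\<close> on
  \<open>{a..b}\<close> as majorant.\<close>

lemma integral_interval_eq_0:
  assumes h: "sq_integrable h" and z: "\<And>\<phi>. test_fun \<phi> \<Longrightarrow> (\<integral>x. h x * \<phi> x \<partial>lborel) = 0"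
  shows "(\<integral>x. h x * indicator {a<..<b} x \<partial>lborel) = 0"
proof -
  have hm[measurable]: "h \<in> borel_measurable borel" using h by (simp add: sq_integrable_def)
  have pm[measurable]: "plateau a b n \<in> borel_measurable borel" for n
    using sq_integrable_test_fun[OF test_fun_plateau] by (simp add: sq_integrable_def)
  have "(\<lambda>n. \<integral>x. h x * plateau a b n x \<partial>lborel) \<longlonglongrightarrow> (\<integral>x. h x * indicator {a<..<b} x \<partial>lborel)"
  proof (rule integral_dominated_convergence[where w = "\<lambda>x. \<bar>h x * indicator {a..b} x\<bar>"])
    show "integrable lborel (\<lambda>x. \<bar>h x * indicator {a..b} x\<bar>)"
      by (intro integrable_abs sq_integrable_mult h sq_integrable_indicator)
    show "AE x in lborel. (\<lambda>n. h x * plateau a b n x) \<longlonglongrightarrow> h x * indicator {a<..<b} x"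
      by (intro AE_I2 tendsto_mult tendsto_const plateau_tendsto)
    show "AE x in lborel. norm (h x * plateau a b n x) \<le> \<bar>h x * indicator {a..b} x\<bar>" for n
    proof (rule AE_I2)
      fix x
      have "\<bar>plateau a b n x\<bar> \<le> \<bar>indicator {a..b} x\<bar>"
        using plateau_bounds[of a b n x] plateau_outside[of x a b n] by (auto simp: indicator_def)
      then show "norm (h x * plateau a b n x) \<le> \<bar>h x * indicator {a..b} x\<bar>"
        unfolding real_norm_def abs_mult by (rule mult_left_mono) simp
    qed
  qed measurable
  moreover have "(\<integral>x. h x * plateau a b n x \<partial>lborel) = 0" for n by (rule z[OF test_fun_plateau])
  ultimately have "(\<lambda>n. 0) \<longlonglongrightarrow> (\<integral>x. h x * indicator {a<..<b} x \<partial>lborel)" by simp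
  then show ?thesis by (rule LIMSEQ_unique[OF _ tendsto_const])
qed

text \<open>On each bounded interval the positive and negative parts of \<open>h\<close> are
  densities of finite measures that agree on all half-lines, hence are equal; so the two parts
  coincide almost everywhere, and \<open>h\<close> vanishes there.\<close>

lemma AE_zero_of_intervals:
  assumes h: "sq_integrable h" and z: "\<And>a b. (\<integral>x. h x * indicator {a<..<b} x \<partial>lborel) = 0"
  shows "AE x in lborel. h x = 0"
proof -
  have hm[measurable]: "h \<in> borel_measurable borel" using h by (simp add: sq_integrable_def)
  have hi: "integrable lborel (\<lambda>x. h x * indicator {a<..<b} x)" for a b :: real
  proof (rule Bochner_Integration.integrable_bound[OF sq_integrable_mult[OF h sq_integrable_indicator[of a b]]])
    show "AE x in lborel. norm (h x * indicator {a<..<b} x) \<le> norm (h x * indicator {a..b} x)"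
      by (auto simp: indicator_def)
  qed measurable
  have "AE x in lborel. x \<in> {- real N<..<real N} \<longrightarrow> h x = 0" for N
  proof -
    define P where "P s x = ennreal (max 0 (s * h x) * indicator {- real N<..<real N} x)" for s x
    have [measurable]: "P s \<in> borel_measurable borel" for s unfolding P_def by measurable
    have int: "integrable lborel (\<lambda>x. max 0 (s * h x) * indicator {a<..<b} x)" for s a b :: real
    proof (rule Bochner_Integration.integrable_bound[OF integrable_mult_right[OF hi[of a b], of "s"]])
      show "AE x in lborel. norm (max 0 (s * h x) * indicator {a<..<b} x) \<le> norm (s * (h x * indicator {a<..<b} x))"
        by (auto simp: indicator_def max_def)
    qed measurable
    have em: "emeasure (density lborel (P s)) {x<..} =
        ennreal (\<integral>y. max 0 (s * h y) * indicator {max x (- real N)<..<real N} y \<partial>lborel)" for s x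
    proof -
      have "emeasure (density lborel (P s)) {x<..} = (\<integral>\<^sup>+y. P s y * indicator {x<..} y \<partial>lborel)"
        by (rule emeasure_density) auto
      also have "\<dots> = (\<integral>\<^sup>+y. ennreal (max 0 (s * h y) * indicator {max x (- real N)<..<real N} y) \<partial>lborel)"
        by (rule nn_integral_cong) (auto simp: P_def indicator_def)
      also have "\<dots> = ennreal (\<integral>y. max 0 (s * h y) * indicator {max x (- real N)<..<real N} y \<partial>lborel)"
        by (rule nn_integral_eq_integral[OF int]) (auto simp: indicator_def)
      finally show ?thesis .
    qed
    have eq: "(\<integral>y. max 0 (1 * h y) * indicator {a<..<b} y \<partial>lborel) =
        (\<integral>y. max 0 (- 1 * h y) * indicator {a<..<b} y \<partial>lborel)" for a b :: real
    proof -
      have "(\<integral>y. max 0 (1 * h y) * indicator {a<..<b} y \<partial>lborel) - (\<integral>y. max 0 (- 1 * h y) * indicator {a<..<b} y \<partial>lborel)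
        = (\<integral>y. max 0 (1 * h y) * indicator {a<..<b} y - max 0 (- 1 * h y) * indicator {a<..<b} y \<partial>lborel)"
        by (rule Bochner_Integration.integral_diff[symmetric, OF int int])
      also have "\<dots> = (\<integral>y. h y * indicator {a<..<b} y \<partial>lborel)"
        by (rule Bochner_Integration.integral_cong) (auto simp: indicator_def max_def)
      finally show ?thesis using z by simp
    qed
    have "density lborel (P 1) = density lborel (P (- 1))"
    proof (rule measure_eqI_lessThan)
      show "emeasure (density lborel (P 1)) {x<..} < \<infinity>" for x unfolding em by simp
      show "emeasure (density lborel (P 1)) {x<..} = emeasure (density lborel (P (- 1))) {x<..}" for x
        unfolding em eq ..
    qed simp_all
    moreover have "integral\<^sup>N lborel (P 1) \<noteq> \<infinity>"
      unfolding P_def using nn_integral_eq_integral[OF int[of 1 "- real N" "real N"]] by (simp add: indicator_def)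
    ultimately have "AE x in lborel. P 1 x = P (- 1) x"
      by (subst (asm) finite_density_unique) auto
    then show ?thesis
    proof eventually_elim
      case (elim x)
      show ?case
      proof
        assume "x \<in> {- real N<..<real N}"
        then have "max 0 (h x) = max 0 (- h x)" using elim by (simp add: P_def)
        then show "h x = 0" by (auto simp: max_def split: if_splits)
      qed
    qed
  qed
  then have "AE x in lborel. \<forall>N. x \<in> {- real N<..<real N} \<longrightarrow> h x = 0" unfolding AE_all_countable by blast
  then show ?thesis
  proof eventually_elim
    case (elim x)
    obtain N where "\<bar>x\<bar> < real N" using reals_Archimedean2 by blast
    then show ?case using elim by (auto simp: abs_less_iff)
  qed
qed

text \<open>\<open>H1norm\<close> refers to an arbitrarily chosen weak derivative. Uniqueness almost
  everywhere allows the classical one to take its place in \<open>H1_classical\<close>.\<close>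

lemma weak_deriv_unique:
  assumes "weak_deriv f g" "weak_deriv f g'" and g: "sq_integrable g" "sq_integrable g'"
  shows "AE x in lborel. g x = g' x"
proof -
  have d: "sq_integrable (\<lambda>x. g x - g' x)" by (rule sq_integrable_diff[OF g])
  have "(\<integral>x. (g x - g' x) * \<phi> x \<partial>lborel) = 0" if t: "test_fun \<phi>" for \<phi>
  proof -
    have "(\<integral>x. (g x - g' x) * \<phi> x \<partial>lborel) = (\<integral>x. g x * \<phi> x - g' x * \<phi> x \<partial>lborel)"
      by (simp add: left_diff_distrib)
    also have "\<dots> = (\<integral>x. g x * \<phi> x \<partial>lborel) - (\<integral>x. g' x * \<phi> x \<partial>lborel)"
      by (intro Bochner_Integration.integral_diff sq_integrable_mult g sq_integrable_test_fun[OF t])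
    also have "\<dots> = 0" using assms(1,2) t unfolding weak_deriv_def by simp
    finally show ?thesis .
  qed
  then have "AE x in lborel. g x - g' x = 0"
    by (intro AE_zero_of_intervals[OF d] integral_interval_eq_0[OF d])
  then show ?thesis by simp
qed

lemma H1_classical:
  assumes f: "\<And>x. (f has_real_derivative f' x) (at x)" "\<And>x. isCont f' x" and L: "sq_le f M" "sq_le f' N"
  shows "H1 f" "H1norm f \<le> sqrt (M + N)"
proof -
  have w: "sq_integrable f' \<and> weak_deriv f f'"
    using L(2) weak_deriv_classical[OF f] by (simp add: sq_le_def)
  show "H1 f" unfolding H1_def by (intro conjI exI[of _ f'] w) (use L(1) in \<open>simp add: sq_le_def\<close>)
  define g where "g = (SOME g. sq_integrable g \<and> weak_deriv f g)"
  have g: "sq_integrable g \<and> weak_deriv f g" unfolding g_def by (rule someI[where P = "\<lambda>g. sq_integrable g \<and> weak_deriv f g", OF w])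
  have "AE x in lborel. g x = f' x" using g w by (intro weak_deriv_unique[of f g f']) auto
  then have "AE x in lborel. (g x)\<^sup>2 = (f' x)\<^sup>2" by eventually_elim simp
  then have "(\<integral>x. (g x)\<^sup>2 \<partial>lborel) = (\<integral>x. (f' x)\<^sup>2 \<partial>lborel)"
    using g w by (intro integral_cong_AE) (auto simp: sq_integrable_def)
  moreover have "(L2norm u)\<^sup>2 = (\<integral>x. (u x)\<^sup>2 \<partial>lborel)" for u
    unfolding L2norm_def by (rule real_sqrt_pow2) (rule integral_nonneg_AE, simp)
  ultimately have "H1norm f = sqrt ((\<integral>x. (f x)\<^sup>2 \<partial>lborel) + (\<integral>x. (f' x)\<^sup>2 \<partial>lborel))"
    unfolding H1norm_def g_def[symmetric] by simp
  also have "\<dots> \<le> sqrt (M + N)" using L by (intro real_sqrt_le_mono add_mono) (auto simp: sq_le_def)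
  finally show "H1norm f \<le> sqrt (M + N)" .
qed

section \<open>Conclusion\<close>

text \<open>The sign of \<open>K\<close> is unknown and a positive constant is wanted, hence
  \<open>\<bar>K\<bar> + 1\<close>, whose square exceeds \<open>K\<close>.\<close>

lemma sqrt_powr_le: "sqrt (K * c powr (2 * e)) \<le> (\<bar>K\<bar> + 1) * c powr e"
proof -
  define r where "r = c powr e"
  have r: "c powr (2 * e) = r\<^sup>2" by (simp add: r_def power2_eq_square powr_add[symmetric])
  have "K \<le> (\<bar>K\<bar> + 1)\<^sup>2"
    using zero_le_power2[of "\<bar>K\<bar>"] abs_ge_self[of K] abs_ge_zero[of K]
    unfolding power2_sum power_one mult_1_right by linarith
  then have "K * r\<^sup>2 \<le> ((\<bar>K\<bar> + 1) * r)\<^sup>2" unfolding power_mult_distrib by (rule mult_right_mono) simp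
  then show ?thesis unfolding r r_def[symmetric] by (rule real_le_lsqrt[rotated]) (simp add: r_def)
qed

lemma L2norm_le:
  assumes "sq_le f (K * c powr (2 * e))" shows "L2norm f \<le> (\<bar>K\<bar> + 1) * c powr e"
proof -
  have "L2norm f \<le> sqrt (K * c powr (2 * e))"
    using assms unfolding L2norm_def sq_le_def by (intro real_sqrt_le_mono) simp
  also have "\<dots> \<le> (\<bar>K\<bar> + 1) * c powr e" by (rule sqrt_powr_le)
  finally show ?thesis .
qed

context gkdv
begin

lemma Dop_T:
  assumes "f \<in> T 1 I" "up I" "\<beta> \<in> \<A>" shows "Dop \<beta> f \<in> T 1 I"
proof -
  have "approx I f 0" using assms(1) T_subset[OF assms(1)] by (simp add: approx_def T_zero)
  then have "approx I (Dop \<beta> f) (Dop \<beta> 0)" by (rule approx_Dop[OF assms(2) approx_refl[OF assms(3)]])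
  then show ?thesis by (simp add: approx_def Dop_def ds_zero dy_zero)
qed

lemma Dop_pow_T: "f \<in> T 1 I \<Longrightarrow> up I \<Longrightarrow> \<beta> \<in> \<A> \<Longrightarrow> (Dop \<beta> ^^ j) f \<in> T 1 I"
proof (induction j)
  case (Suc j)
  then show ?case using Dop_T[of "(Dop \<beta> ^^ j) f" I \<beta>] by simp
qed simp

lemma lift_Q: "lift (alpha p a c k0 l0) c t (yfun Q) x = Qsol p (x - alpha p a c k0 l0 (x + (1 - c) * t))"
  by (simp add: lift_def yfun_def)

lemma lift_qf: "0 < c \<Longrightarrow> lift al c t qf x = Qc p c (x + (1 - c) * t)"
  by (simp add: lift_def qf_def termA_def q_def)

lemma vform_split:
  assumes g: "\<And>k l. k > 0 \<Longrightarrow> grows (real (D k l)) (A k l) \<and> grows (real (D k l)) (B k l)" and k0: "1 \<le> k0"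
  shows "\<exists>h \<in> T 1 (Iup' 1 0). vform A B k0 l0 - yfun Q - qf = termA 1 0 (A 1 0) + termB 1 0 (B 1 0) + h"
proof -
  define F where "F i = termA (fst i) (snd i) (A (fst i) (snd i)) + termB (fst i) (snd i) (B (fst i) (snd i))" for i
  define S where "S = {1..k0} \<times> {0..l0}"
  have "vform A B k0 l0 - yfun Q - qf = sum F S"
    unfolding vform_def S_def F_def by (simp add: sum.cartesian_product split_def)
  also have "\<dots> = F (1, 0) + sum F (S - {(1, 0)})"
    using k0 by (intro sum.remove) (auto simp: S_def)
  finally have "vform A B k0 l0 - yfun Q - qf = termA 1 0 (A 1 0) + termB 1 0 (B 1 0) + sum F (S - {(1, 0)})"
    by (simp add: F_def)
  moreover have "sum F (S - {(1, 0)}) \<in> T 1 (Iup' 1 0)"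
  proof (rule T_sum)
    fix i assume "i \<in> S - {(1, 0)}"
    then have i: "fst i > 0" "(fst i, snd i) \<in> Iup' 1 0" by (auto simp: S_def Iup'_def Iup_def)
    show "F i \<in> T 1 (Iup' 1 0)" unfolding F_def
      using g[OF i(1)] by (intro T_add T_A T_B D_coef i) auto
  qed
  ultimately show ?thesis by blast
qed

text \<open>Both \<open>v\<close> and its \<open>x\<close>-derivative split into a rapid function of
  \<open>y\<close>, namely \<open>Q\<close> or \<open>Qd\<close>, and terms that decay in
  \<open>s\<close>; the phase enters the second part through \<open>\<beta> * Qd\<close>.\<close>

lemma vfun_H1:
  assumes g: "\<And>k l. k > 0 \<Longrightarrow> grows (real (D k l)) (A k l) \<and> grows (real (D k l)) (B k l)" and c: "0 < c" "c < 1"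
  shows "H1 (vfun p a A B c k0 l0 t)"
proof -
  let ?L = "lift (alpha p a c k0 l0) c t" and ?v = "vform A B k0 l0" and ?b = "bform a k0 l0"
  have v: "?v \<in> \<A>" by (rule vform_\<A>) (rule g)
  have h: "?v - yfun Q \<in> T 1 pos" by (rule vform_T) (rule g)
  have b: "?b \<in> T 1 pos" by (rule bform_T) (rule g)
  have bA: "?b \<in> \<A>" using b by (rule T_subset)
  have QA: "yfun Q \<in> \<A>" using \<A>_yfun rapid_grows[OF rapid_Q_power[of 1], of 0] by simp
  have QdA: "yfun Qd \<in> \<A>" by (rule \<A>_yfun[OF rapid_grows[OF rapid_Qd]])
  have "?b * yfun Qd \<in> T (1 + 0) pos" by (rule T_mult[OF b QdA]) (auto simp: pos_def)
  then have bQ: "?b * yfun Qd \<in> T 1 pos" by simp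
  have D: "Dop ?b ?v = yfun Qd + (Dop ?b (?v - yfun Q) - ?b * yfun Qd)"
    using v QA by (simp add: Dop_def ds_diff dy_diff ds_yfun dy_yfun deriv_Q algebra_simps)
  have h': "Dop ?b (?v - yfun Q) - ?b * yfun Qd \<in> T 1 pos"
    by (intro T_diff Dop_T h bA bQ up_pos)
  have split: "\<exists>M. sq_le (?L (yfun F + u)) M" if F: "rapid F" and u: "u \<in> T 1 pos" for F u
  proof -
    obtain M where M: "sq_le (?L (yfun F)) M" using sq_integrable_lift_rapid[OF F c] by blast
    obtain N where N: "sq_le (?L u) N" using sq_integrable_lift_T[OF u _ c] by blast
    have "?L (yfun F + u) = (\<lambda>x. ?L (yfun F) x + ?L u x)" by (rule ext) (rule lift_add)
    then show ?thesis using sq_le_add[OF M N] by auto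
  qed
  have rQ: "rapid Q" using rapid_Q_power[of 1] by simp
  obtain M where M: "sq_le (?L (yfun Q + (?v - yfun Q))) M" using split[OF rQ h] by blast
  obtain N where N: "sq_le (?L (Dop ?b ?v)) N" unfolding D using split[OF rapid_Qd h'] by blast
  have "H1 (?L ?v)"
  proof (rule H1_classical(1))
    show "(?L ?v has_real_derivative ?L (Dop ?b ?v) x) (at x)" for x
      by (rule DERIV_lift[OF v]) (rule DERIV_alpha[OF c(1)])
    show "isCont (?L (Dop ?b ?v)) x" for x by (rule isCont_lift[OF c(1) Dop_\<A>[OF v bA]])
    show "sq_le (?L ?v) M" using M by simp
  qed (rule N)
  moreover have "vfun p a A B c k0 l0 t = ?L ?v" by (rule ext) (rule vfun_eq[OF c(1)])
  ultimately show ?thesis by simp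
qed

text \<open>The correction and its \<open>x\<close>-derivative have the same shape, by
  \<open>Dop_form\<close>, so one estimate bounds both halves of the norm.\<close>

lemma vfun_near_solitons:
  assumes g: "\<And>k l. k > 0 \<Longrightarrow> grows (real (D k l)) (A k l) \<and> grows (real (D k l)) (B k l)"
    and r: "rapid (A 1 0)" and k0: "1 \<le> k0"
  shows "\<exists>K > 0. \<forall>c t. 0 < c \<and> c < 1 \<and> - Tc c \<le> t \<and> t \<le> Tc c \<longrightarrow>
      H1norm (\<lambda>x. vfun p a A B c k0 l0 t x - Qsol p (x - alpha p a c k0 l0 (x + (1 - c) * t)) - Qc p c (x + (1 - c) * t))
        \<le> K * c powr (1 / (real p - 1))"
proof -
  let ?L = "\<lambda>c t. lift (alpha p a c k0 l0) c t" and ?v = "vform A B k0 l0" and ?b = "bform a k0 l0"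
  define u where "u = ?v - yfun Q - qf"
  obtain h where h: "h \<in> T 1 (Iup' 1 0)" and u: "u = termA 1 0 (A 1 0) + termB 1 0 (B 1 0) + h"
    using vform_split[OF g k0] unfolding u_def by blast
  have B: "grows 0 (B 1 0)" using g[of 1 0] D_0[of 1] p_ge2 by simp
  have b: "?b \<in> T 1 pos" by (rule bform_T) (rule g)
  have bA: "?b \<in> \<A>" using b by (rule T_subset)
  have "?v - yfun Q \<in> T 1 pos" by (rule vform_T) (rule g)
  then have uA: "u \<in> \<A>" unfolding u_def by (intro T_diff[OF T_subset T_subset[OF qf_T]])
  obtain F' G' h' where F': "rapid F'" "grows 0 G'" "h' \<in> T 1 (Iup' 1 0)" "Dop ?b u = termA 1 0 F' + termB 1 0 G' + h'"
    using Dop_form[OF r B h b] unfolding u by blast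
  obtain K where K: "\<And>c t. 0 < c \<and> c < 1 \<and> - Tc c \<le> t \<and> t \<le> Tc c \<Longrightarrow> sq_le (?L c t u) (K * c powr (2 * e1))"
    using uL_form[OF r B h, of a k0 l0] unfolding u uL_def by blast
  obtain N where N: "\<And>c t. 0 < c \<and> c < 1 \<and> - Tc c \<le> t \<and> t \<le> Tc c \<Longrightarrow> sq_le (?L c t (Dop ?b u)) (N * c powr (2 * e1))"
    using uL_form[OF F'(1-3), of a k0 l0] unfolding F'(4) uL_def by blast
  show ?thesis
  proof (intro exI[of _ "\<bar>K + N\<bar> + 1"] conjI allI impI)
    fix c t assume ct: "0 < c \<and> c < 1 \<and> - Tc c \<le> t \<and> t \<le> Tc c"
    have eq: "(\<lambda>x. vfun p a A B c k0 l0 t x - Qsol p (x - alpha p a c k0 l0 (x + (1 - c) * t)) - Qc p c (x + (1 - c) * t)) = ?L c t u"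
      using ct by (intro ext) (simp add: u_def lift_diff lift_Q lift_qf vfun_eq)
    have "H1norm (?L c t u) \<le> sqrt (K * c powr (2 * e1) + N * c powr (2 * e1))"
    proof (rule H1_classical(2)[OF _ _ K[OF ct] N[OF ct]])
      show "(?L c t u has_real_derivative ?L c t (Dop ?b u) x) (at x)" for x
        by (rule DERIV_lift[OF uA DERIV_alpha]) (use ct in simp)
      show "isCont (?L c t (Dop ?b u)) x" for x by (rule isCont_lift[OF _ Dop_\<A>[OF uA bA]]) (use ct in simp)
    qed
    also have "\<dots> \<le> (\<bar>K + N\<bar> + 1) * c powr e1"
      unfolding distrib_right[symmetric] by (rule sqrt_powr_le)
    finally show "H1norm (\<lambda>x. vfun p a A B c k0 l0 t x - Qsol p (x - alpha p a c k0 l0 (x + (1 - c) * t)) - Qc p c (x + (1 - c) * t))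
        \<le> (\<bar>K + N\<bar> + 1) * c powr (1 / (real p - 1))"
      unfolding eq e1_def .
  qed simp
qed

text \<open>Repeated \<open>x\<close>-derivatives act as powers of \<open>Dop\<close> and keep the
  index set and the weight, so the exponent does not depend on \<open>j\<close>.\<close>

lemma residual_small:
  assumes g: "\<And>k l. k > 0 \<Longrightarrow> grows (real (D k l)) (A k l) \<and> grows (real (D k l)) (B k l)"
    and S: "Sop (vform A B k0 l0) (bform a k0 l0) \<in> T 1 (Irect k0 l0)"
  shows "\<exists>K > 0. \<forall>c t. 0 < c \<and> c < 1 \<and> - Tc c \<le> t \<and> t \<le> Tc c \<longrightarrow>
      sq_integrable (\<lambda>x. (deriv ^^ j) (\<lambda>z. Sfun p a A B c k0 l0 t z) x) \<and>
      L2norm (\<lambda>x. (deriv ^^ j) (\<lambda>z. Sfun p a A B c k0 l0 t z) x)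
        \<le> K * c powr ((1/2 - 1/100) * min (real k0 / (real p - 1)) (1 + real l0))"
proof -
  let ?b = "bform a k0 l0"
  define f where "f = (Dop ?b ^^ j) (Sop (vform A B k0 l0) ?b)"
  define e where "e = (1/2 - 1/100) * min (real k0 / (real p - 1)) (1 + real l0)"
  have v: "vform A B k0 l0 \<in> \<A>" by (rule vform_\<A>) (rule g)
  have "?b \<in> T 1 pos" by (rule bform_T) (rule g)
  then have bA: "?b \<in> \<A>" by (rule T_subset)
  have f: "f \<in> T 1 (Irect k0 l0)" unfolding f_def by (rule Dop_pow_T[OF S up_Irect bA])
  have "uL a k0 l0 e f"
    by (rule uL_T[OF f]) (use Irect_exponent in \<open>auto simp: Irect_def pos_def e_def\<close>)
  then obtain K where K: "\<And>c t. 0 < c \<and> c < 1 \<and> - Tc c \<le> t \<and> t \<le> Tc c \<Longrightarrow>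
      sq_le (lift (alpha p a c k0 l0) c t f) (K * c powr (2 * e))"
    unfolding uL_def by blast
  have eq: "(\<lambda>x. (deriv ^^ j) (\<lambda>z. Sfun p a A B c k0 l0 t z) x) = lift (alpha p a c k0 l0) c t f" if c: "0 < c" for c t
  proof -
    have "(\<lambda>z. Sfun p a A B c k0 l0 t z) = lift (alpha p a c k0 l0) c t (Sop (vform A B k0 l0) ?b)"
      by (rule ext) (rule Sfun_eq[OF c v bA])
    then show ?thesis
      using deriv_pow_lift[OF T_subset[OF S] bA DERIV_alpha[OF c], of j t] by (simp add: f_def)
  qed
  show ?thesis
  proof (intro exI[of _ "\<bar>K\<bar> + 1"] conjI allI impI)
    fix c t assume ct: "0 < c \<and> c < 1 \<and> - Tc c \<le> t \<and> t \<le> Tc c"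
    then have e': "(\<lambda>x. (deriv ^^ j) (\<lambda>z. Sfun p a A B c k0 l0 t z) x) = lift (alpha p a c k0 l0) c t f" by (intro eq) simp
    show "sq_integrable (\<lambda>x. (deriv ^^ j) (\<lambda>z. Sfun p a A B c k0 l0 t z) x)"
      unfolding e' using K[OF ct] by (simp add: sq_le_def)
    show "L2norm (\<lambda>x. (deriv ^^ j) (\<lambda>z. Sfun p a A B c k0 l0 t z) x)
        \<le> (\<bar>K\<bar> + 1) * c powr ((1/2 - 1/100) * min (real k0 / (real p - 1)) (1 + real l0))"
      unfolding e' e_def[symmetric] by (rule L2norm_le[OF K[OF ct]])
  qed simp
qed

end

theorem theorem4:
  fixes p :: nat
  assumes "p \<in> {2, 3, 4}"
  shows "\<exists>(a :: nat \<Rightarrow> nat \<Rightarrow> real) (A :: nat \<Rightarrow> nat \<Rightarrow> real \<Rightarrow> real) (B :: nat \<Rightarrow> nat \<Rightarrow> real \<Rightarrow> real).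
     (\<forall>k l. 1 \<le> k \<longrightarrow> smooth_fun (A k l) \<and> smooth_fun (B k l)) \<and>
     (\<forall>k0 l0 :: nat. 1 \<le> k0 \<longrightarrow>
        (\<forall>j :: nat. \<exists>K > 0. \<forall>c t. 0 < c \<and> c < 1 \<and> - Tc c \<le> t \<and> t \<le> Tc c \<longrightarrow>
            sq_integrable (\<lambda>x. (deriv ^^ j) (\<lambda>z. Sfun p a A B c k0 l0 t z) x) \<and>
            L2norm (\<lambda>x. (deriv ^^ j) (\<lambda>z. Sfun p a A B c k0 l0 t z) x)
              \<le> K * c powr ((1/2 - 1/100) * min (real k0 / (real p - 1)) (1 + real l0))) \<and>
        (\<forall>c t. 0 < c \<and> c < 1 \<longrightarrow> H1 (\<lambda>x. vfun p a A B c k0 l0 t x)) \<and>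
        (\<exists>K > 0. \<forall>c t. 0 < c \<and> c < 1 \<and> - Tc c \<le> t \<and> t \<le> Tc c \<longrightarrow>
            H1norm (\<lambda>x. vfun p a A B c k0 l0 t x
                     - Qsol p (x - alpha p a c k0 l0 (x + (1 - c) * t))
                     - Qc p c (x + (1 - c) * t))
              \<le> K * c powr (1 / (real p - 1))))"
proof -
  interpret gkdv p by standard (rule assms)
  obtain a A B where g: "\<And>k l. k > 0 \<Longrightarrow> grows (real (D k l)) (A k l) \<and> grows (real (D k l)) (B k l)"
    and r: "rapid (A 1 0)" and S: "\<And>k0 l0. Sop (vform A B k0 l0) (bform a k0 l0) \<in> T 1 (Irect k0 l0)"
    using formal_solution by blast
  show ?thesis
  proof (rule exI[of _ a], rule exI[of _ A], rule exI[of _ B], intro conjI allI impI)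
    show "smooth_fun (A k l)" "smooth_fun (B k l)" if "1 \<le> k" for k l
      using g[of k l] that by (auto intro: grows_smooth)
  next
    fix k0 l0 j :: nat assume "1 \<le> k0"
    show "\<exists>K > 0. \<forall>c t. 0 < c \<and> c < 1 \<and> - Tc c \<le> t \<and> t \<le> Tc c \<longrightarrow>
            sq_integrable (\<lambda>x. (deriv ^^ j) (\<lambda>z. Sfun p a A B c k0 l0 t z) x) \<and>
            L2norm (\<lambda>x. (deriv ^^ j) (\<lambda>z. Sfun p a A B c k0 l0 t z) x)
              \<le> K * c powr ((1/2 - 1/100) * min (real k0 / (real p - 1)) (1 + real l0))"
      by (rule residual_small[OF g S])
  next
    fix k0 l0 :: nat and c t :: real assume "0 < c \<and> c < 1"
    then show "H1 (\<lambda>x. vfun p a A B c k0 l0 t x)" by (intro vfun_H1 g) auto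
  next
    fix k0 l0 :: nat assume k0: "1 \<le> k0"
    show "\<exists>K > 0. \<forall>c t. 0 < c \<and> c < 1 \<and> - Tc c \<le> t \<and> t \<le> Tc c \<longrightarrow>
            H1norm (\<lambda>x. vfun p a A B c k0 l0 t x
                     - Qsol p (x - alpha p a c k0 l0 (x + (1 - c) * t))
                     - Qc p c (x + (1 - c) * t))
              \<le> K * c powr (1 / (real p - 1))"
      by (rule vfun_near_solitons[OF g r k0])
  qed
qed

end
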